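(* For each integer $s\ge 2$, the algebra $\Pi^s_{\mathcal D}$ is Morita equivalent to the skew group algebra $\Pi^s_{\mathcal A}\#\mathbb{Z}_3$.
   Context: Conventions: algebras are associative, unital, finite-dimensional over $\mathbb{C}$; $\mathbb{N}$ contains $0$; a product of paths $pq$ means "first $p$, then $q$"; $e_x$ is the trivial path at $x$. A quiver with potential (QP) $(Q,W)$ is a quiver with a linear combination $W$ of cycles (cycles regarded up to cyclic permutation); its Jacobian algebra is $\mathcal{J}(Q,W)=\mathbb{C}Q/\langle\partial_\alpha W\mid\alpha\in Q_1\rangle$, where $\partial_\alpha$ is the cyclic derivative: $\partial_\alpha(\alpha_1\cdots\alpha_l)=\sum_{\alpha_i=\alpha}\alpha_{i+1}\cdots\alpha_l\alpha_1\cdots\alpha_{i-1}$. Let $f_0=(-1,1,0)$, $f_1=(0,-1,1)$, $f_2=(1,0,-1)$, let $\omega(x_0,x_1,x_2)=(x_1,x_2,x_0)$, and write $u\sim v$ for triples if $v\in\{u,\omega(u),\omega^2(u)\}$. Let $\succ$ be the strict lexicographic order on $\mathbb{N}^3$. Indices of arrows are taken mod 3. Type A. For $s\ge 2$, $\mathcal{A}^s$ is the quiver with vertices $\{x\in\mathbb{N}^3\mid x_0+x_1+x_2=s-1\}$ and an arrow $e_x\alpha_i\colon x\to x+f_i$ for each $i\in\{0,1,2\}$ and each vertex $x$ such that $x+f_i$ is a vertex. The potential $W^s_{\mathcal A}=\sum_c\lambda_{\mathcal A}(c)c$ is the sum over all 3-cycles $c=e_x\alpha_{i_0}\alpha_{i_1}\alpha_{i_2}$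 (up to rotation) with $\lambda_{\mathcal A}(c)=1$ if $(i_0,i_1,i_2)\sim(0,1,2)$ and $-1$ if $(i_0,i_1,i_2)\sim(0,2,1)$. Put $\Pi^s_{\mathcal A}=\mathcal{J}(\mathcal{A}^s,W^s_{\mathcal A})$. The group $\mathbb{Z}_3$ acts on $\Pi^s_{\mathcal A}$ by $j\mapsto\omega^j$, where $\omega$ is the automorphism $e_x\mapsto e_{\omega(x)}$, $e_x\alpha_i\mapsto e_{\omega(x)}\alpha_{i-1}$. The skew group algebra $\Lambda\# G$ is $\Lambda\otimes\mathbb{C}G$ with multiplication $(a\otimes g)(b\otimes h)=a\,g(b)\otimes gh$. Type D. For $s\ge 2$, let $Q_0=\{x\in\mathbb{N}^3\mid x_0+x_1+x_2=s-1,\ x\succ\omega(x),\ x\succ\omega^2(x)\}$ and let $Q_1$ consist of an arrow $e_x\alpha_{i,j}\colon x\to\omega^j(x)+f_i$ for all $i,j\in\{0,1,2\}$ and $x\in Q_0$ with $\omega^j(x)+f_i\in Q_0$; write $\alpha_i=\alpha_{i,0}$. If $s\not\equiv1\pmod 3$, $\mathcal{D}^s=(Q_0,Q_1)$. If $s=3t+1$ with $t\in\mathbb{Z}^+$, let $X=(t,t,t)$; then $\mathcal{D}^s$ has vertices $Q_0\cup\{X_0,X_1,X_2\}$ (three copies of $X$) and arrows $Q_1\cup\{\beta_k\colon X-f_0\to X_k,\ \gamma_k\colon X_k\to X+f_2\mid k=0,1,2\}$. The potential is $W^s_{\mathcal D}=\sum_c\lambda_{\mathcal D}(c)c$, over all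 3-cycles $c$ of $\mathcal{D}^s$ (up to rotation), where: (1) if $c=e_x\alpha_{i_0,j_0}\alpha_{i_1,j_1}\alpha_{i_2,j_2}$ is a product of three distinct arrows and $j_0+j_1+j_2\equiv0$ (mod 3), then $\lambda_{\mathcal D}(c)=1$ if $(i_0+j_0,i_1-j_2,i_2)\sim(0,1,2)$ and $-1$ if it is $\sim(0,2,1)$; if $j_0+j_1+j_2\not\equiv0$ then $\lambda_{\mathcal D}(c)=0$; (2) if $c=e_x\alpha_{i,j}^3$ for a loop $e_x\alpha_{i,j}$, then $\lambda_{\mathcal D}(c)=\frac13$ if $(i+j,i-j,i)\sim(0,1,2)$ and $-\frac13$ if it is $\sim(0,2,1)$; (3) if $s\equiv1\pmod 3$, then for $k=0,1,2$, $\lambda_{\mathcal D}(\alpha_1\beta_k\gamma_k)=-1$ and $\lambda_{\mathcal D}(\alpha_{2,1}\beta_k\gamma_k)=\zeta^k$ with $\zeta=e^{2\pi i/3}$. Put $\Pi^s_{\mathcal D}=\mathcal{J}(\mathcal{D}^s,W^s_{\mathcal D})$. *)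

theory Defs
  imports
    Complex_Main
    "HOL-Library.FuncSet"
    "HOL-Library.Product_Plus"
    "HOL-Algebra.Algebra"
    "HOL-Algebra.Algebraic_Closure_Type"
    "Graph_Theory.Digraph"
    "Graph_Theory.Arc_Walk"
begin

section \<open>Algebras over the complex numbers\<close>

text \<open>
  An algebra is carried by the record \<^typ>\<open>(complex, 'a) module\<close> of HOL-Algebra, which has both
  the ring operations and the scalar multiplication.  The locale \<^locale>\<open>algebra\<close> of the library
  is not usable because it requires commutativity.
\<close>

locale complex_algebra = ring A + module "ring_of_type_algebra :: complex ring" A
  for A :: "(complex, 'a) module" (structure) +
  assumes smult_mult_left:
      "x \<in> carrier A \<Longrightarrow> y \<in> carrier A \<Longrightarrow> (c \<odot> x) \<otimes> y = c \<odot> (x \<otimes> y)"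
    and smult_mult_right:
      "x \<in> carrier A \<Longrightarrow> y \<in> carrier A \<Longrightarrow> x \<otimes> (c \<odot> y) = c \<odot> (x \<otimes> y)"

definition quotient_algebra :: "(complex, 'a) module \<Rightarrow> 'a set \<Rightarrow> (complex, 'a set) module" where
  "quotient_algebra A I =
    \<lparr>carrier = carrier (A Quot I), monoid.mult = (\<otimes>\<^bsub>A Quot I\<^esub>), one = \<one>\<^bsub>A Quot I\<^esub>,
     ring.zero = \<zero>\<^bsub>A Quot I\<^esub>, ring.add = (\<oplus>\<^bsub>A Quot I\<^esub>),
     module.smult = (\<lambda>c S. \<Union>x\<in>S. I +>\<^bsub>A\<^esub> (c \<odot>\<^bsub>A\<^esub> x))\<rparr>"


section \<open>Morita equivalence\<close>

text \<open>
  Left modules over a not necessarily commutative algebra (the locale \<^locale>\<open>module\<close> requires a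
  commutative ring).  The underlying complex vector space structure of \<open>M\<close> is
  \<open>c \<cdot> m = (c \<cdot> 1) m\<close>.  The fields \<open>mult\<close> and \<open>one\<close> of the record of a module are irrelevant.
\<close>

locale left_module = A: complex_algebra A + M: abelian_group M
  for A :: "(complex, 'a) module" and M :: "('a, 'm) module" (structure) +
  assumes smult_closed:
      "a \<in> carrier A \<Longrightarrow> x \<in> carrier M \<Longrightarrow> a \<odot> x \<in> carrier M"
    and smult_l_distr:
      "a \<in> carrier A \<Longrightarrow> b \<in> carrier A \<Longrightarrow> x \<in> carrier M \<Longrightarrow>
        (a \<oplus>\<^bsub>A\<^esub> b) \<odot> x = a \<odot> x \<oplus> b \<odot> x"
    and smult_r_distr:
      "a \<in> carrier A \<Longrightarrow> x \<in> carrier M \<Longrightarrow> y \<in> carrier M \<Longrightarrow>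
        a \<odot> (x \<oplus> y) = a \<odot> x \<oplus> a \<odot> y"
    and smult_assoc:
      "a \<in> carrier A \<Longrightarrow> b \<in> carrier A \<Longrightarrow> x \<in> carrier M \<Longrightarrow>
        (a \<otimes>\<^bsub>A\<^esub> b) \<odot> x = a \<odot> (b \<odot> x)"
    and smult_one:
      "x \<in> carrier M \<Longrightarrow> \<one>\<^bsub>A\<^esub> \<odot> x = x"

text \<open>Homomorphisms are extensional, so that equality of homomorphisms is equality of functions.\<close>

definition module_hom ::
  "(complex, 'a) module \<Rightarrow> ('a, 'm) module \<Rightarrow> ('a, 'n) module \<Rightarrow> ('m \<Rightarrow> 'n) set" where
  "module_hom A M N =
    {f \<in> carrier M \<rightarrow>\<^sub>E carrier N.
      (\<forall>x\<in>carrier M. \<forall>y\<in>carrier M. f (x \<oplus>\<^bsub>M\<^esub> y) = f x \<oplus>\<^bsub>N\<^esub> f y) \<and>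
      (\<forall>a\<in>carrier A. \<forall>x\<in>carrier M. f (a \<odot>\<^bsub>M\<^esub> x) = a \<odot>\<^bsub>N\<^esub> f x)}"

definition hom_id :: "('a, 'm) module \<Rightarrow> 'm \<Rightarrow> 'm" where
  "hom_id M = (\<lambda>x\<in>carrier M. x)"

definition hom_add ::
  "('a, 'm) module \<Rightarrow> ('a, 'n) module \<Rightarrow> ('m \<Rightarrow> 'n) \<Rightarrow> ('m \<Rightarrow> 'n) \<Rightarrow> 'm \<Rightarrow> 'n" where
  "hom_add M N f g = (\<lambda>x\<in>carrier M. f x \<oplus>\<^bsub>N\<^esub> g x)"

definition hom_scale ::
  "(complex, 'a) module \<Rightarrow> ('a, 'm) module \<Rightarrow> ('a, 'n) module \<Rightarrow> complex \<Rightarrow> ('m \<Rightarrow> 'n) \<Rightarrow> 'm \<Rightarrow> 'n"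
  where
  "hom_scale A M N c f = (\<lambda>x\<in>carrier M. (c \<odot>\<^bsub>A\<^esub> \<one>\<^bsub>A\<^esub>) \<odot>\<^bsub>N\<^esub> f x)"

text \<open>
  A functor from \<open>A\<close>-modules to \<open>B\<close>-modules consists of its action \<open>F\<close> on objects and its action
  \<open>\<phi> M N\<close> on the homomorphisms from \<open>M\<close> to \<open>N\<close>.
\<close>

locale linear_functor =
  fixes A :: "(complex, 'a) module" and B :: "(complex, 'b) module"
    and F :: "('a, 'm) module \<Rightarrow> ('b, 'm) module"
    and \<phi> :: "('a, 'm) module \<Rightarrow> ('a, 'm) module \<Rightarrow> ('m \<Rightarrow> 'm) \<Rightarrow> 'm \<Rightarrow> 'm"
  assumes ob: "left_module A M \<Longrightarrow> left_module B (F M)"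
    and hom: "left_module A M \<Longrightarrow> left_module A N \<Longrightarrow> f \<in> module_hom A M N \<Longrightarrow>
        \<phi> M N f \<in> module_hom B (F M) (F N)"
    and id: "left_module A M \<Longrightarrow> \<phi> M M (hom_id M) = hom_id (F M)"
    and comp: "left_module A L \<Longrightarrow> left_module A M \<Longrightarrow> left_module A N \<Longrightarrow>
        f \<in> module_hom A L M \<Longrightarrow> g \<in> module_hom A M N \<Longrightarrow>
        \<phi> L N (compose (carrier L) g f) = compose (carrier (F L)) (\<phi> M N g) (\<phi> L M f)"
    and add: "left_module A M \<Longrightarrow> left_module A N \<Longrightarrow>
        f \<in> module_hom A M N \<Longrightarrow> g \<in> module_hom A M N \<Longrightarrow>
        \<phi> M N (hom_add M N f g) = hom_add (F M) (F N) (\<phi> M N f) (\<phi> M N g)"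
    and scale: "left_module A M \<Longrightarrow> left_module A N \<Longrightarrow> f \<in> module_hom A M N \<Longrightarrow>
        \<phi> M N (hom_scale A M N c f) = hom_scale B (F M) (F N) c (\<phi> M N f)"

text \<open>
  Natural isomorphisms \<open>\<eta>\<close> from the identity functor of the category of \<open>A\<close>-modules to the
  endofunctor of that category given by \<open>T\<close> on objects and by \<open>\<tau>\<close> on homomorphisms.
\<close>

definition natural_iso_id ::
  "(complex, 'a) module \<Rightarrow> (('a, 'm) module \<Rightarrow> ('a, 'm) module) \<Rightarrow>
   (('a, 'm) module \<Rightarrow> ('a, 'm) module \<Rightarrow> ('m \<Rightarrow> 'm) \<Rightarrow> 'm \<Rightarrow> 'm) \<Rightarrow>
   (('a, 'm) module \<Rightarrow> 'm \<Rightarrow> 'm) \<Rightarrow> bool" where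
  "natural_iso_id A T \<tau> \<eta> \<longleftrightarrow>
    (\<forall>M. left_module A M \<longrightarrow>
      \<eta> M \<in> module_hom A M (T M) \<and> bij_betw (\<eta> M) (carrier M) (carrier (T M))) \<and>
    (\<forall>M N f. left_module A M \<longrightarrow> left_module A N \<longrightarrow> f \<in> module_hom A M N \<longrightarrow>
      compose (carrier M) (\<tau> M N f) (\<eta> M) = compose (carrier M) (\<eta> N) f)"

text \<open>
  Two algebras are Morita equivalent if their categories of modules are equivalent as
  complex-linear categories.  The type \<open>'m\<close> plays the role of the universe: the objects are
  the modules whose carrier is a set of elements of type \<open>'m\<close>.  A statement that is polymorphic
  in \<open>'m\<close> covers module categories of every size.
\<close>

definition morita_equivalent ::
  "'m itself \<Rightarrow> (complex, 'a) module \<Rightarrow> (complex, 'b) module \<Rightarrow> bool" where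
  "morita_equivalent (_ :: 'm itself) A B \<longleftrightarrow>
    complex_algebra A \<and> complex_algebra B \<and>
    (\<exists>(F :: ('a, 'm) module \<Rightarrow> ('b, 'm) module) \<phi> (G :: ('b, 'm) module \<Rightarrow> ('a, 'm) module) \<psi> \<eta> \<epsilon>.
      linear_functor A B F \<phi> \<and> linear_functor B A G \<psi> \<and>
      natural_iso_id A (\<lambda>M. G (F M)) (\<lambda>M N f. \<psi> (F M) (F N) (\<phi> M N f)) \<eta> \<and>
      natural_iso_id B (\<lambda>M. F (G M)) (\<lambda>M N f. \<phi> (G M) (G N) (\<psi> M N f)) \<epsilon>)"


section \<open>Skew group algebras\<close>

text \<open>
  For a finite group \<open>G\<close>, the element \<open>u\<close> of the carrier stands for the sum of the tensors
  \<open>u g \<otimes> g\<close>.  Since \<open>(a \<otimes> g)(b \<otimes> h) = a g(b) \<otimes> gh\<close>, the coefficient of a product \<open>u v\<close> at \<open>k\<close>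
  is the sum over \<open>g\<close> of \<open>u g \<cdot> g(v (g\<inverse>k))\<close>.
\<close>

definition skew_group_algebra ::
  "(complex, 'a) module \<Rightarrow> 'g monoid \<Rightarrow> ('g \<Rightarrow> 'a \<Rightarrow> 'a) \<Rightarrow> (complex, 'g \<Rightarrow> 'a) module" where
  "skew_group_algebra A G act =
    \<lparr>carrier = carrier G \<rightarrow>\<^sub>E carrier A,
     monoid.mult = (\<lambda>u v. \<lambda>k\<in>carrier G.
       \<Oplus>\<^bsub>A\<^esub>g\<in>carrier G. u g \<otimes>\<^bsub>A\<^esub> act g (v (inv\<^bsub>G\<^esub> g \<otimes>\<^bsub>G\<^esub> k))),
     one = (\<lambda>k\<in>carrier G. if k = \<one>\<^bsub>G\<^esub> then \<one>\<^bsub>A\<^esub> else \<zero>\<^bsub>A\<^esub>),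
     ring.zero = (\<lambda>k\<in>carrier G. \<zero>\<^bsub>A\<^esub>),
     ring.add = (\<lambda>u v. \<lambda>k\<in>carrier G. u k \<oplus>\<^bsub>A\<^esub> v k),
     module.smult = (\<lambda>c u. \<lambda>k\<in>carrier G. c \<odot>\<^bsub>A\<^esub> u k)\<rparr>"


section \<open>Path algebras and Jacobian algebras\<close>

text \<open>
  A quiver is a digraph in the sense of \<^typ>\<open>('v, 'e) pre_digraph\<close>, which allows loops and multiple
  arrows.  A path is given by its first vertex and the list of its arrows in the order in which
  they are traversed; \<open>(x, [])\<close> is the trivial path at \<open>x\<close>.
\<close>

type_synonym ('v, 'e) path = "'v \<times> 'e list"

definition paths :: "('v, 'e) pre_digraph \<Rightarrow> ('v, 'e) path set" where
  "paths Q = {(u, p). \<exists>v. pre_digraph.awalk Q u p v}"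

text \<open>
  The coefficient of \<open>f g\<close> at a path is the sum of \<open>f q \<cdot> g r\<close> over the ways to write that path
  as \<open>q\<close> followed by \<open>r\<close>.
\<close>

definition path_algebra ::
  "('v, 'e) pre_digraph \<Rightarrow> (complex, ('v, 'e) path \<Rightarrow> complex) module" where
  "path_algebra Q =
    \<lparr>carrier = {f. finite {p. f p \<noteq> 0} \<and> {p. f p \<noteq> 0} \<subseteq> paths Q},
     monoid.mult = (\<lambda>f g (u, p). \<Sum>k\<le>length p.
       f (u, take k p) * g (pre_digraph.awlast Q u (take k p), drop k p)),
     one = (\<lambda>(u, p). if u \<in> verts Q \<and> p = [] then 1 else 0),
     ring.zero = (\<lambda>_. 0),
     ring.add = (\<lambda>f g p. f p + g p),
     module.smult = (\<lambda>c f p. c * f p)\<rparr>"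

text \<open>
  Cycles (closed walks, possibly with repeated vertices and arrows) are considered up to cyclic
  permutation.  A potential assigns to each cyclic class of cycles its coefficient; it is
  meant to be zero for all but finitely many classes.
\<close>

definition cyclic_class :: "'e list \<Rightarrow> 'e list set" where
  "cyclic_class c = range (\<lambda>n. rotate n c)"

definition cycles :: "('v, 'e) pre_digraph \<Rightarrow> 'e list set" where
  "cycles Q = {c. c \<noteq> [] \<and> (\<exists>u. pre_digraph.awalk Q u c u)}"

definition cycle_classes :: "('v, 'e) pre_digraph \<Rightarrow> 'e list set set" where
  "cycle_classes Q = cyclic_class ` cycles Q"

type_synonym 'e potential = "'e list set \<Rightarrow> complex"

text \<open>
  The derivative of a cycle \<open>c\<close> with respect to \<open>a\<close>: each occurrence of \<open>a\<close> in \<open>c\<close> contributes the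
  path that starts right after that occurrence and goes once around the cycle up to it.
\<close>

definition cycle_deriv ::
  "('v, 'e) pre_digraph \<Rightarrow> 'e \<Rightarrow> 'e list \<Rightarrow> ('v, 'e) path \<Rightarrow> complex" where
  "cycle_deriv Q a c = (\<lambda>p. \<Sum>i | i < length c \<and> c ! i = a.
     if p = (head Q a, drop (Suc i) c @ take i c) then 1 else 0)"

text \<open>The derivative of a cycle depends only on its cyclic class.\<close>

lemma cycle_deriv_rotate: "cycle_deriv Q a (rotate n c) = cycle_deriv Q a c"
proof -
  have rotate1: "cycle_deriv Q a (rotate1 c) = cycle_deriv Q a c" for c
  proof (cases c)
    case Nil
    then show ?thesis by simp
  next
    case (Cons b d)
    have *: "cycle_deriv Q a c p = (\<Sum>i<length c. if c ! i = a
        then if p = (head Q a, drop (Suc i) c @ take i c) then 1 else 0 else 0)" for c p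
      unfolding cycle_deriv_def by (intro sum.mono_neutral_cong_left) auto
    show ?thesis
    proof
      fix p
      let ?term = "\<lambda>i. if d ! i = a
        then if p = (head Q a, drop (Suc i) d @ b # take i d) then 1 else 0 else 0 :: complex"
      let ?last = "if b = a then if p = (head Q a, d) then 1 else 0 else 0 :: complex"
      have "cycle_deriv Q a (b # d) p = ?last + (\<Sum>i<length d. ?term i)"
        unfolding * by (simp add: sum.lessThan_Suc_shift del: sum.lessThan_Suc cong: if_cong)
      moreover have "cycle_deriv Q a (d @ [b]) p = (\<Sum>i<length d. ?term i) + ?last"
        unfolding * by (simp add: nth_append cong: sum.cong_simp if_cong)
      ultimately show "cycle_deriv Q a (rotate1 c) p = cycle_deriv Q a c p"
        by (simp add: Cons)
    qed
  qed
  show ?thesis by (induction n) (simp_all add: rotate1)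
qed

definition potential_deriv ::
  "('v, 'e) pre_digraph \<Rightarrow> 'e potential \<Rightarrow> 'e \<Rightarrow> ('v, 'e) path \<Rightarrow> complex" where
  "potential_deriv Q W a =
    (\<lambda>p. \<Sum>C | C \<in> cycle_classes Q \<and> W C \<noteq> 0. W C * cycle_deriv Q a (SOME c. c \<in> C) p)"

definition jacobian_ideal ::
  "('v, 'e) pre_digraph \<Rightarrow> 'e potential \<Rightarrow> (('v, 'e) path \<Rightarrow> complex) set" where
  "jacobian_ideal Q W = Idl\<^bsub>path_algebra Q\<^esub> (potential_deriv Q W ` arcs Q)"

definition jacobian_algebra ::
  "('v, 'e) pre_digraph \<Rightarrow> 'e potential \<Rightarrow> (complex, (('v, 'e) path \<Rightarrow> complex) set) module" where
  "jacobian_algebra Q W = quotient_algebra (path_algebra Q) (jacobian_ideal Q W)"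

text \<open>
  The potential that is the sum of \<open>w c\<close> times \<open>c\<close> over all cycles \<open>c\<close> of length three up to
  rotation, where \<open>w\<close> is invariant under rotation of 3-cycles.
\<close>

definition three_cycle_potential ::
  "('v, 'e) pre_digraph \<Rightarrow> ('e list \<Rightarrow> complex) \<Rightarrow> 'e potential" where
  "three_cycle_potential Q w = (\<lambda>C.
     if \<exists>c\<in>cycles Q. length c = 3 \<and> C = cyclic_class c
     then w (SOME c. c \<in> C) else 0)"


section \<open>Triples\<close>

text \<open>
  Triples of integers are added componentwise; elements of \<open>\<nat>\<^sup>3\<close> are the triples with
  nonnegative components.  Indices are integers taken modulo 3.
\<close>

type_synonym triple = "int \<times> int \<times> int"

definition shift :: "int \<Rightarrow> triple" where
  "shift i = (if i mod 3 = 0 then (-1, 1, 0) else if i mod 3 = 1 then (0, -1, 1) else (1, 0, -1))"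

fun omega :: "triple \<Rightarrow> triple" where
  "omega (x0, x1, x2) = (x1, x2, x0)"

fun lex_greater :: "triple \<Rightarrow> triple \<Rightarrow> bool" where
  "lex_greater (x0, x1, x2) (y0, y1, y2) \<longleftrightarrow>
    x0 > y0 \<or> (x0 = y0 \<and> (x1 > y1 \<or> (x1 = y1 \<and> x2 > y2)))"

definition simplex_points :: "nat \<Rightarrow> triple set" where
  "simplex_points s = {(x0, x1, x2). x0 \<ge> 0 \<and> x1 \<ge> 0 \<and> x2 \<ge> 0 \<and> x0 + x1 + x2 = int s - 1}"

definition sim3 :: "triple \<Rightarrow> triple \<Rightarrow> bool" where
  "sim3 u v \<longleftrightarrow> v \<in> {u, omega u, omega (omega u)}"

text \<open>
  The sign of a triple of indices; for the triples that occur as index triples of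
  3-cycles one of the first two cases applies.
\<close>

fun index_sign :: "triple \<Rightarrow> complex" where
  "index_sign (i0, i1, i2) =
    (if sim3 (i0 mod 3, i1 mod 3, i2 mod 3) (0, 1, 2) then 1
     else if sim3 (i0 mod 3, i1 mod 3, i2 mod 3) (0, 2, 1) then -1
     else 0)"


section \<open>Type A\<close>

text \<open>The arrow \<open>e\<^sub>x \<alpha>\<^sub>i\<close> is the pair \<open>(x, i)\<close>.\<close>

type_synonym a_arrow = "triple \<times> int"

definition quiver_A :: "nat \<Rightarrow> (triple, a_arrow) pre_digraph" where
  "quiver_A s =
    \<lparr>verts = simplex_points s,
     arcs = {(x, i). x \<in> simplex_points s \<and> i \<in> {0, 1, 2} \<and> x + shift i \<in> simplex_points s},
     tail = (\<lambda>(x, i). x),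
     head = (\<lambda>(x, i). x + shift i)\<rparr>"

fun weight_A :: "a_arrow list \<Rightarrow> complex" where
  "weight_A [(x, i0), (y, i1), (z, i2)] = index_sign (i0, i1, i2)"
| "weight_A _ = 0"

definition potential_A :: "nat \<Rightarrow> a_arrow potential" where
  "potential_A s = three_cycle_potential (quiver_A s) weight_A"

definition Pi_A :: "nat \<Rightarrow> (complex, ((triple, a_arrow) path \<Rightarrow> complex) set) module" where
  "Pi_A s = jacobian_algebra (quiver_A s) (potential_A s)"

fun omega_path :: "(triple, a_arrow) path \<Rightarrow> (triple, a_arrow) path" where
  "omega_path (u, p) = (omega u, map (\<lambda>(x, i). (omega x, (i - 1) mod 3)) p)"

text \<open>
  The linear extension of \<^const>\<open>omega_path\<close> to the path algebra.  It preserves the potential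
  and hence the Jacobian ideal; the induced map on the quotient sends a coset to its image.
\<close>

definition omega_path_algebra ::
  "((triple, a_arrow) path \<Rightarrow> complex) \<Rightarrow> (triple, a_arrow) path \<Rightarrow> complex" where
  "omega_path_algebra f = (\<lambda>q. \<Sum>p | f p \<noteq> 0 \<and> omega_path p = q. f p)"

definition omega_Pi ::
  "((triple, a_arrow) path \<Rightarrow> complex) set \<Rightarrow> ((triple, a_arrow) path \<Rightarrow> complex) set" where
  "omega_Pi S = omega_path_algebra ` S"

definition omega_action ::
  "int \<Rightarrow> ((triple, a_arrow) path \<Rightarrow> complex) set \<Rightarrow> ((triple, a_arrow) path \<Rightarrow> complex) set" where
  "omega_action j = omega_Pi ^^ nat j"


section \<open>Type D\<close>

text \<open>
  \<open>Pt x\<close> is the vertex \<open>x\<close> and \<open>Centre k\<close> is the copy \<open>X\<^sub>k\<close> of \<open>X = (t, t, t)\<close>.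
  \<open>Alpha x i j\<close> is the arrow \<open>e\<^sub>x \<alpha>\<^sub>i\<^sub>,\<^sub>j\<close>, and \<open>Beta k\<close> and \<open>Gamma k\<close> are \<open>\<beta>\<^sub>k\<close> and \<open>\<gamma>\<^sub>k\<close>.
\<close>

datatype d_vertex = Pt triple | Centre int

datatype d_arrow = Alpha triple int int | Beta int | Gamma int

definition fundamental_points :: "nat \<Rightarrow> triple set" where
  "fundamental_points s =
    {x \<in> simplex_points s. lex_greater x (omega x) \<and> lex_greater x (omega (omega x))}"

definition centre_point :: "nat \<Rightarrow> triple" where
  "centre_point s = (let t = (int s - 1) div 3 in (t, t, t))"

fun tail_D :: "nat \<Rightarrow> d_arrow \<Rightarrow> d_vertex" where
  "tail_D s (Alpha x i j) = Pt x"
| "tail_D s (Beta k) = Pt (centre_point s - shift 0)"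
| "tail_D s (Gamma k) = Centre k"

fun head_D :: "nat \<Rightarrow> d_arrow \<Rightarrow> d_vertex" where
  "head_D s (Alpha x i j) = Pt ((omega ^^ nat j) x + shift i)"
| "head_D s (Beta k) = Centre k"
| "head_D s (Gamma k) = Pt (centre_point s + shift 2)"

definition quiver_D :: "nat \<Rightarrow> (d_vertex, d_arrow) pre_digraph" where
  "quiver_D s =
    \<lparr>verts = Pt ` fundamental_points s \<union> (if s mod 3 = 1 then Centre ` {0, 1, 2} else {}),
     arcs = {Alpha x i j | x i j. x \<in> fundamental_points s \<and> i \<in> {0, 1, 2} \<and> j \<in> {0, 1, 2} \<and>
               (omega ^^ nat j) x + shift i \<in> fundamental_points s}
            \<union> (if s mod 3 = 1 then Beta ` {0, 1, 2} \<union> Gamma ` {0, 1, 2} else {}),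
     tail = tail_D s,
     head = head_D s\<rparr>"

text \<open>
  The middle three equations give the coefficient of the cycles \<open>\<alpha>\<^sub>1\<beta>\<^sub>k\<gamma>\<^sub>k\<close> and \<open>\<alpha>\<^sub>2\<^sub>,\<^sub>1\<beta>\<^sub>k\<gamma>\<^sub>k\<close>
  for each of their rotations.  In the first equation, no 3-cycle contains exactly two equal
  arrows.
\<close>

definition weight_centre :: "int \<Rightarrow> int \<Rightarrow> int \<Rightarrow> complex" where
  "weight_centre i j k =
    (if (i, j) = (1, 0) then -1 else if (i, j) = (2, 1) then cis (2 * pi / 3) ^ nat k else 0)"

fun weight_D :: "d_arrow list \<Rightarrow> complex" where
  "weight_D [Alpha x i0 j0, Alpha y i1 j1, Alpha z i2 j2] =
    (if Alpha x i0 j0 = Alpha y i1 j1 \<and> Alpha y i1 j1 = Alpha z i2 j2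
       then index_sign (i0 + j0, i0 - j0, i0) / 3
     else if distinct [Alpha x i0 j0, Alpha y i1 j1, Alpha z i2 j2] \<and> (j0 + j1 + j2) mod 3 = 0
       then index_sign (i0 + j0, i1 - j2, i2)
     else 0)"
| "weight_D [Alpha x i j, Beta k, Gamma l] = weight_centre i j k"
| "weight_D [Beta k, Gamma l, Alpha x i j] = weight_centre i j k"
| "weight_D [Gamma l, Alpha x i j, Beta k] = weight_centre i j k"
| "weight_D _ = 0"

definition potential_D :: "nat \<Rightarrow> d_arrow potential" where
  "potential_D s = three_cycle_potential (quiver_D s) weight_D"

definition Pi_D :: "nat \<Rightarrow> (complex, ((d_vertex, d_arrow) path \<Rightarrow> complex) set) module" where
  "Pi_D s = jacobian_algebra (quiver_D s) (potential_D s)"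

end

theory Submission
  imports Defs
begin

text \<open>
  A representation of the skew group algebra is a representation of the triangle algebra together
  with units \<open>U j\<close> that implement the rotation (\<open>skew_equivariant_rep\<close>, \<open>Skew_universal\<close>).  The units
  make the points of an orbit of the rotation isomorphic, so that nothing is lost by keeping only
  one point of each orbit, the one in the fundamental domain.  A step that leaves the fundamental
  domain is followed by the rotation that leads back into it; this is the arrow \<open>Alpha x i j\<close>.  The
  centre is fixed by the rotation.  It splits into the three eigenspaces of \<open>U 1\<close>, which are the
  vertices \<open>Centre k\<close>, and the eigenvalues are the roots of unity in the potential.  So the algebra
  of type D should be the corner of the skew group algebra at an idempotent that meets every orbit.
  Such an idempotent is full, and a full corner is Morita equivalent to the whole algebra
  (\<open>morita_equivalent_corner\<close>).

  It remains to identify the corner.  In the triangle algebra the relations say that steps in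
  different directions commute.  The paths of length two that occur in a relation of type D lift to
  the two ways around a square of the triangle (\<open>relation_D_step\<close>), except at the centre, where the
  eigenvalues intervene (\<open>relation_D_centre\<close>).  Hence the elements of the corner described above satisfy
  the relations of type D (\<open>qp_rep_D\<close>).  The resulting homomorphism \<open>theta\<close> is onto the corner,
  because each generator of the skew group algebra, cut down to two representatives, is a multiple of
  the image of a vertex or of an arrow (\<open>corner_ev\<close>, \<open>corner_ar\<close>, \<open>corner_U\<close>).

  Injectivity of \<open>theta\<close> needs no bases of the two algebras.  Any representation of type D in an
  algebra \<open>B\<close> can be unfolded: families of elements of \<open>B\<close> that are indexed by the points of the
  triangle, with three components at the centre, carry linear maps that represent the points, the
  steps and the rotation of the triangle (\<open>equivariant_rep_unfolding\<close>), and therefore an action of the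
  skew group algebra.  If \<open>B\<close> is the algebra of type D itself, then \<open>theta b\<close> acts on the components
  over the fundamental domain as left multiplication by \<open>b\<close> (\<open>theta_vec\<close>), so \<open>b\<close> can be recovered
  from \<open>theta b\<close>.
\<close>

(* The arrow with an index is an ambiguous reading of the function space \<rightarrow>. *)
no_notation dominates (\<open>_ \<rightarrow>\<index> _\<close> [100,100] 40)

section \<open>Complex algebras and their homomorphisms\<close>

text \<open>
  The scalars are complex numbers here, not elements of a record, so that the simplifier can compute
  with them.
\<close>

locale complex_ring = ring A for A :: "(complex, 'a) module" (structure) +
  assumes scale_closed [simp, intro]: "x \<in> carrier A \<Longrightarrow> c \<odot> x \<in> carrier A"
    and scale_add_left: "x \<in> carrier A \<Longrightarrow> (b + c) \<odot> x = b \<odot> x \<oplus> c \<odot> x"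
    and scale_add_right:
      "x \<in> carrier A \<Longrightarrow> y \<in> carrier A \<Longrightarrow> c \<odot> (x \<oplus> y) = c \<odot> x \<oplus> c \<odot> y"
    and scale_scale: "x \<in> carrier A \<Longrightarrow> b \<odot> (c \<odot> x) = (b * c) \<odot> x"
    and scale_one [simp]: "x \<in> carrier A \<Longrightarrow> 1 \<odot> x = x"
    and scale_mult_left:
      "x \<in> carrier A \<Longrightarrow> y \<in> carrier A \<Longrightarrow> (c \<odot> x) \<otimes> y = c \<odot> (x \<otimes> y)"
    and scale_mult_right:
      "x \<in> carrier A \<Longrightarrow> y \<in> carrier A \<Longrightarrow> x \<otimes> (c \<odot> y) = c \<odot> (x \<otimes> y)"

lemma complex_algebra_iff_complex_ring: "complex_algebra A \<longleftrightarrow> complex_ring A"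
proof
  assume "complex_algebra A"
  then interpret A: complex_algebra A .
  have "ring A" ..
  then show "complex_ring A"
    using A.smult_closed A.smult_l_distr A.smult_r_distr A.smult_assoc1 A.smult_one
    by (intro complex_ring.intro complex_ring_axioms.intro)
      (auto simp: ring_of_type_algebra_def A.smult_mult_left A.smult_mult_right)
next
  assume "complex_ring A"
  then interpret A: complex_ring A .
  have "module (ring_of_type_algebra :: complex ring) A"
    by (intro moduleI cring_from_type_algebra A.abelian_group_axioms)
      (auto simp: ring_of_type_algebra_def A.scale_add_left A.scale_add_right A.scale_scale)
  then show "complex_algebra A"
    by (intro complex_algebra.intro complex_algebra_axioms.intro A.ring_axioms)
      (auto simp: A.scale_mult_left A.scale_mult_right)
qed

context complex_ring
begin

lemma scale_zero_left [simp]: "x \<in> carrier A \<Longrightarrow> 0 \<odot> x = \<zero>"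
  using scale_add_left[of x 0 0] by simp

lemma scale_zero_right [simp]: "c \<odot> \<zero> = \<zero>"
  using scale_add_right[of \<zero> \<zero> c] by simp

lemma scale_minus_one: "x \<in> carrier A \<Longrightarrow> (- 1) \<odot> x = \<ominus> x"
proof -
  assume x: "x \<in> carrier A"
  have "(- 1) \<odot> x \<oplus> x = (- 1 + 1) \<odot> x"
    using x by (subst scale_add_left) auto
  then show ?thesis
    using x by (simp add: minus_equality)
qed

lemma finsum_scale:
  assumes "f \<in> I \<rightarrow> carrier A"
  shows "c \<odot> finsum A f I = (\<Oplus>i\<in>I. c \<odot> f i)"
  using assms
proof (induction I rule: infinite_finite_induct)
  case (insert i I)
  then show ?case by (simp add: scale_add_right Pi_def)
qed (auto simp: )

end

lemma (in abelian_monoid) finsum_swap: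
  assumes "finite I" "finite J" "\<And>i j. i \<in> I \<Longrightarrow> j \<in> J \<Longrightarrow> f i j \<in> carrier G"
  shows "(\<Oplus>i\<in>I. \<Oplus>j\<in>J. f i j) = (\<Oplus>j\<in>J. \<Oplus>i\<in>I. f i j)"
  using assms(1,3)
proof (induction I rule: finite_induct)
  case (insert i I)
  have "(\<Oplus>j\<in>J. \<Oplus>i\<in>insert i I. f i j) = (\<Oplus>j\<in>J. f i j \<oplus> (\<Oplus>i\<in>I. f i j))"
    using insert by (intro finsum_cong') (auto simp: Pi_def finsum_closed)
  also have "\<dots> = (\<Oplus>j\<in>J. f i j) \<oplus> (\<Oplus>j\<in>J. \<Oplus>i\<in>I. f i j)"
    using insert by (intro finsum_addf) (auto intro!: finsum_closed)
  finally show ?case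
    using insert by (simp add: Pi_def finsum_closed)
qed simp

lemma (in abelian_monoid) finsum_delta:
  assumes "finite I" "i \<in> I" "x \<in> carrier G"
  shows "(\<Oplus>j\<in>I. if j = i then x else \<zero>) = x"
  using finsum_singleton[of i I "\<lambda>_. x"] assms by (simp add: eq_commute)

lemma (in abelian_monoid) finsum_mono_neutral:
  assumes "finite J" "I \<subseteq> J" "\<And>i. i \<in> J - I \<Longrightarrow> f i = \<zero>" "\<And>i. i \<in> I \<Longrightarrow> f i \<in> carrier G"
  shows "finsum G f I = finsum G f J"
  using assms by (intro add.finprod_mono_neutral_cong_left) (auto simp: Pi_def, metis DiffI zero_closed)

definition algebra_hom :: "(complex, 'a) module \<Rightarrow> (complex, 'b) module \<Rightarrow> ('a \<Rightarrow> 'b) set" where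
  "algebra_hom A B = {h \<in> carrier A \<rightarrow> carrier B.
     (\<forall>x\<in>carrier A. \<forall>y\<in>carrier A.
       h (x \<oplus>\<^bsub>A\<^esub> y) = h x \<oplus>\<^bsub>B\<^esub> h y \<and> h (x \<otimes>\<^bsub>A\<^esub> y) = h x \<otimes>\<^bsub>B\<^esub> h y) \<and>
     (\<forall>c. \<forall>x\<in>carrier A. h (c \<odot>\<^bsub>A\<^esub> x) = c \<odot>\<^bsub>B\<^esub> h x)}"

text \<open>
  Homomorphisms need not preserve one: the embedding of a corner does not.
\<close>

locale complex_ring_hom = A: complex_ring A + B: complex_ring B
  for A :: "(complex, 'a) module" and B :: "(complex, 'b) module" and h +
  assumes hom: "h \<in> algebra_hom A B"
begin

lemma closed [simp]: "x \<in> carrier A \<Longrightarrow> h x \<in> carrier B"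
  and add: "x \<in> carrier A \<Longrightarrow> y \<in> carrier A \<Longrightarrow> h (x \<oplus>\<^bsub>A\<^esub> y) = h x \<oplus>\<^bsub>B\<^esub> h y"
  and mult: "x \<in> carrier A \<Longrightarrow> y \<in> carrier A \<Longrightarrow> h (x \<otimes>\<^bsub>A\<^esub> y) = h x \<otimes>\<^bsub>B\<^esub> h y"
  and scale: "x \<in> carrier A \<Longrightarrow> h (c \<odot>\<^bsub>A\<^esub> x) = c \<odot>\<^bsub>B\<^esub> h x"
  using hom by (auto simp: algebra_hom_def)

lemma zero [simp]: "h \<zero>\<^bsub>A\<^esub> = \<zero>\<^bsub>B\<^esub>"
  using scale[of "\<zero>\<^bsub>A\<^esub>" 0] by simp

lemma minus: "x \<in> carrier A \<Longrightarrow> h (\<ominus>\<^bsub>A\<^esub> x) = \<ominus>\<^bsub>B\<^esub> h x"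
  using scale[of x "-1"] by (simp add: A.scale_minus_one B.scale_minus_one)

lemma finsum:
  assumes "f \<in> I \<rightarrow> carrier A"
  shows "h (finsum A f I) = (\<Oplus>\<^bsub>B\<^esub>i\<in>I. h (f i))"
  using assms
proof (induction I rule: infinite_finite_induct)
  case (insert i I)
  then show ?case by (simp add: add Pi_def)
qed auto

lemma kernel_ideal: "ideal {x \<in> carrier A. h x = \<zero>\<^bsub>B\<^esub>} A"
proof (rule idealI)
  show "subgroup {x \<in> carrier A. h x = \<zero>\<^bsub>B\<^esub>} (add_monoid A)"
  proof (rule subgroup.intro)
    fix x assume "x \<in> {x \<in> carrier A. h x = \<zero>\<^bsub>B\<^esub>}"
    then show "inv\<^bsub>add_monoid A\<^esub> x \<in> {x \<in> carrier A. h x = \<zero>\<^bsub>B\<^esub>}"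
      using minus[of x] by (simp add: a_inv_def[symmetric])
  qed (auto simp: add)
qed (auto simp: mult A.ring_axioms)

end


section \<open>Quotient algebras\<close>

locale algebra_ideal = complex_ring A + ideal I A
  for A :: "(complex, 'a) module" (structure) and I
begin

abbreviation "proj x \<equiv> I +>\<^bsub>A\<^esub> x"

lemma scale_mem: "x \<in> I \<Longrightarrow> c \<odot> x \<in> I"
  using I_l_closed[of x "c \<odot> \<one>"] Icarr[of x] by (simp add: scale_mult_left)

lemma proj_eq_iff: "x \<in> carrier A \<Longrightarrow> y \<in> carrier A \<Longrightarrow> proj x = proj y \<longleftrightarrow> x \<ominus> y \<in> I"
  using quotient_eq_iff_same_a_r_cos[OF ideal_axioms] by simp

lemma mem_proj_iff: "x \<in> carrier A \<Longrightarrow> z \<in> proj x \<longleftrightarrow> z \<in> carrier A \<and> proj z = proj x"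
  using a_r_coset_subset_G[OF a_subset, of x] a_rcos_module_minus[OF ring_axioms, of x z]
    proj_eq_iff[of z x] by blast

lemma mem_projD:
  assumes "z \<in> proj x" "x \<in> carrier A"
  shows "z \<in> carrier A" "z \<ominus> x \<in> I"
  using assms mem_proj_iff[of x z] proj_eq_iff[of z x] by auto

lemma scale_coset:
  assumes "x \<in> carrier A"
  shows "(\<Union>z\<in>proj x. proj (c \<odot> z)) = proj (c \<odot> x)"
proof -
  have "proj (c \<odot> z) = proj (c \<odot> x)" if z: "z \<in> proj x" for z
  proof -
    note z = mem_projD[OF z assms]
    have "c \<odot> (z \<ominus> x) = c \<odot> z \<ominus> c \<odot> x"
      using z(1) assms
      by (simp add: minus_eq scale_add_right scale_scale scale_minus_one[symmetric])
    then show ?thesis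
      using z(1) assms scale_mem[OF z(2), of c] by (simp add: proj_eq_iff)
  qed
  moreover have "x \<in> proj x"
    using assms mem_proj_iff[of x x] by simp
  ultimately show ?thesis by blast
qed

lemma proj_zero: "proj \<zero> = I"
  using a_rcos_const by simp

abbreviation "B \<equiv> quotient_algebra A I"

lemma quotient_simps:
  "carrier B = proj ` carrier A" "\<one>\<^bsub>B\<^esub> = proj \<one>" "\<zero>\<^bsub>B\<^esub> = proj \<zero>"
  "x \<in> carrier A \<Longrightarrow> y \<in> carrier A \<Longrightarrow> proj x \<otimes>\<^bsub>B\<^esub> proj y = proj (x \<otimes> y)"
  "x \<in> carrier A \<Longrightarrow> y \<in> carrier A \<Longrightarrow> proj x \<oplus>\<^bsub>B\<^esub> proj y = proj (x \<oplus> y)"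
  "x \<in> carrier A \<Longrightarrow> c \<odot>\<^bsub>B\<^esub> proj x = proj (c \<odot> x)"
  by (auto simp: quotient_algebra_def FactRing_def A_RCOSETS_def' rcoset_mult_add a_rcos_sum
      scale_coset proj_zero)

lemma quotient_complex_ring: "complex_ring B"
proof (intro complex_ring.intro complex_ring_axioms.intro)
  show "ring B"
  proof (rule ringI)
    show "abelian_group B"
    proof (rule abelian_groupI)
      fix x assume "x \<in> carrier B"
      then obtain z where "z \<in> carrier A" "x = proj z"
        by (auto simp: quotient_simps)
      then have "proj (\<ominus> z) \<in> carrier B \<and> proj (\<ominus> z) \<oplus>\<^bsub>B\<^esub> x = \<zero>\<^bsub>B\<^esub>"
        by (simp add: quotient_simps l_neg)
      then show "\<exists>y\<in>carrier B. y \<oplus>\<^bsub>B\<^esub> x = \<zero>\<^bsub>B\<^esub>" by blast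
    qed (auto simp: quotient_simps a_ac)
    show "monoid B"
      by (rule monoidI) (auto simp: quotient_simps m_assoc)
  qed (auto simp: quotient_simps l_distr r_distr)
qed (auto simp: quotient_simps scale_add_left scale_add_right scale_scale scale_mult_left
    scale_mult_right)

lemma proj_hom: "proj \<in> algebra_hom A B"
  by (auto simp: algebra_hom_def quotient_simps)

text \<open>Homomorphisms that vanish on the ideal factor through the quotient.\<close>

definition lift :: "('a \<Rightarrow> 'b) \<Rightarrow> 'a set \<Rightarrow> 'b" where
  "lift h S = h (SOME x. x \<in> S)"

lemma lift_proj:
  assumes "complex_ring_hom A C h" "\<And>x. x \<in> I \<Longrightarrow> h x = \<zero>\<^bsub>C\<^esub>" "x \<in> carrier A"
  shows "lift h (proj x) = h x"
proof -
  interpret h: complex_ring_hom A C h by fact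
  let ?z = "SOME z. z \<in> proj x"
  have z: "?z \<in> proj x"
    using mem_proj_iff[of x x] assms(3) by (metis someI_ex)
  then have zc: "?z \<in> carrier A" and "h (?z \<ominus> x) = \<zero>\<^bsub>C\<^esub>"
    using assms(2,3) mem_projD[OF z] by auto
  then have "h ?z \<ominus>\<^bsub>C\<^esub> h x = \<zero>\<^bsub>C\<^esub>"
    using assms(3) by (simp add: minus_eq h.B.minus_eq h.add h.minus)
  then show ?thesis
    using zc assms(3) by (simp add: lift_def h.B.r_right_minus_eq)
qed

lemma lift_hom:
  assumes "complex_ring_hom A C h" "\<And>x. x \<in> I \<Longrightarrow> h x = \<zero>\<^bsub>C\<^esub>"
  shows "complex_ring_hom B C (lift h)"
proof -
  interpret h: complex_ring_hom A C h by fact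
  interpret B: complex_ring B by (rule quotient_complex_ring)
  show ?thesis
    by unfold_locales
      (auto simp: algebra_hom_def quotient_simps lift_proj[OF assms] h.add h.mult h.scale)
qed

end


section \<open>Path algebras and Jacobian algebras\<close>

text \<open>
  Representations of a quiver in an algebra are the same as homomorphisms from its path algebra.
  They are not required to be unital: the images of the vertices are orthogonal idempotents, but
  their sum may differ from one.
\<close>

locale quiver = wf_digraph Q for Q :: "('v, 'e) pre_digraph" +
  assumes finite_verts: "finite (verts Q)"
begin

abbreviation "CQ \<equiv> path_algebra Q"

definition single :: "('v, 'e) path \<Rightarrow> ('v, 'e) path \<Rightarrow> complex" where
  "single p = (\<lambda>q. if q = p then 1 else 0)"

lemma CQ_simps [simp]:
  "carrier CQ = {f. finite {p. f p \<noteq> 0} \<and> {p. f p \<noteq> 0} \<subseteq> paths Q}"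
  "\<zero>\<^bsub>CQ\<^esub> = (\<lambda>_. 0)" "f \<oplus>\<^bsub>CQ\<^esub> g = (\<lambda>p. f p + g p)" "c \<odot>\<^bsub>CQ\<^esub> f = (\<lambda>p. c * f p)"
  "\<one>\<^bsub>CQ\<^esub> = (\<lambda>(u, p). if u \<in> verts Q \<and> p = [] then 1 else 0)"
  by (simp_all add: path_algebra_def)

lemma CQ_mult: "(f \<otimes>\<^bsub>CQ\<^esub> g) (u, p) =
    (\<Sum>k\<le>length p. f (u, take k p) * g (awlast u (take k p), drop k p))"
  by (simp add: path_algebra_def)

lemma mem_paths_iff: "(u, p) \<in> paths Q \<longleftrightarrow> awalk u p (awlast u p)"
  unfolding paths_def by auto

lemma paths_append:
  "(u, p @ q) \<in> paths Q \<longleftrightarrow> (u, p) \<in> paths Q \<and> (awlast u p, q) \<in> paths Q"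
  by (auto simp: mem_paths_iff)

lemma awlast_append: "awlast u (p @ q) = awlast (awlast u p) q"
  by (cases "q = []") (auto simp: awalk_verts_conv)

lemma finite_support_mult:
  assumes "f \<in> carrier CQ" "g \<in> carrier CQ"
  shows "f \<otimes>\<^bsub>CQ\<^esub> g \<in> carrier CQ"
proof -
  let ?S = "(\<lambda>((u, p), (v, q)). (u, p @ q)) ` ({p. f p \<noteq> 0} \<times> {p. g p \<noteq> 0})"
  have "{p. (f \<otimes>\<^bsub>CQ\<^esub> g) p \<noteq> 0} \<subseteq> ?S \<inter> paths Q"
  proof
    fix x assume "x \<in> {p. (f \<otimes>\<^bsub>CQ\<^esub> g) p \<noteq> 0}"
    then obtain u p where x: "x = (u, p)" "(f \<otimes>\<^bsub>CQ\<^esub> g) (u, p) \<noteq> 0"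
      by (cases x) auto
    then obtain k where k: "f (u, take k p) \<noteq> 0" "g (awlast u (take k p), drop k p) \<noteq> 0"
      unfolding CQ_mult by (metis (no_types, lifting) mult_eq_0_iff sum.neutral)
    then have "(u, take k p) \<in> paths Q" "(awlast u (take k p), drop k p) \<in> paths Q"
      using assms by auto
    then have "(u, p) \<in> paths Q"
      using paths_append[of u "take k p" "drop k p"] by simp
    moreover have "(u, p) \<in> ?S"
      using k by (intro image_eqI[of _ _ "((u, take k p), (awlast u (take k p), drop k p))"]) auto
    ultimately show "x \<in> ?S \<inter> paths Q" by (simp add: x)
  qed
  moreover have "finite ?S"
    using assms by auto
  ultimately show ?thesis
    by (auto intro: finite_subset)
qed

lemma CQ_mult_assoc: "(f \<otimes>\<^bsub>CQ\<^esub> g) \<otimes>\<^bsub>CQ\<^esub> h = f \<otimes>\<^bsub>CQ\<^esub> (g \<otimes>\<^bsub>CQ\<^esub> h)"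
proof
  fix x :: "('v, 'e) path"
  obtain u p where x: "x = (u, p)" by (cases x)
  let ?F = "\<lambda>i j. f (u, take i p) * g (awlast u (take i p), drop i (take j p))
      * h (awlast u (take j p), drop j p)"
  have "((f \<otimes>\<^bsub>CQ\<^esub> g) \<otimes>\<^bsub>CQ\<^esub> h) (u, p) = (\<Sum>j\<le>length p. \<Sum>i\<le>j. ?F i j)"
    by (auto simp: CQ_mult sum_distrib_right min_def intro!: sum.cong)
  also have "\<dots> = (\<Sum>(j, i) \<in> (SIGMA j:{..length p}. {..j}). ?F i j)"
    by (simp add: sum.Sigma)
  also have "\<dots> = (\<Sum>(i, k) \<in> (SIGMA i:{..length p}. {..length p - i}). ?F i (i + k))"
    by (rule sum.reindex_bij_witness[of _ "\<lambda>(i, k). (i + k, i)" "\<lambda>(j, i). (i, j - i)"]) auto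
  also have "\<dots> = (\<Sum>i\<le>length p. \<Sum>k\<le>length p - i. ?F i (i + k))"
    by (simp add: sum.Sigma)
  also have "\<dots> = (f \<otimes>\<^bsub>CQ\<^esub> (g \<otimes>\<^bsub>CQ\<^esub> h)) (u, p)"
    by (simp add: CQ_mult sum_distrib_left mult.assoc drop_take take_add awlast_append add.commute)
  finally show "((f \<otimes>\<^bsub>CQ\<^esub> g) \<otimes>\<^bsub>CQ\<^esub> h) x = (f \<otimes>\<^bsub>CQ\<^esub> (g \<otimes>\<^bsub>CQ\<^esub> h)) x"
    by (simp add: x)
qed

lemma one_carrier: "\<one>\<^bsub>CQ\<^esub> \<in> carrier CQ"
proof -
  have "{p. \<one>\<^bsub>CQ\<^esub> p \<noteq> 0} = (\<lambda>u. (u, [])) ` verts Q"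
    by (auto split: if_splits)
  then show ?thesis
    using finite_verts by (auto simp: mem_paths_iff awalk_Nil_iff)
qed

lemma in_verts:
  assumes "f \<in> carrier CQ" "f (u, p) \<noteq> 0"
  shows "u \<in> verts Q" "awlast u p \<in> verts Q"
proof -
  have "awalk u p (awlast u p)"
    using assms by (auto simp: mem_paths_iff[symmetric])
  then show "u \<in> verts Q" "awlast u p \<in> verts Q"
    by (rule awalk_hd_in_verts, rule awalk_last_in_verts)
qed

sublocale CQ: complex_ring CQ
proof (intro complex_ring.intro complex_ring_axioms.intro)
  have fin: "finite {p. f p + g p \<noteq> 0}" if "finite {p. f p \<noteq> 0}" "finite {p. g p \<noteq> 0}"
    for f g :: "('v, 'e) path \<Rightarrow> complex"
    using that by (intro finite_subset[OF _ finite_UnI[OF that]]) auto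
  show "ring CQ"
  proof (rule ringI)
    show "abelian_group CQ"
    proof (rule abelian_groupI)
      fix f assume "f \<in> carrier CQ"
      then show "\<exists>g\<in>carrier CQ. g \<oplus>\<^bsub>CQ\<^esub> f = \<zero>\<^bsub>CQ\<^esub>"
        by (intro bexI[of _ "\<lambda>p. - f p"]) auto
    next
      fix f g assume "f \<in> carrier CQ" "g \<in> carrier CQ"
      moreover have "{p. f p + g p \<noteq> 0} \<subseteq> {p. f p \<noteq> 0} \<union> {p. g p \<noteq> 0}"
        by auto
      ultimately show "f \<oplus>\<^bsub>CQ\<^esub> g \<in> carrier CQ"
        using fin[of f g] by auto
    qed (simp_all add: ac_simps)
    show "monoid CQ"
    proof (rule monoidI)
      fix f assume f: "f \<in> carrier CQ"
      show "\<one>\<^bsub>CQ\<^esub> \<otimes>\<^bsub>CQ\<^esub> f = f"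
      proof
        fix x :: "('v, 'e) path"
        obtain u p where x: "x = (u, p)" by (cases x)
        have "(\<one>\<^bsub>CQ\<^esub> \<otimes>\<^bsub>CQ\<^esub> f) (u, p) = (\<Sum>k\<in>{0::nat}. if u \<in> verts Q then f (u, p) else 0)"
          unfolding CQ_mult by (rule sum.mono_neutral_cong_right) auto
        also have "\<dots> = f (u, p)"
          using in_verts[OF f, of u p] by auto
        finally show "(\<one>\<^bsub>CQ\<^esub> \<otimes>\<^bsub>CQ\<^esub> f) x = f x" by (simp add: x)
      qed
      show "f \<otimes>\<^bsub>CQ\<^esub> \<one>\<^bsub>CQ\<^esub> = f"
      proof
        fix x :: "('v, 'e) path"
        obtain u p where x: "x = (u, p)" by (cases x)
        have "(f \<otimes>\<^bsub>CQ\<^esub> \<one>\<^bsub>CQ\<^esub>) (u, p) =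
            (\<Sum>k\<in>{length p}. if awlast u p \<in> verts Q then f (u, p) else 0)"
          unfolding CQ_mult by (rule sum.mono_neutral_cong_right) auto
        also have "\<dots> = f (u, p)"
          using in_verts[OF f, of u p] by auto
        finally show "(f \<otimes>\<^bsub>CQ\<^esub> \<one>\<^bsub>CQ\<^esub>) x = f x" by (simp add: x)
      qed
    qed (rule CQ_mult_assoc one_carrier finite_support_mult; assumption)+
    fix f g h assume "f \<in> carrier CQ" "g \<in> carrier CQ" "h \<in> carrier CQ"
    show "(f \<oplus>\<^bsub>CQ\<^esub> g) \<otimes>\<^bsub>CQ\<^esub> h = f \<otimes>\<^bsub>CQ\<^esub> h \<oplus>\<^bsub>CQ\<^esub> g \<otimes>\<^bsub>CQ\<^esub> h"
      "h \<otimes>\<^bsub>CQ\<^esub> (f \<oplus>\<^bsub>CQ\<^esub> g) = h \<otimes>\<^bsub>CQ\<^esub> f \<oplus>\<^bsub>CQ\<^esub> h \<otimes>\<^bsub>CQ\<^esub> g"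
      by (simp_all add: fun_eq_iff CQ_mult distrib_left distrib_right sum.distrib)
  qed
  fix f :: "('v, 'e) path \<Rightarrow> complex" and c
  assume "f \<in> carrier CQ"
  moreover have "{p. c * f p \<noteq> 0} \<subseteq> {p. f p \<noteq> 0}"
    by auto
  ultimately show "c \<odot>\<^bsub>CQ\<^esub> f \<in> carrier CQ"
    by (auto intro: finite_subset)
qed (simp_all add: fun_eq_iff CQ_mult distrib_left distrib_right sum_distrib_left ac_simps)

lemma single_carrier [simp]: "p \<in> paths Q \<Longrightarrow> single p \<in> carrier CQ"
  by (simp add: single_def)

lemma single_mult:
  "single (u, p) \<otimes>\<^bsub>CQ\<^esub> single (v, q) = (if v = awlast u p then single (u, p @ q) else (\<lambda>_. 0))"
proof
  fix x :: "('v, 'e) path"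
  obtain w r where x: "x = (w, r)" by (cases x)
  have "(single (u, p) \<otimes>\<^bsub>CQ\<^esub> single (v, q)) (w, r) =
      (\<Sum>k\<le>length r. if k = length p then
        if w = u \<and> v = awlast u p \<and> r = p @ q then 1 else 0 else 0)"
    unfolding CQ_mult single_def
  proof (intro sum.cong refl)
    fix k assume "k \<in> {..length r}"
    then have *: "take k r = p \<and> drop k r = q \<longleftrightarrow> k = length p \<and> r = p @ q"
      by auto
    show "(if (w, take k r) = (u, p) then 1 else 0) *
        (if (awlast w (take k r), drop k r) = (v, q) then 1 else 0) =
        (if k = length p then if w = u \<and> v = awlast u p \<and> r = p @ q then 1 else 0 else (0 :: complex))"
    proof (cases "take k r = p \<and> drop k r = q")
      case True
      with * have "k = length p" "r = p @ q" by simp_all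
      then show ?thesis by simp
    next
      case False
      then have "\<not> (k = length p \<and> r = p @ q)"
        using * by blast
      then show ?thesis
        using False by (cases "take k r = p"; cases "k = length p") simp_all
    qed
  qed
  then show "(single (u, p) \<otimes>\<^bsub>CQ\<^esub> single (v, q)) x =
      (if v = awlast u p then single (u, p @ q) else (\<lambda>_. 0)) x"
    by (auto simp: x single_def)
qed

text \<open>Additive statements need to be checked on scalar multiples of paths only.\<close>

lemma CQ_induct [consumes 1, case_names zero single add]:
  assumes "f \<in> carrier CQ"
    and zero: "P (\<lambda>_. 0)"
    and single: "\<And>c p. p \<in> paths Q \<Longrightarrow> P (c \<odot>\<^bsub>CQ\<^esub> single p)"
    and add: "\<And>f g. f \<in> carrier CQ \<Longrightarrow> g \<in> carrier CQ \<Longrightarrow> P f \<Longrightarrow> P g \<Longrightarrow> P (f \<oplus>\<^bsub>CQ\<^esub> g)"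
  shows "P f"
proof -
  have "P f" if "finite S" "S \<subseteq> paths Q" "{p. f p \<noteq> 0} \<subseteq> S" for S f
    using that
  proof (induction S arbitrary: f rule: finite_induct)
    case empty
    then have "f = (\<lambda>_. 0)" by auto
    then show ?case using zero by simp
  next
    case (insert p S)
    let ?g = "f(p := 0)"
    have supp: "{q. ?g q \<noteq> 0} \<subseteq> S"
      using insert.prems by auto
    then have "?g \<in> carrier CQ"
      using insert.hyps insert.prems by (auto intro: finite_subset)
    moreover have "f p \<odot>\<^bsub>CQ\<^esub> single p \<in> carrier CQ"
      using insert.prems by (intro CQ.scale_closed single_carrier) auto
    moreover have "f = f p \<odot>\<^bsub>CQ\<^esub> single p \<oplus>\<^bsub>CQ\<^esub> ?g"
      by (auto simp: single_def)
    ultimately show ?case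
      using insert.IH[OF _ supp] insert.prems single add by (metis insert_subset)
  qed
  then show ?thesis
    using assms(1) by auto
qed

end

locale quiver_rep = quiver Q + E: complex_ring E
  for Q :: "('v, 'e) pre_digraph" and E :: "(complex, 'a) module" +
  fixes ev :: "'v \<Rightarrow> 'a" and ar :: "'e \<Rightarrow> 'a"
  assumes ev_closed [simp]: "v \<in> verts Q \<Longrightarrow> ev v \<in> carrier E"
    and ev_ev: "u \<in> verts Q \<Longrightarrow> v \<in> verts Q \<Longrightarrow>
      ev u \<otimes>\<^bsub>E\<^esub> ev v = (if u = v then ev u else \<zero>\<^bsub>E\<^esub>)"
    and ar_closed [simp]: "a \<in> arcs Q \<Longrightarrow> ar a \<in> carrier E"
    and ev_ar: "a \<in> arcs Q \<Longrightarrow> ev (tail Q a) \<otimes>\<^bsub>E\<^esub> ar a = ar a"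
    and ar_ev: "a \<in> arcs Q \<Longrightarrow> ar a \<otimes>\<^bsub>E\<^esub> ev (head Q a) = ar a"
begin

primrec path_value :: "'v \<Rightarrow> 'e list \<Rightarrow> 'a" where
  "path_value u [] = ev u"
| "path_value u (a # p) = ar a \<otimes>\<^bsub>E\<^esub> path_value (head Q a) p"

definition eval_rep :: "(('v, 'e) path \<Rightarrow> complex) \<Rightarrow> 'a" where
  "eval_rep f = (\<Oplus>\<^bsub>E\<^esub>p\<in>{p. f p \<noteq> 0}. f p \<odot>\<^bsub>E\<^esub> path_value (fst p) (snd p))"

lemma path_value_closed [simp]: "awalk u p v \<Longrightarrow> path_value u p \<in> carrier E"
  by (induction p arbitrary: u) (auto simp: awalk_simps)

lemma path_value_ev: "awalk u p v \<Longrightarrow> path_value u p \<otimes>\<^bsub>E\<^esub> ev v = path_value u p"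
proof (induction p arbitrary: u)
  case (Cons a p)
  then have "ev v \<in> carrier E"
    using awalk_last_in_verts[of u "a # p" v] by simp
  with Cons show ?case
    by (auto simp: awalk_simps E.m_assoc)
qed (auto simp: awalk_simps ev_ev)

lemma ev_path_value: "awalk u p v \<Longrightarrow> ev u \<otimes>\<^bsub>E\<^esub> path_value u p = path_value u p"
  by (cases p) (auto simp: awalk_simps ev_ev ev_ar E.m_assoc[symmetric])

lemma path_value_append:
  assumes "awalk u p v" "awalk v q w"
  shows "path_value u (p @ q) = path_value u p \<otimes>\<^bsub>E\<^esub> path_value v q"
  using assms
proof (induction p arbitrary: u)
  case Nil
  then show ?case by (auto simp: awalk_simps ev_path_value)
next
  case (Cons a p)
  then show ?case by (auto simp: awalk_simps E.m_assoc)
qed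

lemma path_value_mult_zero:
  assumes "awalk u p v" "awalk v' q w" "v \<noteq> v'"
  shows "path_value u p \<otimes>\<^bsub>E\<^esub> path_value v' q = \<zero>\<^bsub>E\<^esub>"
proof -
  have "v \<in> verts Q" "v' \<in> verts Q"
    using assms awalk_last_in_verts awalk_hd_in_verts by blast+
  then have "path_value u p \<otimes>\<^bsub>E\<^esub> path_value v' q =
      (path_value u p \<otimes>\<^bsub>E\<^esub> (ev v \<otimes>\<^bsub>E\<^esub> ev v')) \<otimes>\<^bsub>E\<^esub> path_value v' q"
    using assms path_value_ev[OF assms(1)] ev_path_value[OF assms(2)]
    by (simp add: E.m_assoc del: ev_ev flip: E.m_assoc[of "path_value u p"])
  then show ?thesis
    using assms \<open>v \<in> verts Q\<close> \<open>v' \<in> verts Q\<close> by (simp add: ev_ev)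
qed

lemma path_closed: "p \<in> paths Q \<Longrightarrow> path_value (fst p) (snd p) \<in> carrier E"
  by (auto simp: paths_def)

lemma eval_rep_superset:
  assumes "finite S" "S \<subseteq> paths Q" "{p. f p \<noteq> 0} \<subseteq> S"
  shows "eval_rep f = (\<Oplus>\<^bsub>E\<^esub>p\<in>S. f p \<odot>\<^bsub>E\<^esub> path_value (fst p) (snd p))"
  unfolding eval_rep_def using assms path_closed
  by (intro E.finsum_mono_neutral) auto

lemma eval_rep_add:
  assumes "f \<in> carrier CQ" "g \<in> carrier CQ"
  shows "eval_rep (f \<oplus>\<^bsub>CQ\<^esub> g) = eval_rep f \<oplus>\<^bsub>E\<^esub> eval_rep g"
proof -
  let ?S = "{p. f p \<noteq> 0} \<union> {p. g p \<noteq> 0}"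
  have S: "finite ?S" "?S \<subseteq> paths Q" using assms by auto
  have "eval_rep (f \<oplus>\<^bsub>CQ\<^esub> g) = (\<Oplus>\<^bsub>E\<^esub>p\<in>?S. (f \<oplus>\<^bsub>CQ\<^esub> g) p \<odot>\<^bsub>E\<^esub> path_value (fst p) (snd p))"
    using S by (intro eval_rep_superset) auto
  also have "\<dots> = (\<Oplus>\<^bsub>E\<^esub>p\<in>?S. f p \<odot>\<^bsub>E\<^esub> path_value (fst p) (snd p) \<oplus>\<^bsub>E\<^esub>
      g p \<odot>\<^bsub>E\<^esub> path_value (fst p) (snd p))"
    using S path_closed by (intro E.finsum_cong') (auto simp: E.scale_add_left)
  also have "\<dots> = eval_rep f \<oplus>\<^bsub>E\<^esub> eval_rep g"
    using S path_closed eval_rep_superset[OF S, of f] eval_rep_superset[OF S, of g]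
    by (subst E.finsum_addf) auto
  finally show ?thesis .
qed

lemma eval_rep_single:
  assumes "p \<in> paths Q"
  shows "eval_rep (c \<odot>\<^bsub>CQ\<^esub> single p) = c \<odot>\<^bsub>E\<^esub> path_value (fst p) (snd p)"
proof -
  have "eval_rep (c \<odot>\<^bsub>CQ\<^esub> single p) =
      (\<Oplus>\<^bsub>E\<^esub>q\<in>{p}. (c \<odot>\<^bsub>CQ\<^esub> single p) q \<odot>\<^bsub>E\<^esub> path_value (fst q) (snd q))"
    using assms by (intro eval_rep_superset) (auto simp: single_def)
  then show ?thesis
    using path_closed[OF assms] by (simp add: single_def)
qed

lemma eval_rep_zero [simp]: "eval_rep (\<lambda>_. 0) = \<zero>\<^bsub>E\<^esub>"
  by (simp add: eval_rep_def)

lemma eval_rep_closed: "f \<in> carrier CQ \<Longrightarrow> eval_rep f \<in> carrier E"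
  unfolding eval_rep_def using path_closed by (intro E.finsum_closed) auto

lemma eval_rep_scale:
  assumes "f \<in> carrier CQ"
  shows "eval_rep (c \<odot>\<^bsub>CQ\<^esub> f) = c \<odot>\<^bsub>E\<^esub> eval_rep f"
  using assms
proof (induction f rule: CQ_induct)
  case (single d p)
  then show ?case
    using eval_rep_single[of p "c * d"] eval_rep_single[of p d] path_closed[of p]
    by (simp add: E.scale_scale mult.assoc)
next
  case (add f g)
  then show ?case
    using CQ.scale_add_right[of f g c] eval_rep_add[of "c \<odot>\<^bsub>CQ\<^esub> f" "c \<odot>\<^bsub>CQ\<^esub> g"]
      CQ.scale_closed[of f c] CQ.scale_closed[of g c] eval_rep_add[of f g]
    by (simp add: E.scale_add_right eval_rep_closed del: CQ_simps)
qed simp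

lemma eval_rep_mult:
  assumes "f \<in> carrier CQ" "g \<in> carrier CQ"
  shows "eval_rep (f \<otimes>\<^bsub>CQ\<^esub> g) = eval_rep f \<otimes>\<^bsub>E\<^esub> eval_rep g"
  using assms(1)
proof (induction f rule: CQ_induct)
  case zero
  then show ?case
    using CQ.l_null[OF assms(2)] assms(2) eval_rep_closed by simp
next
  case (single c p)
  show ?case
    using assms(2)
  proof (induction g rule: CQ_induct)
    case zero
    then show ?case
      using CQ.r_null[of "c \<odot>\<^bsub>CQ\<^esub> local.single p"] single eval_rep_closed[of "c \<odot>\<^bsub>CQ\<^esub> local.single p"]
        CQ.scale_closed[OF single_carrier] by (simp del: CQ_simps(1,4))
  next
    case (single d q)
    obtain u r v where p: "p = (u, r)" "awalk u r v"
      using \<open>p \<in> paths Q\<close> by (auto simp: paths_def)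
    obtain v' t w where q: "q = (v', t)" "awalk v' t w"
      using single by (auto simp: paths_def)
    have "(c \<odot>\<^bsub>CQ\<^esub> local.single p) \<otimes>\<^bsub>CQ\<^esub> (d \<odot>\<^bsub>CQ\<^esub> local.single q) =
        (c * d) \<odot>\<^bsub>CQ\<^esub> (local.single p \<otimes>\<^bsub>CQ\<^esub> local.single q)"
      using \<open>p \<in> paths Q\<close> single
      by (simp add: CQ.scale_mult_left CQ.scale_mult_right CQ.scale_scale mult.commute del: CQ_simps)
    moreover have "eval_rep (c \<odot>\<^bsub>CQ\<^esub> local.single p) \<otimes>\<^bsub>E\<^esub> eval_rep (d \<odot>\<^bsub>CQ\<^esub> local.single q) =
        (c * d) \<odot>\<^bsub>E\<^esub> (path_value u r \<otimes>\<^bsub>E\<^esub> path_value v' t)"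
      using \<open>p \<in> paths Q\<close> single p q
      by (simp add: eval_rep_single E.scale_mult_left E.scale_mult_right E.scale_scale
          mult.commute del: CQ_simps)
    moreover have "awlast u r = v"
      using p by simp
    moreover have "(u, r @ t) \<in> paths Q" if "v = v'"
      using p q that by (auto simp: paths_def)
    ultimately show ?case
      using p q eval_rep_single[of "(u, r @ t)" "c * d"] path_value_append[of u r v t w]
        path_value_mult_zero[of u r v v' t w]
      by (auto simp: single_mult)
  next
    case (add g h)
    let ?s = "c \<odot>\<^bsub>CQ\<^esub> local.single p"
    have "?s \<in> carrier CQ" using single by (simp del: CQ_simps)
    then show ?case
      using add eval_rep_closed by (simp add: CQ.r_distr E.r_distr eval_rep_add del: CQ_simps)
  qed
next
  case (add f h)
  then show ?case
    using assms(2) eval_rep_closed by (simp add: CQ.l_distr E.l_distr eval_rep_add del: CQ_simps)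
qed

lemma eval_rep_hom: "complex_ring_hom CQ E eval_rep"
  by unfold_locales
    (simp add: algebra_hom_def eval_rep_closed eval_rep_add eval_rep_mult eval_rep_scale del: CQ_simps)

end


context quiver
begin

lemma path_rep: "quiver_rep Q CQ (\<lambda>v. single (v, [])) (\<lambda>a. single (tail Q a, [a]))"
  by unfold_locales
    (auto simp: single_mult mem_paths_iff awalk_simps simp del: CQ_simps(1) intro!: single_carrier)

lemma path_rep_value:
  "awalk u p v \<Longrightarrow> quiver_rep.path_value Q CQ (\<lambda>v. single (v, [])) (\<lambda>a. single (tail Q a, [a])) u p
    = single (u, p)"
proof (induction p arbitrary: u)
  case Nil
  then show ?case by (simp add: quiver_rep.path_value.simps[OF path_rep])
next
  case (Cons a p)
  then show ?case
    by (simp add: quiver_rep.path_value.simps[OF path_rep] awalk_simps single_mult)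
qed

lemma path_rep_eval:
  assumes "f \<in> carrier CQ"
  shows "quiver_rep.eval_rep Q CQ (\<lambda>v. single (v, [])) (\<lambda>a. single (tail Q a, [a])) f = f"
proof -
  interpret rep: quiver_rep Q CQ "\<lambda>v. single (v, [])" "\<lambda>a. single (tail Q a, [a])"
    by (rule path_rep)
  show ?thesis
    using assms
  proof (induction f rule: CQ_induct)
    case (single c p)
    then show ?case
      using rep.eval_rep_single[OF single, of c] path_rep_value[of "fst p" "snd p"]
      by (auto simp: paths_def simp del: CQ_simps)
  next
    case (add f g)
    then show ?case by (simp add: rep.eval_rep_add del: CQ_simps)
  qed (simp add: rep.eval_rep_zero)
qed

text \<open>
  Homomorphisms, here and on quotients, are compared by this induction: it suffices that they agree
  on the vertices and the arrows.
\<close>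

lemma CQ_generated [consumes 1, case_names vert arc zero add mult scale]:
  assumes "f \<in> carrier CQ"
    and vert: "\<And>v. v \<in> verts Q \<Longrightarrow> P (single (v, []))"
    and arc: "\<And>a. a \<in> arcs Q \<Longrightarrow> P (single (tail Q a, [a]))"
    and zero: "P \<zero>\<^bsub>CQ\<^esub>"
    and add: "\<And>f g. f \<in> carrier CQ \<Longrightarrow> g \<in> carrier CQ \<Longrightarrow> P f \<Longrightarrow> P g \<Longrightarrow> P (f \<oplus>\<^bsub>CQ\<^esub> g)"
    and mult: "\<And>f g. f \<in> carrier CQ \<Longrightarrow> g \<in> carrier CQ \<Longrightarrow> P f \<Longrightarrow> P g \<Longrightarrow> P (f \<otimes>\<^bsub>CQ\<^esub> g)"
    and scale: "\<And>f c. f \<in> carrier CQ \<Longrightarrow> P f \<Longrightarrow> P (c \<odot>\<^bsub>CQ\<^esub> f)"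
  shows "P f"
proof -
  have path: "P (single (u, p))" if "awalk u p v" for u p v
    using that
  proof (induction p arbitrary: u)
    case Nil
    then show ?case by (auto simp: awalk_simps vert)
  next
    case (Cons a p)
    then have "single (u, a # p) = single (tail Q a, [a]) \<otimes>\<^bsub>CQ\<^esub> single (head Q a, p)"
      by (simp add: single_mult awalk_simps)
    then show ?case
      using Cons by (auto simp: awalk_simps mem_paths_iff simp del: CQ_simps
          intro!: mult arc single_carrier)
  qed
  show ?thesis
    using assms(1)
  proof (induction f rule: CQ_induct)
    case (single c p)
    then show ?case
      using path by (auto simp: paths_def simp del: CQ_simps intro!: scale single_carrier)
  qed (use zero add in \<open>auto simp del: CQ_simps(1,3)\<close>)
qed

end

locale three_cycle_qp = quiver Q for Q :: "('v, 'e) pre_digraph" +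
  fixes w :: "'e list \<Rightarrow> complex"
  assumes finite_arcs: "finite (arcs Q)"
    and weight_rotate: "[a, b, c] \<in> cycles Q \<Longrightarrow> w [b, c, a] = w [a, b, c]"
begin

text \<open>
  The paths of length two that close the arrow \<open>a\<close> to a cycle; they are the terms of the derivative
  with respect to \<open>a\<close>.
\<close>

definition completions :: "'e \<Rightarrow> ('e \<times> 'e) set" where
  "completions a = {(b, c). [a, b, c] \<in> cycles Q}"

text \<open>
  A cycle that is the cube of a loop occurs three times in its own derivative.
\<close>

definition deriv_weight :: "'e \<Rightarrow> 'e \<Rightarrow> 'e \<Rightarrow> complex" where
  "deriv_weight a b c = w [a, b, c] * (if a = b \<and> b = c then 3 else 1)"

lemma cycles_iff: "[a, b, c] \<in> cycles Q \<longleftrightarrow> {a, b, c} \<subseteq> arcs Q \<and> head Q a = tail Q b \<and>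
    head Q b = tail Q c \<and> head Q c = tail Q a"
  by (auto simp: cycles_def awalk_simps)

lemma finite_completions: "finite (completions a)"
  by (rule finite_subset[of _ "arcs Q \<times> arcs Q"])
    (auto simp: completions_def cycles_iff finite_arcs)

lemma rotations3: "cyclic_class [a, b, c] = {[a, b, c], [b, c, a], [c, a, b]}"
proof -
  let ?f = "\<lambda>n. rotate n [a, b, c]"
  have "?f n \<in> {[a, b, c], [b, c, a], [c, a, b]}" for n
  proof (induction n)
    case (Suc n)
    then consider "?f n = [a, b, c]" | "?f n = [b, c, a]" | "?f n = [c, a, b]" by blast
    then show ?case by cases simp_all
  qed simp
  then have "range ?f \<subseteq> {[a, b, c], [b, c, a], [c, a, b]}"
    by (rule image_subsetI)
  moreover have "[a, b, c] \<in> range ?f"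
    by (rule range_eqI[of _ _ 0]) simp
  moreover have "[b, c, a] \<in> range ?f"
    by (rule range_eqI[of _ _ "Suc 0"]) simp
  moreover have "[c, a, b] \<in> range ?f"
    by (rule range_eqI[of _ _ "Suc (Suc 0)"]) simp
  ultimately show ?thesis
    unfolding cyclic_class_def by (intro equalityI insert_subsetI empty_subsetI)
qed

lemma cycle3_rotate: "[a, b, c] \<in> cycles Q \<Longrightarrow> [b, c, a] \<in> cycles Q"
  by (auto simp: cycles_iff)

lemma weight_class:
  assumes "[a, b, c] \<in> cycles Q" "d \<in> cyclic_class [a, b, c]"
  shows "w d = w [a, b, c]" "cycle_deriv Q e d = cycle_deriv Q e [a, b, c]"
proof -
  show "w d = w [a, b, c]"
    using assms weight_rotate[of a b c] weight_rotate[of b c a] cycle3_rotate by (auto simp: rotations3)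
  show "cycle_deriv Q e d = cycle_deriv Q e [a, b, c]"
    using assms(2) by (auto simp: cyclic_class_def cycle_deriv_rotate)
qed

lemma some_in_class: "(SOME d. d \<in> cyclic_class c) \<in> cyclic_class c"
  by (rule someI[of _ c]) (auto simp: cyclic_class_def intro!: image_eqI[of _ _ 0])

lemma cycle_deriv3: "cycle_deriv Q a [b, c, d] p =
    (if a = b \<and> p = (head Q a, [c, d]) then 1 else 0) +
    (if a = c \<and> p = (head Q a, [d, b]) then 1 else 0) +
    (if a = d \<and> p = (head Q a, [b, c]) then 1 else 0)"
proof -
  have "cycle_deriv Q a [b, c, d] p = (\<Sum>i<3. if [b, c, d] ! i = a then
      if p = (head Q a, drop (Suc i) [b, c, d] @ take i [b, c, d]) then 1 else 0 else 0)"
    unfolding cycle_deriv_def by (intro sum.mono_neutral_cong_left) auto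
  then show ?thesis
    by (cases "a = b"; cases "a = c"; cases "a = d") (simp_all add: numeral_3_eq_3)
qed

abbreviation "W \<equiv> three_cycle_potential Q w"

lemma W_class:
  assumes "[a, b, c] \<in> cycles Q"
  shows "W (cyclic_class [a, b, c]) = w [a, b, c]"
  using weight_class(1)[OF assms some_in_class] assms
  by (auto simp: three_cycle_potential_def intro!: bexI[of _ "[a, b, c]"])

lemma W_nonzeroE:
  assumes "W C \<noteq> 0"
  obtains a b c where "[a, b, c] \<in> cycles Q" "C = cyclic_class [a, b, c]"
proof -
  from assms obtain d where d: "d \<in> cycles Q" "length d = 3" "C = cyclic_class d"
    by (auto simp: three_cycle_potential_def split: if_splits)
  then obtain a b c where "d = [a, b, c]"
    by (auto simp: eval_nat_numeral length_Suc_conv)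
  with d that show ?thesis by blast
qed

text \<open>
  The potential refers to chosen representatives of the cyclic classes.  Since the weight is
  invariant under rotation, the choice does not matter, and the derivative becomes a sum over the
  completions of \<open>a\<close>.
\<close>

lemma potential_deriv_apply: "potential_deriv Q W a p =
    (\<Sum>(b, c)\<in>completions a. if p = (head Q a, [b, c]) then deriv_weight a b c else 0)"
proof -
  let ?S = "{C. C \<in> cycle_classes Q \<and> W C \<noteq> 0}"
  have "?S \<subseteq> (\<lambda>(a, b, c). cyclic_class [a, b, c]) ` (arcs Q \<times> arcs Q \<times> arcs Q)"
  proof
    fix C assume "C \<in> ?S"
    then obtain a b c where "[a, b, c] \<in> cycles Q" "C = cyclic_class [a, b, c]"
      using W_nonzeroE by blast
    then show "C \<in> (\<lambda>(a, b, c). cyclic_class [a, b, c]) ` (arcs Q \<times> arcs Q \<times> arcs Q)"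
      by (intro image_eqI[of _ _ "(a, b, c)"]) (auto simp: cycles_iff)
  qed
  then have fin: "finite ?S"
    using finite_arcs by (auto intro: finite_subset)
  have lhs: "potential_deriv Q W a p = (\<Sum>C\<in>?S. W C * cycle_deriv Q a (SOME c. c \<in> C) p)"
    by (simp add: potential_deriv_def)
  have zero: "cycle_deriv Q a (SOME c. c \<in> C) p = 0"
    if C: "C \<in> ?S" and ne: "\<And>b c. p = (head Q a, [b, c]) \<Longrightarrow> C \<noteq> cyclic_class [a, b, c]" for C
  proof -
    obtain x y z where xyz: "[x, y, z] \<in> cycles Q" "C = cyclic_class [x, y, z]"
      using C W_nonzeroE by blast
    have "cyclic_class [y, z, x] = C" "cyclic_class [z, x, y] = C"
      by (simp_all only: xyz(2) rotations3 insert_commute)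
    then have "\<not> (a = x \<and> p = (head Q a, [y, z]))" "\<not> (a = y \<and> p = (head Q a, [z, x]))"
      "\<not> (a = z \<and> p = (head Q a, [x, y]))"
      using ne[of y z] ne[of z x] ne[of x y] xyz(2) by (simp_all only: not_False_eq_True de_Morgan_conj) metis+
    then have "cycle_deriv Q a [x, y, z] p = 0"
      unfolding cycle_deriv3 by (simp only: if_False add_0_left)
    then show ?thesis
      using weight_class(2)[OF xyz(1) some_in_class] xyz(2) by simp
  qed
  show ?thesis
  proof (cases "\<exists>b c. (b, c) \<in> completions a \<and> p = (head Q a, [b, c])")
    case True
    then obtain b c where bc: "[a, b, c] \<in> cycles Q" and p: "p = (head Q a, [b, c])"
      by (auto simp: completions_def)
    let ?C = "cyclic_class [a, b, c]"
    have "potential_deriv Q W a p = (\<Sum>C\<in>?S. if C = ?C then w [a, b, c] * cycle_deriv Q a [a, b, c] p else 0)"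
      unfolding lhs
    proof (intro sum.cong refl)
      fix C assume "C \<in> ?S"
      show "W C * cycle_deriv Q a (SOME c. c \<in> C) p =
          (if C = ?C then w [a, b, c] * cycle_deriv Q a [a, b, c] p else 0)"
      proof (cases "C = ?C")
        case True
        then show ?thesis
          using weight_class(2)[OF bc some_in_class] W_class[OF bc] by simp
      next
        case False
        then have "cycle_deriv Q a (SOME c. c \<in> C) p = 0"
          using \<open>C \<in> ?S\<close> by (intro zero) (auto simp: p)
        then show ?thesis using False by simp
      qed
    qed
    also have "\<dots> = w [a, b, c] * cycle_deriv Q a [a, b, c] p"
    proof (cases "?C \<in> ?S")
      case True
      then show ?thesis using fin by (simp only: sum.delta if_True)
    next
      case False
      then have "w [a, b, c] = 0"
        using bc W_class[OF bc] by (simp add: cycle_classes_def)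
      then show ?thesis by (simp only: mult_zero_left if_cancel sum.neutral_const)
    qed
    also have "\<dots> = deriv_weight a b c"
      by (cases "a = b"; cases "b = c"; cases "a = c") (simp_all add: cycle_deriv3 p deriv_weight_def)
    also have "\<dots> = (\<Sum>x\<in>completions a. if x = (b, c) then deriv_weight a b c else 0)"
      using finite_completions[of a] bc by (auto simp: completions_def)
    also have "\<dots> = (\<Sum>(b, c)\<in>completions a. if p = (head Q a, [b, c]) then deriv_weight a b c else 0)"
      by (intro sum.cong) (auto simp: p split: if_splits)
    finally show ?thesis .
  next
    case False
    have "W C * cycle_deriv Q a (SOME c. c \<in> C) p = 0" if C: "C \<in> ?S" for C
    proof (subst zero[OF C])
      fix b c assume p: "p = (head Q a, [b, c])"
      show "C \<noteq> cyclic_class [a, b, c]"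
      proof
        assume "C = cyclic_class [a, b, c]"
        moreover obtain x y z where xyz: "[x, y, z] \<in> cycles Q" "C = cyclic_class [x, y, z]"
          using C W_nonzeroE by blast
        ultimately have "[a, b, c] \<in> cyclic_class [x, y, z]"
          by (auto simp: rotations3)
        then have "[a, b, c] \<in> cycles Q"
          using xyz(1) cycle3_rotate by (auto simp: rotations3)
        then show False
          using False p by (auto simp: completions_def)
      qed
    qed simp
    then have "potential_deriv Q W a p = 0"
      unfolding lhs by (rule sum.neutral[OF ballI])
    moreover have "(case x of (b, c) \<Rightarrow> if p = (head Q a, [b, c]) then deriv_weight a b c else 0) = 0"
      if "x \<in> completions a" for x
      using False that by (cases x) auto
    then have "(\<Sum>(b, c)\<in>completions a. if p = (head Q a, [b, c]) then deriv_weight a b c else 0) = 0"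
      by (rule sum.neutral[OF ballI])
    ultimately show ?thesis by simp
  qed
qed

lemma potential_deriv_eq: "potential_deriv Q W a (u, q) =
    (if u = head Q a \<and> (\<exists>b c. q = [b, c] \<and> (b, c) \<in> completions a)
     then deriv_weight a (q ! 0) (q ! 1) else 0)"
proof (cases "u = head Q a \<and> (\<exists>b c. q = [b, c] \<and> (b, c) \<in> completions a)")
  case True
  then obtain b c where bc: "u = head Q a" "q = [b, c]" "(b, c) \<in> completions a" by blast
  have "potential_deriv Q W a (u, q) =
      (\<Sum>x\<in>completions a. if x = (b, c) then deriv_weight a b c else 0)"
    unfolding potential_deriv_apply using bc by (intro sum.cong) (auto split: if_splits)
  then show ?thesis
    using finite_completions[of a] bc by simp
next
  case False
  then have "potential_deriv Q W a (u, q) = 0"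
    unfolding potential_deriv_apply by (intro sum.neutral) auto
  then show ?thesis by (simp only: if_not_P[OF False])
qed

lemma potential_deriv_support:
  "{p. potential_deriv Q W a p \<noteq> 0} \<subseteq> (\<lambda>(b, c). (head Q a, [b, c])) ` completions a"
proof
  fix p assume "p \<in> {p. potential_deriv Q W a p \<noteq> 0}"
  then have "potential_deriv Q W a (fst p, snd p) \<noteq> 0" by simp
  then obtain b c where "fst p = head Q a" "snd p = [b, c]" "(b, c) \<in> completions a"
    unfolding potential_deriv_eq by metis
  then show "p \<in> (\<lambda>(b, c). (head Q a, [b, c])) ` completions a"
    by (intro image_eqI[of _ _ "(b, c)"]) (auto simp: prod_eq_iff)
qed

lemma completion_paths: "(\<lambda>(b, c). (head Q a, [b, c])) ` completions a \<subseteq> paths Q"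
  by (auto simp: completions_def cycles_iff mem_paths_iff awalk_simps)

lemma potential_deriv_closed: "potential_deriv Q W a \<in> carrier CQ"
  using potential_deriv_support[of a] completion_paths[of a] finite_completions[of a]
  by (auto intro: finite_subset)

abbreviation "J \<equiv> jacobian_ideal Q W"
abbreviation "Jac \<equiv> jacobian_algebra Q W"

sublocale J: algebra_ideal CQ J
proof -
  interpret ideal J CQ
    unfolding jacobian_ideal_def using potential_deriv_closed by (intro CQ.genideal_ideal) blast
  show "algebra_ideal CQ J" ..
qed

sublocale Jac: complex_ring Jac
  unfolding jacobian_algebra_def by (rule J.quotient_complex_ring)

end

text \<open>
  A representation of the quiver with potential: the images of the arrows satisfy the relations
  given by the derivatives of the potential.
\<close>

locale qp_rep = three_cycle_qp Q w + quiver_rep Q E ev ar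
  for Q :: "('v, 'e) pre_digraph" and w and E :: "(complex, 'a) module" and ev ar +
  assumes relation: "a \<in> arcs Q \<Longrightarrow>
    (\<Oplus>\<^bsub>E\<^esub>x\<in>completions a. deriv_weight a (fst x) (snd x) \<odot>\<^bsub>E\<^esub>
      (ar (fst x) \<otimes>\<^bsub>E\<^esub> ar (snd x))) = \<zero>\<^bsub>E\<^esub>"

context three_cycle_qp
begin

lemma eval_potential_deriv:
  assumes "quiver_rep Q E ev ar"
  shows "quiver_rep.eval_rep Q E ev ar (potential_deriv Q W a) =
    (\<Oplus>\<^bsub>E\<^esub>x\<in>completions a. deriv_weight a (fst x) (snd x) \<odot>\<^bsub>E\<^esub>
      (ar (fst x) \<otimes>\<^bsub>E\<^esub> ar (snd x)))"
proof -
  interpret quiver_rep Q E ev ar by fact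
  let ?g = "\<lambda>(b, c). (head Q a, [b, c])"
  have inj: "inj_on ?g (completions a)"
    by (auto simp: inj_on_def)
  have val: "ar b \<otimes>\<^bsub>E\<^esub> path_value (head Q b) [c] = ar b \<otimes>\<^bsub>E\<^esub> ar c"
    if "(b, c) \<in> completions a" for b c
    using that ar_ev[of c] by (auto simp: completions_def cycles_iff)
  have "eval_rep (potential_deriv Q W a) = (\<Oplus>\<^bsub>E\<^esub>p\<in>?g ` completions a.
      potential_deriv Q W a p \<odot>\<^bsub>E\<^esub> path_value (fst p) (snd p))"
    using finite_completions[of a] completion_paths[of a] potential_deriv_support[of a]
    by (intro eval_rep_superset) auto
  also have "\<dots> = (\<Oplus>\<^bsub>E\<^esub>x\<in>completions a.
      potential_deriv Q W a (?g x) \<odot>\<^bsub>E\<^esub> path_value (fst (?g x)) (snd (?g x)))"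
    using completion_paths[of a] path_closed by (intro E.finsum_reindex inj) blast
  also have "\<dots> = (\<Oplus>\<^bsub>E\<^esub>x\<in>completions a. deriv_weight a (fst x) (snd x) \<odot>\<^bsub>E\<^esub>
      (ar (fst x) \<otimes>\<^bsub>E\<^esub> ar (snd x)))"
    using val by (intro E.finsum_cong')
      (auto simp: potential_deriv_eq completions_def cycles_iff ar_ev)
  finally show ?thesis .
qed

abbreviation "vertex v \<equiv> J.proj (single (v, []))"
abbreviation "arrow a \<equiv> J.proj (single (tail Q a, [a]))"

lemma proj_hom: "complex_ring_hom CQ Jac J.proj"
  using J.proj_hom by unfold_locales (simp add: jacobian_algebra_def)

lemma path_rep_quotient: "quiver_rep Q Jac vertex arrow"
proof -
  interpret rep: quiver_rep Q CQ "\<lambda>v. single (v, [])" "\<lambda>a. single (tail Q a, [a])"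
    by (rule path_rep)
  interpret proj: complex_ring_hom CQ Jac J.proj
    by (rule proj_hom)
  show ?thesis
    by unfold_locales
      (auto simp: proj.mult[symmetric] rep.ev_ev rep.ev_ar rep.ar_ev simp del: CQ_simps(1,2) intro!: proj.closed)
qed

text \<open>
  The derivatives of the potential vanish in the Jacobian algebra because they generate the ideal.
\<close>

lemma universal_rep: "qp_rep Q w Jac vertex arrow"
proof -
  interpret rep: quiver_rep Q CQ "\<lambda>v. single (v, [])" "\<lambda>a. single (tail Q a, [a])"
    by (rule path_rep)
  interpret proj: complex_ring_hom CQ Jac J.proj
    by (rule proj_hom)
  interpret rep': quiver_rep Q Jac vertex arrow
    by (rule path_rep_quotient)
  show ?thesis
  proof unfold_locales
    fix a assume a: "a \<in> arcs Q"
    let ?s = "\<lambda>a. single (tail Q a, [a])"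
    let ?f = "\<lambda>x. deriv_weight a (fst x) (snd x) \<odot>\<^bsub>CQ\<^esub> (?s (fst x) \<otimes>\<^bsub>CQ\<^esub> ?s (snd x))"
    have closed: "?f \<in> completions a \<rightarrow> carrier CQ"
      by (auto simp: completions_def cycles_iff simp del: CQ_simps
          intro!: CQ.scale_closed CQ.m_closed)
    have "potential_deriv Q W a \<in> J"
      unfolding jacobian_ideal_def
      using CQ.genideal_self[of "potential_deriv Q W ` arcs Q"] potential_deriv_closed a by blast
    then have "J.proj (potential_deriv Q W a) = \<zero>\<^bsub>Jac\<^esub>"
      using J.a_rcos_const J.quotient_simps(3) J.proj_zero by (simp add: jacobian_algebra_def)
    moreover have "potential_deriv Q W a = finsum CQ ?f (completions a)"
      using eval_potential_deriv[OF path_rep, of a] path_rep_eval[OF potential_deriv_closed] by simp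
    moreover have "J.proj (finsum CQ ?f (completions a)) =
        (\<Oplus>\<^bsub>Jac\<^esub>x\<in>completions a. J.proj (?f x))"
      by (rule proj.finsum[OF closed])
    moreover have "(\<Oplus>\<^bsub>Jac\<^esub>x\<in>completions a. J.proj (?f x)) =
        (\<Oplus>\<^bsub>Jac\<^esub>x\<in>completions a. deriv_weight a (fst x) (snd x) \<odot>\<^bsub>Jac\<^esub>
      (arrow (fst x) \<otimes>\<^bsub>Jac\<^esub> arrow (snd x)))"
      by (intro Jac.finsum_cong')
        (auto simp: completions_def cycles_iff proj.scale proj.mult simp del: CQ_simps
          intro!: Jac.scale_closed Jac.m_closed)
    ultimately show "(\<Oplus>\<^bsub>Jac\<^esub>x\<in>completions a. deriv_weight a (fst x) (snd x) \<odot>\<^bsub>Jac\<^esub>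
      (arrow (fst x) \<otimes>\<^bsub>Jac\<^esub> arrow (snd x))) = \<zero>\<^bsub>Jac\<^esub>"
      by simp
  qed
qed

lemma Jac_carrierE:
  assumes "x \<in> carrier Jac"
  obtains f where "f \<in> carrier CQ" "x = J.proj f"
  using assms J.quotient_simps(1) by (auto simp: jacobian_algebra_def simp del: CQ_simps)

lemma Jac_generated [consumes 1, case_names vert arc zero add mult scale]:
  assumes "x \<in> carrier Jac"
    and vert: "\<And>v. v \<in> verts Q \<Longrightarrow> P (vertex v)"
    and arc: "\<And>a. a \<in> arcs Q \<Longrightarrow> P (arrow a)"
    and zero: "P \<zero>\<^bsub>Jac\<^esub>"
    and add: "\<And>x y. x \<in> carrier Jac \<Longrightarrow> y \<in> carrier Jac \<Longrightarrow> P x \<Longrightarrow> P y \<Longrightarrow> P (x \<oplus>\<^bsub>Jac\<^esub> y)"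
    and mult: "\<And>x y. x \<in> carrier Jac \<Longrightarrow> y \<in> carrier Jac \<Longrightarrow> P x \<Longrightarrow> P y \<Longrightarrow> P (x \<otimes>\<^bsub>Jac\<^esub> y)"
    and scale: "\<And>x c. x \<in> carrier Jac \<Longrightarrow> P x \<Longrightarrow> P (c \<odot>\<^bsub>Jac\<^esub> x)"
  shows "P x"
proof -
  interpret proj: complex_ring_hom CQ Jac J.proj
    by (rule proj_hom)
  obtain f where f: "f \<in> carrier CQ" "x = J.proj f"
    using assms(1) by (rule Jac_carrierE)
  have "P (J.proj f)"
    using f(1)
  proof (induction f rule: CQ_generated)
    case zero
    then show ?case using \<open>P \<zero>\<^bsub>Jac\<^esub>\<close> proj.zero by simp
  qed (simp_all add: vert arc add mult scale proj.add proj.mult proj.scale del: CQ_simps)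
  then show ?thesis using f by simp
qed

lemma one_eq_sum_vertices: "\<one>\<^bsub>Jac\<^esub> = (\<Oplus>\<^bsub>Jac\<^esub>v\<in>verts Q. vertex v)"
proof -
  interpret proj: complex_ring_hom CQ Jac J.proj
    by (rule proj_hom)
  have sum: "finsum CQ (\<lambda>v. single (v, [])) S = (\<lambda>(u, p). if u \<in> S \<and> p = [] then 1 else 0)"
    if "finite S" "S \<subseteq> verts Q" for S
    using that
  proof (induction S rule: finite_induct)
    case (insert v S)
    then have "(\<lambda>v. single (v, [])) \<in> insert v S \<rightarrow> carrier CQ"
      by (auto simp: mem_paths_iff awalk_simps simp del: CQ_simps)
    with insert show ?case
      by (auto simp: CQ.finsum_insert single_def fun_eq_iff simp del: CQ_simps(1))
  qed (auto simp: fun_eq_iff)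
  have "\<one>\<^bsub>Jac\<^esub> = J.proj \<one>\<^bsub>CQ\<^esub>"
    using J.quotient_simps(2) by (simp add: jacobian_algebra_def)
  also have "\<one>\<^bsub>CQ\<^esub> = finsum CQ (\<lambda>v. single (v, [])) (verts Q)"
    using sum[OF finite_verts] by simp
  also have "J.proj \<dots> = (\<Oplus>\<^bsub>Jac\<^esub>v\<in>verts Q. vertex v)"
    by (intro proj.finsum) (auto simp: mem_paths_iff awalk_simps simp del: CQ_simps)
  finally show ?thesis .
qed

end

context qp_rep
begin

definition hom_of_rep :: "(('v, 'e) path \<Rightarrow> complex) set \<Rightarrow> 'a" where
  "hom_of_rep = J.lift eval_rep"

lemma eval_rep_ideal:
  assumes "f \<in> J"
  shows "eval_rep f = \<zero>\<^bsub>E\<^esub>"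
proof -
  interpret ev: complex_ring_hom CQ E eval_rep by (rule eval_rep_hom)
  have "J \<subseteq> {f \<in> carrier CQ. eval_rep f = \<zero>\<^bsub>E\<^esub>}"
    unfolding jacobian_ideal_def
  proof (rule CQ.genideal_minimal[OF ev.kernel_ideal], safe)
    fix a assume "a \<in> arcs Q"
    then show "potential_deriv Q W a \<in> carrier CQ" "eval_rep (potential_deriv Q W a) = \<zero>\<^bsub>E\<^esub>"
      using potential_deriv_closed eval_potential_deriv[OF quiver_rep_axioms] relation by auto
  qed
  with assms show ?thesis by blast
qed

sublocale hom: complex_ring_hom Jac E hom_of_rep
  unfolding hom_of_rep_def jacobian_algebra_def
  by (rule J.lift_hom[OF eval_rep_hom eval_rep_ideal])

lemma hom_proj: "f \<in> carrier CQ \<Longrightarrow> hom_of_rep (J.proj f) = eval_rep f"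
  unfolding hom_of_rep_def by (rule J.lift_proj[OF eval_rep_hom eval_rep_ideal])

lemma hom_vertex: "v \<in> verts Q \<Longrightarrow> hom_of_rep (vertex v) = ev v"
  using hom_proj[of "1 \<odot>\<^bsub>CQ\<^esub> single (v, [])"] eval_rep_single[of "(v, [])" 1]
  by (simp add: mem_paths_iff awalk_simps CQ.scale_one del: CQ_simps)

lemma hom_arrow: "a \<in> arcs Q \<Longrightarrow> hom_of_rep (arrow a) = ar a"
  using hom_proj[of "1 \<odot>\<^bsub>CQ\<^esub> single (tail Q a, [a])"] eval_rep_single[of "(tail Q a, [a])" 1]
  by (simp add: mem_paths_iff awalk_simps CQ.scale_one ar_ev del: CQ_simps)

end


lemma (in abelian_monoid) finsum_eqI:
  assumes "\<And>i. i \<in> I \<Longrightarrow> f i = g i" "\<And>i. i \<in> I \<Longrightarrow> g i \<in> carrier G"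
  shows "finsum G f I = finsum G g I"
  using assms by (intro finsum_cong'[OF refl]) auto

section \<open>Endomorphism algebras\<close>

locale complex_space = abelian_group V for V :: "(complex, 'v) module" (structure) +
  assumes scale_closed [simp, intro]: "x \<in> carrier V \<Longrightarrow> c \<odot> x \<in> carrier V"
    and scale_add_left: "x \<in> carrier V \<Longrightarrow> (b + c) \<odot> x = b \<odot> x \<oplus> c \<odot> x"
    and scale_add_right:
      "x \<in> carrier V \<Longrightarrow> y \<in> carrier V \<Longrightarrow> c \<odot> (x \<oplus> y) = c \<odot> x \<oplus> c \<odot> y"
    and scale_scale: "x \<in> carrier V \<Longrightarrow> b \<odot> (c \<odot> x) = (b * c) \<odot> x"
    and scale_one [simp]: "x \<in> carrier V \<Longrightarrow> 1 \<odot> x = x"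

text \<open>
  Linear maps are extensional, so that they are equal if they agree on the carrier.
\<close>

definition linear_maps :: "(complex, 'v) module \<Rightarrow> ('v \<Rightarrow> 'v) set" where
  "linear_maps V = {f \<in> carrier V \<rightarrow>\<^sub>E carrier V.
     (\<forall>x\<in>carrier V. \<forall>y\<in>carrier V. f (x \<oplus>\<^bsub>V\<^esub> y) = f x \<oplus>\<^bsub>V\<^esub> f y) \<and>
     (\<forall>c. \<forall>x\<in>carrier V. f (c \<odot>\<^bsub>V\<^esub> x) = c \<odot>\<^bsub>V\<^esub> f x)}"

definition End_algebra :: "(complex, 'v) module \<Rightarrow> (complex, 'v \<Rightarrow> 'v) module" where
  "End_algebra V =
    \<lparr>carrier = linear_maps V, monoid.mult = (\<lambda>f g. compose (carrier V) f g),
     one = (\<lambda>x\<in>carrier V. x), ring.zero = (\<lambda>x\<in>carrier V. \<zero>\<^bsub>V\<^esub>),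
     ring.add = (\<lambda>f g. \<lambda>x\<in>carrier V. f x \<oplus>\<^bsub>V\<^esub> g x),
     module.smult = (\<lambda>c f. \<lambda>x\<in>carrier V. c \<odot>\<^bsub>V\<^esub> f x)\<rparr>"

lemma End_simps [simp]:
  "carrier (End_algebra V) = linear_maps V"
  "f \<otimes>\<^bsub>End_algebra V\<^esub> g = compose (carrier V) f g"
  "\<one>\<^bsub>End_algebra V\<^esub> = (\<lambda>x\<in>carrier V. x)"
  "\<zero>\<^bsub>End_algebra V\<^esub> = (\<lambda>x\<in>carrier V. \<zero>\<^bsub>V\<^esub>)"
  "f \<oplus>\<^bsub>End_algebra V\<^esub> g = (\<lambda>x\<in>carrier V. f x \<oplus>\<^bsub>V\<^esub> g x)"
  "c \<odot>\<^bsub>End_algebra V\<^esub> f = (\<lambda>x\<in>carrier V. c \<odot>\<^bsub>V\<^esub> f x)"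
  by (simp_all add: End_algebra_def)

context complex_space
begin

lemma scale_zero_left: "x \<in> carrier V \<Longrightarrow> 0 \<odot> x = \<zero>"
  using scale_add_left[of x 0 0] by simp

lemma linear_mapsI:
  assumes "\<And>x. x \<in> carrier V \<Longrightarrow> f x \<in> carrier V" "f \<in> extensional (carrier V)"
    "\<And>x y. x \<in> carrier V \<Longrightarrow> y \<in> carrier V \<Longrightarrow> f (x \<oplus> y) = f x \<oplus> f y"
    "\<And>c x. x \<in> carrier V \<Longrightarrow> f (c \<odot> x) = c \<odot> f x"
  shows "f \<in> linear_maps V"
  using assms by (auto simp: linear_maps_def PiE_def)

lemma linear_mapsD:
  assumes "f \<in> linear_maps V"
  shows "x \<in> carrier V \<Longrightarrow> f x \<in> carrier V"
    and "x \<in> carrier V \<Longrightarrow> y \<in> carrier V \<Longrightarrow> f (x \<oplus> y) = f x \<oplus> f y"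
    and "x \<in> carrier V \<Longrightarrow> f (c \<odot> x) = c \<odot> f x"
  using assms by (auto simp: linear_maps_def)

lemma linear_maps_restrict: "f \<in> linear_maps V \<Longrightarrow> restrict f (carrier V) = f"
  by (auto simp: linear_maps_def extensional_restrict)

lemma linear_maps_eqI:
  assumes "f \<in> linear_maps V" "g \<in> linear_maps V" "\<And>x. x \<in> carrier V \<Longrightarrow> f x = g x"
  shows "f = g"
  using assms by (auto simp: linear_maps_def intro: PiE_ext)

lemma scale_zero_right: "c \<odot> \<zero> = \<zero>"
  using scale_scale[of \<zero> c 0] scale_zero_left[of \<zero>] by simp

lemma linear_maps_closed:
  "f \<in> linear_maps V \<Longrightarrow> g \<in> linear_maps V \<Longrightarrow> compose (carrier V) f g \<in> linear_maps V"
  "f \<in> linear_maps V \<Longrightarrow> g \<in> linear_maps V \<Longrightarrow> (\<lambda>x\<in>carrier V. f x \<oplus> g x) \<in> linear_maps V"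
  "f \<in> linear_maps V \<Longrightarrow> (\<lambda>x\<in>carrier V. c \<odot> f x) \<in> linear_maps V"
  "(\<lambda>x\<in>carrier V. x) \<in> linear_maps V" "(\<lambda>x\<in>carrier V. \<zero>) \<in> linear_maps V"
  by (rule linear_mapsI; simp add: linear_mapsD compose_def a_ac scale_add_right scale_scale
      scale_zero_right mult.commute)+

lemma End_complex_ring: "complex_ring (End_algebra V)"
proof -
  let ?E = "End_algebra V"
  note closed = linear_maps_closed
  note [simp] = linear_mapsD
  have minus: "\<exists>g\<in>carrier ?E. g \<oplus>\<^bsub>?E\<^esub> f = \<zero>\<^bsub>?E\<^esub>" if f: "f \<in> carrier ?E" for f
  proof (rule bexI[of _ "\<lambda>x\<in>carrier V. (- 1) \<odot> f x"])
    have "(- 1) \<odot> f x \<oplus> f x = \<zero>" if "x \<in> carrier V" for x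
      using f that scale_add_left[of "f x" "- 1" 1] by (simp add: scale_zero_left)
    then show "(\<lambda>x\<in>carrier V. (- 1) \<odot> f x) \<oplus>\<^bsub>?E\<^esub> f = \<zero>\<^bsub>?E\<^esub>"
      by (simp cong: restrict_cong)
  qed (use f in \<open>simp add: closed\<close>)
  have group: "abelian_group ?E"
  proof (rule abelian_groupI)
    fix f assume f: "f \<in> carrier ?E"
    then show "\<zero>\<^bsub>?E\<^esub> \<oplus>\<^bsub>?E\<^esub> f = f"
      by (intro linear_maps_eqI) (simp_all add: linear_maps_restrict cong: restrict_cong)
    show "\<exists>g\<in>carrier ?E. g \<oplus>\<^bsub>?E\<^esub> f = \<zero>\<^bsub>?E\<^esub>"
      using f by (rule minus)
  qed (simp_all add: closed a_ac cong: restrict_cong)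
  have monoid: "Group.monoid ?E"
  proof (rule monoidI)
    fix f assume f: "f \<in> carrier ?E"
    then show "\<one>\<^bsub>?E\<^esub> \<otimes>\<^bsub>?E\<^esub> f = f" "f \<otimes>\<^bsub>?E\<^esub> \<one>\<^bsub>?E\<^esub> = f"
      using closed(1)[of "\<lambda>x\<in>carrier V. x" f] closed(1)[of f "\<lambda>x\<in>carrier V. x"] closed(4)
      by (auto intro!: linear_maps_eqI simp: compose_def)
  next
    fix f g h assume "f \<in> carrier ?E" "g \<in> carrier ?E" "h \<in> carrier ?E"
    then show "f \<otimes>\<^bsub>?E\<^esub> g \<otimes>\<^bsub>?E\<^esub> h = f \<otimes>\<^bsub>?E\<^esub> (g \<otimes>\<^bsub>?E\<^esub> h)"
      by (simp add: compose_def cong: restrict_cong)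
  qed (simp_all add: closed)
  have "ring ?E"
    by (rule ringI[OF group monoid]) (simp_all add: closed compose_def cong: restrict_cong)
  then show ?thesis
  proof (intro complex_ring.intro complex_ring_axioms.intro)
    fix f assume f: "f \<in> carrier ?E"
    then show "1 \<odot>\<^bsub>?E\<^esub> f = f"
      by (intro linear_maps_eqI) (simp_all add: closed)
  qed (simp_all add: closed compose_def scale_add_left scale_add_right scale_scale cong: restrict_cong)
qed

end

sublocale complex_ring \<subseteq> space: complex_space A
  by unfold_locales (auto simp: scale_add_left scale_add_right scale_scale)

text \<open>
  Only the vector space structure is meant; the multiplicative fields are left undefined.
\<close>

definition power_space :: "'i set \<Rightarrow> (complex, 'a) module \<Rightarrow> (complex, 'i \<Rightarrow> 'a) module" where
  "power_space I A =
    \<lparr>carrier = I \<rightarrow>\<^sub>E carrier A, monoid.mult = undefined, one = undefined,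
     ring.zero = (\<lambda>i\<in>I. \<zero>\<^bsub>A\<^esub>), ring.add = (\<lambda>u v. \<lambda>i\<in>I. u i \<oplus>\<^bsub>A\<^esub> v i),
     module.smult = (\<lambda>c u. \<lambda>i\<in>I. c \<odot>\<^bsub>A\<^esub> u i)\<rparr>"

lemma power_simps [simp]:
  "carrier (power_space I A) = I \<rightarrow>\<^sub>E carrier A" "\<zero>\<^bsub>power_space I A\<^esub> = (\<lambda>i\<in>I. \<zero>\<^bsub>A\<^esub>)"
  "u \<oplus>\<^bsub>power_space I A\<^esub> v = (\<lambda>i\<in>I. u i \<oplus>\<^bsub>A\<^esub> v i)"
  "c \<odot>\<^bsub>power_space I A\<^esub> u = (\<lambda>i\<in>I. c \<odot>\<^bsub>A\<^esub> u i)"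
  by (simp_all add: power_space_def)

locale power_of_space = complex_space V for V :: "(complex, 'v) module" (structure) +
  fixes I :: "'i set"
begin

abbreviation "VI \<equiv> power_space I V"

lemma power_mem [simp]: "u \<in> I \<rightarrow>\<^sub>E carrier V \<Longrightarrow> i \<in> I \<Longrightarrow> u i \<in> carrier V"
  by auto

lemma power_ext:
  "u \<in> I \<rightarrow>\<^sub>E carrier V \<Longrightarrow> v \<in> I \<rightarrow>\<^sub>E carrier V \<Longrightarrow> (\<And>i. i \<in> I \<Longrightarrow> u i = v i) \<Longrightarrow> u = v"
  by (rule PiE_ext)

sublocale power: complex_space VI
proof -
  have "abelian_group VI"
  proof (rule abelian_groupI)
    fix u assume u: "u \<in> carrier VI"
    then have "(\<lambda>i\<in>I. \<ominus> u i) \<oplus>\<^bsub>VI\<^esub> u = \<zero>\<^bsub>VI\<^esub>"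
      by (simp add: l_neg cong: restrict_cong)
    then show "\<exists>v\<in>carrier VI. v \<oplus>\<^bsub>VI\<^esub> u = \<zero>\<^bsub>VI\<^esub>"
      using u by (intro bexI[of _ "\<lambda>i\<in>I. \<ominus> u i"]) auto
    show "\<zero>\<^bsub>VI\<^esub> \<oplus>\<^bsub>VI\<^esub> u = u"
      using u by (intro power_ext) auto
  qed (auto simp: a_ac cong: restrict_cong)
  then show "complex_space VI"
  proof (intro complex_space.intro complex_space_axioms.intro)
    fix u assume "u \<in> carrier VI"
    then show "1 \<odot>\<^bsub>VI\<^esub> u = u"
      by (intro power_ext) auto
  qed (auto simp: scale_add_left scale_add_right scale_scale cong: restrict_cong)
qed

end


section \<open>Skew group algebras\<close>

locale group_action_on_algebra = complex_ring A + G: group G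
  for A :: "(complex, 'a) module" (structure) and G :: "'g monoid" +
  fixes act :: "'g \<Rightarrow> 'a \<Rightarrow> 'a"
  assumes finite_group: "finite (carrier G)"
    and act_hom: "g \<in> carrier G \<Longrightarrow> act g \<in> algebra_hom A A"
    and act_unit: "g \<in> carrier G \<Longrightarrow> act g \<one> = \<one>"
    and act_mult: "g \<in> carrier G \<Longrightarrow> h \<in> carrier G \<Longrightarrow> x \<in> carrier A \<Longrightarrow>
      act (g \<otimes>\<^bsub>G\<^esub> h) x = act g (act h x)"
    and act_one: "x \<in> carrier A \<Longrightarrow> act \<one>\<^bsub>G\<^esub> x = x"
begin

abbreviation "S \<equiv> skew_group_algebra A G act"

lemma act_is_hom: "g \<in> carrier G \<Longrightarrow> complex_ring_hom A A (act g)"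
  by unfold_locales (rule act_hom)

lemmas act_closed [simp] = complex_ring_hom.closed[OF act_is_hom]
lemmas act_add = complex_ring_hom.add[OF act_is_hom]
lemmas act_prod = complex_ring_hom.mult[OF act_is_hom]
lemmas act_scale = complex_ring_hom.scale[OF act_is_hom]
lemmas act_zero [simp] = complex_ring_hom.zero[OF act_is_hom]
lemmas act_finsum = complex_ring_hom.finsum[OF act_is_hom]

lemma S_simps:
  "carrier S = carrier G \<rightarrow>\<^sub>E carrier A"
  "u \<otimes>\<^bsub>S\<^esub> v = (\<lambda>k\<in>carrier G.
     \<Oplus>g\<in>carrier G. u g \<otimes> act g (v (inv\<^bsub>G\<^esub> g \<otimes>\<^bsub>G\<^esub> k)))"
  "\<one>\<^bsub>S\<^esub> = (\<lambda>k\<in>carrier G. if k = \<one>\<^bsub>G\<^esub> then \<one> else \<zero>)"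
  "\<zero>\<^bsub>S\<^esub> = (\<lambda>k\<in>carrier G. \<zero>)"
  "u \<oplus>\<^bsub>S\<^esub> v = (\<lambda>k\<in>carrier G. u k \<oplus> v k)"
  "c \<odot>\<^bsub>S\<^esub> u = (\<lambda>k\<in>carrier G. c \<odot> u k)"
  by (simp_all add: skew_group_algebra_def)

lemma S_ext: "u \<in> carrier S \<Longrightarrow> v \<in> carrier S \<Longrightarrow> (\<And>g. g \<in> carrier G \<Longrightarrow> u g = v g) \<Longrightarrow> u = v"
  by (auto simp: S_simps intro: PiE_ext)

lemma S_mem [simp]: "u \<in> carrier S \<Longrightarrow> g \<in> carrier G \<Longrightarrow> u g \<in> carrier A"
  by (auto simp: S_simps)

lemma S_memI: "u \<in> extensional (carrier G) \<Longrightarrow> (\<And>g. g \<in> carrier G \<Longrightarrow> u g \<in> carrier A) \<Longrightarrow> u \<in> carrier S"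
  by (auto simp: S_simps PiE_def)

text \<open>Left translation permutes the group, which reindexes the convolution sums.\<close>

lemma finsum_translate:
  assumes "g \<in> carrier G" "\<And>h. h \<in> carrier G \<Longrightarrow> f h \<in> carrier A"
  shows "(\<Oplus>k\<in>carrier G. f k) = (\<Oplus>h\<in>carrier G. f (g \<otimes>\<^bsub>G\<^esub> h))"
proof -
  have inj: "inj_on (\<lambda>h. g \<otimes>\<^bsub>G\<^esub> h) (carrier G)"
    using assms(1) by (auto simp: inj_on_def)
  have "(\<lambda>h. g \<otimes>\<^bsub>G\<^esub> h) ` carrier G = carrier G"
    using G.surj_const_mult[OF assms(1)] by simp
  then show ?thesis
    using finsum_reindex[OF _ inj, of f] assms by (simp add: Pi_def)
qed

lemma S_mult_closed:
  assumes "u \<in> carrier S" "v \<in> carrier S"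
  shows "u \<otimes>\<^bsub>S\<^esub> v \<in> carrier S"
  using assms by (intro S_memI) (auto simp: S_simps(2) intro!: finsum_closed)

lemma S_mult_apply:
  assumes "k \<in> carrier G"
  shows "(u \<otimes>\<^bsub>S\<^esub> v) k = (\<Oplus>g\<in>carrier G. u g \<otimes> act g (v (inv\<^bsub>G\<^esub> g \<otimes>\<^bsub>G\<^esub> k)))"
  using assms by (simp add: S_simps)

lemma S_mult_assoc:
  assumes S: "u \<in> carrier S" "v \<in> carrier S" "w \<in> carrier S"
  shows "(u \<otimes>\<^bsub>S\<^esub> v) \<otimes>\<^bsub>S\<^esub> w = u \<otimes>\<^bsub>S\<^esub> (v \<otimes>\<^bsub>S\<^esub> w)"
proof (rule S_ext)
  fix k assume k: "k \<in> carrier G"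
  let ?c = "carrier G"
  let ?t = "\<lambda>g h. u g \<otimes> act g (v h) \<otimes> act (g \<otimes>\<^bsub>G\<^esub> h) (w (inv\<^bsub>G\<^esub> (g \<otimes>\<^bsub>G\<^esub> h) \<otimes>\<^bsub>G\<^esub> k))"
  have "((u \<otimes>\<^bsub>S\<^esub> v) \<otimes>\<^bsub>S\<^esub> w) k =
      (\<Oplus>m\<in>?c. (\<Oplus>g\<in>?c. u g \<otimes> act g (v (inv\<^bsub>G\<^esub> g \<otimes>\<^bsub>G\<^esub> m))) \<otimes> act m (w (inv\<^bsub>G\<^esub> m \<otimes>\<^bsub>G\<^esub> k)))"
    unfolding S_mult_apply[OF k] using S k
    by (intro finsum_eqI) (auto simp: S_mult_apply intro!: finsum_closed)
  also have "\<dots> = (\<Oplus>m\<in>?c. \<Oplus>g\<in>?c. u g \<otimes> act g (v (inv\<^bsub>G\<^esub> g \<otimes>\<^bsub>G\<^esub> m)) \<otimes> act m (w (inv\<^bsub>G\<^esub> m \<otimes>\<^bsub>G\<^esub> k)))"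
    using S k finite_group
    by (intro finsum_eqI finsum_ldistr) (auto intro!: finsum_closed)
  also have "\<dots> = (\<Oplus>g\<in>?c. \<Oplus>m\<in>?c. u g \<otimes> act g (v (inv\<^bsub>G\<^esub> g \<otimes>\<^bsub>G\<^esub> m)) \<otimes> act m (w (inv\<^bsub>G\<^esub> m \<otimes>\<^bsub>G\<^esub> k)))"
    using S k finite_group by (intro finsum_swap) auto
  also have "\<dots> = (\<Oplus>g\<in>?c. \<Oplus>h\<in>?c. ?t g h)"
  proof (rule finsum_eqI)
    fix g assume g: "g \<in> ?c"
    have "(\<Oplus>m\<in>?c. u g \<otimes> act g (v (inv\<^bsub>G\<^esub> g \<otimes>\<^bsub>G\<^esub> m)) \<otimes> act m (w (inv\<^bsub>G\<^esub> m \<otimes>\<^bsub>G\<^esub> k))) =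
      (\<Oplus>h\<in>?c. u g \<otimes> act g (v (inv\<^bsub>G\<^esub> g \<otimes>\<^bsub>G\<^esub> (g \<otimes>\<^bsub>G\<^esub> h))) \<otimes>
        act (g \<otimes>\<^bsub>G\<^esub> h) (w (inv\<^bsub>G\<^esub> (g \<otimes>\<^bsub>G\<^esub> h) \<otimes>\<^bsub>G\<^esub> k)))"
      using S k g by (intro finsum_translate) auto
    also have "\<dots> = (\<Oplus>h\<in>?c. ?t g h)"
      using S k g by (intro finsum_eqI) (auto simp: G.m_assoc[symmetric])
    finally show "(\<Oplus>m\<in>?c. u g \<otimes> act g (v (inv\<^bsub>G\<^esub> g \<otimes>\<^bsub>G\<^esub> m)) \<otimes> act m (w (inv\<^bsub>G\<^esub> m \<otimes>\<^bsub>G\<^esub> k))) =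
      (\<Oplus>h\<in>?c. ?t g h)" .
  qed (use S k in \<open>auto intro!: finsum_closed\<close>)
  also have "\<dots> = (\<Oplus>g\<in>?c. u g \<otimes> act g (\<Oplus>h\<in>?c. v h \<otimes> act h (w (inv\<^bsub>G\<^esub> h \<otimes>\<^bsub>G\<^esub> (inv\<^bsub>G\<^esub> g \<otimes>\<^bsub>G\<^esub> k)))))"
  proof (rule finsum_eqI)
    fix g assume g: "g \<in> ?c"
    have "u g \<otimes> act g (\<Oplus>h\<in>?c. v h \<otimes> act h (w (inv\<^bsub>G\<^esub> h \<otimes>\<^bsub>G\<^esub> (inv\<^bsub>G\<^esub> g \<otimes>\<^bsub>G\<^esub> k)))) =
      (\<Oplus>h\<in>?c. u g \<otimes> act g (v h \<otimes> act h (w (inv\<^bsub>G\<^esub> h \<otimes>\<^bsub>G\<^esub> (inv\<^bsub>G\<^esub> g \<otimes>\<^bsub>G\<^esub> k)))))"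
      using S k g finite_group by (subst act_finsum) (auto intro!: finsum_rdistr)
    also have "\<dots> = (\<Oplus>h\<in>?c. ?t g h)"
      using S k g by (intro finsum_eqI)
        (auto simp: act_prod act_mult G.inv_mult_group G.m_assoc m_assoc)
    finally show "(\<Oplus>h\<in>?c. ?t g h) =
      u g \<otimes> act g (\<Oplus>h\<in>?c. v h \<otimes> act h (w (inv\<^bsub>G\<^esub> h \<otimes>\<^bsub>G\<^esub> (inv\<^bsub>G\<^esub> g \<otimes>\<^bsub>G\<^esub> k))))"
      by simp
  qed (use S k in \<open>auto intro!: finsum_closed\<close>)
  also have "\<dots> = (u \<otimes>\<^bsub>S\<^esub> (v \<otimes>\<^bsub>S\<^esub> w)) k"
    unfolding S_mult_apply[OF k] using S k
    by (intro finsum_eqI) (auto simp: S_mult_apply intro!: finsum_closed)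
  finally show "((u \<otimes>\<^bsub>S\<^esub> v) \<otimes>\<^bsub>S\<^esub> w) k = (u \<otimes>\<^bsub>S\<^esub> (v \<otimes>\<^bsub>S\<^esub> w)) k" .
qed (use S in \<open>auto intro!: S_mult_closed\<close>)

lemma S_one_mem: "\<one>\<^bsub>S\<^esub> \<in> carrier S"
  by (rule S_memI) (auto simp: S_simps)

lemma S_one_mult:
  assumes u: "u \<in> carrier S"
  shows "\<one>\<^bsub>S\<^esub> \<otimes>\<^bsub>S\<^esub> u = u" "u \<otimes>\<^bsub>S\<^esub> \<one>\<^bsub>S\<^esub> = u"
proof -
  show "\<one>\<^bsub>S\<^esub> \<otimes>\<^bsub>S\<^esub> u = u"
  proof (rule S_ext)
    fix k assume k: "k \<in> carrier G"
    have "(\<one>\<^bsub>S\<^esub> \<otimes>\<^bsub>S\<^esub> u) k = (\<Oplus>g\<in>carrier G. if g = \<one>\<^bsub>G\<^esub> then u k else \<zero>)"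
      unfolding S_mult_apply[OF k] using u k
      by (intro finsum_eqI) (auto simp: S_simps(3) act_one)
    also have "\<dots> = u k"
      using u k finite_group by (intro finsum_delta) auto
    finally show "(\<one>\<^bsub>S\<^esub> \<otimes>\<^bsub>S\<^esub> u) k = u k" .
  qed (auto intro!: S_mult_closed u S_one_mem)
  show "u \<otimes>\<^bsub>S\<^esub> \<one>\<^bsub>S\<^esub> = u"
  proof (rule S_ext)
    fix k assume k: "k \<in> carrier G"
    have "(u \<otimes>\<^bsub>S\<^esub> \<one>\<^bsub>S\<^esub>) k = (\<Oplus>g\<in>carrier G. if g = k then u k else \<zero>)"
      unfolding S_mult_apply[OF k]
    proof (rule finsum_eqI)
      fix g assume g: "g \<in> carrier G"
      have "inv\<^bsub>G\<^esub> g \<otimes>\<^bsub>G\<^esub> k = \<one>\<^bsub>G\<^esub> \<longleftrightarrow> g = k"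
        using g k G.inv_solve_left[of "\<one>\<^bsub>G\<^esub>" g k] by auto
      then show "u g \<otimes> act g (\<one>\<^bsub>S\<^esub> (inv\<^bsub>G\<^esub> g \<otimes>\<^bsub>G\<^esub> k)) = (if g = k then u k else \<zero>)"
        using u g k by (auto simp: S_simps(3) act_unit)
    qed (use u k in auto)
    also have "\<dots> = u k"
      using u k finite_group by (intro finsum_delta) auto
    finally show "(u \<otimes>\<^bsub>S\<^esub> \<one>\<^bsub>S\<^esub>) k = u k" .
  qed (auto intro!: S_mult_closed u S_one_mem)
qed

lemma S_distrib:
  assumes S: "u \<in> carrier S" "v \<in> carrier S" "w \<in> carrier S"
  shows "(u \<oplus>\<^bsub>S\<^esub> v) \<otimes>\<^bsub>S\<^esub> w = u \<otimes>\<^bsub>S\<^esub> w \<oplus>\<^bsub>S\<^esub> v \<otimes>\<^bsub>S\<^esub> w"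
    "w \<otimes>\<^bsub>S\<^esub> (u \<oplus>\<^bsub>S\<^esub> v) = w \<otimes>\<^bsub>S\<^esub> u \<oplus>\<^bsub>S\<^esub> w \<otimes>\<^bsub>S\<^esub> v"
proof -
  note [simp] = S S_mem[OF S(1)] S_mem[OF S(2)] S_mem[OF S(3)]
  have closed: "a \<oplus>\<^bsub>S\<^esub> b \<in> carrier S" if "a \<in> carrier S" "b \<in> carrier S" for a b
    using that by (intro S_memI) (auto simp: S_simps(5))
  show "(u \<oplus>\<^bsub>S\<^esub> v) \<otimes>\<^bsub>S\<^esub> w = u \<otimes>\<^bsub>S\<^esub> w \<oplus>\<^bsub>S\<^esub> v \<otimes>\<^bsub>S\<^esub> w"
  proof (rule S_ext)
    fix k assume k [simp]: "k \<in> carrier G"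
    have "((u \<oplus>\<^bsub>S\<^esub> v) \<otimes>\<^bsub>S\<^esub> w) k = (\<Oplus>g\<in>carrier G. u g \<otimes> act g (w (inv\<^bsub>G\<^esub> g \<otimes>\<^bsub>G\<^esub> k)) \<oplus>
        v g \<otimes> act g (w (inv\<^bsub>G\<^esub> g \<otimes>\<^bsub>G\<^esub> k)))"
      unfolding S_mult_apply[OF k] by (intro finsum_eqI) (auto simp: S_simps(5) l_distr)
    also have "\<dots> = (u \<otimes>\<^bsub>S\<^esub> w) k \<oplus> (v \<otimes>\<^bsub>S\<^esub> w) k"
      unfolding S_mult_apply[OF k] by (rule finsum_addf) auto
    finally show "((u \<oplus>\<^bsub>S\<^esub> v) \<otimes>\<^bsub>S\<^esub> w) k = (u \<otimes>\<^bsub>S\<^esub> w \<oplus>\<^bsub>S\<^esub> v \<otimes>\<^bsub>S\<^esub> w) k"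
      by (simp add: S_simps(5))
  qed (auto intro!: S_mult_closed closed)
  show "w \<otimes>\<^bsub>S\<^esub> (u \<oplus>\<^bsub>S\<^esub> v) = w \<otimes>\<^bsub>S\<^esub> u \<oplus>\<^bsub>S\<^esub> w \<otimes>\<^bsub>S\<^esub> v"
  proof (rule S_ext)
    fix k assume k [simp]: "k \<in> carrier G"
    have "(w \<otimes>\<^bsub>S\<^esub> (u \<oplus>\<^bsub>S\<^esub> v)) k = (\<Oplus>g\<in>carrier G. w g \<otimes> act g (u (inv\<^bsub>G\<^esub> g \<otimes>\<^bsub>G\<^esub> k)) \<oplus>
        w g \<otimes> act g (v (inv\<^bsub>G\<^esub> g \<otimes>\<^bsub>G\<^esub> k)))"
      unfolding S_mult_apply[OF k] by (intro finsum_eqI) (auto simp: S_simps(5) act_add r_distr)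
    also have "\<dots> = (w \<otimes>\<^bsub>S\<^esub> u) k \<oplus> (w \<otimes>\<^bsub>S\<^esub> v) k"
      unfolding S_mult_apply[OF k] by (rule finsum_addf) auto
    finally show "(w \<otimes>\<^bsub>S\<^esub> (u \<oplus>\<^bsub>S\<^esub> v)) k = (w \<otimes>\<^bsub>S\<^esub> u \<oplus>\<^bsub>S\<^esub> w \<otimes>\<^bsub>S\<^esub> v) k"
      by (simp add: S_simps(5))
  qed (auto intro!: S_mult_closed closed)
qed

lemma S_scale_mult:
  assumes S: "u \<in> carrier S" "v \<in> carrier S"
  shows "(c \<odot>\<^bsub>S\<^esub> u) \<otimes>\<^bsub>S\<^esub> v = c \<odot>\<^bsub>S\<^esub> (u \<otimes>\<^bsub>S\<^esub> v)" "u \<otimes>\<^bsub>S\<^esub> (c \<odot>\<^bsub>S\<^esub> v) = c \<odot>\<^bsub>S\<^esub> (u \<otimes>\<^bsub>S\<^esub> v)"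
proof -
  note [simp] = S S_mem[OF S(1)] S_mem[OF S(2)]
  have closed: "c \<odot>\<^bsub>S\<^esub> a \<in> carrier S" if "a \<in> carrier S" for a
    using that by (intro S_memI) (auto simp: S_simps(6))
  have sum: "c \<odot> (\<Oplus>g\<in>carrier G. u g \<otimes> act g (v (inv\<^bsub>G\<^esub> g \<otimes>\<^bsub>G\<^esub> k))) =
      (\<Oplus>g\<in>carrier G. c \<odot> (u g \<otimes> act g (v (inv\<^bsub>G\<^esub> g \<otimes>\<^bsub>G\<^esub> k))))" if "k \<in> carrier G" for k
    using that by (intro finsum_scale) auto
  show "(c \<odot>\<^bsub>S\<^esub> u) \<otimes>\<^bsub>S\<^esub> v = c \<odot>\<^bsub>S\<^esub> (u \<otimes>\<^bsub>S\<^esub> v)"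
  proof (rule S_ext)
    fix k assume k [simp]: "k \<in> carrier G"
    show "((c \<odot>\<^bsub>S\<^esub> u) \<otimes>\<^bsub>S\<^esub> v) k = (c \<odot>\<^bsub>S\<^esub> (u \<otimes>\<^bsub>S\<^esub> v)) k"
      unfolding S_simps(6) restrict_apply' [OF k] S_mult_apply[OF k] sum[OF k]
      by (intro finsum_eqI) (auto simp: scale_mult_left)
  qed (auto intro!: S_mult_closed closed)
  show "u \<otimes>\<^bsub>S\<^esub> (c \<odot>\<^bsub>S\<^esub> v) = c \<odot>\<^bsub>S\<^esub> (u \<otimes>\<^bsub>S\<^esub> v)"
  proof (rule S_ext)
    fix k assume k [simp]: "k \<in> carrier G"
    show "(u \<otimes>\<^bsub>S\<^esub> (c \<odot>\<^bsub>S\<^esub> v)) k = (c \<odot>\<^bsub>S\<^esub> (u \<otimes>\<^bsub>S\<^esub> v)) k"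
      unfolding S_simps(6) restrict_apply' [OF k] S_mult_apply[OF k] sum[OF k]
      by (intro finsum_eqI) (auto simp: scale_mult_right act_scale)
  qed (auto intro!: S_mult_closed closed)
qed

sublocale S: complex_ring S
proof -
  interpret power: power_of_space A "carrier G" ..
  have group: "abelian_group S"
  proof (rule abelian_groupI)
    fix u assume u: "u \<in> carrier S"
    show "\<zero>\<^bsub>S\<^esub> \<oplus>\<^bsub>S\<^esub> u = u" "\<exists>v\<in>carrier S. v \<oplus>\<^bsub>S\<^esub> u = \<zero>\<^bsub>S\<^esub>"
      using u power.power.l_zero[of u] power.power.l_neg[of u] power.power.a_inv_closed[of u]
      by (auto simp: S_simps)
  qed (use power.power.a_assoc power.power.a_comm in \<open>auto simp: S_simps\<close>)
  have "ring S"
    using S_mult_closed S_one_mem S_mult_assoc S_one_mult S_distrib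
    by (intro ringI[OF group] monoidI) auto
  then show "complex_ring S"
    by (intro complex_ring.intro complex_ring_axioms.intro S_scale_mult)
      (use power.power.scale_add_left power.power.scale_add_right power.power.scale_scale
        power.power.scale_one in \<open>auto simp: S_simps\<close>)
qed

definition tensor :: "'a \<Rightarrow> 'g \<Rightarrow> 'g \<Rightarrow> 'a" where
  "tensor a g = (\<lambda>k\<in>carrier G. if k = g then a else \<zero>)"

lemma tensor_closed [simp]: "a \<in> carrier A \<Longrightarrow> tensor a g \<in> carrier S"
  by (rule S_memI) (auto simp: tensor_def)

lemma tensor_mult:
  assumes "a \<in> carrier A" "b \<in> carrier A" "g \<in> carrier G" "h \<in> carrier G"
  shows "tensor a g \<otimes>\<^bsub>S\<^esub> tensor b h = tensor (a \<otimes> act g b) (g \<otimes>\<^bsub>G\<^esub> h)"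
proof (rule S_ext)
  fix k assume k: "k \<in> carrier G"
  have "(tensor a g \<otimes>\<^bsub>S\<^esub> tensor b h) k = (\<Oplus>g'\<in>carrier G. if g' = g then
      if k = g \<otimes>\<^bsub>G\<^esub> h then a \<otimes> act g b else \<zero> else \<zero>)"
    unfolding S_mult_apply[OF k]
  proof (rule finsum_eqI)
    fix g' assume g': "g' \<in> carrier G"
    have "inv\<^bsub>G\<^esub> g \<otimes>\<^bsub>G\<^esub> k = h \<longleftrightarrow> k = g \<otimes>\<^bsub>G\<^esub> h"
      using k assms G.inv_solve_left[of h g k] by auto
    then show "tensor a g g' \<otimes> act g' (tensor b h (inv\<^bsub>G\<^esub> g' \<otimes>\<^bsub>G\<^esub> k)) =
        (if g' = g then if k = g \<otimes>\<^bsub>G\<^esub> h then a \<otimes> act g b else \<zero> else \<zero>)"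
      using k g' assms by (auto simp: tensor_def)
  qed (use assms in auto)
  also have "\<dots> = (if k = g \<otimes>\<^bsub>G\<^esub> h then a \<otimes> act g b else \<zero>)"
    using finite_group assms by (intro finsum_delta) auto
  finally show "(tensor a g \<otimes>\<^bsub>S\<^esub> tensor b h) k = tensor (a \<otimes> act g b) (g \<otimes>\<^bsub>G\<^esub> h) k"
    using k by (simp add: tensor_def)
qed (use assms in \<open>auto intro!: S.m_closed\<close>)

lemma tensor_decomposition:
  assumes u: "u \<in> carrier S"
  shows "u = (\<Oplus>\<^bsub>S\<^esub>g\<in>carrier G. tensor (u g) g)"
proof -
  have *: "(\<Oplus>\<^bsub>S\<^esub>g\<in>H. tensor (u g) g) = (\<lambda>k\<in>carrier G. if k \<in> H then u k else \<zero>)"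
    if "finite H" "H \<subseteq> carrier G" for H
    using that
  proof (induction H rule: finite_induct)
    case (insert g H)
    then have "(\<Oplus>\<^bsub>S\<^esub>g\<in>insert g H. tensor (u g) g) = tensor (u g) g \<oplus>\<^bsub>S\<^esub> (\<Oplus>\<^bsub>S\<^esub>g\<in>H. tensor (u g) g)"
      using u by (intro S.finsum_insert) (auto simp: Pi_def)
    moreover have "(\<Oplus>\<^bsub>S\<^esub>g\<in>H. tensor (u g) g) = (\<lambda>k\<in>carrier G. if k \<in> H then u k else \<zero>)"
      using insert by blast
    ultimately show ?case
      using insert.hyps insert.prems S_mem[OF u]
      by (simp only:) (auto simp: S_simps(5) tensor_def fun_eq_iff)
  qed (simp add: S_simps)
  have "(\<lambda>k\<in>carrier G. if k \<in> carrier G then u k else \<zero>) = u"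
    using u by (auto simp: S_simps PiE_def extensional_def fun_eq_iff)
  then show ?thesis
    using *[OF finite_group] by simp
qed

lemma S_induct [consumes 1, case_names zero tensor add]:
  assumes u: "u \<in> carrier S" and zero: "P \<zero>\<^bsub>S\<^esub>"
    and tensor: "\<And>a g. a \<in> carrier A \<Longrightarrow> g \<in> carrier G \<Longrightarrow> P (tensor a g)"
    and add: "\<And>u v. u \<in> carrier S \<Longrightarrow> v \<in> carrier S \<Longrightarrow> P u \<Longrightarrow> P v \<Longrightarrow> P (u \<oplus>\<^bsub>S\<^esub> v)"
  shows "P u"
proof -
  have *: "P (\<Oplus>\<^bsub>S\<^esub>g\<in>H. tensor (u g) g)" if "finite H" "H \<subseteq> carrier G" for H
    using that
  proof (induction H rule: finite_induct)
    case (insert g H)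
    then have "(\<Oplus>\<^bsub>S\<^esub>g\<in>insert g H. tensor (u g) g) = tensor (u g) g \<oplus>\<^bsub>S\<^esub> (\<Oplus>\<^bsub>S\<^esub>g\<in>H. tensor (u g) g)"
      using u by (intro S.finsum_insert) (auto simp: Pi_def)
    moreover have "(\<Oplus>\<^bsub>S\<^esub>g\<in>H. tensor (u g) g) \<in> carrier S"
      using u insert by (intro S.finsum_closed) (auto simp: Pi_def)
    ultimately show ?case
      using insert u tensor add by simp
  qed (simp add: zero)
  show ?thesis
    by (subst tensor_decomposition[OF u]) (rule *[OF finite_group subset_refl])
qed

text \<open>
  A homomorphism from \<open>A\<close> together with units that implement the action by conjugation extends to
  the skew group algebra.
\<close>

lemma extend_hom:
  assumes "complex_ring_hom A E T"
    and U: "\<And>g. g \<in> carrier G \<Longrightarrow> U g \<in> carrier E"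
    and UU: "\<And>g h. g \<in> carrier G \<Longrightarrow> h \<in> carrier G \<Longrightarrow> U (g \<otimes>\<^bsub>G\<^esub> h) = U g \<otimes>\<^bsub>E\<^esub> U h"
    and UT: "\<And>g a. g \<in> carrier G \<Longrightarrow> a \<in> carrier A \<Longrightarrow> U g \<otimes>\<^bsub>E\<^esub> T a = T (act g a) \<otimes>\<^bsub>E\<^esub> U g"
  shows "\<exists>F. complex_ring_hom S E F \<and>
    (\<forall>a\<in>carrier A. \<forall>g\<in>carrier G. F (tensor a g) = T a \<otimes>\<^bsub>E\<^esub> U g)"
proof -
  interpret T: complex_ring_hom A E T by fact
  define F where "F u = (\<Oplus>\<^bsub>E\<^esub>g\<in>carrier G. T (u g) \<otimes>\<^bsub>E\<^esub> U g)" for u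
  have closed: "F u \<in> carrier E" if "u \<in> carrier S" for u
    unfolding F_def using that U by (intro T.B.finsum_closed) auto
  have add: "F (u \<oplus>\<^bsub>S\<^esub> v) = F u \<oplus>\<^bsub>E\<^esub> F v" if uv: "u \<in> carrier S" "v \<in> carrier S" for u v
  proof -
    have "F (u \<oplus>\<^bsub>S\<^esub> v) = (\<Oplus>\<^bsub>E\<^esub>g\<in>carrier G. T (u g) \<otimes>\<^bsub>E\<^esub> U g \<oplus>\<^bsub>E\<^esub> T (v g) \<otimes>\<^bsub>E\<^esub> U g)"
      unfolding F_def using uv U
      by (intro T.B.finsum_eqI) (auto simp: S_simps(5) T.add T.B.l_distr)
    also have "\<dots> = F u \<oplus>\<^bsub>E\<^esub> F v"
      unfolding F_def using uv U by (intro T.B.finsum_addf) auto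
    finally show ?thesis .
  qed
  have scale: "F (c \<odot>\<^bsub>S\<^esub> u) = c \<odot>\<^bsub>E\<^esub> F u" if u: "u \<in> carrier S" for c u
  proof -
    have "F (c \<odot>\<^bsub>S\<^esub> u) = (\<Oplus>\<^bsub>E\<^esub>g\<in>carrier G. c \<odot>\<^bsub>E\<^esub> (T (u g) \<otimes>\<^bsub>E\<^esub> U g))"
      unfolding F_def using u U
      by (intro T.B.finsum_eqI) (auto simp: S_simps(6) T.scale T.B.scale_mult_left)
    also have "\<dots> = c \<odot>\<^bsub>E\<^esub> F u"
      unfolding F_def using u U by (intro T.B.finsum_scale[symmetric]) auto
    finally show ?thesis .
  qed
  have tensor: "F (tensor a g) = T a \<otimes>\<^bsub>E\<^esub> U g" if "a \<in> carrier A" "g \<in> carrier G" for a g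
  proof -
    have "F (tensor a g) = (\<Oplus>\<^bsub>E\<^esub>h\<in>carrier G. if h = g then T a \<otimes>\<^bsub>E\<^esub> U g else \<zero>\<^bsub>E\<^esub>)"
      unfolding F_def using that U by (intro T.B.finsum_eqI) (auto simp: tensor_def)
    also have "\<dots> = T a \<otimes>\<^bsub>E\<^esub> U g"
      using that U finite_group by (intro T.B.finsum_delta) auto
    finally show ?thesis .
  qed
  have mult: "F (u \<otimes>\<^bsub>S\<^esub> v) = F u \<otimes>\<^bsub>E\<^esub> F v" if u: "u \<in> carrier S" and v: "v \<in> carrier S" for u v
    using u
  proof (rule S_induct)
    show "F (\<zero>\<^bsub>S\<^esub> \<otimes>\<^bsub>S\<^esub> v) = F \<zero>\<^bsub>S\<^esub> \<otimes>\<^bsub>E\<^esub> F v"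
      using scale[of "\<zero>\<^bsub>S\<^esub>" 0] closed[OF v] closed[of "\<zero>\<^bsub>S\<^esub>"] v by simp
  next
    fix a g assume ag: "a \<in> carrier A" "g \<in> carrier G"
    show "F (tensor a g \<otimes>\<^bsub>S\<^esub> v) = F (tensor a g) \<otimes>\<^bsub>E\<^esub> F v"
      using v
    proof (rule S_induct)
      show "F (tensor a g \<otimes>\<^bsub>S\<^esub> \<zero>\<^bsub>S\<^esub>) = F (tensor a g) \<otimes>\<^bsub>E\<^esub> F \<zero>\<^bsub>S\<^esub>"
        using scale[of "\<zero>\<^bsub>S\<^esub>" 0] closed[of "tensor a g"] closed[of "\<zero>\<^bsub>S\<^esub>"] ag by simp
    next
      fix b h assume bh: "b \<in> carrier A" "h \<in> carrier G"
      have "F (tensor a g \<otimes>\<^bsub>S\<^esub> tensor b h) = T a \<otimes>\<^bsub>E\<^esub> (T (act g b) \<otimes>\<^bsub>E\<^esub> U g) \<otimes>\<^bsub>E\<^esub> U h"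
        using ag bh U by (simp add: tensor_mult tensor UU T.mult T.B.m_assoc)
      then show "F (tensor a g \<otimes>\<^bsub>S\<^esub> tensor b h) = F (tensor a g) \<otimes>\<^bsub>E\<^esub> F (tensor b h)"
        using ag bh U by (simp add: tensor UT[symmetric] T.B.m_assoc)
    next
      fix v w assume "v \<in> carrier S" "w \<in> carrier S"
        "F (tensor a g \<otimes>\<^bsub>S\<^esub> v) = F (tensor a g) \<otimes>\<^bsub>E\<^esub> F v"
        "F (tensor a g \<otimes>\<^bsub>S\<^esub> w) = F (tensor a g) \<otimes>\<^bsub>E\<^esub> F w"
      then show "F (tensor a g \<otimes>\<^bsub>S\<^esub> (v \<oplus>\<^bsub>S\<^esub> w)) = F (tensor a g) \<otimes>\<^bsub>E\<^esub> F (v \<oplus>\<^bsub>S\<^esub> w)"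
        using ag closed by (simp add: S.r_distr add T.B.r_distr)
    qed
  next
    fix u w assume "u \<in> carrier S" "w \<in> carrier S"
      "F (u \<otimes>\<^bsub>S\<^esub> v) = F u \<otimes>\<^bsub>E\<^esub> F v" "F (w \<otimes>\<^bsub>S\<^esub> v) = F w \<otimes>\<^bsub>E\<^esub> F v"
    then show "F ((u \<oplus>\<^bsub>S\<^esub> w) \<otimes>\<^bsub>S\<^esub> v) = F (u \<oplus>\<^bsub>S\<^esub> w) \<otimes>\<^bsub>E\<^esub> F v"
      using v closed by (simp add: S.l_distr add T.B.l_distr)
  qed
  have "complex_ring_hom S E F"
    by unfold_locales (auto simp: algebra_hom_def closed add mult scale)
  with tensor show ?thesis by blast
qed

end


section \<open>Morita equivalence with a full corner\<close>

text \<open>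
  A nonzero vector has as many multiples as there are scalars.
\<close>

lemma (in complex_space) infinite_carrier:
  assumes "x \<in> carrier V" "x \<noteq> \<zero>"
  shows "infinite (carrier V)"
proof -
  have "inj (\<lambda>c. c \<odot> x)"
  proof (rule injI)
    fix c d assume "c \<odot> x = d \<odot> x"
    then have "(c - d) \<odot> x = \<zero>"
      using assms scale_add_left[of x c "- d"] scale_add_left[of x d "- d"]
      by (simp add: scale_zero_left)
    then have "(inverse (c - d) * (c - d)) \<odot> x = \<zero>"
      using assms by (simp add: scale_scale[symmetric] scale_zero_right)
    then show "c = d"
      using assms by (cases "c = d") auto
  qed
  then have "infinite (range (\<lambda>c. c \<odot> x))"
    using infinite_UNIV_char_0 finite_imageD by blast
  moreover have "range (\<lambda>c. c \<odot> x) \<subseteq> carrier V"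
    using assms by auto
  ultimately show ?thesis
    using finite_subset by blast
qed

text \<open>
  A finite power of an infinite set has the same cardinality as the set, so that a finite power
  of a module can be realised inside the type of the module.
\<close>

lemma finite_power_embedding:
  assumes "finite I" "infinite Y \<or> Y = {x}"
  shows "\<exists>f. inj_on f (I \<rightarrow>\<^sub>E Y) \<and> f ` (I \<rightarrow>\<^sub>E Y) \<subseteq> Y"
  using assms(2)
proof
  assume "Y = {x}"
  then have "inj_on (\<lambda>_. x) (I \<rightarrow>\<^sub>E Y)"
    by (auto simp: inj_on_def intro: PiE_ext)
  then show ?thesis using \<open>Y = {x}\<close> by blast
next
  assume Y: "infinite Y"
  then have "|Y \<times> Y| \<le>o |Y|"
    using card_of_Times_same_infinite ordIso_iff_ordLeq by blast
  then obtain p where p: "inj_on p (Y \<times> Y)" "p ` (Y \<times> Y) \<subseteq> Y"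
    using card_of_ordLeq[of "Y \<times> Y" Y] by blast
  show ?thesis
    using assms(1)
  proof (induction I rule: finite_induct)
    case empty
    obtain x where "x \<in> Y" using infinite_imp_nonempty[OF Y] by blast
    then show ?case by (intro exI[of _ "\<lambda>_. x"]) auto
  next
    case (insert i I)
    then obtain f where f: "inj_on f (I \<rightarrow>\<^sub>E Y)" "f ` (I \<rightarrow>\<^sub>E Y) \<subseteq> Y" by blast
    let ?g = "\<lambda>v. p (v i, f (restrict v I))"
    have mem: "v i \<in> Y" "restrict v I \<in> I \<rightarrow>\<^sub>E Y" "f (restrict v I) \<in> Y"
      if "v \<in> insert i I \<rightarrow>\<^sub>E Y" for v
    proof -
      show "v i \<in> Y" and r: "restrict v I \<in> I \<rightarrow>\<^sub>E Y"
        using that by auto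
      show "f (restrict v I) \<in> Y"
        using f(2) r by blast
    qed
    have "inj_on ?g (insert i I \<rightarrow>\<^sub>E Y)"
    proof (rule inj_onI)
      fix v w assume v: "v \<in> insert i I \<rightarrow>\<^sub>E Y" and w: "w \<in> insert i I \<rightarrow>\<^sub>E Y" and eq: "?g v = ?g w"
      have "(v i, f (restrict v I)) = (w i, f (restrict w I))"
        using mem[OF v] mem[OF w] by (intro inj_onD[OF p(1) eq]) auto
      then have "v i = w i" "restrict v I = restrict w I"
        using inj_onD[OF f(1) _ mem(2)[OF v] mem(2)[OF w]] by auto
      then have "v j = w j" if "j \<in> insert i I" for j
        using that by (auto simp: restrict_def fun_eq_iff split: if_splits)
      then show "v = w"
        using v w by (intro PiE_ext[OF v w])
    qed
    moreover have "?g ` (insert i I \<rightarrow>\<^sub>E Y) \<subseteq> Y"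
      using mem p(2) by blast
    ultimately show ?case by blast
  qed
qed

lemma left_moduleI:
  fixes M (structure)
  assumes "complex_ring A" "abelian_group M"
    "\<And>a x. a \<in> carrier A \<Longrightarrow> x \<in> carrier M \<Longrightarrow> a \<odot> x \<in> carrier M"
    "\<And>a b x. a \<in> carrier A \<Longrightarrow> b \<in> carrier A \<Longrightarrow> x \<in> carrier M \<Longrightarrow>
      (a \<oplus>\<^bsub>A\<^esub> b) \<odot> x = a \<odot> x \<oplus> b \<odot> x"
    "\<And>a x y. a \<in> carrier A \<Longrightarrow> x \<in> carrier M \<Longrightarrow> y \<in> carrier M \<Longrightarrow>
      a \<odot> (x \<oplus> y) = a \<odot> x \<oplus> a \<odot> y"
    "\<And>a b x. a \<in> carrier A \<Longrightarrow> b \<in> carrier A \<Longrightarrow> x \<in> carrier M \<Longrightarrow>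
      (a \<otimes>\<^bsub>A\<^esub> b) \<odot> x = a \<odot> (b \<odot> x)"
    "\<And>x. x \<in> carrier M \<Longrightarrow> \<one>\<^bsub>A\<^esub> \<odot> x = x"
  shows "left_module A M"
  using assms by (intro left_module.intro left_module_axioms.intro)
    (auto simp: complex_algebra_iff_complex_ring)

locale module_over = complex_ring A + M: abelian_group M
  for A :: "(complex, 'a) module" and M :: "('a, 'm) module" +
  assumes left_module: "left_module A M"
begin

lemma act_closed [simp]: "a \<in> carrier A \<Longrightarrow> x \<in> carrier M \<Longrightarrow> a \<odot>\<^bsub>M\<^esub> x \<in> carrier M"
  and act_add_left: "a \<in> carrier A \<Longrightarrow> b \<in> carrier A \<Longrightarrow> x \<in> carrier M \<Longrightarrow>
    (a \<oplus>\<^bsub>A\<^esub> b) \<odot>\<^bsub>M\<^esub> x = a \<odot>\<^bsub>M\<^esub> x \<oplus>\<^bsub>M\<^esub> b \<odot>\<^bsub>M\<^esub> x"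
  and act_add_right: "a \<in> carrier A \<Longrightarrow> x \<in> carrier M \<Longrightarrow> y \<in> carrier M \<Longrightarrow>
    a \<odot>\<^bsub>M\<^esub> (x \<oplus>\<^bsub>M\<^esub> y) = a \<odot>\<^bsub>M\<^esub> x \<oplus>\<^bsub>M\<^esub> a \<odot>\<^bsub>M\<^esub> y"
  and act_act: "a \<in> carrier A \<Longrightarrow> b \<in> carrier A \<Longrightarrow> x \<in> carrier M \<Longrightarrow>
    a \<odot>\<^bsub>M\<^esub> (b \<odot>\<^bsub>M\<^esub> x) = (a \<otimes>\<^bsub>A\<^esub> b) \<odot>\<^bsub>M\<^esub> x"
  and act_one [simp]: "x \<in> carrier M \<Longrightarrow> \<one>\<^bsub>A\<^esub> \<odot>\<^bsub>M\<^esub> x = x"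
proof -
  interpret L: left_module A M by (rule left_module)
  show "a \<in> carrier A \<Longrightarrow> x \<in> carrier M \<Longrightarrow> a \<odot>\<^bsub>M\<^esub> x \<in> carrier M"
    "a \<in> carrier A \<Longrightarrow> b \<in> carrier A \<Longrightarrow> x \<in> carrier M \<Longrightarrow>
      (a \<oplus>\<^bsub>A\<^esub> b) \<odot>\<^bsub>M\<^esub> x = a \<odot>\<^bsub>M\<^esub> x \<oplus>\<^bsub>M\<^esub> b \<odot>\<^bsub>M\<^esub> x"
    "a \<in> carrier A \<Longrightarrow> x \<in> carrier M \<Longrightarrow> y \<in> carrier M \<Longrightarrow>
      a \<odot>\<^bsub>M\<^esub> (x \<oplus>\<^bsub>M\<^esub> y) = a \<odot>\<^bsub>M\<^esub> x \<oplus>\<^bsub>M\<^esub> a \<odot>\<^bsub>M\<^esub> y"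
    "a \<in> carrier A \<Longrightarrow> b \<in> carrier A \<Longrightarrow> x \<in> carrier M \<Longrightarrow>
      a \<odot>\<^bsub>M\<^esub> (b \<odot>\<^bsub>M\<^esub> x) = (a \<otimes>\<^bsub>A\<^esub> b) \<odot>\<^bsub>M\<^esub> x"
    "x \<in> carrier M \<Longrightarrow> \<one>\<^bsub>A\<^esub> \<odot>\<^bsub>M\<^esub> x = x"
    by (rule L.smult_closed L.smult_l_distr L.smult_r_distr L.smult_assoc[symmetric] L.smult_one;
        assumption)+
qed

lemma act_zero_left: "x \<in> carrier M \<Longrightarrow> \<zero>\<^bsub>A\<^esub> \<odot>\<^bsub>M\<^esub> x = \<zero>\<^bsub>M\<^esub>"
  using act_add_left[of "\<zero>\<^bsub>A\<^esub>" "\<zero>\<^bsub>A\<^esub>" x] by simp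

lemma act_zero_right: "a \<in> carrier A \<Longrightarrow> a \<odot>\<^bsub>M\<^esub> \<zero>\<^bsub>M\<^esub> = \<zero>\<^bsub>M\<^esub>"
  using act_add_right[of a "\<zero>\<^bsub>M\<^esub>" "\<zero>\<^bsub>M\<^esub>"] by simp

lemma act_finsum_right:
  assumes "a \<in> carrier A" "f \<in> I \<rightarrow> carrier M"
  shows "a \<odot>\<^bsub>M\<^esub> finsum M f I = (\<Oplus>\<^bsub>M\<^esub>i\<in>I. a \<odot>\<^bsub>M\<^esub> f i)"
  using assms(2)
proof (induction I rule: infinite_finite_induct)
  case (insert i I)
  then show ?case using assms(1) by (simp add: act_add_right Pi_def M.finsum_closed)
qed (use assms act_zero_right in auto)

lemma act_finsum_left:
  assumes "x \<in> carrier M" "f \<in> I \<rightarrow> carrier A"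
  shows "finsum A f I \<odot>\<^bsub>M\<^esub> x = (\<Oplus>\<^bsub>M\<^esub>i\<in>I. f i \<odot>\<^bsub>M\<^esub> x)"
  using assms(2)
proof (induction I rule: infinite_finite_induct)
  case (insert i I)
  then show ?case using assms(1) by (simp add: act_add_left Pi_def finsum_closed)
qed (use assms act_zero_left in auto)

lemma carrier_infinite_or_zero: "infinite (carrier M) \<or> carrier M = {\<zero>\<^bsub>M\<^esub>}"
proof (cases "carrier M = {\<zero>\<^bsub>M\<^esub>}")
  case False
  then obtain x where x: "x \<in> carrier M" "x \<noteq> \<zero>\<^bsub>M\<^esub>" by auto
  define V :: "(complex, 'm) module" where "V = \<lparr>carrier = carrier M, monoid.mult = undefined,
    one = undefined, ring.zero = \<zero>\<^bsub>M\<^esub>, ring.add = (\<oplus>\<^bsub>M\<^esub>), module.smult = (\<lambda>c x. (c \<odot>\<^bsub>A\<^esub> \<one>\<^bsub>A\<^esub>) \<odot>\<^bsub>M\<^esub> x)\<rparr>"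
  have "abelian_group V"
    by (rule abelian_groupI)
      (auto simp: V_def M.a_ac M.l_neg intro!: bexI[of _ "\<ominus>\<^bsub>M\<^esub> _"])
  then interpret V: complex_space V
    by (intro complex_space.intro complex_space_axioms.intro)
      (auto simp: V_def act_add_left act_add_right act_act scale_add_left scale_mult_left scale_scale)
  show ?thesis
    using V.infinite_carrier[of x] x by (simp add: V_def)
qed simp

end

lemma module_over_iff: "left_module A M \<longleftrightarrow> module_over A M"
proof
  assume "left_module A M"
  then interpret L: left_module A M .
  show "module_over A M"
    by (intro module_over.intro module_over_axioms.intro \<open>left_module A M\<close> L.M.abelian_group_axioms)
      (simp add: complex_algebra_iff_complex_ring[symmetric] L.A.complex_algebra_axioms)
qed (simp add: module_over_def module_over_axioms_def)

text \<open>
  A module that is built from families of elements of another module lives in a larger type.  It is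
  brought back to the type of the given module along an injection.
\<close>

definition transport :: "('x \<Rightarrow> 'm) \<Rightarrow> ('a, 'x) module \<Rightarrow> ('a, 'm) module" where
  "transport f M = (let g = inv_into (carrier M) f in
    \<lparr>carrier = f ` carrier M, monoid.mult = undefined, one = undefined, ring.zero = f \<zero>\<^bsub>M\<^esub>,
     ring.add = (\<lambda>x y. f (g x \<oplus>\<^bsub>M\<^esub> g y)), module.smult = (\<lambda>a x. f (a \<odot>\<^bsub>M\<^esub> g x))\<rparr>)"

lemma transport_simps:
  assumes "inj_on f (carrier M)"
  shows "carrier (transport f M) = f ` carrier M"
    "\<zero>\<^bsub>transport f M\<^esub> = f \<zero>\<^bsub>M\<^esub>"
    "x \<in> carrier M \<Longrightarrow> y \<in> carrier M \<Longrightarrow> f x \<oplus>\<^bsub>transport f M\<^esub> f y = f (x \<oplus>\<^bsub>M\<^esub> y)"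
    "x \<in> carrier M \<Longrightarrow> a \<odot>\<^bsub>transport f M\<^esub> f x = f (a \<odot>\<^bsub>M\<^esub> x)"
  using assms by (simp_all add: transport_def Let_def inv_into_f_f)

lemma transport_left_module:
  assumes inj: "inj_on f (carrier M)" and M: "left_module A M"
  shows "left_module A (transport f M)"
proof -
  interpret module_over A M using M by (simp add: module_over_iff)
  note T = transport_simps[OF inj]
  show ?thesis
  proof (rule left_moduleI)
    show "abelian_group (transport f M)"
    proof (rule abelian_groupI)
      fix x assume "x \<in> carrier (transport f M)"
      then obtain y where y: "y \<in> carrier M" "x = f y" by (auto simp: T)
      then show "\<exists>z\<in>carrier (transport f M). z \<oplus>\<^bsub>transport f M\<^esub> x = \<zero>\<^bsub>transport f M\<^esub>"
        by (intro bexI[of _ "f (\<ominus>\<^bsub>M\<^esub> y)"]) (auto simp: T M.l_neg)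
    qed (auto simp: T M.a_ac)
  qed (auto simp: T act_add_left act_add_right act_act[symmetric] complex_ring_axioms)
qed


text \<open>
  Let \<open>\<theta>\<close> embed \<open>B\<close> into \<open>A\<close> with image the corner \<open>e A e\<close>, and let \<open>e\<close> be full: one is a sum of
  elements \<open>d i \<otimes> c i\<close> with \<open>d i \<in> A e\<close> and \<open>c i \<in> e A\<close>.  The functor from \<open>A\<close>-modules to \<open>B\<close>-modules
  takes the corner \<open>e M\<close>.  Instead of the tensor product \<open>A e \<otimes> N\<close>, the functor in the other
  direction uses the image of the idempotent matrix with entries \<open>c i \<otimes> d j\<close> on a finite
  power of \<open>N\<close>: the element \<open>d i \<otimes> n\<close> of the tensor product corresponds to a column of the matrix.
\<close>

locale full_corner = \<theta>: complex_ring_hom B A \<theta>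
  for B :: "(complex, 'b) module" and A :: "(complex, 'a) module" and \<theta> +
  fixes e :: 'a and I :: "'i set" and c d :: "'i \<Rightarrow> 'a"
  assumes e_def: "e = \<theta> \<one>\<^bsub>B\<^esub>"
    and injective: "inj_on \<theta> (carrier B)"
    and onto_corner: "\<And>x. x \<in> carrier A \<Longrightarrow> e \<otimes>\<^bsub>A\<^esub> x \<otimes>\<^bsub>A\<^esub> e \<in> \<theta> ` carrier B"
    and finite_index: "finite I"
    and c_closed [simp]: "i \<in> I \<Longrightarrow> c i \<in> carrier A"
    and d_closed [simp]: "i \<in> I \<Longrightarrow> d i \<in> carrier A"
    and e_c: "i \<in> I \<Longrightarrow> e \<otimes>\<^bsub>A\<^esub> c i = c i"
    and d_e: "i \<in> I \<Longrightarrow> d i \<otimes>\<^bsub>A\<^esub> e = d i"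
    and full: "(\<Oplus>\<^bsub>A\<^esub>i\<in>I. d i \<otimes>\<^bsub>A\<^esub> c i) = \<one>\<^bsub>A\<^esub>"
begin

lemma e_closed [simp]: "e \<in> carrier A"
  by (simp add: e_def)

lemma e_theta: "b \<in> carrier B \<Longrightarrow> e \<otimes>\<^bsub>A\<^esub> \<theta> b = \<theta> b" "b \<in> carrier B \<Longrightarrow> \<theta> b \<otimes>\<^bsub>A\<^esub> e = \<theta> b"
  by (simp_all add: e_def \<theta>.mult[symmetric])

lemma e_e: "e \<otimes>\<^bsub>A\<^esub> e = e"
  using e_theta[of "\<one>\<^bsub>B\<^esub>"] by (simp add: e_def)

text \<open>
  Cutting down to the corner, read in \<open>B\<close>.
\<close>

definition \<kappa> :: "'a \<Rightarrow> 'b" where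
  "\<kappa> x = inv_into (carrier B) \<theta> (e \<otimes>\<^bsub>A\<^esub> x \<otimes>\<^bsub>A\<^esub> e)"

lemma \<kappa>_closed [simp]: "x \<in> carrier A \<Longrightarrow> \<kappa> x \<in> carrier B"
  unfolding \<kappa>_def by (rule inv_into_into[OF onto_corner])

lemma theta_\<kappa>: "x \<in> carrier A \<Longrightarrow> \<theta> (\<kappa> x) = e \<otimes>\<^bsub>A\<^esub> x \<otimes>\<^bsub>A\<^esub> e"
  unfolding \<kappa>_def by (rule f_inv_into_f[OF onto_corner])

lemma \<kappa>_eqI: "x \<in> carrier A \<Longrightarrow> b \<in> carrier B \<Longrightarrow> \<theta> b = e \<otimes>\<^bsub>A\<^esub> x \<otimes>\<^bsub>A\<^esub> e \<Longrightarrow> \<kappa> x = b"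
  using injective theta_\<kappa>[of x] \<kappa>_closed[of x] by (auto simp: inj_on_def)

lemma \<kappa>_theta [simp]: "b \<in> carrier B \<Longrightarrow> \<kappa> (\<theta> b) = b"
  by (rule \<kappa>_eqI) (auto simp: e_theta)

lemma \<kappa>_e [simp]: "\<kappa> e = \<one>\<^bsub>B\<^esub>"
  by (rule \<kappa>_eqI) (auto simp: e_e e_def[symmetric])

lemma \<kappa>_add: "x \<in> carrier A \<Longrightarrow> y \<in> carrier A \<Longrightarrow> \<kappa> (x \<oplus>\<^bsub>A\<^esub> y) = \<kappa> x \<oplus>\<^bsub>B\<^esub> \<kappa> y"
  by (rule \<kappa>_eqI) (auto simp: \<theta>.add theta_\<kappa> \<theta>.B.l_distr \<theta>.B.r_distr)

lemma \<kappa>_mult: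
  assumes "x \<in> carrier A" "y \<in> carrier A"
  shows "\<kappa> x \<otimes>\<^bsub>B\<^esub> \<kappa> y = \<kappa> (x \<otimes>\<^bsub>A\<^esub> e \<otimes>\<^bsub>A\<^esub> y)"
proof (rule \<kappa>_eqI[symmetric])
  have "\<theta> (\<kappa> x \<otimes>\<^bsub>B\<^esub> \<kappa> y) = e \<otimes>\<^bsub>A\<^esub> x \<otimes>\<^bsub>A\<^esub> (e \<otimes>\<^bsub>A\<^esub> e) \<otimes>\<^bsub>A\<^esub> y \<otimes>\<^bsub>A\<^esub> e"
    using assms by (simp add: \<theta>.mult theta_\<kappa> \<theta>.B.m_assoc)
  then show "\<theta> (\<kappa> x \<otimes>\<^bsub>B\<^esub> \<kappa> y) = e \<otimes>\<^bsub>A\<^esub> (x \<otimes>\<^bsub>A\<^esub> e \<otimes>\<^bsub>A\<^esub> y) \<otimes>\<^bsub>A\<^esub> e"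
    using assms by (simp add: e_e \<theta>.B.m_assoc)
qed (use assms in auto)

lemma \<kappa>_scale: "x \<in> carrier A \<Longrightarrow> \<kappa> (a \<odot>\<^bsub>A\<^esub> x) = a \<odot>\<^bsub>B\<^esub> \<kappa> x"
  by (rule \<kappa>_eqI) (auto simp: \<theta>.scale theta_\<kappa> \<theta>.B.scale_mult_left \<theta>.B.scale_mult_right)

lemma \<kappa>_zero [simp]: "\<kappa> \<zero>\<^bsub>A\<^esub> = \<zero>\<^bsub>B\<^esub>"
  by (rule \<kappa>_eqI) auto

lemma \<kappa>_finsum:
  assumes "f \<in> J \<rightarrow> carrier A"
  shows "\<kappa> (finsum A f J) = (\<Oplus>\<^bsub>B\<^esub>j\<in>J. \<kappa> (f j))"
  using assms
proof (induction J rule: infinite_finite_induct)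
  case (insert j J)
  then show ?case by (simp add: \<kappa>_add Pi_def \<theta>.B.finsum_closed)
qed auto

text \<open>
  Inserting the sum of the \<open>d j \<otimes> c j\<close>, which is one, turns a product in \<open>A\<close> into a product of a row
  and a column over \<open>B\<close>.
\<close>

lemma \<kappa>_matrix_mult:
  assumes xy: "x \<in> carrier A" "y \<in> carrier A"
  shows "(\<Oplus>\<^bsub>B\<^esub>j\<in>I. \<kappa> (x \<otimes>\<^bsub>A\<^esub> d j) \<otimes>\<^bsub>B\<^esub> \<kappa> (c j \<otimes>\<^bsub>A\<^esub> y)) = \<kappa> (x \<otimes>\<^bsub>A\<^esub> y)"
proof -
  have "(\<Oplus>\<^bsub>B\<^esub>j\<in>I. \<kappa> (x \<otimes>\<^bsub>A\<^esub> d j) \<otimes>\<^bsub>B\<^esub> \<kappa> (c j \<otimes>\<^bsub>A\<^esub> y)) =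
      (\<Oplus>\<^bsub>B\<^esub>j\<in>I. \<kappa> (x \<otimes>\<^bsub>A\<^esub> ((d j \<otimes>\<^bsub>A\<^esub> c j) \<otimes>\<^bsub>A\<^esub> y)))"
  proof (rule \<theta>.A.finsum_eqI)
    fix j assume j: "j \<in> I"
    have "x \<otimes>\<^bsub>A\<^esub> d j \<otimes>\<^bsub>A\<^esub> e \<otimes>\<^bsub>A\<^esub> (c j \<otimes>\<^bsub>A\<^esub> y) = x \<otimes>\<^bsub>A\<^esub> ((d j \<otimes>\<^bsub>A\<^esub> e) \<otimes>\<^bsub>A\<^esub> (c j \<otimes>\<^bsub>A\<^esub> y))"
      using xy j by (simp add: \<theta>.B.m_assoc)
    then show "\<kappa> (x \<otimes>\<^bsub>A\<^esub> d j) \<otimes>\<^bsub>B\<^esub> \<kappa> (c j \<otimes>\<^bsub>A\<^esub> y) = \<kappa> (x \<otimes>\<^bsub>A\<^esub> ((d j \<otimes>\<^bsub>A\<^esub> c j) \<otimes>\<^bsub>A\<^esub> y))"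
      using xy j by (simp add: \<kappa>_mult d_e \<theta>.B.m_assoc)
  qed (use xy in auto)
  also have "\<dots> = \<kappa> (\<Oplus>\<^bsub>A\<^esub>j\<in>I. x \<otimes>\<^bsub>A\<^esub> ((d j \<otimes>\<^bsub>A\<^esub> c j) \<otimes>\<^bsub>A\<^esub> y))"
    using xy by (intro \<kappa>_finsum[symmetric]) auto
  also have "(\<Oplus>\<^bsub>A\<^esub>j\<in>I. x \<otimes>\<^bsub>A\<^esub> ((d j \<otimes>\<^bsub>A\<^esub> c j) \<otimes>\<^bsub>A\<^esub> y)) = x \<otimes>\<^bsub>A\<^esub> (\<Oplus>\<^bsub>A\<^esub>j\<in>I. (d j \<otimes>\<^bsub>A\<^esub> c j) \<otimes>\<^bsub>A\<^esub> y)"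
    using xy finite_index by (intro \<theta>.B.finsum_rdistr[symmetric]) auto
  also have "(\<Oplus>\<^bsub>A\<^esub>j\<in>I. (d j \<otimes>\<^bsub>A\<^esub> c j) \<otimes>\<^bsub>A\<^esub> y) = (\<Oplus>\<^bsub>A\<^esub>j\<in>I. d j \<otimes>\<^bsub>A\<^esub> c j) \<otimes>\<^bsub>A\<^esub> y"
    using xy finite_index by (intro \<theta>.B.finsum_ldistr[symmetric]) auto
  finally show ?thesis
    using xy by (simp add: full)
qed

subsection \<open>The corner functor\<close>

definition corner :: "('a, 'm) module \<Rightarrow> ('b, 'm) module" where
  "corner M = \<lparr>carrier = {x \<in> carrier M. e \<odot>\<^bsub>M\<^esub> x = x}, monoid.mult = undefined, one = undefined,
     ring.zero = \<zero>\<^bsub>M\<^esub>, ring.add = (\<oplus>\<^bsub>M\<^esub>), module.smult = (\<lambda>b. (\<odot>\<^bsub>M\<^esub>) (\<theta> b))\<rparr>"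

lemma corner_simps:
  "carrier (corner M) = {x \<in> carrier M. e \<odot>\<^bsub>M\<^esub> x = x}" "\<zero>\<^bsub>corner M\<^esub> = \<zero>\<^bsub>M\<^esub>"
  "x \<oplus>\<^bsub>corner M\<^esub> y = x \<oplus>\<^bsub>M\<^esub> y" "b \<odot>\<^bsub>corner M\<^esub> x = \<theta> b \<odot>\<^bsub>M\<^esub> x"
  by (simp_all add: corner_def)

lemma corner_left_module:
  assumes "left_module A M"
  shows "left_module B (corner M)"
proof -
  interpret M: module_over A M using assms by (simp add: module_over_iff)
  show ?thesis
  proof (rule left_moduleI)
    show "abelian_group (corner M)"
    proof (rule abelian_groupI)
      fix x assume x: "x \<in> carrier (corner M)"
      then have "e \<odot>\<^bsub>M\<^esub> (\<ominus>\<^bsub>M\<^esub> x) \<oplus>\<^bsub>M\<^esub> x = e \<odot>\<^bsub>M\<^esub> (\<ominus>\<^bsub>M\<^esub> x \<oplus>\<^bsub>M\<^esub> x)"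
        by (simp add: corner_simps M.act_add_right)
      then have "e \<odot>\<^bsub>M\<^esub> (\<ominus>\<^bsub>M\<^esub> x) = \<ominus>\<^bsub>M\<^esub> x"
        using x by (intro M.M.minus_equality[symmetric]) (auto simp: corner_simps M.M.l_neg M.act_zero_right)
      then show "\<exists>y\<in>carrier (corner M). y \<oplus>\<^bsub>corner M\<^esub> x = \<zero>\<^bsub>corner M\<^esub>"
        using x by (intro bexI[of _ "\<ominus>\<^bsub>M\<^esub> x"]) (auto simp: corner_simps M.M.l_neg)
    qed (auto simp: corner_simps M.act_add_right M.act_zero_right M.M.a_ac)
  qed (auto simp: corner_simps M.act_add_left M.act_add_right M.act_act \<theta>.add \<theta>.mult e_theta
      e_def[symmetric] \<theta>.A.complex_ring_axioms)
qed

lemma corner_functor: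
  "linear_functor A B corner (\<lambda>M N f. restrict f (carrier (corner M)))"
proof (rule linear_functor.intro)
  fix M N :: "('a, 'm) module" and f
  assume M: "left_module A M" and N: "left_module A N" and f: "f \<in> module_hom A M N"
  interpret M: module_over A M using M by (simp add: module_over_iff)
  interpret N: module_over A N using N by (simp add: module_over_iff)
  have f': "x \<in> carrier M \<Longrightarrow> f x \<in> carrier N" "x \<in> carrier M \<Longrightarrow> y \<in> carrier M \<Longrightarrow> f (x \<oplus>\<^bsub>M\<^esub> y) = f x \<oplus>\<^bsub>N\<^esub> f y"
    "a \<in> carrier A \<Longrightarrow> x \<in> carrier M \<Longrightarrow> f (a \<odot>\<^bsub>M\<^esub> x) = a \<odot>\<^bsub>N\<^esub> f x" for x y a
    using f by (auto simp: module_hom_def)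
  have ef: "e \<odot>\<^bsub>N\<^esub> f x = f x" if "x \<in> carrier M" "e \<odot>\<^bsub>M\<^esub> x = x" for x
    using f'(3)[of e x] that by simp
  show "restrict f (carrier (corner M)) \<in> module_hom B (corner M) (corner N)"
    by (auto simp: module_hom_def corner_simps f' ef M.act_add_right M.act_act e_theta)
  fix g assume g: "g \<in> module_hom A M N"
  show "restrict (hom_add M N f g) (carrier (corner M)) =
      hom_add (corner M) (corner N) (restrict f (carrier (corner M))) (restrict g (carrier (corner M)))"
    by (auto simp: hom_add_def corner_simps fun_eq_iff)
  show "restrict (hom_scale A M N a f) (carrier (corner M)) =
      hom_scale B (corner M) (corner N) a (restrict f (carrier (corner M)))" for a
  proof -
    have "(a \<odot>\<^bsub>A\<^esub> \<one>\<^bsub>A\<^esub>) \<odot>\<^bsub>N\<^esub> f x = \<theta> (a \<odot>\<^bsub>B\<^esub> \<one>\<^bsub>B\<^esub>) \<odot>\<^bsub>N\<^esub> f x"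
      if x: "x \<in> carrier M" "e \<odot>\<^bsub>M\<^esub> x = x" for x
    proof -
      have "(a \<odot>\<^bsub>A\<^esub> \<one>\<^bsub>A\<^esub>) \<odot>\<^bsub>N\<^esub> (e \<odot>\<^bsub>N\<^esub> f x) = \<theta> (a \<odot>\<^bsub>B\<^esub> \<one>\<^bsub>B\<^esub>) \<odot>\<^bsub>N\<^esub> f x"
        using x f'(1) by (simp add: N.act_act \<theta>.scale e_def[symmetric] \<theta>.B.scale_mult_left)
      then show ?thesis using ef[OF x] by simp
    qed
    then show ?thesis
      by (auto simp: hom_scale_def corner_simps fun_eq_iff)
  qed
next
  fix M :: "('a, 'm) module"
  show "restrict (hom_id M) (carrier (corner M)) = hom_id (corner M)"
    by (auto simp: hom_id_def corner_simps fun_eq_iff)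
next
  fix L M N :: "('a, 'm) module" and f g
  assume "f \<in> module_hom A L M" "left_module A L" "left_module A M"
  then have "f x \<in> carrier M" "e \<odot>\<^bsub>M\<^esub> f x = f (e \<odot>\<^bsub>L\<^esub> x)" if "x \<in> carrier L" for x
    using that by (auto simp: module_hom_def)
  then show "restrict (compose (carrier L) g f) (carrier (corner L)) =
      compose (carrier (corner L)) (restrict g (carrier (corner M))) (restrict f (carrier (corner L)))"
    by (auto simp: corner_simps compose_def fun_eq_iff)
qed (rule corner_left_module)

end


context full_corner
begin

subsection \<open>The matrix functor\<close>

text \<open>
  The matrix of \<open>a\<close> has the entries \<open>c i \<otimes> a \<otimes> d j\<close>.  The matrix of one is idempotent but in general
  not the identity, which is why \<open>columns\<close> keeps only the families that it fixes.
\<close>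

definition matrix_act :: "('b, 'm) module \<Rightarrow> 'a \<Rightarrow> ('i \<Rightarrow> 'm) \<Rightarrow> 'i \<Rightarrow> 'm" where
  "matrix_act N a v = (\<lambda>i\<in>I. \<Oplus>\<^bsub>N\<^esub>j\<in>I. \<kappa> (c i \<otimes>\<^bsub>A\<^esub> a \<otimes>\<^bsub>A\<^esub> d j) \<odot>\<^bsub>N\<^esub> v j)"

definition columns :: "('b, 'm) module \<Rightarrow> ('a, 'i \<Rightarrow> 'm) module" where
  "columns N = \<lparr>carrier = {v \<in> I \<rightarrow>\<^sub>E carrier N. matrix_act N \<one>\<^bsub>A\<^esub> v = v},
     monoid.mult = undefined, one = undefined, ring.zero = (\<lambda>i\<in>I. \<zero>\<^bsub>N\<^esub>),
     ring.add = (\<lambda>v w. \<lambda>i\<in>I. v i \<oplus>\<^bsub>N\<^esub> w i), module.smult = matrix_act N\<rparr>"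

lemma columns_simps:
  "carrier (columns N) = {v \<in> I \<rightarrow>\<^sub>E carrier N. matrix_act N \<one>\<^bsub>A\<^esub> v = v}"
  "\<zero>\<^bsub>columns N\<^esub> = (\<lambda>i\<in>I. \<zero>\<^bsub>N\<^esub>)" "v \<oplus>\<^bsub>columns N\<^esub> w = (\<lambda>i\<in>I. v i \<oplus>\<^bsub>N\<^esub> w i)"
  "a \<odot>\<^bsub>columns N\<^esub> v = matrix_act N a v"
  by (simp_all add: columns_def)

end

locale full_corner_module = full_corner B A \<theta> e I c d + N: module_over B N
  for B :: "(complex, 'b) module" and A :: "(complex, 'a) module" and \<theta> e
    and I :: "'i set" and c d and N :: "('b, 'm) module"
begin

abbreviation "NI \<equiv> I \<rightarrow>\<^sub>E carrier N"

lemma NI_mem [simp]: "v \<in> NI \<Longrightarrow> i \<in> I \<Longrightarrow> v i \<in> carrier N"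
  by auto

lemma matrix_act_closed [simp]:
  assumes "a \<in> carrier A" "v \<in> NI"
  shows "matrix_act N a v \<in> NI"
  unfolding matrix_act_def using assms by (auto intro!: N.M.finsum_closed)

lemma matrix_act_apply:
  "i \<in> I \<Longrightarrow> matrix_act N a v i = (\<Oplus>\<^bsub>N\<^esub>j\<in>I. \<kappa> (c i \<otimes>\<^bsub>A\<^esub> a \<otimes>\<^bsub>A\<^esub> d j) \<odot>\<^bsub>N\<^esub> v j)"
  by (simp add: matrix_act_def)

lemma sum_act_matrix_act:
  assumes x: "x \<in> carrier A" and a: "a \<in> carrier A" and v: "v \<in> NI"
  shows "(\<Oplus>\<^bsub>N\<^esub>j\<in>I. \<kappa> (x \<otimes>\<^bsub>A\<^esub> d j) \<odot>\<^bsub>N\<^esub> matrix_act N a v j) =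
    (\<Oplus>\<^bsub>N\<^esub>k\<in>I. \<kappa> (x \<otimes>\<^bsub>A\<^esub> a \<otimes>\<^bsub>A\<^esub> d k) \<odot>\<^bsub>N\<^esub> v k)"
proof -
  let ?t = "\<lambda>j k. (\<kappa> (x \<otimes>\<^bsub>A\<^esub> d j) \<otimes>\<^bsub>B\<^esub> \<kappa> (c j \<otimes>\<^bsub>A\<^esub> (a \<otimes>\<^bsub>A\<^esub> d k))) \<odot>\<^bsub>N\<^esub> v k"
  have "(\<Oplus>\<^bsub>N\<^esub>j\<in>I. \<kappa> (x \<otimes>\<^bsub>A\<^esub> d j) \<odot>\<^bsub>N\<^esub> matrix_act N a v j) = (\<Oplus>\<^bsub>N\<^esub>j\<in>I. \<Oplus>\<^bsub>N\<^esub>k\<in>I. ?t j k)"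
  proof (rule N.M.finsum_eqI)
    fix j assume j: "j \<in> I"
    have "\<kappa> (x \<otimes>\<^bsub>A\<^esub> d j) \<odot>\<^bsub>N\<^esub> matrix_act N a v j =
        (\<Oplus>\<^bsub>N\<^esub>k\<in>I. \<kappa> (x \<otimes>\<^bsub>A\<^esub> d j) \<odot>\<^bsub>N\<^esub> (\<kappa> (c j \<otimes>\<^bsub>A\<^esub> a \<otimes>\<^bsub>A\<^esub> d k) \<odot>\<^bsub>N\<^esub> v k))"
      unfolding matrix_act_apply[OF j] using x a v j by (intro N.act_finsum_right) auto
    also have "\<dots> = (\<Oplus>\<^bsub>N\<^esub>k\<in>I. ?t j k)"
      using x a v j by (intro N.M.finsum_eqI) (auto simp: N.act_act \<theta>.B.m_assoc)
    finally show "\<kappa> (x \<otimes>\<^bsub>A\<^esub> d j) \<odot>\<^bsub>N\<^esub> matrix_act N a v j = (\<Oplus>\<^bsub>N\<^esub>k\<in>I. ?t j k)" .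
  qed (use x a v in \<open>auto intro!: N.M.finsum_closed\<close>)
  also have "\<dots> = (\<Oplus>\<^bsub>N\<^esub>k\<in>I. \<Oplus>\<^bsub>N\<^esub>j\<in>I. ?t j k)"
    using x a v finite_index by (intro N.M.finsum_swap) auto
  also have "\<dots> = (\<Oplus>\<^bsub>N\<^esub>k\<in>I. \<kappa> (x \<otimes>\<^bsub>A\<^esub> a \<otimes>\<^bsub>A\<^esub> d k) \<odot>\<^bsub>N\<^esub> v k)"
  proof (rule N.M.finsum_eqI)
    fix k assume k: "k \<in> I"
    have "(\<Oplus>\<^bsub>N\<^esub>j\<in>I. ?t j k) =
        (\<Oplus>\<^bsub>B\<^esub>j\<in>I. \<kappa> (x \<otimes>\<^bsub>A\<^esub> d j) \<otimes>\<^bsub>B\<^esub> \<kappa> (c j \<otimes>\<^bsub>A\<^esub> (a \<otimes>\<^bsub>A\<^esub> d k))) \<odot>\<^bsub>N\<^esub> v k"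
      using x a v k by (intro N.act_finsum_left[symmetric]) auto
    then show "(\<Oplus>\<^bsub>N\<^esub>j\<in>I. ?t j k) = \<kappa> (x \<otimes>\<^bsub>A\<^esub> a \<otimes>\<^bsub>A\<^esub> d k) \<odot>\<^bsub>N\<^esub> v k"
      using x a k by (simp add: \<kappa>_matrix_mult \<theta>.B.m_assoc)
  qed (use x a v in auto)
  finally show ?thesis .
qed

lemma matrix_act_mult:
  assumes "a \<in> carrier A" "b \<in> carrier A" "v \<in> NI"
  shows "matrix_act N a (matrix_act N b v) = matrix_act N (a \<otimes>\<^bsub>A\<^esub> b) v"
proof (rule PiE_ext)
  fix i assume i: "i \<in> I"
  show "matrix_act N a (matrix_act N b v) i = matrix_act N (a \<otimes>\<^bsub>A\<^esub> b) v i"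
    using i assms sum_act_matrix_act[of "c i \<otimes>\<^bsub>A\<^esub> a" b v]
    by (simp add: matrix_act_apply \<theta>.B.m_assoc)
qed (rule matrix_act_closed, use assms in auto)+

lemma matrix_act_add_left:
  assumes a: "a \<in> carrier A" and b: "b \<in> carrier A" and v: "v \<in> NI"
  shows "matrix_act N (a \<oplus>\<^bsub>A\<^esub> b) v = (\<lambda>i\<in>I. matrix_act N a v i \<oplus>\<^bsub>N\<^esub> matrix_act N b v i)"
proof -
  have "(\<Oplus>\<^bsub>N\<^esub>j\<in>I. \<kappa> (c i \<otimes>\<^bsub>A\<^esub> (a \<oplus>\<^bsub>A\<^esub> b) \<otimes>\<^bsub>A\<^esub> d j) \<odot>\<^bsub>N\<^esub> v j) =
      matrix_act N a v i \<oplus>\<^bsub>N\<^esub> matrix_act N b v i" if i: "i \<in> I" for i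
  proof -
    have "(\<Oplus>\<^bsub>N\<^esub>j\<in>I. \<kappa> (c i \<otimes>\<^bsub>A\<^esub> (a \<oplus>\<^bsub>A\<^esub> b) \<otimes>\<^bsub>A\<^esub> d j) \<odot>\<^bsub>N\<^esub> v j) =
        (\<Oplus>\<^bsub>N\<^esub>j\<in>I. \<kappa> (c i \<otimes>\<^bsub>A\<^esub> a \<otimes>\<^bsub>A\<^esub> d j) \<odot>\<^bsub>N\<^esub> v j \<oplus>\<^bsub>N\<^esub> \<kappa> (c i \<otimes>\<^bsub>A\<^esub> b \<otimes>\<^bsub>A\<^esub> d j) \<odot>\<^bsub>N\<^esub> v j)"
      using a b v i by (intro N.M.finsum_eqI)
        (auto simp: \<theta>.B.l_distr \<theta>.B.r_distr \<kappa>_add N.act_add_left)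
    also have "\<dots> = matrix_act N a v i \<oplus>\<^bsub>N\<^esub> matrix_act N b v i"
      unfolding matrix_act_apply[OF i] using a b v i by (intro N.M.finsum_addf) auto
    finally show ?thesis .
  qed
  then show ?thesis
    by (auto simp: matrix_act_def)
qed

lemma matrix_act_add_right:
  assumes a: "a \<in> carrier A" and v: "v \<in> NI" and w: "w \<in> NI"
  shows "matrix_act N a (\<lambda>i\<in>I. v i \<oplus>\<^bsub>N\<^esub> w i) = (\<lambda>i\<in>I. matrix_act N a v i \<oplus>\<^bsub>N\<^esub> matrix_act N a w i)"
proof -
  have "(\<Oplus>\<^bsub>N\<^esub>j\<in>I. \<kappa> (c i \<otimes>\<^bsub>A\<^esub> a \<otimes>\<^bsub>A\<^esub> d j) \<odot>\<^bsub>N\<^esub> (\<lambda>i\<in>I. v i \<oplus>\<^bsub>N\<^esub> w i) j) =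
      matrix_act N a v i \<oplus>\<^bsub>N\<^esub> matrix_act N a w i" if i: "i \<in> I" for i
  proof -
    have "(\<Oplus>\<^bsub>N\<^esub>j\<in>I. \<kappa> (c i \<otimes>\<^bsub>A\<^esub> a \<otimes>\<^bsub>A\<^esub> d j) \<odot>\<^bsub>N\<^esub> (\<lambda>i\<in>I. v i \<oplus>\<^bsub>N\<^esub> w i) j) =
        (\<Oplus>\<^bsub>N\<^esub>j\<in>I. \<kappa> (c i \<otimes>\<^bsub>A\<^esub> a \<otimes>\<^bsub>A\<^esub> d j) \<odot>\<^bsub>N\<^esub> v j \<oplus>\<^bsub>N\<^esub> \<kappa> (c i \<otimes>\<^bsub>A\<^esub> a \<otimes>\<^bsub>A\<^esub> d j) \<odot>\<^bsub>N\<^esub> w j)"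
      using a v w i by (intro N.M.finsum_eqI) (auto simp: N.act_add_right)
    also have "\<dots> = matrix_act N a v i \<oplus>\<^bsub>N\<^esub> matrix_act N a w i"
      unfolding matrix_act_apply[OF i] using a v w i by (intro N.M.finsum_addf) auto
    finally show ?thesis .
  qed
  then show ?thesis
    by (auto simp: matrix_act_def)
qed

lemma matrix_act_zero: "a \<in> carrier A \<Longrightarrow> matrix_act N a (\<lambda>i\<in>I. \<zero>\<^bsub>N\<^esub>) = (\<lambda>i\<in>I. \<zero>\<^bsub>N\<^esub>)"
  unfolding matrix_act_def
  by (intro restrict_ext N.M.add.finprod_one_eqI) (auto simp: N.act_zero_right)

lemma columns_left_module: "left_module A (columns N)"
proof (rule left_moduleI)
  show "abelian_group (columns N)"
  proof (rule abelian_groupI)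
    fix v assume v: "v \<in> carrier (columns N)"
    define w where "w = matrix_act N (\<ominus>\<^bsub>A\<^esub> \<one>\<^bsub>A\<^esub>) v"
    have v': "v \<in> NI" "matrix_act N \<one>\<^bsub>A\<^esub> v = v" using v by (auto simp: columns_simps)
    have "w \<oplus>\<^bsub>columns N\<^esub> v = matrix_act N (\<ominus>\<^bsub>A\<^esub> \<one>\<^bsub>A\<^esub> \<oplus>\<^bsub>A\<^esub> \<one>\<^bsub>A\<^esub>) v"
      using v' by (subst matrix_act_add_left) (auto simp: w_def columns_simps)
    also have "\<dots> = \<zero>\<^bsub>columns N\<^esub>"
      using v' unfolding matrix_act_def columns_simps
      by (intro restrict_ext N.M.add.finprod_one_eqI) (auto simp: \<theta>.B.l_neg N.act_zero_left)
    finally show "\<exists>w\<in>carrier (columns N). w \<oplus>\<^bsub>columns N\<^esub> v = \<zero>\<^bsub>columns N\<^esub>"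
      using v' by (intro bexI[of _ w]) (auto simp: w_def columns_simps matrix_act_mult)
    show "\<zero>\<^bsub>columns N\<^esub> \<oplus>\<^bsub>columns N\<^esub> v = v"
      using v' by (intro PiE_ext[of _ I "\<lambda>_. carrier N"]) (auto simp: columns_simps)
  next
    fix v w assume "v \<in> carrier (columns N)" "w \<in> carrier (columns N)"
    then show "v \<oplus>\<^bsub>columns N\<^esub> w \<in> carrier (columns N)"
      by (auto simp: columns_simps matrix_act_add_right)
  qed (auto simp: columns_simps matrix_act_zero N.M.a_ac cong: restrict_cong)
qed (auto simp: columns_simps matrix_act_mult matrix_act_add_left matrix_act_add_right
    \<theta>.B.complex_ring_axioms)

lemma ex_encoding: "\<exists>f :: ('i \<Rightarrow> 'm) \<Rightarrow> 'm. inj_on f NI"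
  using finite_power_embedding[OF finite_index N.carrier_infinite_or_zero] by blast

end

context full_corner
begin

text \<open>
  Such an injection exists because a nonzero module over a complex algebra is infinite.
\<close>

definition encode :: "('b, 'm) module \<Rightarrow> ('i \<Rightarrow> 'm) \<Rightarrow> 'm" where
  "encode N = (SOME f. inj_on f (I \<rightarrow>\<^sub>E carrier N))"

definition matrices :: "('b, 'm) module \<Rightarrow> ('a, 'm) module" where
  "matrices N = transport (encode N) (columns N)"

definition matrices_map :: "('b, 'm) module \<Rightarrow> ('b, 'm) module \<Rightarrow> ('m \<Rightarrow> 'm) \<Rightarrow> 'm \<Rightarrow> 'm" where
  "matrices_map N N' f = (\<lambda>y\<in>carrier (matrices N).
     encode N' (\<lambda>i\<in>I. f (inv_into (carrier (columns N)) (encode N) y i)))"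

lemma full_corner_moduleI: "left_module B N \<Longrightarrow> full_corner_module B A \<theta> e I c d N"
  by (intro full_corner_module.intro full_corner_axioms) (simp add: module_over_iff)

lemma encode_inj:
  assumes "left_module B N"
  shows "inj_on (encode N) (carrier (columns N))"
proof -
  interpret full_corner_module B A \<theta> e I c d N by (rule full_corner_moduleI[OF assms])
  have "inj_on (encode N) (I \<rightarrow>\<^sub>E carrier N)"
    unfolding encode_def by (rule someI_ex[OF ex_encoding])
  then show ?thesis
    by (rule inj_on_subset) (auto simp: columns_simps)
qed

lemma matrices_simps:
  assumes "left_module B N"
  shows "carrier (matrices N) = encode N ` carrier (columns N)"
    "v \<in> carrier (columns N) \<Longrightarrow> w \<in> carrier (columns N) \<Longrightarrow>
      encode N v \<oplus>\<^bsub>matrices N\<^esub> encode N w = encode N (\<lambda>i\<in>I. v i \<oplus>\<^bsub>N\<^esub> w i)"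
    "v \<in> carrier (columns N) \<Longrightarrow> a \<odot>\<^bsub>matrices N\<^esub> encode N v = encode N (matrix_act N a v)"
    "v \<in> carrier (columns N) \<Longrightarrow>
      matrices_map N N' f (encode N v) = encode N' (\<lambda>i\<in>I. f (v i))"
  unfolding matrices_map_def matrices_def
  using transport_simps[OF encode_inj[OF assms]] inv_into_f_f[OF encode_inj[OF assms]]
  by (simp_all add: columns_simps)

lemma columns_map:
  assumes "left_module B N" "left_module B N'" "f \<in> module_hom B N N'" "v \<in> carrier (columns N)"
  shows "(\<lambda>i\<in>I. f (v i)) \<in> carrier (columns N')"
    "a \<in> carrier A \<Longrightarrow> (\<lambda>i\<in>I. f (matrix_act N a v i)) = matrix_act N' a (\<lambda>i\<in>I. f (v i))"
proof -
  interpret N: full_corner_module B A \<theta> e I c d N by (rule full_corner_moduleI[OF assms(1)])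
  interpret N': full_corner_module B A \<theta> e I c d N' by (rule full_corner_moduleI[OF assms(2)])
  have f: "x \<in> carrier N \<Longrightarrow> f x \<in> carrier N'"
    "x \<in> carrier N \<Longrightarrow> y \<in> carrier N \<Longrightarrow> f (x \<oplus>\<^bsub>N\<^esub> y) = f x \<oplus>\<^bsub>N'\<^esub> f y"
    "b \<in> carrier B \<Longrightarrow> x \<in> carrier N \<Longrightarrow> f (b \<odot>\<^bsub>N\<^esub> x) = b \<odot>\<^bsub>N'\<^esub> f x" for x y b
    using assms(3) by (auto simp: module_hom_def)
  have f0: "f \<zero>\<^bsub>N\<^esub> = \<zero>\<^bsub>N'\<^esub>"
    using f(3)[of "\<zero>\<^bsub>B\<^esub>" "\<zero>\<^bsub>N\<^esub>"] f(1)[of "\<zero>\<^bsub>N\<^esub>"] by (simp add: N.N.act_zero_left N'.N.act_zero_left)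
  have fsum: "f (finsum N g J) = (\<Oplus>\<^bsub>N'\<^esub>j\<in>J. f (g j))" if "g \<in> J \<rightarrow> carrier N" for g and J :: "'i set"
    using that
  proof (induction J rule: infinite_finite_induct)
    case (insert j J)
    then show ?case by (simp add: f Pi_def N.N.M.finsum_closed)
  qed (auto simp: f0)
  have v: "v \<in> I \<rightarrow>\<^sub>E carrier N" "matrix_act N \<one>\<^bsub>A\<^esub> v = v"
    using assms(4) by (auto simp: columns_simps)
  have *: "(\<lambda>i\<in>I. f (matrix_act N a v i)) = matrix_act N' a (\<lambda>i\<in>I. f (v i))" if "a \<in> carrier A" for a
  proof -
    have "f (\<Oplus>\<^bsub>N\<^esub>j\<in>I. \<kappa> (c i \<otimes>\<^bsub>A\<^esub> a \<otimes>\<^bsub>A\<^esub> d j) \<odot>\<^bsub>N\<^esub> v j) =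
        (\<Oplus>\<^bsub>N'\<^esub>j\<in>I. \<kappa> (c i \<otimes>\<^bsub>A\<^esub> a \<otimes>\<^bsub>A\<^esub> d j) \<odot>\<^bsub>N'\<^esub> (\<lambda>i\<in>I. f (v i)) j)" if i: "i \<in> I" for i
      using i v \<open>a \<in> carrier A\<close> by (subst fsum) (auto intro!: N'.N.M.finsum_eqI simp: f)
    then show ?thesis
      unfolding matrix_act_def by (auto cong: restrict_cong)
  qed
  then show "a \<in> carrier A \<Longrightarrow> (\<lambda>i\<in>I. f (matrix_act N a v i)) = matrix_act N' a (\<lambda>i\<in>I. f (v i))" .
  show "(\<lambda>i\<in>I. f (v i)) \<in> carrier (columns N')"
    using *[of "\<one>\<^bsub>A\<^esub>"] v by (auto simp: columns_simps f)
qed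

lemma matrices_left_module: "left_module B N \<Longrightarrow> left_module A (matrices N)"
  unfolding matrices_def
  by (intro transport_left_module encode_inj full_corner_module.columns_left_module full_corner_moduleI)

lemma matrices_functor: "linear_functor B A matrices matrices_map"
proof (rule linear_functor.intro)
  fix N N' :: "('b, 'm) module" and f
  assume N: "left_module B N" and N': "left_module B N'" and f: "f \<in> module_hom B N N'"
  interpret N: full_corner_module B A \<theta> e I c d N by (rule full_corner_moduleI[OF N])
  interpret N': full_corner_module B A \<theta> e I c d N' by (rule full_corner_moduleI[OF N'])
  interpret CN: module_over A "columns N" using N.columns_left_module by (simp add: module_over_iff)
  note S = matrices_simps[OF N] and S' = matrices_simps[OF N'] and cm = columns_map[OF N N']
  have hom: "f x \<in> carrier N'" "y \<in> carrier N \<Longrightarrow> f (x \<oplus>\<^bsub>N\<^esub> y) = f x \<oplus>\<^bsub>N'\<^esub> f y"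
    if "x \<in> carrier N" for x y
    using f that by (auto simp: module_hom_def)
  have add: "(\<lambda>i\<in>I. v i \<oplus>\<^bsub>N\<^esub> w i) \<in> carrier (columns N)"
    if "v \<in> carrier (columns N)" "w \<in> carrier (columns N)" for v w
    using CN.M.a_closed[OF that] by (simp add: columns_simps)
  have act: "matrix_act N a v \<in> carrier (columns N)"
    if "v \<in> carrier (columns N)" "a \<in> carrier A" for v a
    using CN.act_closed[OF that(2,1)] by (simp add: columns_simps)
  have mem: "v i \<in> carrier N" if "v \<in> carrier (columns N)" "i \<in> I" for v i
    using that by (auto simp: columns_simps)
  show "matrices_map N N' f \<in> module_hom A (matrices N) (matrices N')"
    unfolding module_hom_def
  proof (intro CollectI conjI ballI)
    show "matrices_map N N' f \<in> carrier (matrices N) \<rightarrow>\<^sub>E carrier (matrices N')"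
    proof (rule PiE_I)
      fix y assume "y \<in> carrier (matrices N)"
      then show "matrices_map N N' f y \<in> carrier (matrices N')"
        using cm(1)[OF f] by (auto simp: S S'(1))
    qed (simp add: matrices_map_def)
  next
    fix y z assume "y \<in> carrier (matrices N)" "z \<in> carrier (matrices N)"
    then obtain v w where v: "v \<in> carrier (columns N)" "y = encode N v"
      and w: "w \<in> carrier (columns N)" "z = encode N w"
      by (auto simp: S(1))
    show "matrices_map N N' f (y \<oplus>\<^bsub>matrices N\<^esub> z) =
        matrices_map N N' f y \<oplus>\<^bsub>matrices N'\<^esub> matrices_map N N' f z"
      using v w add[OF v(1) w(1)] cm(1)[OF f v(1)] cm(1)[OF f w(1)] hom mem
      by (simp add: S S' cong: restrict_cong)
  next
    fix a y assume a: "a \<in> carrier A" and "y \<in> carrier (matrices N)"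
    then obtain v where v: "v \<in> carrier (columns N)" "y = encode N v"
      by (auto simp: S(1))
    show "matrices_map N N' f (a \<odot>\<^bsub>matrices N\<^esub> y) = a \<odot>\<^bsub>matrices N'\<^esub> matrices_map N N' f y"
      using v act[OF v(1) a] cm(1)[OF f v(1)] cm(2)[OF f v(1) a] by (simp add: S S')
  qed
  fix g assume g: "g \<in> module_hom B N N'"
  show "matrices_map N N' (hom_add N N' f g) =
      hom_add (matrices N) (matrices N') (matrices_map N N' f) (matrices_map N N' g)"
  proof (rule extensionalityI[of _ "carrier (matrices N)"])
    fix y assume y: "y \<in> carrier (matrices N)"
    then obtain v where v: "v \<in> carrier (columns N)" "y = encode N v"
      by (auto simp: S(1))
    have "(\<lambda>i\<in>I. hom_add N N' f g (v i)) = (\<lambda>i\<in>I. (\<lambda>i\<in>I. f (v i)) i \<oplus>\<^bsub>N'\<^esub> (\<lambda>i\<in>I. g (v i)) i)"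
      using mem[OF v(1)] by (auto simp: hom_add_def)
    then show "matrices_map N N' (hom_add N N' f g) y =
      hom_add (matrices N) (matrices N') (matrices_map N N' f) (matrices_map N N' g) y"
      using y v cm(1)[OF f v(1)] cm(1)[OF g v(1)]
      by (simp add: hom_add_def[of "matrices N"] S(4) S'(2))
  qed (simp_all add: matrices_map_def hom_add_def)
  fix a
  show "matrices_map N N' (hom_scale B N N' a f) =
      hom_scale A (matrices N) (matrices N') a (matrices_map N N' f)"
  proof (rule extensionalityI[of _ "carrier (matrices N)"])
    fix y assume y: "y \<in> carrier (matrices N)"
    then obtain v where v: "v \<in> carrier (columns N)" "y = encode N v"
      by (auto simp: S(1))
    let ?w = "\<lambda>i\<in>I. f (v i)"
    have w: "?w \<in> I \<rightarrow>\<^sub>E carrier N'" "matrix_act N' \<one>\<^bsub>A\<^esub> ?w = ?w"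
      using cm(1)[OF f v(1)] by (simp_all add: columns_simps)
    have "matrix_act N' (a \<odot>\<^bsub>A\<^esub> \<one>\<^bsub>A\<^esub>) ?w i = (a \<odot>\<^bsub>B\<^esub> \<one>\<^bsub>B\<^esub>) \<odot>\<^bsub>N'\<^esub> matrix_act N' \<one>\<^bsub>A\<^esub> ?w i" if i: "i \<in> I" for i
    proof -
      have "(a \<odot>\<^bsub>B\<^esub> \<one>\<^bsub>B\<^esub>) \<odot>\<^bsub>N'\<^esub> matrix_act N' \<one>\<^bsub>A\<^esub> ?w i =
          (\<Oplus>\<^bsub>N'\<^esub>j\<in>I. (a \<odot>\<^bsub>B\<^esub> \<one>\<^bsub>B\<^esub>) \<odot>\<^bsub>N'\<^esub> (\<kappa> (c i \<otimes>\<^bsub>A\<^esub> \<one>\<^bsub>A\<^esub> \<otimes>\<^bsub>A\<^esub> d j) \<odot>\<^bsub>N'\<^esub> ?w j))"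
        unfolding N'.matrix_act_apply[OF i]
        using i w(1) N'.NI_mem[OF w(1)] by (intro N'.N.act_finsum_right) auto
      also have "\<dots> = matrix_act N' (a \<odot>\<^bsub>A\<^esub> \<one>\<^bsub>A\<^esub>) ?w i"
        unfolding N'.matrix_act_apply[OF i]
        using i N'.NI_mem[OF w(1)]
        by (intro N'.N.M.finsum_eqI) (auto simp: N'.N.act_act \<theta>.B.scale_mult_left
            \<theta>.B.scale_mult_right \<theta>.A.scale_mult_left \<kappa>_scale simp del: restrict_apply)
      finally show ?thesis by simp
    qed
    moreover have "matrix_act N' (a \<odot>\<^bsub>A\<^esub> \<one>\<^bsub>A\<^esub>) ?w \<in> extensional I"
      by (simp add: matrix_act_def)
    ultimately have "matrix_act N' (a \<odot>\<^bsub>A\<^esub> \<one>\<^bsub>A\<^esub>) ?w = (\<lambda>i\<in>I. hom_scale B N N' a f (v i))"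
      using mem[OF v(1)] unfolding w(2)
      by (intro extensionalityI[of _ I]) (auto simp: hom_scale_def)
    then show "matrices_map N N' (hom_scale B N N' a f) y =
      hom_scale A (matrices N) (matrices N') a (matrices_map N N' f) y"
      using y v cm(1)[OF f v(1)] by (simp add: hom_scale_def[of A] S(4) S'(3))
  qed (simp_all add: matrices_map_def hom_scale_def)
next
  fix N :: "('b, 'm) module" assume N: "left_module B N"
  note S = matrices_simps[OF N]
  show "matrices_map N N (hom_id N) = hom_id (matrices N)"
  proof (rule extensionalityI[of _ "carrier (matrices N)"])
    fix y assume y: "y \<in> carrier (matrices N)"
    then obtain v where v: "v \<in> carrier (columns N)" "y = encode N v"
      by (auto simp: S(1))
    have "(\<lambda>i\<in>I. hom_id N (v i)) = v"
      using v(1) by (intro PiE_ext[of _ I "\<lambda>_. carrier N"]) (auto simp: hom_id_def columns_simps)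
    then show "matrices_map N N (hom_id N) y = hom_id (matrices N) y"
      using y v by (simp add: S(4) hom_id_def[of "matrices N"])
  qed (simp_all add: matrices_map_def hom_id_def)
next
  fix L M N :: "('b, 'm) module" and f g
  assume L: "left_module B L" and M: "left_module B M" and N: "left_module B N"
    and f: "f \<in> module_hom B L M" and g: "g \<in> module_hom B M N"
  note S = matrices_simps[OF L]
  show "matrices_map L N (compose (carrier L) g f) =
      compose (carrier (matrices L)) (matrices_map M N g) (matrices_map L M f)"
  proof (rule extensionalityI[of _ "carrier (matrices L)"])
    fix y assume y: "y \<in> carrier (matrices L)"
    then obtain v where v: "v \<in> carrier (columns L)" "y = encode L v"
      by (auto simp: S(1))
    have "v i \<in> carrier L" if "i \<in> I" for i
      using v(1) that by (auto simp: columns_simps)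
    then show "matrices_map L N (compose (carrier L) g f) y =
        compose (carrier (matrices L)) (matrices_map M N g) (matrices_map L M f) y"
      using y v columns_map(1)[OF L M f v(1)] matrices_simps(4)[OF M]
      by (simp add: S(4) compose_def cong: restrict_cong)
  qed (simp_all add: matrices_map_def compose_def)
qed (rule matrices_left_module)

end


context full_corner
begin

subsection \<open>The natural isomorphisms\<close>

lemma \<kappa>_cut: "x \<in> carrier A \<Longrightarrow> \<kappa> (x \<otimes>\<^bsub>A\<^esub> e) = \<kappa> x" "x \<in> carrier A \<Longrightarrow> \<kappa> (e \<otimes>\<^bsub>A\<^esub> x) = \<kappa> x"
proof -
  assume x: "x \<in> carrier A"
  have "e \<otimes>\<^bsub>A\<^esub> (x \<otimes>\<^bsub>A\<^esub> e) \<otimes>\<^bsub>A\<^esub> e = e \<otimes>\<^bsub>A\<^esub> x \<otimes>\<^bsub>A\<^esub> (e \<otimes>\<^bsub>A\<^esub> e)"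
    "e \<otimes>\<^bsub>A\<^esub> (e \<otimes>\<^bsub>A\<^esub> x) \<otimes>\<^bsub>A\<^esub> e = (e \<otimes>\<^bsub>A\<^esub> e) \<otimes>\<^bsub>A\<^esub> x \<otimes>\<^bsub>A\<^esub> e"
    using x by (simp_all add: \<theta>.B.m_assoc del: e_e)
  then show "\<kappa> (x \<otimes>\<^bsub>A\<^esub> e) = \<kappa> x" "\<kappa> (e \<otimes>\<^bsub>A\<^esub> x) = \<kappa> x"
    using x by (simp_all add: \<kappa>_def e_e)
qed

lemma corner_finsum:
  assumes "left_module A M" "f \<in> J \<rightarrow> carrier (corner M)"
  shows "finsum (corner M) f J = finsum M f J"
proof -
  interpret M: module_over A M using assms(1) by (simp add: module_over_iff)
  interpret C: module_over B "corner M"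
    using corner_left_module[OF assms(1)] by (simp add: module_over_iff)
  show ?thesis
    using assms(2)
  proof (induction J rule: infinite_finite_induct)
    case (insert j J)
    then have "f j \<in> carrier M" "f \<in> J \<rightarrow> carrier M" "f j \<in> carrier (corner M)"
      "f \<in> J \<rightarrow> carrier (corner M)"
      by (auto simp: corner_simps)
    with insert show ?case by (simp add: corner_simps(3) C.M.finsum_insert)
  qed (simp_all add: corner_simps)
qed

text \<open>
  In the language of tensor products this is \<open>n \<mapsto> e \<otimes> n\<close>; the coordinates of \<open>e\<close> are the \<open>c i\<close>.
\<close>

definition to_corner_of_matrices :: "('b, 'm) module \<Rightarrow> 'm \<Rightarrow> 'm" where
  "to_corner_of_matrices N = (\<lambda>n\<in>carrier N. encode N (\<lambda>i\<in>I. \<kappa> (c i) \<odot>\<^bsub>N\<^esub> n))"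

lemma to_corner_of_matrices:
  assumes N: "left_module B N"
  shows "to_corner_of_matrices N \<in> module_hom B N (corner (matrices N))"
    and "bij_betw (to_corner_of_matrices N) (carrier N) (carrier (corner (matrices N)))"
proof -
  interpret N: full_corner_module B A \<theta> e I c d N by (rule full_corner_moduleI[OF N])
  note S = matrices_simps[OF N]
  note inj = encode_inj[OF N]
  let ?col = "\<lambda>n. \<lambda>i\<in>I. \<kappa> (c i) \<odot>\<^bsub>N\<^esub> n"
  have col [simp]: "?col n \<in> I \<rightarrow>\<^sub>E carrier N" if "n \<in> carrier N" for n
    using that by auto
  have act_col: "matrix_act N a (?col n) = (\<lambda>i\<in>I. \<kappa> (c i \<otimes>\<^bsub>A\<^esub> a) \<odot>\<^bsub>N\<^esub> n)"
    if a: "a \<in> carrier A" and n: "n \<in> carrier N" for a n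
  proof -
    have "(\<Oplus>\<^bsub>N\<^esub>j\<in>I. \<kappa> (c i \<otimes>\<^bsub>A\<^esub> a \<otimes>\<^bsub>A\<^esub> d j) \<odot>\<^bsub>N\<^esub> ?col n j) = \<kappa> (c i \<otimes>\<^bsub>A\<^esub> a) \<odot>\<^bsub>N\<^esub> n"
      if i: "i \<in> I" for i
    proof -
      have "(\<Oplus>\<^bsub>N\<^esub>j\<in>I. \<kappa> (c i \<otimes>\<^bsub>A\<^esub> a \<otimes>\<^bsub>A\<^esub> d j) \<odot>\<^bsub>N\<^esub> ?col n j) =
          (\<Oplus>\<^bsub>N\<^esub>j\<in>I. (\<kappa> (c i \<otimes>\<^bsub>A\<^esub> a \<otimes>\<^bsub>A\<^esub> d j) \<otimes>\<^bsub>B\<^esub> \<kappa> (c j \<otimes>\<^bsub>A\<^esub> e)) \<odot>\<^bsub>N\<^esub> n)"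
        using i a n by (intro N.N.M.finsum_eqI) (auto simp: N.N.act_act \<kappa>_cut)
      also have "\<dots> = (\<Oplus>\<^bsub>B\<^esub>j\<in>I. \<kappa> (c i \<otimes>\<^bsub>A\<^esub> a \<otimes>\<^bsub>A\<^esub> d j) \<otimes>\<^bsub>B\<^esub> \<kappa> (c j \<otimes>\<^bsub>A\<^esub> e)) \<odot>\<^bsub>N\<^esub> n"
        using i a n by (intro N.N.act_finsum_left[symmetric]) auto
      also have "\<dots> = \<kappa> (c i \<otimes>\<^bsub>A\<^esub> a) \<odot>\<^bsub>N\<^esub> n"
        using i a by (simp add: \<kappa>_matrix_mult \<kappa>_cut)
      finally show ?thesis .
    qed
    then show ?thesis
      unfolding matrix_act_def by (intro restrict_ext)
  qed
  have col_mem: "?col n \<in> carrier (columns N)" if "n \<in> carrier N" for n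
    using that act_col[of "\<one>\<^bsub>A\<^esub>" n] by (simp add: columns_simps cong: restrict_cong)
  have "matrix_act N e (?col n) = ?col n" if "n \<in> carrier N" for n
    using that act_col[of e n] by (simp add: \<kappa>_cut cong: restrict_cong)
  then have mem: "encode N (?col n) \<in> carrier (corner (matrices N))" if "n \<in> carrier N" for n
    using that col_mem by (simp add: corner_simps S)
  show "to_corner_of_matrices N \<in> module_hom B N (corner (matrices N))"
    unfolding module_hom_def
  proof (intro CollectI conjI ballI)
    show "to_corner_of_matrices N \<in> carrier N \<rightarrow>\<^sub>E carrier (corner (matrices N))"
      unfolding to_corner_of_matrices_def using mem by auto
  next
    fix m n assume "m \<in> carrier N" "n \<in> carrier N"
    then show "to_corner_of_matrices N (m \<oplus>\<^bsub>N\<^esub> n) =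
        to_corner_of_matrices N m \<oplus>\<^bsub>corner (matrices N)\<^esub> to_corner_of_matrices N n"
      by (simp add: to_corner_of_matrices_def corner_simps S col_mem N.N.act_add_right cong: restrict_cong)
  next
    fix b n assume b: "b \<in> carrier B" and n: "n \<in> carrier N"
    have "\<kappa> (c i \<otimes>\<^bsub>A\<^esub> \<theta> b) = \<kappa> (c i) \<otimes>\<^bsub>B\<^esub> b" if "i \<in> I" for i
      using \<kappa>_mult[of "c i" "\<theta> b"] b that \<theta>.B.m_assoc[of "c i" e "\<theta> b"] by (simp add: e_theta)
    then show "to_corner_of_matrices N (b \<odot>\<^bsub>N\<^esub> n) = b \<odot>\<^bsub>corner (matrices N)\<^esub> to_corner_of_matrices N n"
      using b n by (simp add: to_corner_of_matrices_def corner_simps S col_mem act_col N.N.act_act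
          cong: restrict_cong)
  qed
  let ?inv = "\<lambda>v. \<Oplus>\<^bsub>N\<^esub>j\<in>I. \<kappa> (d j) \<odot>\<^bsub>N\<^esub> v j"
  have left: "?inv (?col n) = n" if n: "n \<in> carrier N" for n
  proof -
    have "?inv (?col n) = (\<Oplus>\<^bsub>N\<^esub>j\<in>I. (\<kappa> (e \<otimes>\<^bsub>A\<^esub> d j) \<otimes>\<^bsub>B\<^esub> \<kappa> (c j \<otimes>\<^bsub>A\<^esub> e)) \<odot>\<^bsub>N\<^esub> n)"
      using n by (intro N.N.M.finsum_eqI) (auto simp: N.N.act_act \<kappa>_cut)
    also have "\<dots> = (\<Oplus>\<^bsub>B\<^esub>j\<in>I. \<kappa> (e \<otimes>\<^bsub>A\<^esub> d j) \<otimes>\<^bsub>B\<^esub> \<kappa> (c j \<otimes>\<^bsub>A\<^esub> e)) \<odot>\<^bsub>N\<^esub> n"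
      using n by (intro N.N.act_finsum_left[symmetric]) auto
    also have "\<dots> = n"
      using n by (subst \<kappa>_matrix_mult) (auto simp: e_e)
    finally show ?thesis .
  qed
  have right: "?inv v \<in> carrier N \<and> ?col (?inv v) = v"
    if v: "v \<in> carrier (columns N)" and ev: "matrix_act N e v = v" for v
  proof
    have v': "v \<in> I \<rightarrow>\<^sub>E carrier N" using v by (simp add: columns_simps)
    then show "?inv v \<in> carrier N" by (auto intro!: N.N.M.finsum_closed)
    have "\<kappa> (c i) \<odot>\<^bsub>N\<^esub> ?inv v = matrix_act N e v i" if i: "i \<in> I" for i
    proof -
      have "\<kappa> (c i) \<odot>\<^bsub>N\<^esub> ?inv v = (\<Oplus>\<^bsub>N\<^esub>j\<in>I. \<kappa> (c i) \<odot>\<^bsub>N\<^esub> (\<kappa> (d j) \<odot>\<^bsub>N\<^esub> v j))"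
        using i v' by (intro N.N.act_finsum_right) auto
      also have "\<dots> = matrix_act N e v i"
        unfolding N.matrix_act_apply[OF i]
        using i v' by (intro N.N.M.finsum_eqI) (auto simp: N.N.act_act \<kappa>_mult)
      finally show ?thesis .
    qed
    then show "?col (?inv v) = v"
      unfolding ev using v' by (intro PiE_ext[of _ I "\<lambda>_. carrier N"]) (auto intro!: N.N.M.finsum_closed)
  qed
  show "bij_betw (to_corner_of_matrices N) (carrier N) (carrier (corner (matrices N)))"
    unfolding bij_betw_def
  proof
    show "inj_on (to_corner_of_matrices N) (carrier N)"
    proof (rule inj_onI)
      fix m n assume mn: "m \<in> carrier N" "n \<in> carrier N"
        and "to_corner_of_matrices N m = to_corner_of_matrices N n"
      then have "?col m = ?col n"
        by (intro inj_onD[OF inj]) (auto simp: to_corner_of_matrices_def col_mem)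
      then show "m = n"
        using left[OF mn(1)] left[OF mn(2)] by metis
    qed
    show "to_corner_of_matrices N ` carrier N = carrier (corner (matrices N))"
    proof
      show "to_corner_of_matrices N ` carrier N \<subseteq> carrier (corner (matrices N))"
        using mem by (auto simp: to_corner_of_matrices_def)
      show "carrier (corner (matrices N)) \<subseteq> to_corner_of_matrices N ` carrier N"
      proof
        fix y assume "y \<in> carrier (corner (matrices N))"
        then obtain v where v: "v \<in> carrier (columns N)" "y = encode N v"
          and ev: "encode N (matrix_act N e v) = encode N v"
          by (auto simp: corner_simps S)
        interpret C: module_over A "columns N"
          using N.columns_left_module by (simp add: module_over_iff)
        have "matrix_act N e v \<in> carrier (columns N)"
          using C.act_closed[OF e_closed v(1)] by (simp add: columns_simps)
        then have "matrix_act N e v = v"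
          using inj_onD[OF inj, OF ev] v(1) by blast
        then show "y \<in> to_corner_of_matrices N ` carrier N"
          using right[OF v(1)] v(2) by (intro image_eqI[of _ _ "?inv v"]) (auto simp: to_corner_of_matrices_def)
      qed
    qed
  qed
qed

text \<open>
  An element \<open>m\<close> is the sum of the \<open>d i (c i m)\<close>, hence determined by the elements \<open>c i m\<close> of the
  corner.
\<close>

definition to_matrices_of_corner :: "('a, 'm) module \<Rightarrow> 'm \<Rightarrow> 'm" where
  "to_matrices_of_corner M = (\<lambda>m\<in>carrier M. encode (corner M) (\<lambda>i\<in>I. c i \<odot>\<^bsub>M\<^esub> m))"

lemma to_matrices_of_corner:
  assumes M: "left_module A M"
  shows "to_matrices_of_corner M \<in> module_hom A M (matrices (corner M))"
    and "bij_betw (to_matrices_of_corner M) (carrier M) (carrier (matrices (corner M)))"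
proof -
  interpret M: module_over A M using M by (simp add: module_over_iff)
  have N: "left_module B (corner M)" by (rule corner_left_module[OF M])
  let ?N = "corner M"
  interpret N: full_corner_module B A \<theta> e I c d ?N by (rule full_corner_moduleI[OF N])
  note S = matrices_simps[OF N]
  note inj = encode_inj[OF N]
  let ?col = "\<lambda>m. \<lambda>i\<in>I. c i \<odot>\<^bsub>M\<^esub> m"
  have col [simp]: "?col m \<in> I \<rightarrow>\<^sub>E carrier ?N" if "m \<in> carrier M" for m
    using that by (auto simp: corner_simps M.act_act e_c)
  have theta_entry: "\<theta> (\<kappa> (c i \<otimes>\<^bsub>A\<^esub> a \<otimes>\<^bsub>A\<^esub> d j)) = c i \<otimes>\<^bsub>A\<^esub> a \<otimes>\<^bsub>A\<^esub> d j"
    if "i \<in> I" "j \<in> I" "a \<in> carrier A" for i j a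
  proof -
    have "e \<otimes>\<^bsub>A\<^esub> (c i \<otimes>\<^bsub>A\<^esub> a \<otimes>\<^bsub>A\<^esub> d j) \<otimes>\<^bsub>A\<^esub> e = (e \<otimes>\<^bsub>A\<^esub> c i) \<otimes>\<^bsub>A\<^esub> a \<otimes>\<^bsub>A\<^esub> (d j \<otimes>\<^bsub>A\<^esub> e)"
      using that by (simp add: \<theta>.B.m_assoc del: e_c d_e)
    then show ?thesis using that by (simp add: theta_\<kappa> e_c d_e)
  qed
  have act: "matrix_act ?N a v i = c i \<odot>\<^bsub>M\<^esub> (a \<odot>\<^bsub>M\<^esub> (\<Oplus>\<^bsub>M\<^esub>j\<in>I. d j \<odot>\<^bsub>M\<^esub> v j))"
    if i: "i \<in> I" and a: "a \<in> carrier A" and v: "v \<in> I \<rightarrow>\<^sub>E carrier ?N" for i a v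
  proof -
    have vM: "v j \<in> carrier M" if "j \<in> I" for j
      using v that by (auto simp: corner_simps)
    have "matrix_act ?N a v i = (\<Oplus>\<^bsub>M\<^esub>j\<in>I. \<kappa> (c i \<otimes>\<^bsub>A\<^esub> a \<otimes>\<^bsub>A\<^esub> d j) \<odot>\<^bsub>?N\<^esub> v j)"
      unfolding N.matrix_act_apply[OF i] using i a N.NI_mem[OF v] by (intro corner_finsum[OF M]) auto
    also have "\<dots> = (\<Oplus>\<^bsub>M\<^esub>j\<in>I. (c i \<otimes>\<^bsub>A\<^esub> a) \<odot>\<^bsub>M\<^esub> (d j \<odot>\<^bsub>M\<^esub> v j))"
      using i a vM by (intro M.M.finsum_eqI) (auto simp: corner_simps theta_entry M.act_act)
    also have "\<dots> = (c i \<otimes>\<^bsub>A\<^esub> a) \<odot>\<^bsub>M\<^esub> (\<Oplus>\<^bsub>M\<^esub>j\<in>I. d j \<odot>\<^bsub>M\<^esub> v j)"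
      using i a vM by (intro M.act_finsum_right[symmetric]) auto
    finally show ?thesis
      using i a vM by (simp add: M.act_act M.M.finsum_closed Pi_def)
  qed
  have inv_col: "(\<Oplus>\<^bsub>M\<^esub>j\<in>I. d j \<odot>\<^bsub>M\<^esub> ?col m j) = m" if m: "m \<in> carrier M" for m
  proof -
    have "(\<Oplus>\<^bsub>M\<^esub>j\<in>I. d j \<odot>\<^bsub>M\<^esub> ?col m j) = (\<Oplus>\<^bsub>M\<^esub>j\<in>I. (d j \<otimes>\<^bsub>A\<^esub> c j) \<odot>\<^bsub>M\<^esub> m)"
      using m by (intro M.M.finsum_eqI) (auto simp: M.act_act)
    also have "\<dots> = (\<Oplus>\<^bsub>A\<^esub>j\<in>I. d j \<otimes>\<^bsub>A\<^esub> c j) \<odot>\<^bsub>M\<^esub> m"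
      using m by (intro M.act_finsum_left[symmetric]) auto
    finally show ?thesis using m by (simp add: full)
  qed
  have act_col: "matrix_act ?N a (?col m) = ?col (a \<odot>\<^bsub>M\<^esub> m)"
    if a: "a \<in> carrier A" and m: "m \<in> carrier M" for a m
  proof (rule PiE_ext[OF N.matrix_act_closed[OF a col[OF m]] col])
    show "a \<odot>\<^bsub>M\<^esub> m \<in> carrier M" using a m by simp
    fix i assume i: "i \<in> I"
    show "matrix_act ?N a (?col m) i = ?col (a \<odot>\<^bsub>M\<^esub> m) i"
      unfolding act[OF i a col[OF m]] inv_col[OF m] using i by simp
  qed
  have col_mem: "?col m \<in> carrier (columns ?N)" if "m \<in> carrier M" for m
    unfolding columns_simps using act_col[OF \<theta>.B.one_closed that] col[OF that] M.act_one[OF that]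
    by (simp only: mem_Collect_eq simp_thms)
  show "to_matrices_of_corner M \<in> module_hom A M (matrices ?N)"
    unfolding module_hom_def
  proof (intro CollectI conjI ballI)
    show "to_matrices_of_corner M \<in> carrier M \<rightarrow>\<^sub>E carrier (matrices ?N)"
      unfolding to_matrices_of_corner_def using col_mem by (auto simp: S)
  next
    fix m n assume "m \<in> carrier M" "n \<in> carrier M"
    then show "to_matrices_of_corner M (m \<oplus>\<^bsub>M\<^esub> n) =
        to_matrices_of_corner M m \<oplus>\<^bsub>matrices ?N\<^esub> to_matrices_of_corner M n"
      by (simp add: to_matrices_of_corner_def S col_mem M.act_add_right corner_simps cong: restrict_cong)
  next
    fix a m assume "a \<in> carrier A" "m \<in> carrier M"
    then show "to_matrices_of_corner M (a \<odot>\<^bsub>M\<^esub> m) = a \<odot>\<^bsub>matrices ?N\<^esub> to_matrices_of_corner M m"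
      by (simp add: to_matrices_of_corner_def S col_mem act_col)
  qed
  show "bij_betw (to_matrices_of_corner M) (carrier M) (carrier (matrices ?N))"
    unfolding bij_betw_def
  proof
    show "inj_on (to_matrices_of_corner M) (carrier M)"
    proof (rule inj_onI)
      fix m n assume mn: "m \<in> carrier M" "n \<in> carrier M"
        and "to_matrices_of_corner M m = to_matrices_of_corner M n"
      then have "?col m = ?col n"
        by (intro inj_onD[OF inj]) (auto simp: to_matrices_of_corner_def col_mem)
      then show "m = n"
        using inv_col[OF mn(1)] inv_col[OF mn(2)] by metis
    qed
    show "to_matrices_of_corner M ` carrier M = carrier (matrices ?N)"
    proof
      show "to_matrices_of_corner M ` carrier M \<subseteq> carrier (matrices ?N)"
        using col_mem by (auto simp: to_matrices_of_corner_def S)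
      show "carrier (matrices ?N) \<subseteq> to_matrices_of_corner M ` carrier M"
      proof
        fix y assume "y \<in> carrier (matrices ?N)"
        then obtain v where v: "v \<in> carrier (columns ?N)" "y = encode ?N v"
          by (auto simp: S)
        then have v': "v \<in> I \<rightarrow>\<^sub>E carrier ?N" "matrix_act ?N \<one>\<^bsub>A\<^esub> v = v"
          by (auto simp: columns_simps)
        let ?m = "\<Oplus>\<^bsub>M\<^esub>j\<in>I. d j \<odot>\<^bsub>M\<^esub> v j"
        have m: "?m \<in> carrier M"
          using N.NI_mem[OF v'(1)] by (intro M.M.finsum_closed) (auto simp: corner_simps)
        have "?col ?m = v"
          using v' m act[of _ "\<one>\<^bsub>A\<^esub>" v] by (intro PiE_ext[OF col v'(1)]) auto
        then show "y \<in> to_matrices_of_corner M ` carrier M"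
          using v m by (intro image_eqI[of _ _ ?m]) (auto simp: to_matrices_of_corner_def)
      qed
    qed
  qed
qed

theorem morita_equivalent_corner: "morita_equivalent TYPE('m) B A"
proof -
  let ?\<psi> = "\<lambda>(M :: ('a, 'm) module) (N :: ('a, 'm) module) f. restrict f (carrier (corner M))"
  have "natural_iso_id B (\<lambda>N. corner (matrices N))
      (\<lambda>N N' f. ?\<psi> (matrices N) (matrices N') (matrices_map N N' f)) (to_corner_of_matrices :: ('b, 'm) module \<Rightarrow> _)"
    unfolding natural_iso_id_def
  proof (intro conjI allI impI to_corner_of_matrices)
    fix N N' :: "('b, 'm) module" and f
    assume N: "left_module B N" and N': "left_module B N'" and f: "f \<in> module_hom B N N'"
    interpret N: full_corner_module B A \<theta> e I c d N by (rule full_corner_moduleI[OF N])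
    show "compose (carrier N) (restrict (matrices_map N N' f) (carrier (corner (matrices N)))) (to_corner_of_matrices N)
        = compose (carrier N) (to_corner_of_matrices N') f"
    proof (rule extensionalityI[of _ "carrier N"])
      fix n assume n: "n \<in> carrier N"
      let ?col = "\<lambda>i\<in>I. \<kappa> (c i) \<odot>\<^bsub>N\<^esub> n"
      have fn: "f n \<in> carrier N'"
        using f n by (auto simp: module_hom_def)
      have mem: "encode N ?col \<in> carrier (corner (matrices N))"
        using to_corner_of_matrices(1)[OF N] n by (auto simp: module_hom_def to_corner_of_matrices_def)
      then have "encode N ?col \<in> encode N ` carrier (columns N)"
        by (simp add: corner_simps(1) matrices_simps(1)[OF N])
      moreover have "inj_on (encode N) (I \<rightarrow>\<^sub>E carrier N)"
        unfolding encode_def by (rule someI_ex[OF N.ex_encoding])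
      moreover have "?col \<in> I \<rightarrow>\<^sub>E carrier N"
        using n by auto
      ultimately have "?col \<in> carrier (columns N)"
        by (auto simp: columns_simps dest!: inj_onD)
      then have "matrices_map N N' f (encode N ?col) = encode N' (\<lambda>i\<in>I. f (?col i))"
        by (rule matrices_simps(4)[OF N])
      also have "(\<lambda>i\<in>I. f (?col i)) = (\<lambda>i\<in>I. \<kappa> (c i) \<odot>\<^bsub>N'\<^esub> f n)"
        using f n by (auto simp: module_hom_def)
      finally show "compose (carrier N) (restrict (matrices_map N N' f) (carrier (corner (matrices N)))) (to_corner_of_matrices N) n
        = compose (carrier N) (to_corner_of_matrices N') f n"
        using n mem fn by (simp only: compose_eq to_corner_of_matrices_def restrict_apply')
    qed (simp_all add: compose_def)
  qed
  moreover have "natural_iso_id A (\<lambda>M. matrices (corner M))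
      (\<lambda>M M' f. matrices_map (corner M) (corner M') (?\<psi> M M' f)) (to_matrices_of_corner :: ('a, 'm) module \<Rightarrow> _)"
    unfolding natural_iso_id_def
  proof (intro conjI allI impI to_matrices_of_corner)
    fix M M' :: "('a, 'm) module" and f
    assume M: "left_module A M" and M': "left_module A M'" and f: "f \<in> module_hom A M M'"
    interpret M: module_over A M using M by (simp add: module_over_iff)
    have N: "left_module B (corner M)" by (rule corner_left_module[OF M])
    interpret N: full_corner_module B A \<theta> e I c d "corner M" by (rule full_corner_moduleI[OF N])
    show "compose (carrier M) (matrices_map (corner M) (corner M') (restrict f (carrier (corner M)))) (to_matrices_of_corner M)
        = compose (carrier M) (to_matrices_of_corner M') f"
    proof (rule extensionalityI[of _ "carrier M"])
      fix m assume m: "m \<in> carrier M"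
      let ?col = "\<lambda>i\<in>I. c i \<odot>\<^bsub>M\<^esub> m"
      have fm: "f m \<in> carrier M'"
        using f m by (auto simp: module_hom_def)
      have "encode (corner M) ?col \<in> encode (corner M) ` carrier (columns (corner M))"
        using to_matrices_of_corner(1)[OF M] m
        by (auto simp: module_hom_def to_matrices_of_corner_def matrices_simps(1)[OF N])
      moreover have "inj_on (encode (corner M)) (I \<rightarrow>\<^sub>E carrier (corner M))"
        unfolding encode_def by (rule someI_ex[OF N.ex_encoding])
      moreover have col: "?col \<in> I \<rightarrow>\<^sub>E carrier (corner M)"
        using m by (auto simp: corner_simps M.act_act e_c)
      ultimately have "?col \<in> carrier (columns (corner M))"
        by (auto simp: columns_simps dest!: inj_onD)
      then have "matrices_map (corner M) (corner M') (restrict f (carrier (corner M))) (encode (corner M) ?col) =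
          encode (corner M') (\<lambda>i\<in>I. restrict f (carrier (corner M)) (?col i))"
        by (rule matrices_simps(4)[OF N])
      also have "(\<lambda>i\<in>I. restrict f (carrier (corner M)) (?col i)) = (\<lambda>i\<in>I. c i \<odot>\<^bsub>M'\<^esub> f m)"
        using f m N.NI_mem[OF col] by (auto simp: module_hom_def)
      finally show "compose (carrier M) (matrices_map (corner M) (corner M') (restrict f (carrier (corner M)))) (to_matrices_of_corner M) m
        = compose (carrier M) (to_matrices_of_corner M') f m"
        using m fm by (simp only: compose_eq to_matrices_of_corner_def restrict_apply')
    qed (simp_all add: compose_def)
  qed
  ultimately show ?thesis
    unfolding morita_equivalent_def complex_algebra_iff_complex_ring
    using matrices_functor corner_functor \<theta>.A.complex_ring_axioms \<theta>.B.complex_ring_axioms by blast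
qed

end


section \<open>Triples and their rotations\<close>

text \<open>
  The rotation \<open>rot j\<close> is the \<open>j\<close>-th power of \<open>\<omega>\<close>; integer exponents modulo 3 make the group
  structure visible.
\<close>

fun rot :: "int \<Rightarrow> triple \<Rightarrow> triple" where
  "rot j (x0, x1, x2) =
    (if j mod 3 = 0 then (x0, x1, x2) else if j mod 3 = 1 then (x1, x2, x0) else (x2, x0, x1))"

lemma mod3_cases: obtains "(i :: int) mod 3 = 0" | "i mod 3 = 1" | "i mod 3 = 2"
proof -
  have "i mod 3 = 0 \<or> i mod 3 = 1 \<or> i mod 3 = 2" by presburger
  then show ?thesis by (elim disjE) (erule that)+
qed

lemma mod3_mem: "(i :: int) mod 3 \<in> {0, 1, 2}"
  by (cases i rule: mod3_cases) simp_all

lemma rot_cong: "i mod 3 = j mod 3 \<Longrightarrow> rot i x = rot j x"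
  by (cases x) (simp only: rot.simps)

lemma rot_mod [simp]: "rot (j mod 3) x = rot j x"
  by (rule rot_cong) simp

lemma rot_rot [simp]: "rot i (rot j x) = rot (i + j) x"
proof -
  have "\<forall>i\<in>{0, 1, 2}. \<forall>j\<in>{0, 1, 2}. rot i (rot j x) = rot (i + j) x"
    by (cases x) simp
  then have "rot (i mod 3) (rot (j mod 3) x) = rot (i mod 3 + j mod 3) x"
    using mod3_mem by blast
  moreover have "rot (i mod 3 + j mod 3) x = rot (i + j) x"
    by (rule rot_cong) (rule mod_add_eq)
  ultimately show ?thesis by (simp only: rot_mod)
qed

lemma rot_zero [simp]: "rot 0 x = x"
  by (cases x) simp

lemma rot_eq_iff [simp]: "rot i x = rot i y \<longleftrightarrow> x = y"
proof
  assume "rot i x = rot i y"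
  then have "rot (- i) (rot i x) = rot (- i) (rot i y)" by simp
  then show "x = y" by simp
qed simp

lemma omega_eq_rot: "omega x = rot 1 x"
  by (cases x) simp

lemma omega_power_eq_rot: "0 \<le> j \<Longrightarrow> (omega ^^ nat j) x = rot j x"
proof (induction j rule: int_ge_induct)
  case (step j)
  then have "nat (j + 1) = Suc (nat j)" by simp
  then show ?case
    using step by (simp add: omega_eq_rot add.commute)
qed simp

lemma shift_mod [simp]: "shift (i mod 3) = shift i"
  by (simp add: shift_def)

lemma shift_cong: "i mod 3 = j mod 3 \<Longrightarrow> shift i = shift j"
  by (simp only: shift_def)

lemma rot_add_triple: "rot j (x + y) = rot j x + rot j y"
  by (cases x; cases y) simp

lemma rot_diff_triple: "rot j (x - y) = rot j x - rot j y"
  by (cases x; cases y) simp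

lemma rot_shift: "rot j (shift i) = shift (i - j)"
proof -
  have "\<forall>i\<in>{0, 1, 2}. \<forall>j\<in>{0, 1, 2}. rot j (shift i) = shift (i - j)"
    by (simp add: shift_def)
  then have "rot (j mod 3) (shift (i mod 3)) = shift (i mod 3 - j mod 3)"
    using mod3_mem by blast
  moreover have "shift (i mod 3 - j mod 3) = shift (i - j)"
    by (rule shift_cong) (rule mod_diff_eq)
  ultimately show ?thesis by (simp only: rot_mod shift_mod)
qed

lemma rot_add_shift: "rot j (x + shift i) = rot j x + shift (i - j)"
  by (simp add: rot_add_triple rot_shift)

text \<open>
  Hence the 3-cycles of the triangle take each of the three directions once.
\<close>

lemma shift_sum_zero_iff:
  "shift i + shift j + shift k = 0 \<longleftrightarrow>
    (j - i) mod 3 = 1 \<and> (k - i) mod 3 = 2 \<or> (j - i) mod 3 = 2 \<and> (k - i) mod 3 = 1"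
proof -
  have "\<forall>i\<in>{0, 1, 2}. \<forall>j\<in>{0, 1, 2}. \<forall>k\<in>{0, 1, 2}. shift i + shift j + shift k = 0 \<longleftrightarrow>
      (j - i) mod 3 = 1 \<and> (k - i) mod 3 = 2 \<or> (j - i) mod 3 = 2 \<and> (k - i) mod 3 = 1"
    by (simp add: shift_def zero_prod_def)
  from this[THEN bspec, OF mod3_mem[of i], THEN bspec, OF mod3_mem[of j], THEN bspec, OF mod3_mem[of k]]
  show ?thesis
    by (simp only: shift_mod mod_diff_eq)
qed

lemma shift_nonzero: "shift i \<noteq> 0"
  by (simp add: shift_def zero_prod_def)

lemma shift_eq_iff: "shift i = shift j \<longleftrightarrow> i mod 3 = j mod 3"
proof -
  have "\<forall>i\<in>{0, 1, 2}. \<forall>j\<in>{0, 1, 2}. shift i = shift j \<longleftrightarrow> i = j"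
    by (simp add: shift_def)
  from this[THEN bspec, OF mod3_mem[of i], THEN bspec, OF mod3_mem[of j]] show ?thesis
    by (simp only: shift_mod)
qed

lemma index_sign_cong:
  assumes "i mod 3 = i' mod 3" "j mod 3 = j' mod 3" "k mod 3 = k' mod 3"
  shows "index_sign (i, j, k) = index_sign (i', j', k')"
  by (simp only: index_sign.simps assms)

lemma index_sign_mod: "index_sign (i mod 3, j mod 3, k mod 3) = index_sign (i, j, k)"
  by (rule index_sign_cong) simp_all

lemma index_sign_eq: "index_sign (i, j, k) =
  (if (j - i) mod 3 = 1 \<and> (k - i) mod 3 = 2 then 1
   else if (j - i) mod 3 = 2 \<and> (k - i) mod 3 = 1 then - 1 else 0)"
proof -
  have "\<forall>i\<in>{0, 1, 2}. \<forall>j\<in>{0, 1, 2}. \<forall>k\<in>{0, 1, 2}. index_sign (i, j, k) =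
      (if (j - i) mod 3 = 1 \<and> (k - i) mod 3 = 2 then 1
       else if (j - i) mod 3 = 2 \<and> (k - i) mod 3 = 1 then - 1 else 0)"
    by (simp add: sim3_def)
  from this[THEN bspec, OF mod3_mem[of i], THEN bspec, OF mod3_mem[of j], THEN bspec, OF mod3_mem[of k]]
  show ?thesis
    by (simp only: index_sign_mod mod_diff_eq)
qed

lemma index_sign_translate: "index_sign (i + l, j + l, k + l) = index_sign (i, j, k)"
  by (simp only: index_sign_eq add_diff_cancel_right)

lemma index_sign_rotate: "index_sign (j, k, i) = index_sign (i, j, k)"
proof -
  have "\<forall>i\<in>{0, 1, 2}. \<forall>j\<in>{0, 1, 2}. \<forall>k\<in>{0, 1, 2}. index_sign (j, k, i) = index_sign (i, j, k)"
    by (simp add: sim3_def)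
  from this[THEN bspec, OF mod3_mem[of i], THEN bspec, OF mod3_mem[of j], THEN bspec, OF mod3_mem[of k]]
  show ?thesis
    by (simp only: index_sign_mod)
qed

lemma simplex_rot [simp]: "rot j x \<in> simplex_points s \<longleftrightarrow> x \<in> simplex_points s"
  by (cases x) (auto simp: simplex_points_def)

lemma finite_simplex_points: "finite (simplex_points s)"
  by (rule finite_subset[of _ "{0..int s} \<times> {0..int s} \<times> {0..int s}"])
    (auto simp: simplex_points_def)


section \<open>A fundamental domain for the rotations\<close>

definition third_root :: "int \<Rightarrow> complex" where
  "third_root j = cis (2 * pi / 3 * of_int j)"

lemma third_root_add: "third_root (i + j) = third_root i * third_root j"
  by (simp add: third_root_def cis_mult distrib_left)

lemma third_root_zero [simp]: "third_root 0 = 1"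
  by (simp add: third_root_def)

lemma third_root_three_mult: "third_root (3 * j) = 1"
proof -
  have "third_root (3 * j) = cis (2 * pi * of_int j)"
    unfolding third_root_def by (rule arg_cong[of _ _ cis]) simp
  then show ?thesis
    using cis_multiple_2pi[OF Ints_of_int, of j] by (simp only:)
qed

lemma third_root_cong:
  assumes "i mod 3 = j mod 3"
  shows "third_root i = third_root j"
proof -
  have "i = j + 3 * (i div 3 - j div 3)"
    using assms div_mult_mod_eq[of i 3] div_mult_mod_eq[of j 3] unfolding right_diff_distrib by linarith
  then have "third_root i = third_root (j + 3 * (i div 3 - j div 3))"
    by (rule arg_cong)
  then show ?thesis
    by (simp only: third_root_add third_root_three_mult mult_1_right)
qed

lemma third_root_power: "0 \<le> k \<Longrightarrow> cis (2 * pi / 3) ^ nat k = third_root k"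
  unfolding third_root_def DeMoivre by (simp add: mult.commute)

lemma third_root_sum: "1 + third_root 1 + third_root 2 = 0"
proof -
  have "third_root 1 ^ 3 = 1"
    using third_root_three_mult[of 1] third_root_add[of 1 2] third_root_add[of 1 1]
    by (simp add: power3_eq_cube mult.assoc)
  moreover have "third_root 1 \<noteq> 1"
  proof
    assume "third_root 1 = 1"
    then have "cos (2 * pi / 3) = 1"
      by (simp add: third_root_def complex_eq_iff)
    then show False
      by (simp add: cos_120)
  qed
  moreover have "third_root 2 = third_root 1 ^ 2"
    using third_root_add[of 1 1] by (simp add: power2_eq_square)
  moreover have "(third_root 1 - 1) * (1 + third_root 1 + third_root 1 ^ 2) = third_root 1 ^ 3 - 1"
    by (simp add: algebra_simps power2_eq_square power3_eq_cube)
  ultimately show ?thesis by simp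
qed

text \<open>
  Orthogonality of the characters of the cyclic group of order three; the projections to the
  eigenspaces of the rotation are built from it.
\<close>

lemma third_root_orthogonality:
  "1 + third_root m + third_root (2 * m) = (if m mod 3 = 0 then 3 else 0)"
proof (cases m rule: mod3_cases)
  case 1
  then have "third_root m = third_root 0"
    by (intro third_root_cong) simp
  moreover have "third_root (2 * m) = 1"
    using third_root_add[of m m] calculation by simp
  ultimately show ?thesis using 1 by simp
next
  case 2
  then have "third_root m = third_root 1"
    by (intro third_root_cong) simp
  moreover have "third_root (2 * m) = third_root 2"
    using third_root_add[of m m] third_root_add[of 1 1] third_root_cong[of 4 1] calculation by simp
  ultimately show ?thesis using 2 third_root_sum by simp
next
  case 3
  then have "third_root m = third_root 2"
    by (intro third_root_cong) simp
  moreover have "third_root (2 * m) = third_root 1"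
    using third_root_add[of m m] third_root_add[of 2 2] third_root_cong[of 4 1] calculation by simp
  ultimately show ?thesis using 3 third_root_sum by (simp add: ac_simps)
qed

locale triangle =
  fixes s :: nat
  assumes s_ge_2: "s \<ge> 2"
begin

abbreviation "N \<equiv> simplex_points s"
abbreviation "ctr \<equiv> centre_point s"
abbreviation "Q0 \<equiv> fundamental_points s"

lemma rot_ctr [simp]: "rot j ctr = ctr"
  by (simp add: centre_point_def Let_def)

lemma ctr_mem_iff: "ctr \<in> N \<longleftrightarrow> s mod 3 = 1"
proof -
  have "3 * ((int s - 1) div 3) = int s - 1 \<longleftrightarrow> s mod 3 = 1" by presburger
  then show ?thesis
    using s_ge_2 by (auto simp: simplex_points_def centre_point_def Let_def)
qed

text \<open>
  The three rotations of a triple are distinct unless its entries are equal, so that away from the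
  centre the lexicographically largest one is strictly largest.
\<close>

lemma lex_maximal_rotation:
  assumes "x \<in> N" "x \<noteq> ctr"
  shows "\<exists>j. j \<in> {0, 1, 2} \<and> rot (- j) x \<in> Q0"
proof -
  obtain a b c where x: "x = (a, b, c)" by (cases x)
  have ne: "\<not> (a = b \<and> b = c)"
    using assms by (auto simp: x simplex_points_def centre_point_def Let_def)
  let ?max = "\<lambda>a b c. lex_greater (a, b, c) (b, c, a) \<and> lex_greater (a, b, c) (c, a, b)"
  have Q0: "(p, q, r) \<in> Q0" if "?max p q r" "(p, q, r) \<in> N" for p q r
    using that by (simp only: fundamental_points_def mem_Collect_eq omega.simps simp_thms)
  have "?max a b c \<or> ?max b c a \<or> ?max c a b"
    unfolding lex_greater.simps using ne by (smt (verit))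
  moreover have "rot (- 0) x = (a, b, c)" "rot (- 1) x = (c, a, b)" "rot (- 2) x = (b, c, a)"
    by (simp_all add: x)
  moreover from this have "(c, a, b) \<in> N" "(b, c, a) \<in> N" "(a, b, c) \<in> N"
    using assms(1) simplex_rot by metis+
  ultimately show ?thesis
    using Q0 by (metis insertCI)
qed

lemma fundamental_rot_eq:
  assumes "x \<in> Q0" "rot j x \<in> Q0"
  shows "j mod 3 = 0"
proof -
  obtain a b c where x: "x = (a, b, c)" by (cases x)
  have lex: "lex_greater y (rot 1 y) \<and> lex_greater y (rot 2 y)" if "y \<in> Q0" for y
    using that by (simp add: fundamental_points_def omega_eq_rot del: rot.simps lex_greater.simps)
  have asym: "\<not> (lex_greater y z \<and> lex_greater z y)" for y z
    by (cases y; cases z) (auto simp: )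
  show ?thesis
  proof (cases j rule: mod3_cases)
    case 2
    then have "rot j x = rot 1 x" by (intro rot_cong) simp
    then show ?thesis
      using lex[OF assms(1)] lex[OF assms(2)] asym[of x "rot 1 x"] rot_cong[of 3 0 x] by simp
  next
    case 3
    then have "rot j x = rot 2 x" by (intro rot_cong) simp
    then show ?thesis
      using lex[OF assms(1)] lex[OF assms(2)] asym[of x "rot 2 x"] rot_cong[of 3 0 x] by simp
  qed simp
qed

lemma fundamental_mem: "x \<in> Q0 \<Longrightarrow> x \<in> N \<and> x \<noteq> ctr"
  by (auto simp: fundamental_points_def centre_point_def Let_def)

text \<open>
  A point \<open>x\<close> other than the centre is \<open>rot (turn x) (rep x)\<close> for exactly one \<open>rep x\<close> in the
  fundamental domain and exactly one \<open>turn x\<close> modulo 3.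
\<close>

definition turn :: "triple \<Rightarrow> int" where
  "turn x = (SOME j. j \<in> {0, 1, 2} \<and> rot (- j) x \<in> Q0)"

definition rep :: "triple \<Rightarrow> triple" where
  "rep x = rot (- turn x) x"

lemma
  assumes "x \<in> N" "x \<noteq> ctr"
  shows turn_mem: "turn x \<in> {0, 1, 2}" and rep_mem: "rep x \<in> Q0"
proof -
  have "turn x \<in> {0, 1, 2} \<and> rot (- turn x) x \<in> Q0"
    unfolding turn_def by (rule someI_ex[OF lex_maximal_rotation[OF assms]])
  then show "turn x \<in> {0, 1, 2}" "rep x \<in> Q0"
    by (simp_all only: rep_def)
qed

lemma rot_turn_rep [simp]: "rot (turn x) (rep x) = x"
  by (simp add: rep_def)

lemma turn_eqI:
  assumes "rot (- j) x \<in> Q0"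
  shows "turn x = j mod 3" "rep x = rot (- j) x"
proof -
  note mem = fundamental_mem[OF assms]
  have x: "x \<in> N" "x \<noteq> ctr"
    using mem simplex_rot[of "- j" x] rot_ctr[of "- j"] by metis+
  have "rot (j - turn x) (rot (- j) x) = rep x"
    unfolding rep_def rot_rot by (rule arg_cong[of _ _ "\<lambda>k. rot k x"]) simp
  then have "(j - turn x) mod 3 = 0"
    using fundamental_rot_eq[OF assms, of "j - turn x"] rep_mem[OF x] by simp
  then have "j mod 3 = turn x mod 3"
    by (simp only: mod_eq_dvd_iff dvd_eq_mod_eq_0)
  moreover have "turn x mod 3 = turn x"
    using turn_mem[OF x] by (elim insertE emptyE) simp_all
  ultimately show turn: "turn x = j mod 3" by (simp only:)
  show "rep x = rot (- j) x"
    unfolding rep_def turn by (rule rot_cong) (rule mod_minus_eq)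
qed

lemma turn_fundamental [simp]: "x \<in> Q0 \<Longrightarrow> turn x = 0" "x \<in> Q0 \<Longrightarrow> rep x = x"
  using turn_eqI[of 0 x] by simp_all

lemma
  assumes "x \<in> N" "x \<noteq> ctr"
  shows turn_rot: "turn (rot j x) = (turn x + j) mod 3" and rep_rot: "rep (rot j x) = rep x"
proof -
  have eq: "rot (- (turn x + j)) (rot j x) = rep x"
    unfolding rep_def rot_rot by (rule arg_cong[of _ _ "\<lambda>k. rot k x"]) simp
  then have "rot (- (turn x + j)) (rot j x) \<in> Q0"
    using rep_mem[OF assms] by (simp only:)
  from turn_eqI[OF this] eq
  show "turn (rot j x) = (turn x + j) mod 3" "rep (rot j x) = rep x"
    by (simp_all only:)
qed

text \<open>
  The starting points of the three steps into the centre form one orbit of the rotation, and so do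
  the end points of the three steps out of it.  These are the representatives of the two orbits.
\<close>

abbreviation "before_ctr \<equiv> ctr - shift 0"
abbreviation "after_ctr \<equiv> ctr + shift 2"

lemma ctr_coordinates:
  assumes "s mod 3 = 1"
  obtains t where "ctr = (t, t, t)" "t \<ge> 1" "int s = 3 * t + 1"
proof
  have "s = s div 3 * 3 + 1"
    using div_mult_mod_eq[of s 3] assms by simp
  then have s: "int s = 3 * int (s div 3) + 1" by linarith
  then show "ctr = (int (s div 3), int (s div 3), int (s div 3))"
    by (simp add: centre_point_def Let_def)
  show "int (s div 3) \<ge> 1" using s s_ge_2 by linarith
  show "int s = 3 * int (s div 3) + 1" by (rule s)
qed

lemma
  assumes "s mod 3 = 1"
  shows before_ctr_mem: "before_ctr \<in> Q0" and after_ctr_mem: "after_ctr \<in> Q0"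
proof -
  obtain t where "ctr = (t, t, t)" "t \<ge> 1" "int s = 3 * t + 1"
    using ctr_coordinates[OF assms] .
  then show "before_ctr \<in> Q0" "after_ctr \<in> Q0"
    by (simp_all add: fundamental_points_def simplex_points_def shift_def)
qed

lemma
  assumes "s mod 3 = 1"
  shows turn_before: "turn (ctr - shift i) = (- i) mod 3" and rep_before: "rep (ctr - shift i) = before_ctr"
    and turn_after: "turn (ctr + shift i) = (2 - i) mod 3" and rep_after: "rep (ctr + shift i) = after_ctr"
proof -
  have "rot i (ctr - shift i) = before_ctr" "rot (i - 2) (ctr + shift i) = after_ctr"
    by (simp_all add: rot_diff_triple rot_shift rot_add_triple)
  then have "rot (- (- i)) (ctr - shift i) = before_ctr" "rot (- (2 - i)) (ctr + shift i) = after_ctr"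
    by simp_all
  then show "turn (ctr - shift i) = (- i) mod 3" "rep (ctr - shift i) = before_ctr"
    "turn (ctr + shift i) = (2 - i) mod 3" "rep (ctr + shift i) = after_ctr"
    using turn_eqI[of "- i" "ctr - shift i"] turn_eqI[of "2 - i" "ctr + shift i"]
      before_ctr_mem[OF assms] after_ctr_mem[OF assms] by (simp_all only:)
qed

lemma
  assumes "s mod 3 = 1"
  shows before_mem: "ctr - shift i \<in> N" "ctr - shift i \<noteq> ctr"
    and after_mem: "ctr + shift i \<in> N" "ctr + shift i \<noteq> ctr"
proof -
  have "rot i (ctr - shift i) = before_ctr" "rot (i - 2) (ctr + shift i) = after_ctr"
    by (simp_all add: rot_diff_triple rot_shift rot_add_triple)
  then show "ctr - shift i \<in> N" "ctr + shift i \<in> N"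
    using fundamental_mem[OF before_ctr_mem[OF assms]] fundamental_mem[OF after_ctr_mem[OF assms]]
      simplex_rot[of i "ctr - shift i"] simplex_rot[of "i - 2" "ctr + shift i"] by simp_all
  show "ctr - shift i \<noteq> ctr" "ctr + shift i \<noteq> ctr"
    using shift_nonzero[of i] by simp_all
qed

end


section \<open>Equivariant representations of the triangle\<close>

lemma mod3_shiftD: "((j :: int) - m) mod 3 = d \<Longrightarrow> j mod 3 = (m + d) mod 3"
  using mod_add_right_eq[of m "j - m" 3] by simp

context group_action_on_algebra
begin

lemma tensor_add:
  "a \<in> carrier A \<Longrightarrow> b \<in> carrier A \<Longrightarrow> tensor (a \<oplus> b) g = tensor a g \<oplus>\<^bsub>S\<^esub> tensor b g"
  by (auto simp: tensor_def S_simps(5) fun_eq_iff)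

lemma tensor_scale: "a \<in> carrier A \<Longrightarrow> tensor (c \<odot> a) g = c \<odot>\<^bsub>S\<^esub> tensor a g"
  by (auto simp: tensor_def S_simps(6) fun_eq_iff)

end

context triangle
begin

abbreviation "QA \<equiv> quiver_A s"

lemma quiver_A_simps:
  "verts QA = N" "(x, i) \<in> arcs QA \<longleftrightarrow> x \<in> N \<and> i \<in> {0, 1, 2} \<and> x + shift i \<in> N"
  "tail QA (x, i) = x" "head QA (x, i) = x + shift i"
  by (auto simp: quiver_A_def)

lemma arc_A_mod: "(x, i mod 3) \<in> arcs QA \<longleftrightarrow> x \<in> N \<and> x + shift i \<in> N"
  using mod3_mem[of i] by (simp only: quiver_A_simps shift_mod simp_thms)

sublocale A: three_cycle_qp QA weight_A
proof
  show "finite (verts QA)"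
    by (simp add: quiver_A_simps finite_simplex_points)
  show "finite (arcs QA)"
    by (rule finite_subset[of _ "N \<times> {0, 1, 2}"])
      (auto simp: quiver_A_simps finite_simplex_points)
  fix a assume "a \<in> arcs QA"
  then show "tail QA a \<in> verts QA" "head QA a \<in> verts QA"
    by (cases a; simp add: quiver_A_simps)+
next
  fix a b c assume "[a, b, c] \<in> cycles QA"
  show "weight_A [b, c, a] = weight_A [a, b, c]"
    by (cases a; cases b; cases c)
      (simp only: weight_A.simps index_sign_rotate)
qed

text \<open>
  The derivative of the potential with respect to an arrow \<open>x \<rightarrow> y\<close> is the difference of
  the two paths of length two from \<open>y\<close> to \<open>x\<close>; a path that leaves the triangle counts as zero.
\<close>

lemma relation_A:
  fixes E :: "(complex, 'a) module" and ev ar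
  assumes "quiver_rep QA E ev ar" "(x, m) \<in> arcs QA"
  defines "y \<equiv> x + shift m"
    and "arA \<equiv> \<lambda>z i. if z \<in> N \<and> z + shift i \<in> N then ar (z, i mod 3) else \<zero>\<^bsub>E\<^esub>"
  shows "(\<Oplus>\<^bsub>E\<^esub>p\<in>A.completions (x, m). A.deriv_weight (x, m) (fst p) (snd p) \<odot>\<^bsub>E\<^esub>
      (ar (fst p) \<otimes>\<^bsub>E\<^esub> ar (snd p))) =
    arA y (m + 1) \<otimes>\<^bsub>E\<^esub> arA (y + shift (m + 1)) (m + 2) \<ominus>\<^bsub>E\<^esub>
    arA y (m + 2) \<otimes>\<^bsub>E\<^esub> arA (y + shift (m + 2)) (m + 1)"
proof -
  interpret quiver_rep QA E ev ar by fact
  have x: "x \<in> N" and y: "y \<in> N" and m: "m \<in> {0, 1, 2}"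
    using assms(2) by (simp_all add: quiver_A_simps y_def)
  let ?p = "\<lambda>j k. ((y, j mod 3), (y + shift j, k mod 3))"
  let ?S = "\<lambda>j k. if y + shift j \<in> N then {?p j k} else {}"
  let ?f = "\<lambda>p. A.deriv_weight (x, m) (fst p) (snd p) \<odot>\<^bsub>E\<^esub> (ar (fst p) \<otimes>\<^bsub>E\<^esub> ar (snd p))"
  have ret: "y + shift (m + 1) + shift (m + 2) = x" "y + shift (m + 2) + shift (m + 1) = x"
    using shift_sum_zero_iff[of m "m + 1" "m + 2"] by (simp_all add: y_def add.assoc ac_simps)
  have cyc_mem: "[(x, m), (y, j mod 3), (y + shift j, k mod 3)] \<in> cycles QA"
    if "y + shift j \<in> N" "y + shift j + shift k = x" for j k
    using that assms(2) x y arc_A_mod[of y j] arc_A_mod[of "y + shift j" k]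
    by (simp add: A.cycles_iff quiver_A_simps(3,4) y_def[symmetric])
  have completions: "A.completions (x, m) = ?S (m + 1) (m + 2) \<union> ?S (m + 2) (m + 1)"
  proof
    show "A.completions (x, m) \<subseteq> ?S (m + 1) (m + 2) \<union> ?S (m + 2) (m + 1)"
    proof
      fix p assume p: "p \<in> A.completions (x, m)"
      obtain z j w k where p_eq: "p = ((z, j), (w, k))" by (metis prod.exhaust)
      have zw: "z = y" "w = y + shift j" "y + shift j + shift k = x" "j \<in> {0, 1, 2}" "k \<in> {0, 1, 2}" "w \<in> N"
        using p by (auto simp: p_eq A.completions_def A.cycles_iff quiver_A_simps y_def)
      have "shift m + shift j + shift k = 0"
        using zw(3) by (simp add: y_def ac_simps)
      then have "j mod 3 = (m + 1) mod 3 \<and> k mod 3 = (m + 2) mod 3 \<or>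
          j mod 3 = (m + 2) mod 3 \<and> k mod 3 = (m + 1) mod 3"
        unfolding shift_sum_zero_iff using mod3_shiftD by blast
      moreover have "j mod 3 = j" "k mod 3 = k"
        using zw(4,5) by (elim insertE emptyE; simp)+
      ultimately have jk: "j = (m + 1) mod 3 \<and> k = (m + 2) mod 3 \<or> j = (m + 2) mod 3 \<and> k = (m + 1) mod 3"
        by (simp only:)
      then show "p \<in> ?S (m + 1) (m + 2) \<union> ?S (m + 2) (m + 1)"
        using zw(1,2,6) by (elim disjE conjE) (simp_all only: p_eq shift_mod if_True Un_iff insert_iff simp_thms)
    qed
    show "?S (m + 1) (m + 2) \<union> ?S (m + 2) (m + 1) \<subseteq> A.completions (x, m)"
      using cyc_mem[OF _ ret(1)] cyc_mem[OF _ ret(2)]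
      by (simp add: A.completions_def)
  qed
  have val: "finsum E ?f (?S j k) = index_sign (m, j, k) \<odot>\<^bsub>E\<^esub> (arA y j \<otimes>\<^bsub>E\<^esub> arA (y + shift j) k)"
    if ret: "y + shift j + shift k = x" and ne: "j mod 3 \<noteq> m mod 3" for j k
  proof (cases "y + shift j \<in> N")
    case True
    note cyc = cyc_mem[OF True ret]
    have "m \<noteq> j mod 3"
      using ne m by auto
    then have weight: "A.deriv_weight (x, m) (y, j mod 3) (y + shift j, k mod 3) = index_sign (m, j, k)"
      by (simp add: A.deriv_weight_def del: index_sign.simps)
        (rule index_sign_cong; simp)
    have arcs: "(y, j mod 3) \<in> arcs QA" "(y + shift j, k mod 3) \<in> arcs QA"
      using cyc by (simp_all add: A.cycles_iff)
    have "arA y j = ar (y, j mod 3)" "arA (y + shift j) k = ar (y + shift j, k mod 3)"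
      using True y ret x by (simp_all add: arA_def)
    then show ?thesis
      using True arcs weight by (simp add: E.finsum_insert del: index_sign.simps)
  next
    case False
    then show ?thesis
      by (simp add: arA_def del: index_sign.simps)
  qed
  have disjoint: "?S (m + 1) (m + 2) \<inter> ?S (m + 2) (m + 1) = {}"
    using m by auto
  have closed: "?f \<in> A.completions (x, m) \<rightarrow> carrier E"
    by (auto simp: A.completions_def A.cycles_iff)
  have arA_closed: "arA z i \<in> carrier E" for z i
    using arc_A_mod[of z i] by (simp add: arA_def)
  have "finsum E ?f (A.completions (x, m)) =
      finsum E ?f (?S (m + 1) (m + 2)) \<oplus>\<^bsub>E\<^esub> finsum E ?f (?S (m + 2) (m + 1))"
    using closed unfolding completions by (intro E.finsum_Un_disjoint disjoint) (auto split: if_splits)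
  also have "\<dots> = 1 \<odot>\<^bsub>E\<^esub> (arA y (m + 1) \<otimes>\<^bsub>E\<^esub> arA (y + shift (m + 1)) (m + 2)) \<oplus>\<^bsub>E\<^esub>
      (- 1) \<odot>\<^bsub>E\<^esub> (arA y (m + 2) \<otimes>\<^bsub>E\<^esub> arA (y + shift (m + 2)) (m + 1))"
  proof -
    have signs: "index_sign (m, m + 1, m + 2) = 1" "index_sign (m, m + 2, m + 1) = - 1"
      by (simp_all add: index_sign_eq del: index_sign.simps)
    have "(m + 1) mod 3 \<noteq> m mod 3" "(m + 2) mod 3 \<noteq> m mod 3"
      using m by auto
    then show ?thesis
      using val[OF ret(1)] val[OF ret(2)] unfolding signs by (simp only: simp_thms)
  qed
  finally show ?thesis
    using arA_closed by (simp add: E.scale_minus_one E.minus_eq)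
qed

end

text \<open>
  A representation of the triangle in an algebra together with units that implement the rotation.
  All parameters are total: a point or an arrow outside the triangle is represented by zero, and
  indices only matter modulo 3.  In this form the Jacobian relations say that steps in different
  directions commute.
\<close>

locale equivariant_rep = triangle s + complex_ring E
  for s and E :: "(complex, 'e) module" (structure) +
  fixes ev :: "triple \<Rightarrow> 'e" and ar :: "triple \<Rightarrow> int \<Rightarrow> 'e" and U :: "int \<Rightarrow> 'e"
  assumes ev_closed [simp]: "ev x \<in> carrier E"
    and ar_closed [simp]: "ar x i \<in> carrier E"
    and U_closed [simp]: "U j \<in> carrier E"
    and ev_outside: "x \<notin> N \<Longrightarrow> ev x = \<zero>"
    and ev_ev: "ev x \<otimes> ev y = (if x = y then ev x else \<zero>)"
    and ev_ar: "ev x \<otimes> ar x i = ar x i"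
    and ar_ev: "ar x i \<otimes> ev (x + shift i) = ar x i"
    and ar_mod: "ar x (i mod 3) = ar x i"
    and U_zero: "U 0 = \<one>"
    and U_add: "U i \<otimes> U j = U (i + j)"
    and U_mod: "U (j mod 3) = U j"
    and U_ev: "U j \<otimes> ev x = ev (rot j x) \<otimes> U j"
    and U_ar: "U j \<otimes> ar x i = ar (rot j x) (i - j) \<otimes> U j"
    and commute: "ar x i \<otimes> ar (x + shift i) j = ar x j \<otimes> ar (x + shift j) i"
begin

lemma ar_cong: "i mod 3 = j mod 3 \<Longrightarrow> ar x i = ar x j"
  using ar_mod[of x i] ar_mod[of x j] by (simp only:)

lemma U_cong: "i mod 3 = j mod 3 \<Longrightarrow> U i = U j"
  using U_mod[of i] U_mod[of j] by (simp only:)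

lemma ar_outside: "x \<notin> N \<or> x + shift i \<notin> N \<Longrightarrow> ar x i = \<zero>"
  using ev_ar[of x i] ar_ev[of x i] ev_outside[of x] ev_outside[of "x + shift i"] by auto

lemma quiver_rep_A: "quiver_rep QA E ev (\<lambda>(x, i). ar x i)"
  by unfold_locales (auto simp: quiver_A_simps ev_ev ev_ar ar_ev split: prod.splits)

lemma qp_rep_A: "qp_rep QA weight_A E ev (\<lambda>(x, i). ar x i)"
proof -
  interpret quiver_rep QA E ev "\<lambda>(x, i). ar x i" by (rule quiver_rep_A)
  show ?thesis
  proof unfold_locales
    fix a assume a: "a \<in> arcs QA"
    obtain x m where xm: "a = (x, m)" by (cases a)
    have ar: "(if z \<in> N \<and> z + shift i \<in> N then (case (z, i mod 3) of (x, i) \<Rightarrow> ar x i) else \<zero>) = ar z i" for z i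
      using ar_outside[of z i] by (auto simp: ar_mod)
    show "(\<Oplus>p\<in>A.completions a. A.deriv_weight a (fst p) (snd p) \<odot>
        ((case fst p of (x, i) \<Rightarrow> ar x i) \<otimes> (case snd p of (x, i) \<Rightarrow> ar x i))) = \<zero>"
      unfolding xm relation_A[OF quiver_rep_A a[unfolded xm], unfolded ar]
      using commute[of "x + shift m" "m + 1" "m + 2"] by (simp add: r_right_minus_eq)
  qed
qed

end


text \<open>
  The skew group algebra of the triangle algebra is the universal equivariant representation.
\<close>

context triangle
begin

lemma omega_path_algebra_single:
  "omega_path_algebra (c \<odot>\<^bsub>A.CQ\<^esub> A.single p) = c \<odot>\<^bsub>A.CQ\<^esub> A.single (omega_path p)"
proof
  fix q
  have "{r. (c \<odot>\<^bsub>A.CQ\<^esub> A.single p) r \<noteq> 0 \<and> omega_path r = q} =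
      (if c \<noteq> 0 \<and> omega_path p = q then {p} else {})"
    by (auto simp: A.single_def)
  then have "omega_path_algebra (c \<odot>\<^bsub>A.CQ\<^esub> A.single p) q =
      (\<Sum>r\<in>(if c \<noteq> 0 \<and> omega_path p = q then {p} else {}). (c \<odot>\<^bsub>A.CQ\<^esub> A.single p) r)"
    unfolding omega_path_algebra_def by (simp only:)
  then show "omega_path_algebra (c \<odot>\<^bsub>A.CQ\<^esub> A.single p) q = (c \<odot>\<^bsub>A.CQ\<^esub> A.single (omega_path p)) q"
    by (auto simp: A.single_def)
qed

lemma omega_path_algebra_add:
  assumes "f \<in> carrier A.CQ" "g \<in> carrier A.CQ"
  shows "omega_path_algebra (f \<oplus>\<^bsub>A.CQ\<^esub> g) = omega_path_algebra f \<oplus>\<^bsub>A.CQ\<^esub> omega_path_algebra g"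
proof
  fix q
  let ?S = "{p. (f p \<noteq> 0 \<or> g p \<noteq> 0) \<and> omega_path p = q}"
  have "?S \<subseteq> {p. f p \<noteq> 0} \<union> {p. g p \<noteq> 0}" by auto
  then have fin: "finite ?S"
    using assms by (auto intro: finite_subset)
  have sum: "omega_path_algebra h q = (\<Sum>p\<in>?S. h p)"
    if "\<And>p. h p \<noteq> 0 \<Longrightarrow> f p \<noteq> 0 \<or> g p \<noteq> 0" for h
    unfolding omega_path_algebra_def using that fin by (intro sum.mono_neutral_left) auto
  have "omega_path_algebra (\<lambda>p. f p + g p) q = (\<Sum>p\<in>?S. f p + g p)"
    by (rule sum) auto
  then show "omega_path_algebra (f \<oplus>\<^bsub>A.CQ\<^esub> g) q = (omega_path_algebra f \<oplus>\<^bsub>A.CQ\<^esub> omega_path_algebra g) q"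
    using sum[of f] sum[of g] by (simp add: sum.distrib)
qed

abbreviation "turned_vertex x \<equiv> A.single (omega x, [])"
abbreviation "turned_arrow \<equiv> \<lambda>(x, i). A.single (omega x, [(omega x, (i - 1) mod 3)])"

lemma omega_arc: "(x, i) \<in> arcs QA \<Longrightarrow> (omega x, (i - 1) mod 3) \<in> arcs QA"
  using rot_add_shift[of 1 x i] simplex_rot[of 1 "x + shift i" s]
  unfolding arc_A_mod by (simp add: quiver_A_simps omega_eq_rot del: rot.simps)

lemma omega_head: "omega (x + shift i) = omega x + shift ((i - 1) mod 3)"
  using rot_add_shift[of 1 x i] by (simp add: omega_eq_rot del: rot.simps)

text \<open>
  The rotation of the path algebra belongs to a representation of the quiver in its own path algebra,
  given by the rotated vertices and arrows.  This makes it multiplicative.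
\<close>

lemma turned_rep: "quiver_rep QA A.CQ turned_vertex turned_arrow"
proof -
  have omega_inj: "omega x = omega y \<longleftrightarrow> x = y" for x y
    unfolding omega_eq_rot by (rule rot_eq_iff)
  show ?thesis
  proof unfold_locales
    fix x assume "x \<in> verts QA"
    then have "omega x \<in> verts QA"
      by (simp add: quiver_A_simps omega_eq_rot del: rot.simps)
    then show "turned_vertex x \<in> carrier A.CQ"
      by (intro A.single_carrier) (simp add: A.mem_paths_iff A.awalk_simps)
  next
    fix x y assume "x \<in> verts QA" "y \<in> verts QA"
    show "turned_vertex x \<otimes>\<^bsub>A.CQ\<^esub> turned_vertex y = (if x = y then turned_vertex x else \<zero>\<^bsub>A.CQ\<^esub>)"
      by (auto simp: A.single_mult omega_inj)
  next
    fix a assume a: "a \<in> arcs QA"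
    obtain x i where xi: "a = (x, i)" by (cases a)
    note arc = omega_arc[OF a[unfolded xi]]
    show "turned_arrow a \<in> carrier A.CQ"
      using arc unfolding xi prod.case
      by (intro A.single_carrier) (simp add: A.mem_paths_iff A.awalk_simps quiver_A_simps(3))
    show "turned_vertex (tail QA a) \<otimes>\<^bsub>A.CQ\<^esub> turned_arrow a = turned_arrow a"
      by (simp add: xi quiver_A_simps A.single_mult)
    show "turned_arrow a \<otimes>\<^bsub>A.CQ\<^esub> turned_vertex (head QA a) = turned_arrow a"
      by (simp add: xi quiver_A_simps A.single_mult omega_head)
  qed
qed

interpretation turned: quiver_rep QA A.CQ turned_vertex turned_arrow
  by (rule turned_rep)

lemma turned_path:
  "A.awalk x p y \<Longrightarrow> turned.path_value x p = A.single (omega_path (x, p))"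
proof (induction p arbitrary: x)
  case (Cons a p)
  obtain z i where zi: "a = (z, i)" by (cases a)
  with Cons show ?case
    by (simp add: A.awalk_simps quiver_A_simps A.single_mult omega_head)
qed simp

lemma omega_path_algebra_eq:
  assumes "f \<in> carrier A.CQ"
  shows "omega_path_algebra f = turned.eval_rep f"
  using assms
proof (induction f rule: A.CQ_induct)
  case (single c p)
  then obtain x r y where p: "p = (x, r)" "A.awalk x r y"
    by (auto simp: paths_def)
  show ?case
    unfolding omega_path_algebra_single turned.eval_rep_single[OF single]
    by (simp only: p fst_conv snd_conv turned_path[OF p(2)])
next
  case (add f g)
  then show ?case
    by (simp only: omega_path_algebra_add turned.eval_rep_add)
qed (simp add: omega_path_algebra_def)

interpretation W: complex_ring_hom A.CQ A.CQ omega_path_algebra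
proof -
  interpret T: complex_ring_hom A.CQ A.CQ turned.eval_rep
    by (rule turned.eval_rep_hom)
  show "complex_ring_hom A.CQ A.CQ omega_path_algebra"
  proof unfold_locales
    have closed: "f \<oplus>\<^bsub>A.CQ\<^esub> g \<in> carrier A.CQ" "f \<otimes>\<^bsub>A.CQ\<^esub> g \<in> carrier A.CQ" "c \<odot>\<^bsub>A.CQ\<^esub> f \<in> carrier A.CQ"
      if "f \<in> carrier A.CQ" "g \<in> carrier A.CQ" for f g c
      using that by (simp_all del: A.CQ_simps)
    then show "omega_path_algebra \<in> algebra_hom A.CQ A.CQ"
      unfolding algebra_hom_def
      by (simp add: omega_path_algebra_eq T.add T.mult T.scale Pi_def del: A.CQ_simps)
  qed
qed

lemma omega_vertex: "omega_path_algebra (A.single (x, [])) = A.single (omega x, [])"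
  using omega_path_algebra_single[of 1 "(x, [])"] by simp

lemma omega_arrow: "omega_path_algebra (A.single (x, [(x, i)])) = A.single (omega x, [(omega x, (i - 1) mod 3)])"
  using omega_path_algebra_single[of 1 "(x, [(x, i)])"] by simp

lemma omega_cubed:
  assumes "f \<in> carrier A.CQ"
  shows "omega_path_algebra (omega_path_algebra (omega_path_algebra f)) = f"
  using assms
proof (induction f rule: A.CQ_generated)
  case (vert x)
  have "omega (omega (omega x)) = x" by (cases x) simp
  then show ?case by (simp add: omega_vertex)
next
  case (arc a)
  obtain x i where a: "a = (x, i)" by (cases a)
  have "omega (omega (omega x)) = x" by (cases x) simp
  moreover have "(((i - 1) mod 3 - 1) mod 3 - 1) mod 3 = i"
    using arc by (auto simp: a quiver_A_simps)
  ultimately show ?case by (simp add: a quiver_A_simps omega_arrow)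
qed (simp_all only: W.zero W.add W.mult W.scale W.closed)

definition evA :: "triple \<Rightarrow> ((triple, a_arrow) path \<Rightarrow> complex) set" where
  "evA x = (if x \<in> N then A.vertex x else \<zero>\<^bsub>A.Jac\<^esub>)"

definition arA :: "triple \<Rightarrow> int \<Rightarrow> ((triple, a_arrow) path \<Rightarrow> complex) set" where
  "arA x i = (if x \<in> N \<and> x + shift i \<in> N then A.arrow (x, i mod 3) else \<zero>\<^bsub>A.Jac\<^esub>)"

interpretation u: qp_rep QA weight_A A.Jac A.vertex A.arrow
  by (rule A.universal_rep)

lemma evA_closed [simp]: "evA x \<in> carrier A.Jac"
  using u.ev_closed[of x] by (simp add: evA_def quiver_A_simps)

lemma arA_closed [simp]: "arA x i \<in> carrier A.Jac"
  using u.ar_closed[of "(x, i mod 3)"] unfolding arc_A_mod by (simp only: arA_def) simp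

lemma arA_cong:
  assumes "i mod 3 = j mod 3"
  shows "arA x i = arA x j"
  by (simp only: arA_def assms shift_cong[OF assms])

lemma evA_evA: "evA x \<otimes>\<^bsub>A.Jac\<^esub> evA y = (if x = y then evA x else \<zero>\<^bsub>A.Jac\<^esub>)"
  using u.ev_ev[of x y] u.ev_closed[of x] u.ev_closed[of y]
  by (cases "x \<in> N"; cases "y \<in> N") (auto simp only: evA_def quiver_A_simps(1) if_True if_False
      A.Jac.l_null A.Jac.r_null A.Jac.zero_closed split: if_split)

lemma evA_arA: "evA x \<otimes>\<^bsub>A.Jac\<^esub> arA x i = arA x i" "arA x i \<otimes>\<^bsub>A.Jac\<^esub> evA (x + shift i) = arA x i"
proof -
  show "evA x \<otimes>\<^bsub>A.Jac\<^esub> arA x i = arA x i"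
  proof (cases "x \<in> N \<and> x + shift i \<in> N")
    case True
    then show ?thesis
      using u.ev_ar[of "(x, i mod 3)"] unfolding arc_A_mod
      by (simp only: evA_def arA_def quiver_A_simps if_True simp_thms)
  next
    case False
    then show ?thesis
      by (simp only: arA_def if_False A.Jac.r_null[OF evA_closed])
  qed
  show "arA x i \<otimes>\<^bsub>A.Jac\<^esub> evA (x + shift i) = arA x i"
  proof (cases "x \<in> N \<and> x + shift i \<in> N")
    case True
    then show ?thesis
      using u.ar_ev[of "(x, i mod 3)"] unfolding arc_A_mod
      by (simp only: evA_def arA_def quiver_A_simps if_True simp_thms shift_mod)
  next
    case False
    then show ?thesis
      by (simp only: arA_def if_False A.Jac.l_null[OF evA_closed])
  qed
qed

lemma arA_commute:
  "arA y j \<otimes>\<^bsub>A.Jac\<^esub> arA (y + shift j) k = arA y k \<otimes>\<^bsub>A.Jac\<^esub> arA (y + shift k) j"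
proof -
  have step: "arA y j \<otimes>\<^bsub>A.Jac\<^esub> arA (y + shift j) k = arA y k \<otimes>\<^bsub>A.Jac\<^esub> arA (y + shift k) j"
    if jk: "(k - j) mod 3 = 1" for j k
  proof (cases "y \<in> N \<and> y + shift j + shift k \<in> N")
    case True
    define m where "m = (j + 2) mod 3"
    have j: "j mod 3 = (m + 1) mod 3"
      using mod_add_left_eq[of "j + 2" 3 1] by (simp add: m_def add.assoc)
    have "(m + 2) mod 3 = (j + 1 + 3) mod 3"
      unfolding m_def mod_add_left_eq by (rule arg_cong[of _ _ "\<lambda>k. k mod 3"]) simp
    also have "\<dots> = (j + 1) mod 3"
      by (rule mod_add_self2)
    also have "\<dots> = k mod 3"
      by (rule mod3_shiftD[OF jk, symmetric])
    finally have "k mod 3 = (m + 2) mod 3" by (rule sym)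
    with j have mod: "j mod 3 = (m + 1) mod 3" "k mod 3 = (m + 2) mod 3" .
    have sum: "shift (m + 1) + shift (m + 2) + shift m = 0"
      using shift_sum_zero_iff[of m "m + 1" "m + 2"] by (simp add: ac_simps)
    let ?x = "y + shift (m + 1) + shift (m + 2)"
    have x: "?x + shift m = y"
    proof -
      have "?x + shift m = y + (shift (m + 1) + shift (m + 2) + shift m)"
        by (simp only: add.assoc)
      then show ?thesis by (simp only: sum add_0_right)
    qed
    have "(?x, m mod 3) \<in> arcs QA"
      unfolding arc_A_mod x using True shift_cong[OF mod(1)] shift_cong[OF mod(2)] by (simp only:)
    then have arc: "(?x, m) \<in> arcs QA"
      by (simp add: m_def)
    have "arA y (m + 1) \<otimes>\<^bsub>A.Jac\<^esub> arA (y + shift (m + 1)) (m + 2) \<ominus>\<^bsub>A.Jac\<^esub>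
        arA y (m + 2) \<otimes>\<^bsub>A.Jac\<^esub> arA (y + shift (m + 2)) (m + 1) = \<zero>\<^bsub>A.Jac\<^esub>"
      using relation_A[OF u.quiver_rep_axioms arc, unfolded x] u.relation[OF arc]
      unfolding arA_def by (simp only:)
    then have "arA y (m + 1) \<otimes>\<^bsub>A.Jac\<^esub> arA (y + shift (m + 1)) (m + 2) =
        arA y (m + 2) \<otimes>\<^bsub>A.Jac\<^esub> arA (y + shift (m + 2)) (m + 1)"
      by (simp only: A.Jac.r_right_minus_eq A.Jac.m_closed arA_closed)
    then show ?thesis
      by (simp only: arA_cong[OF mod(1)] arA_cong[OF mod(2)] shift_cong[OF mod(1)] shift_cong[OF mod(2)])
  next
    case False
    have "y + shift k + shift j = y + shift j + shift k" by (simp only: ac_simps)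
    with False have "arA y j = \<zero>\<^bsub>A.Jac\<^esub> \<or> arA (y + shift j) k = \<zero>\<^bsub>A.Jac\<^esub>"
      "arA y k = \<zero>\<^bsub>A.Jac\<^esub> \<or> arA (y + shift k) j = \<zero>\<^bsub>A.Jac\<^esub>"
      unfolding arA_def by (simp_all only: if_False simp_thms split: if_split) blast+
    then show ?thesis
      by (elim disjE) (simp_all only: A.Jac.l_null A.Jac.r_null arA_closed)
  qed
  consider "j mod 3 = k mod 3" | "(k - j) mod 3 = 1" | "(j - k) mod 3 = 1"
  proof (cases "k - j" rule: mod3_cases)
    case 1
    then have "k mod 3 = j mod 3" by (simp only: mod_eq_dvd_iff dvd_eq_mod_eq_0)
    then show thesis using that(1) by simp
  next
    case 2
    then show thesis using that(2) by simp
  next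
    case 3
    then have "(j - k) mod 3 = 1"
      using mod_minus_cong[of "k - j" 3 2] by simp
    then show thesis using that(3) by simp
  qed
  then show ?thesis
  proof cases
    case 1
    then show ?thesis by (simp only: arA_cong[OF 1] shift_cong[OF 1])
  next
    case 2
    then show ?thesis by (rule step)
  next
    case 3
    then show ?thesis by (rule step[symmetric])
  qed
qed

text \<open>
  The rotation shifts all directions by the same amount, which does not change signs.  It therefore
  respects the relations and passes to the quotient.
\<close>

interpretation pr: complex_ring_hom A.CQ A.Jac A.J.proj
  by (rule A.proj_hom)

lemma turned_qp_rep:
  "qp_rep QA weight_A A.Jac (\<lambda>x. A.J.proj (turned_vertex x)) (\<lambda>a. A.J.proj (turned_arrow a))"
proof -
  let ?ev = "\<lambda>x. A.J.proj (turned_vertex x)" and ?ar = "\<lambda>a. A.J.proj (turned_arrow a)"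
  interpret r: quiver_rep QA A.Jac ?ev ?ar
  proof unfold_locales
    fix x assume "x \<in> verts QA"
    then show "?ev x \<in> carrier A.Jac" by (intro pr.closed turned.ev_closed)
  next
    fix x y assume xy: "x \<in> verts QA" "y \<in> verts QA"
    show "?ev x \<otimes>\<^bsub>A.Jac\<^esub> ?ev y = (if x = y then ?ev x else \<zero>\<^bsub>A.Jac\<^esub>)"
      unfolding pr.mult[OF turned.ev_closed[OF xy(1)] turned.ev_closed[OF xy(2)], symmetric]
        turned.ev_ev[OF xy] by (simp only: pr.zero if_distrib[of A.J.proj])
  next
    fix a assume a: "a \<in> arcs QA"
    have v: "tail QA a \<in> verts QA" "head QA a \<in> verts QA"
      using a A.tail_in_verts A.head_in_verts by blast+
    show "?ar a \<in> carrier A.Jac" by (rule pr.closed[OF turned.ar_closed[OF a]])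
    show "?ev (tail QA a) \<otimes>\<^bsub>A.Jac\<^esub> ?ar a = ?ar a"
      unfolding pr.mult[OF turned.ev_closed[OF v(1)] turned.ar_closed[OF a], symmetric] turned.ev_ar[OF a] ..
    show "?ar a \<otimes>\<^bsub>A.Jac\<^esub> ?ev (head QA a) = ?ar a"
      unfolding pr.mult[OF turned.ar_closed[OF a] turned.ev_closed[OF v(2)], symmetric] turned.ar_ev[OF a] ..
  qed
  have ar: "(if z \<in> N \<and> z + shift i \<in> N then ?ar (z, i mod 3) else \<zero>\<^bsub>A.Jac\<^esub>) = arA (rot 1 z) (i - 1)" for z i
  proof -
    have "rot 1 z + shift (i - 1) = rot 1 (z + shift i)"
      by (simp only: rot_add_shift)
    then have mem: "rot 1 z \<in> N \<and> rot 1 z + shift (i - 1) \<in> N \<longleftrightarrow> z \<in> N \<and> z + shift i \<in> N"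
      by (simp only: simplex_rot)
    have "?ar (z, i mod 3) = A.arrow (rot 1 z, (i - 1) mod 3)"
      by (simp only: prod.case omega_eq_rot mod_diff_left_eq quiver_A_simps(3))
    then show ?thesis
      by (simp only: arA_def mem)
  qed
  have rot: "rot 1 (z + shift i) = rot 1 z + shift (i - 1)" for z i
    by (rule rot_add_shift)
  show ?thesis
  proof unfold_locales
    fix a assume a: "a \<in> arcs QA"
    obtain x m where xm: "a = (x, m)" by (cases a)
    show "(\<Oplus>\<^bsub>A.Jac\<^esub>p\<in>A.completions a. A.deriv_weight a (fst p) (snd p) \<odot>\<^bsub>A.Jac\<^esub>
        (?ar (fst p) \<otimes>\<^bsub>A.Jac\<^esub> ?ar (snd p))) = \<zero>\<^bsub>A.Jac\<^esub>"
      unfolding xm relation_A[OF r.quiver_rep_axioms a[unfolded xm], unfolded ar rot]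
      using arA_commute[of "rot 1 x + shift (m - 1)" "m + 1 - 1" "m + 2 - 1"]
      by (simp only: A.Jac.r_right_minus_eq A.Jac.m_closed arA_closed)
  qed
qed

lemma omega_ideal:
  assumes "f \<in> A.J"
  shows "omega_path_algebra f \<in> A.J"
proof -
  interpret r: qp_rep QA weight_A A.Jac "\<lambda>x. A.J.proj (turned_vertex x)" "\<lambda>a. A.J.proj (turned_arrow a)"
    by (rule turned_qp_rep)
  have eq: "r.eval_rep g = A.J.proj (omega_path_algebra g)" if "g \<in> carrier A.CQ" for g
    using that
  proof (induction g rule: A.CQ_induct)
    case zero
    then show ?case
      using W.zero pr.zero by (simp add: r.eval_rep_zero)
  next
    case (single c p)
    then obtain x q y where p: "p = (x, q)" "A.awalk x q y"
      by (auto simp: paths_def)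
    have path: "r.path_value x q = A.J.proj (turned.path_value x q)" if "A.awalk x q y" for x q
      using that
    proof (induction q arbitrary: x)
      case (Cons a q)
      then have "a \<in> arcs QA" "A.awalk (head QA a) q y"
        by (auto simp: A.awalk_simps)
      then show ?case
        using Cons.IH pr.mult[OF turned.ar_closed turned.path_value_closed]
        by (simp only: r.path_value.simps turned.path_value.simps)
    qed (simp only: r.path_value.simps turned.path_value.simps)
    have "r.eval_rep (c \<odot>\<^bsub>A.CQ\<^esub> A.single p) = A.J.proj (c \<odot>\<^bsub>A.CQ\<^esub> A.single (omega_path p))"
      unfolding r.eval_rep_single[OF single] unfolding p fst_conv snd_conv path[OF p(2)] turned_path[OF p(2), symmetric]
      by (rule pr.scale[OF turned.path_value_closed[OF p(2)], symmetric])
    then show ?case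
      by (simp only: omega_path_algebra_single)
  next
    case (add f g)
    then show ?case
      by (simp only: r.eval_rep_add W.add pr.add W.closed)
  qed
  have f: "f \<in> carrier A.CQ"
    using assms by (rule A.J.Icarr)
  have "A.J.proj (omega_path_algebra f) = A.J.proj \<zero>\<^bsub>A.CQ\<^esub>"
    using r.eval_rep_ideal[OF assms] eq[OF f] pr.zero by simp
  then have "omega_path_algebra f \<ominus>\<^bsub>A.CQ\<^esub> \<zero>\<^bsub>A.CQ\<^esub> \<in> A.J"
    using A.J.proj_eq_iff[OF W.closed[OF f] A.CQ.zero_closed] by simp
  then show ?thesis
    using W.closed[OF f] by (simp only: A.CQ.minus_eq A.CQ.minus_zero A.CQ.r_zero)
qed

lemma omega_Pi_proj:
  assumes f: "f \<in> carrier A.CQ"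
  shows "omega_Pi (A.J.proj f) = A.J.proj (omega_path_algebra f)"
proof -
  have sum: "omega_path_algebra (j \<oplus>\<^bsub>A.CQ\<^esub> f) = omega_path_algebra j \<oplus>\<^bsub>A.CQ\<^esub> omega_path_algebra f"
    if "j \<in> A.J" for j
    using W.add[OF A.J.Icarr[OF that] f] .
  have onto: "\<exists>i\<in>A.J. j = omega_path_algebra i" if "j \<in> A.J" for j
    using omega_ideal[OF omega_ideal[OF that]] omega_cubed[OF A.J.Icarr[OF that], symmetric] by (intro bexI[of _ "omega_path_algebra (omega_path_algebra j)"])
  show ?thesis
  proof (rule equalityI; rule subsetI)
    fix z assume "z \<in> omega_Pi (A.J.proj f)"
    then obtain j where "j \<in> A.J" "z = omega_path_algebra (j \<oplus>\<^bsub>A.CQ\<^esub> f)"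
      unfolding omega_Pi_def a_r_coset_def' by blast
    then show "z \<in> A.J.proj (omega_path_algebra f)"
      using omega_ideal sum unfolding a_r_coset_def' by blast
  next
    fix z assume "z \<in> A.J.proj (omega_path_algebra f)"
    then obtain j where "j \<in> A.J" "z = j \<oplus>\<^bsub>A.CQ\<^esub> omega_path_algebra f"
      unfolding a_r_coset_def' by blast
    moreover then obtain i where "i \<in> A.J" "j = omega_path_algebra i"
      using onto by blast
    ultimately have "z = omega_path_algebra (i \<oplus>\<^bsub>A.CQ\<^esub> f)" "i \<oplus>\<^bsub>A.CQ\<^esub> f \<in> A.J.proj f"
      using sum[of i] unfolding a_r_coset_def' by (simp_all only:) blast
    then show "z \<in> omega_Pi (A.J.proj f)"
      unfolding omega_Pi_def by blast
  qed
qed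

abbreviation "Z3 \<equiv> integer_mod_group 3"

lemma Z3_simps: "carrier Z3 = {0, 1, 2}" "\<one>\<^bsub>Z3\<^esub> = 0" "g \<otimes>\<^bsub>Z3\<^esub> h = (g + h) mod 3"
  by (auto simp: carrier_integer_mod_group)

lemma omega_Pi_hom: "omega_Pi \<in> algebra_hom A.Jac A.Jac"
  unfolding algebra_hom_def
proof (intro CollectI conjI ballI allI Pi_I)
  fix x assume x: "x \<in> carrier A.Jac"
  then obtain f where f: "f \<in> carrier A.CQ" "x = A.J.proj f" by (rule A.Jac_carrierE)
  show "omega_Pi x \<in> carrier A.Jac"
    unfolding f(2) omega_Pi_proj[OF f(1)] by (rule pr.closed[OF W.closed[OF f(1)]])
  show "omega_Pi (c \<odot>\<^bsub>A.Jac\<^esub> x) = c \<odot>\<^bsub>A.Jac\<^esub> omega_Pi x" for c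
    unfolding f(2) pr.scale[OF f(1), symmetric] omega_Pi_proj[OF A.CQ.scale_closed[OF f(1)]]
      W.scale[OF f(1)] omega_Pi_proj[OF f(1)] by (rule pr.scale[OF W.closed[OF f(1)]])
  fix y assume "y \<in> carrier A.Jac"
  then obtain g where g: "g \<in> carrier A.CQ" "y = A.J.proj g" by (rule A.Jac_carrierE)
  show "omega_Pi (x \<oplus>\<^bsub>A.Jac\<^esub> y) = omega_Pi x \<oplus>\<^bsub>A.Jac\<^esub> omega_Pi y"
    unfolding f(2) g(2) pr.add[OF f(1) g(1), symmetric] omega_Pi_proj[OF A.CQ.a_closed[OF f(1) g(1)]]
      W.add[OF f(1) g(1)] omega_Pi_proj[OF f(1)] omega_Pi_proj[OF g(1)]
    by (rule pr.add[OF W.closed[OF f(1)] W.closed[OF g(1)]])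
  show "omega_Pi (x \<otimes>\<^bsub>A.Jac\<^esub> y) = omega_Pi x \<otimes>\<^bsub>A.Jac\<^esub> omega_Pi y"
    unfolding f(2) g(2) pr.mult[OF f(1) g(1), symmetric] omega_Pi_proj[OF A.CQ.m_closed[OF f(1) g(1)]]
      W.mult[OF f(1) g(1)] omega_Pi_proj[OF f(1)] omega_Pi_proj[OF g(1)]
    by (rule pr.mult[OF W.closed[OF f(1)] W.closed[OF g(1)]])
qed

lemma omega_Pi_cubed: "x \<in> carrier A.Jac \<Longrightarrow> omega_Pi (omega_Pi (omega_Pi x)) = x"
  by (elim A.Jac_carrierE) (simp only: omega_Pi_proj W.closed omega_cubed)

lemma omega_action_simps:
  "omega_action 0 x = x" "omega_action 1 x = omega_Pi x" "omega_action 2 x = omega_Pi (omega_Pi x)"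
  by (simp_all add: omega_action_def numeral_2_eq_2)

lemma omega_Pi_closed: "x \<in> carrier A.Jac \<Longrightarrow> omega_Pi x \<in> carrier A.Jac"
  using omega_Pi_hom by (auto simp: algebra_hom_def)

lemma omega_Pi_one: "omega_Pi \<one>\<^bsub>A.Jac\<^esub> = \<one>\<^bsub>A.Jac\<^esub>"
proof -
  interpret o: complex_ring_hom A.Jac A.Jac omega_Pi
    by unfold_locales (rule omega_Pi_hom)
  let ?y = "omega_Pi (omega_Pi \<one>\<^bsub>A.Jac\<^esub>)"
  have y: "?y \<in> carrier A.Jac" by (intro o.closed A.Jac.one_closed)
  \<comment> \<open>a surjective homomorphism preserves one\<close>
  have "omega_Pi \<one>\<^bsub>A.Jac\<^esub> = omega_Pi \<one>\<^bsub>A.Jac\<^esub> \<otimes>\<^bsub>A.Jac\<^esub> omega_Pi ?y"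
    using omega_Pi_cubed[OF A.Jac.one_closed] o.closed[OF A.Jac.one_closed] by simp
  also have "\<dots> = omega_Pi ?y"
    using y o.mult[OF A.Jac.one_closed y] by simp
  finally show ?thesis
    using omega_Pi_cubed[OF A.Jac.one_closed] by simp
qed

lemma omega_action_hom:
  assumes "g \<in> {0, 1, 2}"
  shows "omega_action g \<in> algebra_hom A.Jac A.Jac"
proof -
  interpret o: complex_ring_hom A.Jac A.Jac omega_Pi
    by unfold_locales (rule omega_Pi_hom)
  have 0: "omega_action 0 \<in> algebra_hom A.Jac A.Jac"
    unfolding algebra_hom_def
    by (intro CollectI conjI ballI allI Pi_I) (simp_all only: omega_action_simps)
  have 1: "omega_action 1 \<in> algebra_hom A.Jac A.Jac"
    unfolding algebra_hom_def
    by (intro CollectI conjI ballI allI Pi_I) (simp_all only: omega_action_simps o.add o.mult o.scale o.closed)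
  have 2: "omega_action 2 \<in> algebra_hom A.Jac A.Jac"
    unfolding algebra_hom_def
    by (intro CollectI conjI ballI allI Pi_I) (simp_all only: omega_action_simps o.add o.mult o.scale o.closed)
  from assms 0 1 2 show ?thesis
    by (elim insertE emptyE) (simp_all only:)
qed

lemma omega_action_mult:
  assumes "g \<in> {0, 1, 2}" "h \<in> {0, 1, 2}" "x \<in> carrier A.Jac"
  shows "omega_action ((g + h) mod 3) x = omega_action g (omega_action h x)"
proof -
  have mods: "(0 + 0) mod 3 = (0 :: int)" "(0 + 1) mod 3 = (1 :: int)" "(0 + 2) mod 3 = (2 :: int)"
    "(1 + 0) mod 3 = (1 :: int)" "(1 + 1) mod 3 = (2 :: int)" "(1 + 2) mod 3 = (0 :: int)"
    "(2 + 0) mod 3 = (2 :: int)" "(2 + 1) mod 3 = (0 :: int)" "(2 + 2) mod 3 = (1 :: int)"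
    by simp_all
  show ?thesis
    using assms(1,2)
    by (elim insertE emptyE) (simp_all only: mods omega_action_simps omega_Pi_cubed[OF assms(3)]
        omega_Pi_cubed[OF omega_Pi_closed[OF assms(3)]])
qed

lemma omega_action_one:
  "g \<in> {0, 1, 2} \<Longrightarrow> omega_action g \<one>\<^bsub>A.Jac\<^esub> = \<one>\<^bsub>A.Jac\<^esub>"
  by (elim insertE emptyE) (simp_all only: omega_action_simps omega_Pi_one)

lemma omega_group_action: "group_action_on_algebra A.Jac Z3 omega_action"
proof (intro group_action_on_algebra.intro group_action_on_algebra_axioms.intro)
  show "finite (carrier Z3)" by (simp only: Z3_simps finite.intros)
qed (simp_all only: Z3_simps A.Jac.complex_ring_axioms group_integer_mod_group omega_action_hom
    omega_action_one omega_action_mult omega_action_simps)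

sublocale skew: group_action_on_algebra A.Jac Z3 omega_action
  by (rule omega_group_action)

lemma omega_Pi_evA: "omega_Pi (evA x) = evA (rot 1 x)"
proof (cases "x \<in> N")
  case True
  then have "A.single (x, []) \<in> carrier A.CQ"
    by (intro A.single_carrier) (simp add: A.mem_paths_iff A.awalk_simps quiver_A_simps)
  with True show ?thesis
    by (simp only: evA_def if_True omega_Pi_proj omega_vertex omega_eq_rot simplex_rot)
next
  case False
  have "omega_Pi \<zero>\<^bsub>A.Jac\<^esub> = \<zero>\<^bsub>A.Jac\<^esub>"
    using omega_Pi_proj[OF A.CQ.zero_closed] W.zero pr.zero by simp
  with False show ?thesis
    by (simp only: evA_def if_False simplex_rot)
qed

lemma omega_Pi_arA: "omega_Pi (arA x i) = arA (rot 1 x) (i - 1)"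
proof -
  have "rot 1 x + shift (i - 1) = rot 1 (x + shift i)"
    by (simp only: rot_add_shift)
  then have mem: "rot 1 x \<in> N \<and> rot 1 x + shift (i - 1) \<in> N \<longleftrightarrow> x \<in> N \<and> x + shift i \<in> N"
    by (simp only: simplex_rot)
  show ?thesis
  proof (cases "x \<in> N \<and> x + shift i \<in> N")
    case True
    then have arc: "(x, i mod 3) \<in> arcs QA" by (simp only: arc_A_mod)
    then have "A.single (x, [(x, i mod 3)]) \<in> carrier A.CQ"
      by (intro A.single_carrier) (simp add: A.mem_paths_iff A.awalk_simps quiver_A_simps(3))
    with True show ?thesis
      by (simp only: arA_def mem if_True simp_thms omega_Pi_proj omega_arrow omega_eq_rot mod_diff_left_eq
          quiver_A_simps(3))
  next
    case False
    have "omega_Pi \<zero>\<^bsub>A.Jac\<^esub> = \<zero>\<^bsub>A.Jac\<^esub>"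
      using omega_Pi_proj[OF A.CQ.zero_closed] W.zero pr.zero by simp
    with False show ?thesis
      by (simp only: arA_def mem if_False)
  qed
qed

lemma omega_action_ev_ar:
  assumes "g \<in> {0, 1, 2}"
  shows "omega_action g (evA x) = evA (rot g x)" "omega_action g (arA x i) = arA (rot g x) (i - g)"
  using assms
  by (elim insertE emptyE; simp add: omega_action_simps omega_Pi_evA omega_Pi_arA del: rot.simps)+

abbreviation "Skew \<equiv> skew.S"

definition evS where "evS x = skew.tensor (evA x) 0"
definition arS where "arS x i = skew.tensor (arA x i) 0"
definition US where "US j = skew.tensor \<one>\<^bsub>A.Jac\<^esub> (j mod 3)"

lemma skew_tensor_mult:
  assumes "a \<in> carrier A.Jac" "b \<in> carrier A.Jac" "g \<in> {0, 1, 2}" "h \<in> {0, 1, 2}"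
  shows "skew.tensor a g \<otimes>\<^bsub>Skew\<^esub> skew.tensor b h =
    skew.tensor (a \<otimes>\<^bsub>A.Jac\<^esub> omega_action g b) ((g + h) mod 3)"
  using skew.tensor_mult[of a b g h] assms by (simp only: Z3_simps)

lemma skew_equivariant_rep: "equivariant_rep s Skew evS arS US"
proof -
  have mod0: "j mod 3 \<in> {0, 1, 2}" for j :: int by (rule mod3_mem)
  have zero: "0 \<in> {0, 1, 2 :: int}" by simp
  have tensor_zero: "skew.tensor \<zero>\<^bsub>A.Jac\<^esub> g = \<zero>\<^bsub>Skew\<^esub>" for g
    by (auto simp: skew.tensor_def skew.S_simps)
  have act_one: "omega_action g \<one>\<^bsub>A.Jac\<^esub> = \<one>\<^bsub>A.Jac\<^esub>" if "g \<in> {0, 1, 2}" for g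
    using skew.act_unit[of g] that by (simp only: Z3_simps)
  note mult = skew_tensor_mult[OF _ _ zero zero] skew_tensor_mult[OF _ _ mod0 zero]
    skew_tensor_mult[OF _ _ zero mod0] skew_tensor_mult[OF _ _ mod0 mod0]
  show ?thesis
  proof unfold_locales
    fix x y i j
    show "evS x \<in> carrier Skew" "arS x i \<in> carrier Skew" "US j \<in> carrier Skew"
      by (simp_all add: evS_def arS_def US_def)
    show "x \<notin> N \<Longrightarrow> evS x = \<zero>\<^bsub>Skew\<^esub>"
      by (simp add: evS_def evA_def tensor_zero)
    show "evS x \<otimes>\<^bsub>Skew\<^esub> evS y = (if x = y then evS x else \<zero>\<^bsub>Skew\<^esub>)"
      by (simp add: evS_def mult omega_action_simps evA_evA tensor_zero)
    show "evS x \<otimes>\<^bsub>Skew\<^esub> arS x i = arS x i" "arS x i \<otimes>\<^bsub>Skew\<^esub> evS (x + shift i) = arS x i"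
      by (simp_all add: evS_def arS_def mult omega_action_simps evA_arA)
    show "arS x (i mod 3) = arS x i"
      unfolding arS_def by (simp only: arA_cong[of "i mod 3" i] mod_mod_trivial)
    show "US 0 = \<one>\<^bsub>Skew\<^esub>"
      by (auto simp: US_def skew.tensor_def skew.S_simps(3) Z3_simps)
    show "US i \<otimes>\<^bsub>Skew\<^esub> US j = US (i + j)"
      by (simp add: US_def mult act_one[OF mod0] mod_add_eq)
    show "US (j mod 3) = US j"
      by (simp add: US_def)
    show "US j \<otimes>\<^bsub>Skew\<^esub> evS x = evS (rot j x) \<otimes>\<^bsub>Skew\<^esub> US j"
      by (simp add: US_def evS_def mult omega_action_ev_ar[OF mod0] omega_action_simps del: rot.simps)
    show "US j \<otimes>\<^bsub>Skew\<^esub> arS x i = arS (rot j x) (i - j) \<otimes>\<^bsub>Skew\<^esub> US j"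
      using arA_cong[of "i - j mod 3" "i - j" "rot j x"]
      by (simp add: US_def arS_def mult omega_action_ev_ar[OF mod0] omega_action_simps mod_diff_right_eq
          del: rot.simps)
    show "arS x i \<otimes>\<^bsub>Skew\<^esub> arS (x + shift i) j = arS x j \<otimes>\<^bsub>Skew\<^esub> arS (x + shift j) i"
      by (simp add: arS_def mult omega_action_simps arA_commute[of x i j])
  qed
qed

text \<open>
  Every tensor is the product of an element of the triangle algebra and a power of the rotation.
\<close>

lemma evA_arA_generate:
  assumes "x \<in> carrier A.Jac"
    and "\<And>x. P (evA x)" "\<And>x i. P (arA x i)"
    and "\<And>x y. x \<in> carrier A.Jac \<Longrightarrow> y \<in> carrier A.Jac \<Longrightarrow> P x \<Longrightarrow> P y \<Longrightarrow> P (x \<oplus>\<^bsub>A.Jac\<^esub> y)"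
    and "\<And>x y. x \<in> carrier A.Jac \<Longrightarrow> y \<in> carrier A.Jac \<Longrightarrow> P x \<Longrightarrow> P y \<Longrightarrow> P (x \<otimes>\<^bsub>A.Jac\<^esub> y)"
    and "\<And>x c. x \<in> carrier A.Jac \<Longrightarrow> P x \<Longrightarrow> P (c \<odot>\<^bsub>A.Jac\<^esub> x)"
  shows "P x"
  using assms(1)
proof (induction x rule: A.Jac_generated)
  case (vert x)
  then show ?case
    using assms(2)[of x] by (simp only: evA_def quiver_A_simps if_True)
next
  case (arc a)
  obtain x i where a: "a = (x, i)" by (cases a)
  then have "arA x i = A.arrow a"
    using arc by (auto simp: arA_def quiver_A_simps)
  then show ?case using assms(3)[of x i] by simp
next
  case zero
  have "(0, 0, 0) + (- 1, 0, 0) \<notin> N" by (simp add: simplex_points_def)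
  then show ?case
    using assms(2)[of "(0, 0, 0) + (- 1, 0, 0)"] by (simp only: evA_def if_False)
qed (rule assms(4,5,6); assumption)+

lemma Skew_generated [consumes 1, case_names ev ar U add mult scale]:
  assumes "u \<in> carrier Skew"
    and ev: "\<And>x. P (evS x)" and ar: "\<And>x i. P (arS x i)" and U: "\<And>j. P (US j)"
    and add: "\<And>u v. u \<in> carrier Skew \<Longrightarrow> v \<in> carrier Skew \<Longrightarrow> P u \<Longrightarrow> P v \<Longrightarrow> P (u \<oplus>\<^bsub>Skew\<^esub> v)"
    and mult: "\<And>u v. u \<in> carrier Skew \<Longrightarrow> v \<in> carrier Skew \<Longrightarrow> P u \<Longrightarrow> P v \<Longrightarrow> P (u \<otimes>\<^bsub>Skew\<^esub> v)"
    and scale: "\<And>u c. u \<in> carrier Skew \<Longrightarrow> P u \<Longrightarrow> P (c \<odot>\<^bsub>Skew\<^esub> u)"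
  shows "P u"
proof -
  have zero: "0 \<in> {0, 1, 2 :: int}" by simp
  have tensor: "P (skew.tensor a 0)" if "a \<in> carrier A.Jac" for a
    using that
  proof (rule evA_arA_generate)
    show "P (skew.tensor (evA x) 0)" "P (skew.tensor (arA x i) 0)" for x i
      using ev[of x] ar[of x i] by (simp_all only: evS_def arS_def)
  next
    fix x y assume xy: "x \<in> carrier A.Jac" "y \<in> carrier A.Jac"
      and P: "P (skew.tensor x 0)" "P (skew.tensor y 0)"
    have "skew.tensor (x \<oplus>\<^bsub>A.Jac\<^esub> y) 0 = skew.tensor x 0 \<oplus>\<^bsub>Skew\<^esub> skew.tensor y 0"
      using xy by (rule skew.tensor_add)
    then show "P (skew.tensor (x \<oplus>\<^bsub>A.Jac\<^esub> y) 0)"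
      using add xy P skew.tensor_closed by simp
    have "skew.tensor (x \<otimes>\<^bsub>A.Jac\<^esub> y) 0 = skew.tensor x 0 \<otimes>\<^bsub>Skew\<^esub> skew.tensor y 0"
      using skew_tensor_mult[OF xy zero zero] by (simp add: omega_action_simps)
    then show "P (skew.tensor (x \<otimes>\<^bsub>A.Jac\<^esub> y) 0)"
      using mult xy P skew.tensor_closed by simp
  next
    fix x c assume x: "x \<in> carrier A.Jac" and P: "P (skew.tensor x 0)"
    have "skew.tensor (c \<odot>\<^bsub>A.Jac\<^esub> x) 0 = c \<odot>\<^bsub>Skew\<^esub> skew.tensor x 0"
      using x by (rule skew.tensor_scale)
    then show "P (skew.tensor (c \<odot>\<^bsub>A.Jac\<^esub> x) 0)"
      using scale x P skew.tensor_closed by simp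
  qed
  show ?thesis
    using assms(1)
  proof (induction u rule: skew.S_induct)
    case zero
    have "\<zero>\<^bsub>Skew\<^esub> = skew.tensor \<zero>\<^bsub>A.Jac\<^esub> 0"
      by (auto simp: skew.tensor_def skew.S_simps)
    then show ?case using tensor[OF A.Jac.zero_closed] by simp
  next
    case (tensor a g)
    then have g: "g \<in> {0, 1, 2}" by (simp only: Z3_simps)
    then have "g mod 3 = g" by auto
    then have "skew.tensor a g = skew.tensor a 0 \<otimes>\<^bsub>Skew\<^esub> US g"
      using skew_tensor_mult[OF tensor(1) A.Jac.one_closed _ g, of 0] tensor(1)
      by (simp add: US_def omega_action_simps)
    then show ?case
      using mult \<open>\<And>a. a \<in> carrier A.Jac \<Longrightarrow> P (skew.tensor a 0)\<close>[OF tensor(1)] U[of g] tensor(1)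
      by (simp add: US_def)
  qed (rule add)
qed

lemma Skew_one: "\<one>\<^bsub>Skew\<^esub> = (\<Oplus>\<^bsub>Skew\<^esub>x\<in>N. evS x)"
proof -
  interpret t: complex_ring_hom A.Jac Skew "\<lambda>a. skew.tensor a 0"
  proof unfold_locales
    have "skew.tensor x 0 \<otimes>\<^bsub>Skew\<^esub> skew.tensor y 0 = skew.tensor (x \<otimes>\<^bsub>A.Jac\<^esub> y) 0"
      if "x \<in> carrier A.Jac" "y \<in> carrier A.Jac" for x y
      using skew_tensor_mult[of x y 0 0] that by (simp add: omega_action_simps)
    then show "(\<lambda>a. skew.tensor a 0) \<in> algebra_hom A.Jac Skew"
      unfolding algebra_hom_def by (simp add: skew.tensor_add skew.tensor_scale)
  qed
  have "\<one>\<^bsub>Skew\<^esub> = skew.tensor \<one>\<^bsub>A.Jac\<^esub> 0"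
    by (auto simp: skew.tensor_def skew.S_simps Z3_simps)
  also have "\<one>\<^bsub>A.Jac\<^esub> = (\<Oplus>\<^bsub>A.Jac\<^esub>x\<in>N. evA x)"
    unfolding A.one_eq_sum_vertices quiver_A_simps(1)
    by (rule A.Jac.finsum_eqI) (simp add: evA_def, rule evA_closed)
  also have "skew.tensor \<dots> 0 = (\<Oplus>\<^bsub>Skew\<^esub>x\<in>N. evS x)"
    unfolding evS_def by (rule t.finsum) simp
  finally show ?thesis .
qed

end


context equivariant_rep
begin

text \<open>
  The points need not sum to one in an equivariant representation.  Since one goes to their sum, the
  rotation goes to the part of \<open>U j\<close> over the points.
\<close>

lemma Skew_universal:
  "\<exists>F. complex_ring_hom Skew E F \<and> (\<forall>x. F (evS x) = ev x) \<and> (\<forall>x i. F (arS x i) = ar x i) \<and>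
    (\<forall>j. F (US j) = (\<Oplus>\<^bsub>E\<^esub>x\<in>N. ev x) \<otimes>\<^bsub>E\<^esub> U j)"
proof -
  interpret T: qp_rep QA weight_A E ev "\<lambda>(x, i). ar x i" by (rule qp_rep_A)
  let ?T = "T.hom_of_rep"
  have T_ev: "?T (evA x) = ev x" for x
  proof (cases "x \<in> N")
    case True
    then show ?thesis
      using T.hom_vertex[of x] by (simp only: evA_def quiver_A_simps if_True)
  next
    case False
    then show ?thesis
      by (simp only: evA_def if_False T.hom.zero ev_outside[OF False])
  qed
  have T_ar: "?T (arA x i) = ar x i" for x i
  proof (cases "x \<in> N \<and> x + shift i \<in> N")
    case True
    then show ?thesis
      using T.hom_arrow[of "(x, i mod 3)"] unfolding arc_A_mod
      by (simp only: arA_def if_True simp_thms prod.case ar_mod)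
  next
    case False
    then have "x \<notin> N \<or> x + shift i \<notin> N" by blast
    then show ?thesis
      unfolding arA_def if_not_P[OF False] by (simp only: T.hom.zero ar_outside)
  qed
  have UT: "\<forall>g\<in>{0, 1, 2}. U g \<otimes> ?T a = ?T (omega_action g a) \<otimes> U g" if "a \<in> carrier A.Jac" for a
    using that
  proof (rule evA_arA_generate)
    show "\<forall>g\<in>{0, 1, 2}. U g \<otimes> ?T (evA x) = ?T (omega_action g (evA x)) \<otimes> U g" for x
      by (intro ballI) (simp only: omega_action_ev_ar T_ev U_ev)
    show "\<forall>g\<in>{0, 1, 2}. U g \<otimes> ?T (arA x i) = ?T (omega_action g (arA x i)) \<otimes> U g" for x i
      by (intro ballI) (simp only: omega_action_ev_ar T_ar U_ar)
  next
    fix x y assume xy: "x \<in> carrier A.Jac" "y \<in> carrier A.Jac"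
      and IH: "\<forall>g\<in>{0, 1, 2}. U g \<otimes> ?T x = ?T (omega_action g x) \<otimes> U g"
        "\<forall>g\<in>{0, 1, 2}. U g \<otimes> ?T y = ?T (omega_action g y) \<otimes> U g"
    show "\<forall>g\<in>{0, 1, 2}. U g \<otimes> ?T (x \<oplus>\<^bsub>A.Jac\<^esub> y) = ?T (omega_action g (x \<oplus>\<^bsub>A.Jac\<^esub> y)) \<otimes> U g"
    proof
      fix g :: int assume g: "g \<in> {0, 1, 2}"
      then have g': "g \<in> carrier Z3" by (simp only: Z3_simps)
      show "U g \<otimes> ?T (x \<oplus>\<^bsub>A.Jac\<^esub> y) = ?T (omega_action g (x \<oplus>\<^bsub>A.Jac\<^esub> y)) \<otimes> U g"
        using xy bspec[OF IH(1) g] bspec[OF IH(2) g] skew.act_closed[OF g']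
        by (simp only: skew.act_add[OF g'] T.hom.add T.hom.closed r_distr l_distr U_closed)
    qed
    show "\<forall>g\<in>{0, 1, 2}. U g \<otimes> ?T (x \<otimes>\<^bsub>A.Jac\<^esub> y) = ?T (omega_action g (x \<otimes>\<^bsub>A.Jac\<^esub> y)) \<otimes> U g"
    proof
      fix g :: int assume g: "g \<in> {0, 1, 2}"
      then have g': "g \<in> carrier Z3" by (simp only: Z3_simps)
      have "U g \<otimes> ?T (x \<otimes>\<^bsub>A.Jac\<^esub> y) = (U g \<otimes> ?T x) \<otimes> ?T y"
        using xy by (simp only: T.hom.mult T.hom.closed m_assoc U_closed)
      also have "\<dots> = ?T (omega_action g x) \<otimes> (U g \<otimes> ?T y)"
        using xy skew.act_closed[OF g'] by (simp only: bspec[OF IH(1) g] T.hom.closed m_assoc U_closed)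
      also have "\<dots> = ?T (omega_action g (x \<otimes>\<^bsub>A.Jac\<^esub> y)) \<otimes> U g"
        using xy skew.act_closed[OF g']
        by (simp only: bspec[OF IH(2) g] T.hom.closed m_assoc U_closed skew.act_prod[OF g'] T.hom.mult)
      finally show "U g \<otimes> ?T (x \<otimes>\<^bsub>A.Jac\<^esub> y) = ?T (omega_action g (x \<otimes>\<^bsub>A.Jac\<^esub> y)) \<otimes> U g" .
    qed
  next
    fix x c assume x: "x \<in> carrier A.Jac"
      and IH: "\<forall>g\<in>{0, 1, 2}. U g \<otimes> ?T x = ?T (omega_action g x) \<otimes> U g"
    show "\<forall>g\<in>{0, 1, 2}. U g \<otimes> ?T (c \<odot>\<^bsub>A.Jac\<^esub> x) = ?T (omega_action g (c \<odot>\<^bsub>A.Jac\<^esub> x)) \<otimes> U g"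
    proof
      fix g :: int assume g: "g \<in> {0, 1, 2}"
      then have g': "g \<in> carrier Z3" by (simp only: Z3_simps)
      show "U g \<otimes> ?T (c \<odot>\<^bsub>A.Jac\<^esub> x) = ?T (omega_action g (c \<odot>\<^bsub>A.Jac\<^esub> x)) \<otimes> U g"
        using x bspec[OF IH g] skew.act_closed[OF g']
        by (simp only: skew.act_scale[OF g'] T.hom.scale T.hom.closed scale_mult_left scale_mult_right U_closed)
    qed
  qed
  have "\<exists>F. complex_ring_hom Skew E F \<and>
    (\<forall>a\<in>carrier A.Jac. \<forall>g\<in>carrier Z3. F (skew.tensor a g) = ?T a \<otimes> U g)"
  proof (rule skew.extend_hom[OF T.hom.complex_ring_hom_axioms])
    show "U (g \<otimes>\<^bsub>Z3\<^esub> h) = U g \<otimes> U h" for g h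
      by (simp only: Z3_simps U_mod U_add)
    show "U g \<otimes> ?T a = ?T (omega_action g a) \<otimes> U g" if "g \<in> carrier Z3" "a \<in> carrier A.Jac" for g a
      using UT[OF that(2)] that(1) unfolding Z3_simps by (rule bspec)
  qed (rule U_closed)
  then obtain F where F: "complex_ring_hom Skew E F"
    and F_tensor: "\<And>a g. a \<in> carrier A.Jac \<Longrightarrow> g \<in> {0, 1, 2} \<Longrightarrow> F (skew.tensor a g) = ?T a \<otimes> U g"
    by (auto simp only: Z3_simps)
  have "?T \<one>\<^bsub>A.Jac\<^esub> = (\<Oplus>x\<in>N. ev x)"
  proof -
    have "\<one>\<^bsub>A.Jac\<^esub> = (\<Oplus>\<^bsub>A.Jac\<^esub>x\<in>N. evA x)"
      unfolding A.one_eq_sum_vertices quiver_A_simps(1)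
      by (rule A.Jac.finsum_eqI) (simp add: evA_def, rule evA_closed)
    then show ?thesis
      using T.hom.finsum[of evA N] by (simp add: T_ev)
  qed
  then have "F (US j) = (\<Oplus>x\<in>N. ev x) \<otimes> U j" for j
    unfolding US_def using F_tensor[OF A.Jac.one_closed mod3_mem[of j]] by (simp only: U_mod)
  moreover have "F (evS x) = ev x" "F (arS x i) = ar x i" for x i
    unfolding evS_def arS_def using F_tensor[of _ 0] by (simp_all add: T_ev T_ar U_zero)
  ultimately show ?thesis using F by blast
qed

end


section \<open>The relations of type D\<close>

lemma (in abelian_monoid) finsum_012:
  assumes "f 0 \<in> carrier G" "f 1 \<in> carrier G" "f 2 \<in> carrier G"
  shows "(\<Oplus>l\<in>{0, 1, 2 :: int}. f l) = f 0 \<oplus> (f 1 \<oplus> f 2)"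
  using assms by (simp add: finsum_insert)

context triangle
begin

abbreviation "QD \<equiv> quiver_D s"
abbreviation "inner \<equiv> N - {ctr}"

lemma quiver_D_simps:
  "Pt x \<in> verts QD \<longleftrightarrow> x \<in> Q0"
  "Centre k \<in> verts QD \<longleftrightarrow> s mod 3 = 1 \<and> k \<in> {0, 1, 2}"
  "Beta k \<in> arcs QD \<longleftrightarrow> s mod 3 = 1 \<and> k \<in> {0, 1, 2}"
  "Gamma k \<in> arcs QD \<longleftrightarrow> s mod 3 = 1 \<and> k \<in> {0, 1, 2}"
  "tail QD (Alpha x i j) = Pt x" "tail QD (Beta k) = Pt before_ctr" "tail QD (Gamma k) = Centre k"
  "head QD (Beta k) = Centre k" "head QD (Gamma k) = Pt after_ctr"
  by (auto simp: quiver_D_def)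

lemma arc_Alpha: "Alpha x i j \<in> arcs QD \<longleftrightarrow>
    x \<in> Q0 \<and> i \<in> {0, 1, 2} \<and> j \<in> {0, 1, 2} \<and> rot j x + shift i \<in> Q0"
proof -
  have eq: "j \<in> {0, 1, 2} \<Longrightarrow> (omega ^^ nat j) x = rot j x"
    by (rule omega_power_eq_rot) auto
  have "Alpha x i j \<in> arcs QD \<longleftrightarrow>
      x \<in> Q0 \<and> i \<in> {0, 1, 2} \<and> j \<in> {0, 1, 2} \<and> (omega ^^ nat j) x + shift i \<in> Q0"
    unfolding quiver_D_def by (cases x) (auto split: if_splits)
  then show ?thesis
    using eq by (simp only: cong: conj_cong)
qed

lemma head_Alpha: "j \<in> {0, 1, 2} \<Longrightarrow> head QD (Alpha x i j) = Pt (rot j x + shift i)"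
  using omega_power_eq_rot[of j x] by (auto simp: quiver_D_def)

lemma turn_values: "x \<in> inner \<Longrightarrow> turn x \<in> {0, 1, 2}"
  using turn_mem by blast

lemma rep_Q0: "x \<in> inner \<Longrightarrow> rep x \<in> Q0"
  using rep_mem by blast

lemma inner_rot [simp]: "rot j x \<in> inner \<longleftrightarrow> x \<in> inner"
  using rot_eq_iff[of j x ctr] unfolding rot_ctr by (simp only: Diff_iff simplex_rot insert_iff empty_iff)

lemma Q0_inner: "x \<in> Q0 \<Longrightarrow> x \<in> inner"
  using fundamental_mem by blast

text \<open>
  The arrow of the quotient quiver that lies under the step from \<open>x\<close> in direction \<open>m\<close>: turning \<open>x\<close> back
  to its representative turns the direction as well, and the second index is the turn by which the
  image of the step still misses the fundamental domain.
\<close>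

definition abar :: "triple \<Rightarrow> int \<Rightarrow> d_arrow" where
  "abar x m = Alpha (rep x) ((m + turn (x + shift m)) mod 3) ((turn x - turn (x + shift m)) mod 3)"

lemma abar_cong:
  assumes "m mod 3 = m' mod 3"
  shows "abar x m = abar x m'"
  unfolding abar_def shift_cong[OF assms] using mod_add_cong[OF assms refl] by (simp only:)

lemma abar_arc:
  assumes "x \<in> inner" "x + shift m \<in> inner"
  shows "abar x m \<in> arcs QD" "tail QD (abar x m) = Pt (rep x)" "head QD (abar x m) = Pt (rep (x + shift m))"
proof -
  let ?y = "x + shift m"
  have "rot ((turn x - turn ?y) mod 3) (rep x) + shift ((m + turn ?y) mod 3) = rot (- turn ?y) ?y"
  proof -
    have "rot ((turn x - turn ?y) mod 3) (rep x) = rot (turn x - turn ?y) (rep x)"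
      by (rule rot_mod)
    also have "\<dots> = rot (turn x - turn ?y + - turn x) x"
      unfolding rep_def rot_rot ..
    also have "turn x - turn ?y + - turn x = - turn ?y" by simp
    finally show ?thesis
      unfolding shift_mod rot_add_shift by (simp only: diff_minus_eq_add)
  qed
  then have eq: "rot ((turn x - turn ?y) mod 3) (rep x) + shift ((m + turn ?y) mod 3) = rep ?y"
    by (simp only: rep_def[symmetric])
  show "abar x m \<in> arcs QD"
    unfolding abar_def arc_Alpha eq using rep_Q0[OF assms(1)] rep_Q0[OF assms(2)] mod3_mem by (simp only: simp_thms)
  show "tail QD (abar x m) = Pt (rep x)"
    by (simp only: abar_def quiver_D_simps)
  show "head QD (abar x m) = Pt (rep ?y)"
    unfolding abar_def head_Alpha[OF mod3_mem] eq ..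
qed

lemma abar_rot:
  assumes "x \<in> inner" "x + shift m \<in> inner"
  shows "abar (rot l x) (m - l) = abar x m"
proof -
  let ?y = "x + shift m"
  have x: "x \<in> N" "x \<noteq> ctr" and y: "?y \<in> N" "?y \<noteq> ctr"
    using assms by blast+
  have y': "rot l x + shift (m - l) = rot l ?y"
    by (simp only: rot_add_shift)
  have "(m - l + (turn ?y + l) mod 3) mod 3 = (m + turn ?y) mod 3"
    unfolding mod_add_right_eq by (rule arg_cong[of _ _ "\<lambda>k. k mod 3"]) simp
  moreover have "((turn x + l) mod 3 - (turn ?y + l) mod 3) mod 3 = (turn x - turn ?y) mod 3"
    unfolding mod_diff_eq by (rule arg_cong[of _ _ "\<lambda>k. k mod 3"]) simp
  ultimately show ?thesis
    unfolding abar_def y' turn_rot[OF x] turn_rot[OF y] rep_rot[OF x] by (simp only:)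
qed

lemma arc_is_abar:
  assumes "Alpha p i j \<in> arcs QD" "p = rep y" "y \<in> inner"
  shows "\<exists>m. Alpha p i j = abar y m \<and> y + shift m \<in> inner"
proof -
  have p: "p \<in> Q0" and i: "i \<in> {0, 1, 2}" and j: "j \<in> {0, 1, 2}" and q: "rot j p + shift i \<in> Q0"
    using assms(1) by (simp_all only: arc_Alpha)
  let ?z = "p + shift (i + j)"
  have z: "rot (- (- j)) ?z = rot j p + shift i"
    by (simp only: minus_minus rot_add_shift add_diff_cancel_right')
  then have zQ: "rot (- (- j)) ?z \<in> Q0"
    using q by (simp only:)
  have turn_z: "turn ?z = (- j) mod 3"
    by (rule turn_eqI(1)[OF zQ])
  have zin: "?z \<in> inner"
    using Q0_inner[OF zQ] by (simp only: inner_rot)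
  have ij: "i mod 3 = i" "j mod 3 = j"
    using i j by (elim insertE emptyE; simp)+
  have "(i + j + (- j) mod 3) mod 3 = i"
    unfolding mod_add_right_eq using ij by simp
  moreover have "(0 - (- j) mod 3) mod 3 = j"
    unfolding mod_diff_right_eq using ij by simp
  ultimately have abar: "Alpha p i j = abar p (i + j)"
    unfolding abar_def turn_z turn_fundamental[OF p] by (simp only:)
  have y: "rot (turn y) p = y"
    unfolding assms(2) by (rule rot_turn_rep)
  have "abar y (i + j - turn y) = abar p (i + j)"
    using abar_rot[OF Q0_inner[OF p] zin, of "turn y"] unfolding y .
  moreover have "y + shift (i + j - turn y) = rot (turn y) ?z"
    unfolding rot_add_shift y ..
  ultimately show ?thesis
    using abar zin inner_rot[of "turn y" ?z] by metis
qed

lemma finite_arcs_D: "finite (arcs QD)"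
proof -
  have "finite Q0"
    by (rule finite_subset[OF _ finite_simplex_points[of s]]) (auto simp: fundamental_points_def)
  then have "finite ((\<lambda>(x, i, j). Alpha x i j) ` (Q0 \<times> {0, 1, 2} \<times> {0, 1, 2}) \<union>
      Beta ` {0, 1, 2} \<union> Gamma ` {0, 1, 2})"
    by simp
  moreover have "arcs QD \<subseteq> (\<lambda>(x, i, j). Alpha x i j) ` (Q0 \<times> {0, 1, 2} \<times> {0, 1, 2}) \<union>
      Beta ` {0, 1, 2} \<union> Gamma ` {0, 1, 2}"
  proof
    fix a assume a: "a \<in> arcs QD"
    show "a \<in> (\<lambda>(x, i, j). Alpha x i j) ` (Q0 \<times> {0, 1, 2} \<times> {0, 1, 2}) \<union>
      Beta ` {0, 1, 2} \<union> Gamma ` {0, 1, 2}"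
    proof (cases a)
      case (Alpha x i j)
      then have "(x, i, j) \<in> Q0 \<times> {0, 1, 2} \<times> {0, 1, 2}"
        using a unfolding Alpha arc_Alpha by (simp only: mem_Times_iff fst_conv snd_conv simp_thms)
      then show ?thesis
        unfolding Alpha by (intro UnI1 image_eqI[of _ _ "(x, i, j)"]) simp_all
    next
      case (Beta k)
      then show ?thesis using a unfolding Beta quiver_D_simps by blast
    next
      case (Gamma k)
      then show ?thesis using a unfolding Gamma quiver_D_simps by blast
    qed
  qed
  ultimately show ?thesis by (rule finite_subset[rotated])
qed

lemma weight_D_rotate: "weight_D [b, c, a] = weight_D [a, b, c]"
proof (cases "\<exists>x i0 j0 y i1 j1 z i2 j2. a = Alpha x i0 j0 \<and> b = Alpha y i1 j1 \<and> c = Alpha z i2 j2")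
  case True
  then obtain x i0 j0 y i1 j1 z i2 j2 where abc: "a = Alpha x i0 j0" "b = Alpha y i1 j1" "c = Alpha z i2 j2"
    by blast
  have sum: "(j1 + j2 + j0) mod 3 = (j0 + j1 + j2) mod 3" by (simp only: ac_simps)
  have sign: "index_sign (i1 + j1, i2 - j0, i0) = index_sign (i0 + j0, i1 - j2, i2)"
    if "(j0 + j1 + j2) mod 3 = 0"
  proof -
    have "index_sign (i0 + j0, i1 - j2, i2) = index_sign (i0 + j0 + - j0, i1 - j2 + - j0, i2 + - j0)"
      by (rule index_sign_translate[symmetric])
    also have "\<dots> = index_sign (i0, i1 + j1, i2 - j0)"
    proof (rule index_sign_cong)
      have "(i1 - j2 + - j0) mod 3 = (i1 + j1 - (j0 + j1 + j2) mod 3) mod 3"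
        unfolding mod_diff_right_eq by (rule arg_cong[of _ _ "\<lambda>k. k mod 3"]) simp
      then show "(i1 - j2 + - j0) mod 3 = (i1 + j1) mod 3"
        unfolding that by simp
    qed simp_all
    finally show ?thesis by (simp only: index_sign_rotate)
  qed
  have "Alpha y i1 j1 = Alpha z i2 j2 \<and> Alpha z i2 j2 = Alpha x i0 j0 \<longleftrightarrow>
      Alpha x i0 j0 = Alpha y i1 j1 \<and> Alpha y i1 j1 = Alpha z i2 j2"
    by blast
  moreover have "distinct [Alpha y i1 j1, Alpha z i2 j2, Alpha x i0 j0] \<longleftrightarrow>
      distinct [Alpha x i0 j0, Alpha y i1 j1, Alpha z i2 j2]"
    by auto
  ultimately show ?thesis
    unfolding abc weight_D.simps sum
    using sign by (cases "Alpha x i0 j0 = Alpha y i1 j1 \<and> Alpha y i1 j1 = Alpha z i2 j2")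
      (simp_all only: d_arrow.inject if_True if_False simp_thms cong: if_cong conj_cong)
next
  case False
  then show ?thesis
    by (cases a; cases b; cases c) (simp_all only: weight_D.simps d_arrow.inject simp_thms ex_simps)
qed

sublocale D: three_cycle_qp QD weight_D
proof
  have "finite Q0"
    by (rule finite_subset[OF _ finite_simplex_points[of s]]) (auto simp: fundamental_points_def)
  then show "finite (verts QD)"
    by (simp add: quiver_D_def)
  show "finite (arcs QD)" by (rule finite_arcs_D)
  fix a assume a: "a \<in> arcs QD"
  show "tail QD a \<in> verts QD"
    using a before_ctr_mem by (cases a) (simp_all add: quiver_D_simps arc_Alpha)
  show "head QD a \<in> verts QD"
    using a after_ctr_mem by (cases a) (simp_all add: quiver_D_simps arc_Alpha head_Alpha)
qed (rule weight_D_rotate)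

text \<open>
  A 3-cycle of total turn zero that repeats an arrow is the cube of a loop.  So a cycle of
  nonzero weight falls under one of two clauses, the cube of a loop or three distinct arrows.
\<close>

lemma third_equal:
  assumes "Alpha p i j \<in> arcs QD" "Alpha q i2 j2 \<in> arcs QD" "(j + j + j2) mod 3 = 0"
    and "q = p" "rot j p + shift i = p" "rot j2 q + shift i2 = p"
  shows "Alpha q i2 j2 = Alpha p i j"
proof -
  have ij: "i \<in> {0, 1, 2}" "j \<in> {0, 1, 2}" "i2 \<in> {0, 1, 2}" "j2 \<in> {0, 1, 2}"
    using assms(1,2) by (simp_all only: arc_Alpha)
  have j: "j2 = j"
    using ij(2,4) assms(3) by (elim insertE emptyE) simp_all
  have "shift i2 = shift i"
    using assms(5,6) unfolding j assms(4) by (metis add_left_cancel)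
  then have "i2 = i"
    unfolding shift_eq_iff using ij(1,3) by (elim insertE emptyE) simp_all
  then show ?thesis
    using j assms(4) by simp
qed

text \<open>
  The turns add up along the lift, so that their sum vanishes exactly if the lift is closed.  In that
  case translating all three indices by the same turn gives the directions of the lift and does not
  change the sign.
\<close>

lemma deriv_weight_lift:
  fixes x m j k
  defines "y \<equiv> x + shift m" and "z \<equiv> x + shift m + shift j" and "w \<equiv> x + shift m + shift j + shift k"
  assumes inner: "x \<in> inner" "y \<in> inner" "z \<in> inner" "w \<in> inner" and rep: "rep w = rep x"
  shows "D.deriv_weight (abar x m) (abar y j) (abar z k) = (if w = x then index_sign (m, j, k) else 0)"
proof -
  have z: "y + shift j = z" and w: "z + shift k = w"
    by (simp_all only: y_def z_def w_def)
  define i0 i1 i2 where "i0 = (m + turn y) mod 3" and "i1 = (j + turn z) mod 3" and "i2 = (k + turn w) mod 3"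
  define j0 j1 j2 where "j0 = (turn x - turn y) mod 3" and "j1 = (turn y - turn z) mod 3" and "j2 = (turn z - turn w) mod 3"
  have abc: "abar x m = Alpha (rep x) i0 j0" "abar y j = Alpha (rep y) i1 j1" "abar z k = Alpha (rep z) i2 j2"
    by (simp_all only: abar_def z w y_def[symmetric] i0_def i1_def i2_def j0_def j1_def j2_def)
  have jsum: "(j0 + j1 + j2) mod 3 = (turn x - turn w) mod 3"
  proof -
    have "(j0 + j1 + j2) mod 3 = ((j0 + j1) mod 3 + j2) mod 3"
      by (rule mod_add_left_eq[symmetric])
    also have "\<dots> = ((turn x - turn y + (turn y - turn z)) mod 3 + (turn z - turn w) mod 3) mod 3"
      unfolding j0_def j1_def j2_def mod_add_eq ..
    also have "\<dots> = (turn x - turn y + (turn y - turn z) + (turn z - turn w)) mod 3"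
      by (rule mod_add_eq)
    finally show ?thesis by simp
  qed
  have turns: "turn x \<in> {0, 1, 2}" "turn w \<in> {0, 1, 2}"
    using inner turn_values by blast+
  have arcs: "Alpha (rep x) i0 j0 \<in> arcs QD" "Alpha (rep y) i1 j1 \<in> arcs QD" "Alpha (rep z) i2 j2 \<in> arcs QD"
    using abar_arc(1)[of x m] abar_arc(1)[of y j] abar_arc(1)[of z k] inner
    unfolding abc z w y_def[symmetric] by blast+
  have jmem: "j0 \<in> {0, 1, 2}" "j1 \<in> {0, 1, 2}" "j2 \<in> {0, 1, 2}"
    unfolding j0_def j1_def j2_def by (rule mod3_mem)+
  have heads: "rot j0 (rep x) + shift i0 = rep y" "rot j1 (rep y) + shift i1 = rep z"
    using abar_arc(3)[of x m] abar_arc(3)[of y j] inner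
    unfolding abc z y_def[symmetric] head_Alpha[OF jmem(1)] head_Alpha[OF jmem(2)]
    by blast+
  have head3: "rot j2 (rep z) + shift i2 = rep x"
    using abar_arc(3)[of z k] inner unfolding abc w rep head_Alpha[OF jmem(3)] by blast
  show ?thesis
  proof (cases "w = x")
    case True
    have sum0: "(j0 + j1 + j2) mod 3 = 0"
      unfolding jsum True by simp
    have sign: "index_sign (i0 + j0, i1 - j2, i2) = index_sign (m, j, k)"
    proof -
      have "index_sign (i0 + j0, i1 - j2, i2) = index_sign (m + turn x, j + turn x, k + turn x)"
        by (rule index_sign_cong) (simp_all add: i0_def i1_def i2_def j0_def j2_def True mod_simps)
      then show ?thesis by (simp only: index_sign_translate)
    qed
    show ?thesis
    proof (cases "Alpha (rep x) i0 j0 = Alpha (rep y) i1 j1 \<and> Alpha (rep y) i1 j1 = Alpha (rep z) i2 j2")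
      case eq: True
      then have "index_sign (i0 + j0, i0 - j0, i0) = index_sign (m, j, k)"
        using sign by simp
      then show ?thesis
        unfolding D.deriv_weight_def abc weight_D.simps if_P[OF eq] if_P[OF True] by simp
    next
      case False
      have "distinct [Alpha (rep x) i0 j0, Alpha (rep y) i1 j1, Alpha (rep z) i2 j2]"
      proof (rule ccontr)
        assume "\<not> distinct [Alpha (rep x) i0 j0, Alpha (rep y) i1 j1, Alpha (rep z) i2 j2]"
        then consider "Alpha (rep x) i0 j0 = Alpha (rep y) i1 j1" | "Alpha (rep y) i1 j1 = Alpha (rep z) i2 j2"
          | "Alpha (rep z) i2 j2 = Alpha (rep x) i0 j0"
          by (auto simp del: d_arrow.inject)
        then show False
        proof cases
          case 1
          then have "Alpha (rep z) i2 j2 = Alpha (rep x) i0 j0"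
            using heads head3 sum0 by (intro third_equal[OF arcs(1,3)]) auto
          with 1 False show False by metis
        next
          case 2
          then have "Alpha (rep x) i0 j0 = Alpha (rep y) i1 j1"
            using heads head3 sum0 by (intro third_equal[OF arcs(2,1)]) (auto simp: ac_simps)
          with 2 False show False by metis
        next
          case 3
          then have "Alpha (rep y) i1 j1 = Alpha (rep z) i2 j2"
            using heads head3 sum0 by (intro third_equal[OF arcs(3,2)]) (auto simp: ac_simps)
          with 3 False show False by metis
        qed
      qed
      then show ?thesis
        unfolding D.deriv_weight_def abc weight_D.simps if_not_P[OF False] using sum0 sign True by simp
    qed
  next
    case False
    have "turn w \<noteq> turn x"
    proof
      assume "turn w = turn x"
      then have "rot (turn w) (rep w) = rot (turn x) (rep x)" using rep by simp
      then show False using False by simp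
    qed
    then have sum: "(j0 + j1 + j2) mod 3 \<noteq> 0"
      unfolding jsum using turns by (elim insertE emptyE) simp_all
    have "\<not> (Alpha (rep x) i0 j0 = Alpha (rep y) i1 j1 \<and> Alpha (rep y) i1 j1 = Alpha (rep z) i2 j2)"
    proof
      assume "Alpha (rep x) i0 j0 = Alpha (rep y) i1 j1 \<and> Alpha (rep y) i1 j1 = Alpha (rep z) i2 j2"
      then have "j0 + j1 + j2 = 3 * j0" by simp
      then have "(j0 + j1 + j2) mod 3 = 0" by (simp only: mod_mult_self1_is_0)
      then show False using sum by (rule notE[rotated])
    qed
    then show ?thesis
      unfolding D.deriv_weight_def abc weight_D.simps using sum False by (simp only: if_False simp_thms mult_zero_left)
  qed
qed

text \<open>
  The value of the lifted path from \<open>y\<close> in directions \<open>j\<close>, \<open>k\<close>, where steps of the triangle are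
  represented by the arrows below them.  A path through the centre has one component for each of
  the three vertices above the centre; the factor records the turn between the two ends.
\<close>

definition step_value :: "(complex, 'e) module \<Rightarrow> (d_arrow \<Rightarrow> 'e) \<Rightarrow> triple \<Rightarrow> int \<Rightarrow> 'e" where
  "step_value E ar x m = (if x \<in> inner \<and> x + shift m \<in> inner then ar (abar x m) else \<zero>\<^bsub>E\<^esub>)"

definition path2_value :: "(complex, 'e) module \<Rightarrow> (d_arrow \<Rightarrow> 'e) \<Rightarrow> triple \<Rightarrow> int \<Rightarrow> int \<Rightarrow> 'e" where
  "path2_value E ar y j k =
    (if y + shift j = ctr \<and> ctr \<in> N
     then \<Oplus>\<^bsub>E\<^esub>l\<in>{0, 1, 2}. third_root ((j + 2 - k) * l) \<odot>\<^bsub>E\<^esub> (ar (Beta l) \<otimes>\<^bsub>E\<^esub> ar (Gamma l))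
     else step_value E ar y j \<otimes>\<^bsub>E\<^esub> step_value E ar (y + shift j) k)"

lemma weight_centre_values:
  "k \<in> {0, 1, 2} \<Longrightarrow> weight_centre 2 1 k = third_root k" "weight_centre 1 0 k = - 1"
  using third_root_power[of k] by (auto simp: weight_centre_def)

text \<open>
  An arrow that closes up with the arrow below \<open>x \<rightarrow> y\<close> lifts to a path from \<open>y\<close> that ends in the orbit
  of \<open>x\<close>.  The weight discards the paths that do not end in \<open>x\<close> itself; what is left are the two ways
  back from \<open>y\<close> to \<open>x\<close>.
\<close>

lemma relation_D_step:
  fixes E :: "(complex, 'e) module" and ar ev x m
  assumes "quiver_rep QD E ev ar" and x: "x \<in> inner" and y: "x + shift m \<in> inner"
  defines "y \<equiv> x + shift m"
  shows "(\<Oplus>\<^bsub>E\<^esub>p\<in>D.completions (abar x m). D.deriv_weight (abar x m) (fst p) (snd p) \<odot>\<^bsub>E\<^esub>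
      (ar (fst p) \<otimes>\<^bsub>E\<^esub> ar (snd p))) =
    path2_value E ar y (m + 1) (m + 2) \<ominus>\<^bsub>E\<^esub> path2_value E ar y (m + 2) (m + 1)"
proof -
  interpret quiver_rep QD E ev ar by fact
  note y = y[folded y_def]
  let ?a = "abar x m"
  let ?f = "\<lambda>p. D.deriv_weight ?a (fst p) (snd p) \<odot>\<^bsub>E\<^esub> (ar (fst p) \<otimes>\<^bsub>E\<^esub> ar (snd p))"
  let ?K = "\<lambda>j k. if y + shift j \<in> N then
      if y + shift j = ctr then (\<lambda>l. (Beta l, Gamma l)) ` {0, 1, 2} else {(abar y j, abar (y + shift j) k)} else {}"
  have step_closed: "step_value E ar p i \<in> carrier E" for p i
    using abar_arc(1)[of p i] by (simp add: step_value_def)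
  note a = abar_arc[OF x y[unfolded y_def], folded y_def]
  have ret: "y + shift (m + 1) + shift (m + 2) = x" "y + shift (m + 2) + shift (m + 1) = x"
    using shift_sum_zero_iff[of m "m + 1" "m + 2"] by (simp_all add: y_def add.assoc ac_simps)
  have at_centre: "s mod 3 = 1 \<and> y = ctr - shift j \<and> x = ctr + shift k"
    if "y + shift j = ctr" "ctr \<in> N" "y + shift j + shift k = x" for j k
    using that ctr_mem_iff by (auto simp: eq_diff_eq)
  have sub: "?K j k \<subseteq> D.completions ?a" if ret: "y + shift j + shift k = x" for j k
  proof (cases "y + shift j = ctr")
    case True
    show ?thesis
    proof (cases "ctr \<in> N")
      case cN: True
      note ends = at_centre[OF True cN ret]
      have reps: "rep x = after_ctr" "rep y = before_ctr"
        using ends rep_before[of j] rep_after[of k] by (simp_all only:)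
      have "(Beta l, Gamma l) \<in> D.completions ?a" if "l \<in> {0, 1, 2}" for l
        using that ends a unfolding reps
        by (simp only: D.completions_def D.cycles_iff mem_Collect_eq prod.case quiver_D_simps simp_thms
            insert_subset empty_subsetI)
      then show ?thesis
        unfolding True if_P[OF cN] if_P[OF refl] by (rule image_subsetI)
    next
      case False
      then show ?thesis using True by simp
    qed
  next
    case False
    show ?thesis
    proof (cases "y + shift j \<in> N")
      case True
      with False have z: "y + shift j \<in> inner" by blast
      note b = abar_arc[OF y z]
      have "y + shift j + shift k \<in> inner" using x ret by simp
      note c = abar_arc[OF z this, unfolded ret]
      have "(abar y j, abar (y + shift j) k) \<in> D.completions ?a"
        using a b c by (simp only: D.completions_def D.cycles_iff mem_Collect_eq prod.case simp_thms
            insert_subset empty_subsetI)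
      then show ?thesis
        using False True by simp
    qed simp
  qed
  have K_cong: "?K j k = ?K j' k'" if "j mod 3 = j' mod 3" "k mod 3 = k' mod 3" for j k j' k'
    by (simp only: shift_cong[OF that(1)] abar_cong[OF that(1)] abar_cong[OF that(2)])
  have others: "?f p = \<zero>\<^bsub>E\<^esub>" if p: "p \<in> D.completions ?a" "p \<notin> ?K (m + 1) (m + 2) \<union> ?K (m + 2) (m + 1)" for p
  proof -
    obtain b c where bc: "p = (b, c)" by (cases p)
    have arcs: "b \<in> arcs QD" "c \<in> arcs QD" and ends: "tail QD b = Pt (rep y)" "head QD b = tail QD c" "head QD c = Pt (rep x)"
      using p(1) a by (auto simp: bc D.completions_def D.cycles_iff)
    have directions: "p \<in> ?K (m + 1) (m + 2) \<union> ?K (m + 2) (m + 1)"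
      if "p \<in> ?K j k" "shift m + shift j + shift k = 0" for j k
      using that(2) unfolding shift_sum_zero_iff
    proof (elim disjE conjE)
      assume "(j - m) mod 3 = 1" "(k - m) mod 3 = 2"
      then have "?K j k = ?K (m + 1) (m + 2)"
        by (intro K_cong mod3_shiftD)
      then show ?thesis using that(1) by blast
    next
      assume "(j - m) mod 3 = 2" "(k - m) mod 3 = 1"
      then have "?K j k = ?K (m + 2) (m + 1)"
        by (intro K_cong mod3_shiftD)
      then show ?thesis using that(1) by blast
    qed
    show ?thesis
    proof (cases b)
      case (Alpha p0 i j0)
      then obtain j where b: "b = abar y j" and z: "y + shift j \<in> inner"
        using arc_is_abar[of p0 i j0 y] arcs(1) ends(1) y by (auto simp: quiver_D_simps)
      let ?z = "y + shift j"
      have tail_c: "tail QD c = Pt (rep ?z)"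
        using ends(2) abar_arc(3)[OF y z] by (simp add: b)
      obtain q i' j' where c': "c = Alpha q i' j'"
        using ends(3) tail_c by (cases c) (simp_all add: quiver_D_simps)
      then obtain k where c: "c = abar ?z k" and w: "?z + shift k \<in> inner"
        using arc_is_abar[of q i' j' ?z] arcs(2) tail_c z by (auto simp: quiver_D_simps)
      have rep: "rep (?z + shift k) = rep x"
        using ends(3) abar_arc(3)[OF z w] by (simp add: c)
      have weight: "D.deriv_weight ?a b c = (if ?z + shift k = x then index_sign (m, j, k) else 0)"
        unfolding b c y_def
        by (rule deriv_weight_lift) (use x y z w rep in \<open>simp_all only: y_def\<close>)
      have "?z + shift k \<noteq> x"
      proof
        assume eq: "?z + shift k = x"
        have "p \<in> ?K j k"
          using z by (simp add: bc b c)
        moreover have "shift m + shift j + shift k = 0"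
          using eq by (simp add: y_def ac_simps)
        ultimately show False
          using directions p(2) by blast
      qed
      then show ?thesis
        using weight arcs by (simp add: bc)
    next
      case (Beta l)
      then have l: "s mod 3 = 1" "l \<in> {0, 1, 2}" "rep y = before_ctr"
        using arcs(1) ends(1) by (simp_all add: quiver_D_simps)
      then have c: "c = Gamma l"
        using ends(2) Beta by (cases c) (simp_all add: quiver_D_simps)
      then have rep_x: "rep x = after_ctr"
        using ends(3) by (simp add: quiver_D_simps)
      (* the step into the centre and the step out of it whose ends are the given lifts *)
      let ?j = "- turn y" and ?k = "2 - turn x"
      have "rot (turn y) before_ctr = y" "rot (turn x) after_ctr = x"
        unfolding l(3)[symmetric] rep_x[symmetric] by (rule rot_turn_rep)+
      then have yx: "y = ctr - shift ?j" "x = ctr + shift ?k"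
        by (simp_all add: rot_diff_triple rot_add_triple rot_shift)
      have cN: "ctr \<in> N" using l(1) ctr_mem_iff by simp
      have "y + shift ?j = ctr - shift ?j + shift ?j"
        by (rule arg_cong[OF yx(1), of "\<lambda>u. u + shift ?j"])
      also have "\<dots> = ctr"
        by (rule diff_add_cancel)
      finally have z: "y + shift ?j = ctr" .
      have "p \<in> ?K ?j ?k"
        unfolding z if_P[OF cN] if_P[OF refl] bc Beta c using l(2) by (rule imageI)
      moreover have "shift m + shift ?j + shift ?k = 0"
      proof -
        have "ctr + shift ?k + shift m + shift ?j = x + shift m + shift ?j"
          by (rule arg_cong[OF yx(2)[symmetric], of "\<lambda>u. u + shift m + shift ?j"])
        also have "\<dots> = ctr"
          using z unfolding y_def .
        finally have closed: "ctr + shift ?k + shift m + shift ?j = ctr" .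
        have "shift m + shift ?j + shift ?k = ctr + shift ?k + shift m + shift ?j - ctr"
          by (simp add: ac_simps)
        also have "\<dots> = 0"
          unfolding closed by simp
        finally show ?thesis .
      qed
      ultimately show ?thesis
        using directions p(2) by blast
    next
      case (Gamma l)
      then show ?thesis using ends(1) by (simp add: quiver_D_simps)
    qed
  qed
  have val: "finsum E ?f (?K j k) = index_sign (m, j, k) \<odot>\<^bsub>E\<^esub> path2_value E ar y j k"
    if ret: "y + shift j + shift k = x"
      and jk: "j = m + 1 \<and> k = m + 2 \<or> j = m + 2 \<and> k = m + 1" for j k
  proof (cases "y + shift j \<in> N")
    case zN: True
    show ?thesis
    proof (cases "y + shift j = ctr")
      case True
      then have cN: "ctr \<in> N" using zN by simp
      note ends = at_centre[OF True cN ret]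
      have "turn y = (- j) mod 3" "turn x = (2 - k) mod 3"
        by (subst conjunct1[OF conjunct2[OF ends]], rule turn_before[OF conjunct1[OF ends]],
            subst conjunct2[OF conjunct2[OF ends]], rule turn_after[OF conjunct1[OF ends]])
      note turns = this
      have i: "(m + turn y) mod 3 = (m - j) mod 3" "(turn x - turn y) mod 3 = (2 - k + j) mod 3"
        unfolding turns mod_add_right_eq mod_diff_eq by simp_all
      have alpha: "?a = Alpha (rep x) ((m - j) mod 3) ((2 - k + j) mod 3)"
        unfolding abar_def y_def[symmetric] i ..
      have weight: "D.deriv_weight ?a (Beta l) (Gamma l) = index_sign (m, j, k) * third_root ((j + 2 - k) * l)"
        if l: "l \<in> {0, 1, 2}" for l
        using jk
      proof (elim disjE conjE)
        assume jk: "j = m + 1" "k = m + 2"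
        have v: "(m - j) mod 3 = 2" "(2 - k + j) mod 3 = 1" "index_sign (m, j, k) = 1" "j + 2 - k = 1"
          by (simp_all add: jk index_sign_eq del: index_sign.simps)
        show ?thesis
          unfolding D.deriv_weight_def alpha weight_D.simps v using weight_centre_values(1)[OF l] by simp
      next
        assume jk: "j = m + 2" "k = m + 1"
        have v: "(m - j) mod 3 = 1" "(2 - k + j) mod 3 = 0" "index_sign (m, j, k) = - 1" "j + 2 - k = 3"
          by (simp_all add: jk index_sign_eq del: index_sign.simps)
        show ?thesis
          unfolding D.deriv_weight_def alpha weight_D.simps v third_root_three_mult
          using weight_centre_values(2)[of l] by simp
      qed
      have closed: "ar (Beta l) \<otimes>\<^bsub>E\<^esub> ar (Gamma l) \<in> carrier E" if "l \<in> {0, 1, 2}" for l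
        using that ends by (intro E.m_closed ar_closed) (simp_all only: quiver_D_simps simp_thms)
      have inj: "inj_on (\<lambda>l. (Beta l, Gamma l)) {0, 1, 2}"
        by (rule inj_onI) simp
      have K: "?K j k = (\<lambda>l. (Beta l, Gamma l)) ` {0, 1, 2}"
        unfolding True if_P[OF cN] if_P[OF refl] ..
      have "finsum E ?f (?K j k) = (\<Oplus>\<^bsub>E\<^esub>l\<in>{0, 1, 2}. ?f (Beta l, Gamma l))"
        unfolding K by (rule E.finsum_reindex[OF _ inj]) (use closed in auto)
      also have "\<dots> = (\<Oplus>\<^bsub>E\<^esub>l\<in>{0, 1, 2}. index_sign (m, j, k) \<odot>\<^bsub>E\<^esub>
          (third_root ((j + 2 - k) * l) \<odot>\<^bsub>E\<^esub> (ar (Beta l) \<otimes>\<^bsub>E\<^esub> ar (Gamma l))))"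
        using closed weight by (intro E.finsum_eqI) (simp_all only: fst_conv snd_conv E.scale_scale E.scale_closed)
      also have "\<dots> = index_sign (m, j, k) \<odot>\<^bsub>E\<^esub> path2_value E ar y j k"
        unfolding path2_value_def if_P[OF conjI[OF True cN]]
        by (rule E.finsum_scale[symmetric]) (rule Pi_I, rule E.scale_closed, rule closed)
      finally show ?thesis .
    next
      case False
      with zN have z: "y + shift j \<in> inner" by blast
      have w: "y + shift j + shift k \<in> inner" using x ret by simp
      have weight: "D.deriv_weight ?a (abar y j) (abar (y + shift j) k) = index_sign (m, j, k)"
      proof -
        have "D.deriv_weight (abar x m) (abar (x + shift m) j) (abar (x + shift m + shift j) k) =
            (if x + shift m + shift j + shift k = x then index_sign (m, j, k) else 0)"
          using x y z w ret by (intro deriv_weight_lift) (simp_all only: y_def)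
        then show ?thesis
          using ret by (simp only: y_def if_True simp_thms)
      qed
      have K: "?K j k = {(abar y j, abar (y + shift j) k)}"
        using zN False by simp
      have "ar (abar y j) \<otimes>\<^bsub>E\<^esub> ar (abar (y + shift j) k) \<in> carrier E"
        using abar_arc(1)[OF y z] abar_arc(1)[OF z w] by simp
      moreover have "path2_value E ar y j k = ar (abar y j) \<otimes>\<^bsub>E\<^esub> ar (abar (y + shift j) k)"
        using False y z w by (simp add: path2_value_def step_value_def)
      ultimately show ?thesis
        unfolding K using weight by (simp add: E.finsum_insert del: index_sign.simps)
    qed
  next
    case False
    then have out: "\<not> (y \<in> inner \<and> y + shift j \<in> inner)" "\<not> (y + shift j = ctr \<and> ctr \<in> N)"
      by auto
    have "step_value E ar y j = \<zero>\<^bsub>E\<^esub>"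
      unfolding step_value_def by (rule if_not_P[OF out(1)])
    then have "path2_value E ar y j k = \<zero>\<^bsub>E\<^esub>"
      unfolding path2_value_def if_not_P[OF out(2)] using E.l_null[OF step_closed] by (simp only:)
    then show ?thesis
      unfolding if_not_P[OF False] by (simp only: E.finsum_empty E.scale_zero_right)
  qed
  (* the two ways back use different arrows, so no completion is counted twice *)
  have shift_ne: "shift (m + 1) \<noteq> shift (m + 2)"
  proof
    assume "shift (m + 1) = shift (m + 2)"
    then have "(m + 1 - (m + 1)) mod 3 = (m + 2 - (m + 1)) mod 3"
      unfolding shift_eq_iff by (rule mod_diff_cong) (rule refl)
    then show False by simp
  qed
  have disjoint: "?K (m + 1) (m + 2) \<inter> ?K (m + 2) (m + 1) = {}"
  proof -
    have ne: "abar y (m + 1) \<noteq> abar y (m + 2)"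
    proof
      assume eq: "abar y (m + 1) = abar y (m + 2)"
      let ?t = "turn (y + shift (m + 1))" and ?u = "turn (y + shift (m + 2))"
      have "(turn y - ?t) mod 3 = (turn y - ?u) mod 3" "(m + 1 + ?t) mod 3 = (m + 2 + ?u) mod 3"
        using eq by (simp_all only: abar_def d_arrow.inject)
      then have "(turn y - ?t + (m + 1 + ?t)) mod 3 = (turn y - ?u + (m + 2 + ?u)) mod 3"
        by (rule mod_add_cong)
      then have "(turn y + (m + 1)) mod 3 = (turn y + (m + 2)) mod 3" by (simp add: algebra_simps)
      then have "(turn y + (m + 1) - turn y) mod 3 = (turn y + (m + 2) - turn y) mod 3"
        by (rule mod_diff_cong) (rule refl)
      then have "(m + 1) mod 3 = (m + 2) mod 3" by simp
      then show False
        using shift_ne unfolding shift_eq_iff by blast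
    qed
    have ne_centre: "\<not> (y + shift (m + 1) = ctr \<and> y + shift (m + 2) = ctr)"
    proof
      assume "y + shift (m + 1) = ctr \<and> y + shift (m + 2) = ctr"
      then have "y + shift (m + 1) = y + shift (m + 2)" by (simp only:)
      then show False using shift_ne by (simp only: add_left_cancel)
    qed
    have not_Beta: "abar y j \<noteq> Beta l" for j l
      unfolding abar_def by simp
    have first: "fst p = abar y j \<or> y + shift j = ctr \<and> (\<exists>l. fst p = Beta l)" if "p \<in> ?K j k" for p j k
      using that by (auto split: if_splits)
    show ?thesis
    proof (rule equals0I)
      fix p assume "p \<in> ?K (m + 1) (m + 2) \<inter> ?K (m + 2) (m + 1)"
      then have "p \<in> ?K (m + 1) (m + 2)" "p \<in> ?K (m + 2) (m + 1)"
        by (rule IntD1, rule IntD2)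
      from first[OF this(1)] first[OF this(2)] show False
        using ne ne_centre not_Beta by metis
    qed
  qed
  have closed: "?f \<in> D.completions ?a \<rightarrow> carrier E"
    by (auto simp: D.completions_def D.cycles_iff)
  have finite_K: "finite (?K j k)" for j k by simp
  note K1 = sub[OF ret(1)] and K2 = sub[OF ret(2)]
  have "finsum E ?f (?K (m + 1) (m + 2) \<union> ?K (m + 2) (m + 1)) = finsum E ?f (D.completions ?a)"
  proof (rule E.finsum_mono_neutral[OF D.finite_completions Un_least[OF K1 K2]])
    fix q assume q: "q \<in> D.completions ?a - (?K (m + 1) (m + 2) \<union> ?K (m + 2) (m + 1))"
    show "?f q = \<zero>\<^bsub>E\<^esub>"
      using q by (intro others) (simp_all only: Diff_iff simp_thms)
  next
    fix q assume q: "q \<in> ?K (m + 1) (m + 2) \<union> ?K (m + 2) (m + 1)"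
    show "?f q \<in> carrier E"
      by (rule funcset_mem[OF closed subsetD[OF Un_least[OF K1 K2] q]])
  qed
  then have "finsum E ?f (D.completions ?a) = finsum E ?f (?K (m + 1) (m + 2) \<union> ?K (m + 2) (m + 1))"
    by (rule sym)
  also have "\<dots> = finsum E ?f (?K (m + 1) (m + 2)) \<oplus>\<^bsub>E\<^esub> finsum E ?f (?K (m + 2) (m + 1))"
    by (rule E.finsum_Un_disjoint[OF finite_K finite_K disjoint])
      (rule Pi_I, rule funcset_mem[OF closed], erule subsetD[OF K1], rule Pi_I, rule funcset_mem[OF closed], erule subsetD[OF K2])
  also have "\<dots> = 1 \<odot>\<^bsub>E\<^esub> path2_value E ar y (m + 1) (m + 2) \<oplus>\<^bsub>E\<^esub> (- 1) \<odot>\<^bsub>E\<^esub> path2_value E ar y (m + 2) (m + 1)"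
  proof -
    have signs: "index_sign (m, m + 1, m + 2) = 1" "index_sign (m, m + 2, m + 1) = - 1"
      by (simp_all add: index_sign_eq del: index_sign.simps)
    show ?thesis
      using val[OF ret(1)] val[OF ret(2)] unfolding signs by (simp only: simp_thms)
  qed
  finally show ?thesis
  proof -
    have "path2_value E ar y j k \<in> carrier E" for j k
      unfolding path2_value_def using step_closed ctr_mem_iff
      by (auto simp: quiver_D_simps intro!: E.finsum_closed E.scale_closed E.m_closed ar_closed)
    then show "finsum E ?f (D.completions ?a) = 1 \<odot>\<^bsub>E\<^esub> path2_value E ar y (m + 1) (m + 2) \<oplus>\<^bsub>E\<^esub>
        (- 1) \<odot>\<^bsub>E\<^esub> path2_value E ar y (m + 2) (m + 1) \<Longrightarrow> ?thesis"
      by (simp add: E.scale_minus_one E.minus_eq)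
  qed
qed

text \<open>
  The two arrows that lie under the steps around the centre, from the end points of the steps out of
  it to the starting points of the steps into it.
\<close>

abbreviation "straight \<equiv> Alpha after_ctr 1 0"
abbreviation "twisted \<equiv> Alpha after_ctr 2 1"

lemma centre_arrows:
  assumes "s mod 3 = 1"
  shows "straight \<in> arcs QD" "twisted \<in> arcs QD"
    "head QD straight = Pt before_ctr" "head QD twisted = Pt before_ctr"
proof -
  have "after_ctr + shift 1 = before_ctr" "rot 1 after_ctr + shift 2 = before_ctr"
    unfolding rot_add_shift rot_ctr by (cases ctr; simp add: shift_def)+
  then show "straight \<in> arcs QD" "twisted \<in> arcs QD"
    "head QD straight = Pt before_ctr" "head QD twisted = Pt before_ctr"
    using before_ctr_mem[OF assms] after_ctr_mem[OF assms]
    by (simp_all only: arc_Alpha rot_zero head_Alpha[of 0] head_Alpha[of 1] insert_iff simp_thms)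
qed

lemma abar_centre:
  assumes "s mod 3 = 1"
  shows "abar (ctr + shift (j + 1)) j = straight" "abar (ctr + shift (j + 2)) j = twisted"
proof -
  have sum: "shift (j + 1) + shift j = - shift (j + 2)" "shift (j + 2) + shift j = - shift (j + 1)"
    using shift_sum_zero_iff[of j "j + 1" "j + 2"] by (simp_all add: eq_neg_iff_add_eq_0 ac_simps)
  have ends: "ctr + shift (j + 1) + shift j = ctr - shift (j + 2)" "ctr + shift (j + 2) + shift j = ctr - shift (j + 1)"
    unfolding add.assoc sum by simp_all
  have mods: "(j + (- (j + 2)) mod 3) mod 3 = 1" "(j + (- (j + 1)) mod 3) mod 3 = 2"
    "((2 - (j + 1)) mod 3 - (- (j + 2)) mod 3) mod 3 = 0" "((2 - (j + 2)) mod 3 - (- (j + 1)) mod 3) mod 3 = 1"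
    unfolding mod_add_right_eq mod_diff_eq by simp_all
  show "abar (ctr + shift (j + 1)) j = straight" "abar (ctr + shift (j + 2)) j = twisted"
    unfolding abar_def ends rep_after[OF assms] turn_after[OF assms] turn_before[OF assms] mods by simp_all
qed

lemma relation_D_centre:
  fixes E :: "(complex, 'e) module" and ar ev
  assumes "quiver_rep QD E ev ar" and s: "s mod 3 = 1" and l: "l \<in> {0, 1, 2}"
  shows "(\<Oplus>\<^bsub>E\<^esub>p\<in>D.completions (Beta l). D.deriv_weight (Beta l) (fst p) (snd p) \<odot>\<^bsub>E\<^esub>
      (ar (fst p) \<otimes>\<^bsub>E\<^esub> ar (snd p))) =
    third_root l \<odot>\<^bsub>E\<^esub> (ar (Gamma l) \<otimes>\<^bsub>E\<^esub> ar twisted) \<ominus>\<^bsub>E\<^esub> ar (Gamma l) \<otimes>\<^bsub>E\<^esub> ar straight"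
    and "(\<Oplus>\<^bsub>E\<^esub>p\<in>D.completions (Gamma l). D.deriv_weight (Gamma l) (fst p) (snd p) \<odot>\<^bsub>E\<^esub>
      (ar (fst p) \<otimes>\<^bsub>E\<^esub> ar (snd p))) =
    third_root l \<odot>\<^bsub>E\<^esub> (ar twisted \<otimes>\<^bsub>E\<^esub> ar (Beta l)) \<ominus>\<^bsub>E\<^esub> ar straight \<otimes>\<^bsub>E\<^esub> ar (Beta l)"
proof -
  interpret quiver_rep QD E ev ar by fact
  note arrows = centre_arrows[OF s]
  have BG: "Beta l \<in> arcs QD" "Gamma l \<in> arcs QD"
    using s l by (simp_all only: quiver_D_simps simp_thms)
  note [simp] = ar_closed[OF BG(1)] ar_closed[OF BG(2)] ar_closed[OF arrows(1)] ar_closed[OF arrows(2)]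
  have weights: "D.deriv_weight (Beta l) (Gamma l) straight = - 1" "D.deriv_weight (Beta l) (Gamma l) twisted = third_root l"
    "D.deriv_weight (Gamma l) straight (Beta l) = - 1" "D.deriv_weight (Gamma l) twisted (Beta l) = third_root l"
    using weight_centre_values(1)[OF l] weight_centre_values(2)[of l] by (simp_all add: D.deriv_weight_def)
  have other: "weight_centre i j l = 0" if "(i, j) \<noteq> (1, 0)" "(i, j) \<noteq> (2, 1)" for i j
    using that by (simp add: weight_centre_def)
  let ?f = "\<lambda>p. D.deriv_weight (Beta l) (fst p) (snd p) \<odot>\<^bsub>E\<^esub> (ar (fst p) \<otimes>\<^bsub>E\<^esub> ar (snd p))"
  have "finsum E ?f {(Gamma l, twisted), (Gamma l, straight)} = finsum E ?f (D.completions (Beta l))"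
  proof (rule E.finsum_mono_neutral[OF D.finite_completions])
    show "{(Gamma l, twisted), (Gamma l, straight)} \<subseteq> D.completions (Beta l)"
      using arrows BG by (auto simp: D.completions_def D.cycles_iff quiver_D_simps)
    fix p assume p: "p \<in> D.completions (Beta l) - {(Gamma l, twisted), (Gamma l, straight)}"
    obtain b c where bc: "p = (b, c)" by (cases p)
    have arcs: "b \<in> arcs QD" "c \<in> arcs QD" and ends: "tail QD b = Centre l" "head QD b = tail QD c" "head QD c = Pt before_ctr"
      using p by (auto simp: bc D.completions_def D.cycles_iff quiver_D_simps)
    have b: "b = Gamma l" using ends(1) by (cases b) (simp_all add: quiver_D_simps)
    then have "tail QD c = Pt after_ctr" using ends(2) by (simp add: quiver_D_simps)
    moreover obtain q i j where c: "c = Alpha q i j"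
      using ends(3) calculation \<open>tail QD c = Pt after_ctr\<close> by (cases c) (auto simp: quiver_D_simps)
    ultimately have "q = after_ctr" by (simp add: quiver_D_simps)
    then have "(i, j) \<noteq> (1, 0)" "(i, j) \<noteq> (2, 1)"
      using p by (auto simp: bc b c)
    then have "D.deriv_weight (Beta l) b c = 0"
      using other[of i j] by (simp add: D.deriv_weight_def b c)
    then show "?f p = \<zero>\<^bsub>E\<^esub>"
      using arcs by (simp add: bc)
  qed (auto simp: weights)
  then show "finsum E ?f (D.completions (Beta l)) =
    third_root l \<odot>\<^bsub>E\<^esub> (ar (Gamma l) \<otimes>\<^bsub>E\<^esub> ar twisted) \<ominus>\<^bsub>E\<^esub> ar (Gamma l) \<otimes>\<^bsub>E\<^esub> ar straight"
    by (simp add: weights E.finsum_insert E.scale_minus_one E.minus_eq)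
  let ?g = "\<lambda>p. D.deriv_weight (Gamma l) (fst p) (snd p) \<odot>\<^bsub>E\<^esub> (ar (fst p) \<otimes>\<^bsub>E\<^esub> ar (snd p))"
  have "finsum E ?g {(twisted, Beta l), (straight, Beta l)} = finsum E ?g (D.completions (Gamma l))"
  proof (rule E.finsum_mono_neutral[OF D.finite_completions])
    show "{(twisted, Beta l), (straight, Beta l)} \<subseteq> D.completions (Gamma l)"
      using arrows BG by (auto simp: D.completions_def D.cycles_iff quiver_D_simps)
    fix p assume p: "p \<in> D.completions (Gamma l) - {(twisted, Beta l), (straight, Beta l)}"
    obtain b c where bc: "p = (b, c)" by (cases p)
    have arcs: "b \<in> arcs QD" "c \<in> arcs QD" and ends: "tail QD b = Pt after_ctr" "head QD b = tail QD c" "head QD c = Centre l"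
      using p by (auto simp: bc D.completions_def D.cycles_iff quiver_D_simps)
    have c: "c = Beta l"
      using ends(3) arcs(2) by (cases c) (auto simp: quiver_D_simps arc_Alpha head_Alpha)
    then have "head QD b = Pt before_ctr" using ends(2) by (simp add: quiver_D_simps)
    then obtain q i j where b: "b = Alpha q i j"
      using ends(1) by (cases b) (auto simp: quiver_D_simps)
    then have "q = after_ctr" using ends(1) by (simp add: quiver_D_simps)
    then have "(i, j) \<noteq> (1, 0)" "(i, j) \<noteq> (2, 1)"
      using p by (auto simp: bc b c)
    then have "D.deriv_weight (Gamma l) b c = 0"
      using other[of i j] by (simp add: D.deriv_weight_def b c)
    then show "?g p = \<zero>\<^bsub>E\<^esub>"
      using arcs by (simp add: bc)
  qed (auto simp: weights)
  then show "finsum E ?g (D.completions (Gamma l)) =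
    third_root l \<odot>\<^bsub>E\<^esub> (ar twisted \<otimes>\<^bsub>E\<^esub> ar (Beta l)) \<ominus>\<^bsub>E\<^esub> ar straight \<otimes>\<^bsub>E\<^esub> ar (Beta l)"
    by (simp add: weights E.finsum_insert E.scale_minus_one E.minus_eq)
qed

end


section \<open>The algebra of type D inside the skew group algebra\<close>

context equivariant_rep
begin

text \<open>
  The rotation fixes the centre, so that the vertex at the centre splits into the eigenspaces of
  the rotation; this is the projection to the eigenspace with eigenvalue \<open>third_root k\<close>.
\<close>

definition eps :: "int \<Rightarrow> 'e" where
  "eps k = (1 / 3) \<odot> (\<one> \<oplus> third_root (- k) \<odot> U 1 \<oplus> third_root (- (2 * k)) \<odot> U 2)"

lemma eps_closed [simp]: "eps k \<in> carrier E"
  by (simp add: eps_def)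

lemma U_one_eps: "U 1 \<otimes> eps k = third_root k \<odot> eps k" "eps k \<otimes> U 1 = third_root k \<odot> eps k"
proof -
  have three: "U 3 = \<one>"
    using U_cong[of 3 0] U_zero by simp
  have root: "third_root (- (2 * k)) = third_root k"
    using third_root_add[of "- (2 * k)" "3 * k"] third_root_three_mult[of k] by simp
  have prods: "third_root k * third_root (- k) = 1" "third_root k * third_root k = third_root (- k)"
    using third_root_add[of k "- k"] third_root_add[of k "- (2 * k)"] root by simp_all
  have "third_root k \<odot> eps k =
      (1 / 3) \<odot> (third_root k \<odot> (\<one> \<oplus> third_root (- k) \<odot> U 1 \<oplus> third_root k \<odot> U 2))"
    unfolding eps_def root by (simp add: scale_scale)
  also have "\<dots> = (1 / 3) \<odot> (third_root k \<odot> \<one> \<oplus> U 1 \<oplus> third_root (- k) \<odot> U 2)"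
    by (simp add: scale_add_right scale_scale prods)
  finally have rhs: "third_root k \<odot> eps k = (1 / 3) \<odot> (third_root k \<odot> \<one> \<oplus> U 1 \<oplus> third_root (- k) \<odot> U 2)" .
  show "U 1 \<otimes> eps k = third_root k \<odot> eps k" "eps k \<otimes> U 1 = third_root k \<odot> eps k"
    unfolding rhs by (simp_all add: eps_def root scale_mult_right scale_mult_left r_distr l_distr U_add three a_ac)
qed

lemma U_eps: "U j \<otimes> eps k = third_root (j * k) \<odot> eps k"
  and eps_U: "eps k \<otimes> U j = third_root (j * k) \<odot> eps k"
proof -
  have base: "U r \<otimes> eps k = third_root (r * k) \<odot> eps k \<and> eps k \<otimes> U r = third_root (r * k) \<odot> eps k"
    if "r \<in> {0, 1, 2}" for r
    using that
  proof (elim insertE emptyE)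
    assume r: "r = 2"
    have U2: "U 2 = U 1 \<otimes> U 1" using U_add[of 1 1] by simp
    have two: "third_root (2 * k) = third_root k * third_root k"
      by (simp only: mult_2 third_root_add)
    have "U 2 \<otimes> eps k = U 1 \<otimes> (U 1 \<otimes> eps k)" "eps k \<otimes> U 2 = eps k \<otimes> U 1 \<otimes> U 1"
      by (simp_all add: U2 m_assoc)
    then show ?thesis
      unfolding r two by (simp add: U_one_eps scale_mult_left scale_mult_right scale_scale)
  qed (simp_all add: U_zero U_one_eps)
  have "third_root (j mod 3 * k) = third_root (j * k)"
    by (rule third_root_cong) (rule mod_mult_left_eq)
  then show "U j \<otimes> eps k = third_root (j * k) \<odot> eps k" "eps k \<otimes> U j = third_root (j * k) \<odot> eps k"
    using base[OF mod3_mem[of j]] unfolding U_mod by (simp_all only:)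
qed

lemma eps_eps:
  assumes "k \<in> {0, 1, 2}" "l \<in> {0, 1, 2}"
  shows "eps k \<otimes> eps l = (if k = l then eps l else \<zero>)"
proof -
  have coeffs: "third_root (- k) * third_root l = third_root (l - k)"
    "third_root (- (2 * k)) * third_root (2 * l) = third_root (2 * (l - k))"
    unfolding third_root_add[symmetric] by (rule arg_cong[of _ _ third_root], simp)+
  have "eps k \<otimes> eps l = (1 / 3) \<odot> (\<one> \<otimes> eps l \<oplus> third_root (- k) \<odot> (U 1 \<otimes> eps l) \<oplus>
      third_root (- (2 * k)) \<odot> (U 2 \<otimes> eps l))"
    unfolding eps_def[of k] by (simp add: scale_mult_left l_distr)
  also have "\<dots> = (1 / 3) \<odot> (1 \<odot> eps l \<oplus> third_root (l - k) \<odot> eps l \<oplus> third_root (2 * (l - k)) \<odot> eps l)"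
    using coeffs by (simp add: U_eps scale_scale)
  also have "\<dots> = (1 / 3 * (1 + third_root (l - k) + third_root (2 * (l - k)))) \<odot> eps l"
    by (simp only: scale_add_left[symmetric] scale_scale eps_closed)
  also have "\<dots> = (if k = l then eps l else \<zero>)"
  proof -
    have "(l - k) mod 3 = 0 \<longleftrightarrow> k = l"
      using assms by (elim insertE emptyE) simp_all
    then show ?thesis
      unfolding third_root_orthogonality by simp
  qed
  finally show ?thesis .
qed

lemma eps_sum: "eps 0 \<oplus> (eps 1 \<oplus> eps 2) = \<one>"
proof -
  have eps: "eps k = (1 / 3 * 1) \<odot> \<one> \<oplus> ((1 / 3 * third_root (- k)) \<odot> U 1 \<oplus> (1 / 3 * third_root (- (2 * k))) \<odot> U 2)" for k
    by (simp add: eps_def scale_add_right scale_scale a_assoc)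
  have regroup: "a1 \<oplus> (b1 \<oplus> c1) \<oplus> (a2 \<oplus> (b2 \<oplus> c2) \<oplus> (a3 \<oplus> (b3 \<oplus> c3))) =
      (a1 \<oplus> a2 \<oplus> a3) \<oplus> ((b1 \<oplus> b2 \<oplus> b3) \<oplus> (c1 \<oplus> c2 \<oplus> c3))"
    if "a1 \<in> carrier E" "a2 \<in> carrier E" "a3 \<in> carrier E" "b1 \<in> carrier E" "b2 \<in> carrier E" "b3 \<in> carrier E"
      "c1 \<in> carrier E" "c2 \<in> carrier E" "c3 \<in> carrier E" for a1 a2 a3 b1 b2 b3 c1 c2 c3
    using that by (simp add: a_ac)
  have collect: "(1 / 3 * p) \<odot> x \<oplus> (1 / 3 * q) \<odot> x \<oplus> (1 / 3 * r) \<odot> x = (1 / 3 * (p + q + r)) \<odot> x"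
    if "x \<in> carrier E" for p q r x
    using that by (simp only: scale_add_left[symmetric] distrib_left)
  have zeros: "third_root (- 0) + third_root (- 1) + third_root (- 2) = 0"
    "third_root (- (2 * 0)) + third_root (- (2 * 1)) + third_root (- (2 * 2)) = 0"
    using third_root_orthogonality[of "- 1"] third_root_orthogonality[of "- 2"] by simp_all
  have "eps 0 \<oplus> (eps 1 \<oplus> eps 2) = (1 / 3 * (1 + 1 + 1)) \<odot> \<one> \<oplus>
      ((1 / 3 * (third_root (- 0) + third_root (- 1) + third_root (- 2))) \<odot> U 1 \<oplus>
       (1 / 3 * (third_root (- (2 * 0)) + third_root (- (2 * 1)) + third_root (- (2 * 2)))) \<odot> U 2)"
    unfolding eps by (simp only: regroup collect scale_closed one_closed U_closed)
  also have "\<dots> = \<one>"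
    unfolding zeros by simp
  finally show ?thesis .
qed

lemma U_eigen: "(\<Oplus>l\<in>{0, 1, 2}. third_root (m * l) \<odot> eps l) = U m"
proof -
  have "U m = U m \<otimes> (eps 0 \<oplus> (eps 1 \<oplus> eps 2))"
    unfolding eps_sum by simp
  also have "\<dots> = (\<Oplus>l\<in>{0, 1, 2}. third_root (m * l) \<odot> eps l)"
    by (subst finsum_012) (simp_all add: r_distr U_eps)
  finally show ?thesis by (rule sym)
qed

lemma ev_ctr_eps: "ev ctr \<otimes> eps k = eps k \<otimes> ev ctr"
  by (simp add: eps_def scale_mult_left scale_mult_right l_distr r_distr U_ev)

lemma ar_U: "ar x i \<otimes> U j = U j \<otimes> ar (rot (- j) x) (i + j)"
  by (simp add: U_ar)

text \<open>
  A step is followed by the rotation that brings its end back into the fundamental domain; the steps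
  into and out of the centre are cut down to an eigenspace of the rotation.
\<close>

primrec evD where
  "evD (Pt x) = ev x"
| "evD (Centre k) = ev ctr \<otimes> eps k"

primrec arD where
  "arD (Alpha x i j) = ar x (i + j) \<otimes> U (- j)"
| "arD (Beta k) = ar before_ctr 0 \<otimes> eps k"
| "arD (Gamma k) = eps k \<otimes> ar ctr 2"

lemma quiver_rep_D: "quiver_rep QD E evD arD"
proof unfold_locales
  have not_ctr: "x \<noteq> ctr" if "x \<in> Q0" for x
    using Q0_inner[OF that] by blast
  fix u v assume uv: "u \<in> verts QD" "v \<in> verts QD"
  show "evD u \<in> carrier E" by (cases u) simp_all
  have pc: "ev x \<otimes> (ev ctr \<otimes> eps k) = \<zero>" "ev ctr \<otimes> eps k \<otimes> ev x = \<zero>" if "x \<in> Q0" for x k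
  proof -
    have "ev x \<otimes> (ev ctr \<otimes> eps k) = ev x \<otimes> ev ctr \<otimes> eps k"
      by (simp only: m_assoc ev_closed eps_closed)
    then show "ev x \<otimes> (ev ctr \<otimes> eps k) = \<zero>"
      using not_ctr[OF that] by (simp add: ev_ev)
    have "ev ctr \<otimes> eps k \<otimes> ev x = eps k \<otimes> (ev ctr \<otimes> ev x)"
      by (simp only: ev_ctr_eps m_assoc ev_closed eps_closed)
    then show "ev ctr \<otimes> eps k \<otimes> ev x = \<zero>"
      using not_ctr[OF that] by (simp add: ev_ev)
  qed
  have cc: "ev ctr \<otimes> eps k \<otimes> (ev ctr \<otimes> eps l) = ev ctr \<otimes> (eps k \<otimes> eps l)" for k l
  proof -
    have "ev ctr \<otimes> eps k \<otimes> (ev ctr \<otimes> eps l) = ev ctr \<otimes> (eps k \<otimes> ev ctr) \<otimes> eps l"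
      by (simp add: m_assoc)
    also have "\<dots> = ev ctr \<otimes> ev ctr \<otimes> (eps k \<otimes> eps l)"
      by (simp only: ev_ctr_eps[symmetric] m_assoc ev_closed eps_closed m_closed)
    finally show ?thesis by (simp add: ev_ev)
  qed
  show "evD u \<otimes> evD v = (if u = v then evD u else \<zero>)"
  proof (cases u)
    case u: (Pt x)
    then show ?thesis
      using uv pc by (cases v) (simp_all add: ev_ev quiver_D_simps)
  next
    case u: (Centre k)
    then show ?thesis
      using uv pc cc eps_eps by (cases v) (auto simp: quiver_D_simps)
  qed
next
  fix a assume a: "a \<in> arcs QD"
  show "arD a \<in> carrier E" by (cases a) simp_all
  show "evD (tail QD a) \<otimes> arD a = arD a"
  proof (cases a)
    case (Alpha x i j)
    have "ev x \<otimes> (ar x (i + j) \<otimes> U (- j)) = ev x \<otimes> ar x (i + j) \<otimes> U (- j)"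
      by (simp only: m_assoc ev_closed ar_closed U_closed)
    then show ?thesis by (simp add: Alpha quiver_D_simps ev_ar)
  next
    case (Beta k)
    have "ev before_ctr \<otimes> (ar before_ctr 0 \<otimes> eps k) = ev before_ctr \<otimes> ar before_ctr 0 \<otimes> eps k"
      by (simp only: m_assoc ev_closed ar_closed eps_closed)
    then show ?thesis by (simp add: Beta quiver_D_simps ev_ar)
  next
    case (Gamma k)
    have k: "k \<in> {0, 1, 2}" using a by (simp add: Gamma quiver_D_simps)
    have "ev ctr \<otimes> eps k \<otimes> (eps k \<otimes> ar ctr 2) = eps k \<otimes> ev ctr \<otimes> (eps k \<otimes> ar ctr 2)"
      by (simp only: ev_ctr_eps)
    also have "\<dots> = eps k \<otimes> (ev ctr \<otimes> eps k) \<otimes> ar ctr 2"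
      by (simp only: m_assoc ev_closed ar_closed eps_closed m_closed)
    also have "\<dots> = (eps k \<otimes> eps k) \<otimes> (ev ctr \<otimes> ar ctr 2)"
      by (simp only: ev_ctr_eps m_assoc ev_closed ar_closed eps_closed m_closed)
    finally show ?thesis by (simp add: Gamma quiver_D_simps ev_ar eps_eps[OF k k])
  qed
  show "arD a \<otimes> evD (head QD a) = arD a"
  proof (cases a)
    case (Alpha x i j)
    have j: "j \<in> {0, 1, 2}" using a by (simp add: Alpha arc_Alpha)
    have "U (- j) \<otimes> ev (rot j x + shift i) = ev (x + shift (i + j)) \<otimes> U (- j)"
      by (simp add: U_ev rot_add_shift)
    then have "ar x (i + j) \<otimes> U (- j) \<otimes> ev (rot j x + shift i) = ar x (i + j) \<otimes> ev (x + shift (i + j)) \<otimes> U (- j)"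
      by (simp only: m_assoc ev_closed ar_closed U_closed)
    then show ?thesis by (simp add: Alpha head_Alpha[OF j] ar_ev)
  next
    case (Beta k)
    have k: "k \<in> {0, 1, 2}" using a by (simp add: Beta quiver_D_simps)
    have "ar before_ctr 0 \<otimes> eps k \<otimes> (ev ctr \<otimes> eps k) = ar before_ctr 0 \<otimes> (eps k \<otimes> ev ctr) \<otimes> eps k"
      by (simp only: m_assoc ev_closed ar_closed eps_closed m_closed)
    also have "\<dots> = ar before_ctr 0 \<otimes> ev ctr \<otimes> (eps k \<otimes> eps k)"
      by (simp only: ev_ctr_eps[symmetric] m_assoc ev_closed ar_closed eps_closed m_closed)
    also have "ar before_ctr 0 \<otimes> ev ctr = ar before_ctr 0"
      using ar_ev[of before_ctr 0] by (simp only: diff_add_cancel)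
    finally show ?thesis by (simp add: Beta quiver_D_simps eps_eps[OF k k])
  next
    case (Gamma k)
    then show ?thesis
      using ar_ev[of ctr 2] by (simp add: quiver_D_simps m_assoc)
  qed
qed

text \<open>
  The powers of the rotation at the two ends cancel in products along lifted paths, which are thus
  products in the triangle up to the rotations at the outer ends.
\<close>

lemma arD_abar: "arD (abar x m) = U (- turn x) \<otimes> ar x m \<otimes> U (turn (x + shift m))"
proof -
  let ?t = "turn x" and ?u = "turn (x + shift m)"
  have "ar (rep x) ((m + ?u) mod 3 + (?t - ?u) mod 3) = ar (rep x) (m + ?t)"
    by (rule ar_cong) (simp add: mod_add_eq)
  moreover have "U (- ((?t - ?u) mod 3)) = U (- ?t + ?u)"
    by (rule U_cong) (simp add: mod_minus_eq)
  ultimately have "arD (abar x m) = ar (rep x) (m + ?t) \<otimes> U (- ?t + ?u)"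
    by (simp only: abar_def arD.simps)
  also have "\<dots> = ar (rot (- ?t) x) (m - - ?t) \<otimes> U (- ?t) \<otimes> U ?u"
    by (simp only: rep_def U_add[symmetric] m_assoc ar_closed U_closed diff_minus_eq_add)
  finally show ?thesis by (simp only: U_ar)
qed

lemma step_value_D:
  assumes "x \<noteq> ctr" "x + shift m \<noteq> ctr"
  shows "step_value E arD x m = U (- turn x) \<otimes> ar x m \<otimes> U (turn (x + shift m))"
proof (cases "x \<in> N \<and> x + shift m \<in> N")
  case True
  then have "x \<in> inner \<and> x + shift m \<in> inner" using assms by blast
  then show ?thesis
    unfolding step_value_def by (simp only: if_True arD_abar simp_thms)
next
  case False
  then have out: "\<not> (x \<in> inner \<and> x + shift m \<in> inner)" "x \<notin> N \<or> x + shift m \<notin> N" by blast+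
  show ?thesis
    unfolding step_value_def if_not_P[OF out(1)] ar_outside[OF out(2)] by simp
qed

lemma path2_value_D:
  assumes "y \<noteq> ctr" "x \<noteq> ctr" and x: "y + shift j + shift k = x"
  shows "path2_value E arD y j k = U (- turn y) \<otimes> (ar y j \<otimes> ar (y + shift j) k) \<otimes> U (turn x)"
proof (cases "y + shift j = ctr")
  case False
  let ?z = "y + shift j"
  have "path2_value E arD y j k = U (- turn y) \<otimes> ar y j \<otimes> U (turn ?z) \<otimes> (U (- turn ?z) \<otimes> ar ?z k \<otimes> U (turn x))"
    using step_value_D[OF assms(1) False] step_value_D[of ?z k] False assms(2) unfolding x path2_value_def
    by simp
  also have "\<dots> = U (- turn y) \<otimes> ar y j \<otimes> (U (turn ?z) \<otimes> U (- turn ?z)) \<otimes> (ar ?z k \<otimes> U (turn x))"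
    by (simp only: m_assoc ar_closed U_closed m_closed)
  also have "U (turn ?z) \<otimes> U (- turn ?z) = \<one>"
    by (simp add: U_add U_zero)
  finally show ?thesis by (simp add: m_assoc)
next
  case True
  show ?thesis
  proof (cases "ctr \<in> N")
    case False
    then have out: "\<not> (y + shift j = ctr \<and> ctr \<in> N)" "\<not> (y \<in> inner \<and> y + shift j \<in> inner)" "y \<notin> N \<or> y + shift j \<notin> N"
      using True by auto
    have "step_value E arD (y + shift j) k \<in> carrier E"
      unfolding step_value_def using arD_abar by simp
    then show ?thesis
      unfolding path2_value_def if_not_P[OF out(1)] ar_outside[OF out(3)] step_value_def[of E arD y] if_not_P[OF out(2)]
      by simp
  next
    case cN: True
    then have s3: "s mod 3 = 1" using ctr_mem_iff by simp
    have y: "y = ctr - shift j" and xc: "x = ctr + shift k"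
      using True x by (simp_all add: eq_diff_eq)
    have Uy: "U (- turn y) = U j"
      unfolding y turn_before[OF s3] by (rule U_cong) (simp add: mod_minus_eq)
    have Ux: "U (turn x) = U (2 - k)"
      unfolding xc turn_after[OF s3] by (rule U_mod)
    let ?a = "ar before_ctr 0" and ?b = "ar ctr 2" and ?n = "j + 2 - k"
    have BG: "arD (Beta l) \<otimes> arD (Gamma l) = ?a \<otimes> eps l \<otimes> ?b" if "l \<in> {0, 1, 2}" for l
    proof -
      have "arD (Beta l) \<otimes> arD (Gamma l) = ?a \<otimes> (eps l \<otimes> eps l) \<otimes> ?b"
        by (simp add: m_assoc)
      then show ?thesis by (simp add: eps_eps[OF that that])
    qed
    have "path2_value E arD y j k = (\<Oplus>l\<in>{0, 1, 2}. third_root (?n * l) \<odot> (?a \<otimes> eps l \<otimes> ?b))"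
      unfolding path2_value_def if_P[OF conjI[OF True cN]]
      by (rule finsum_eqI) (simp_all only: BG scale_closed m_closed ar_closed eps_closed)
    also have "\<dots> = ?a \<otimes> (\<Oplus>l\<in>{0, 1, 2}. third_root (?n * l) \<odot> eps l) \<otimes> ?b"
      by (subst (1 2) finsum_012) (simp_all add: l_distr r_distr scale_mult_left scale_mult_right)
    also have "\<dots> = ?a \<otimes> U ?n \<otimes> ?b"
      by (simp only: U_eigen)
    also have "U ?n = U j \<otimes> U (2 - k)"
      by (simp add: U_add algebra_simps)
    also have "?a \<otimes> (U j \<otimes> U (2 - k)) \<otimes> ?b = (?a \<otimes> U j) \<otimes> (U (2 - k) \<otimes> ?b)"
      by (simp only: m_assoc ar_closed U_closed m_closed)
    also have "?a \<otimes> U j = U j \<otimes> ar y j"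
      by (simp add: U_ar y rot_diff_triple rot_shift)
    also have "U (2 - k) \<otimes> ?b = ar ctr k \<otimes> U (2 - k)"
      by (simp add: U_ar)
    finally show ?thesis
      unfolding Uy Ux True by (simp add: m_assoc)
  qed
qed

text \<open>
  Both terms of the relation of an arrow \<open>Alpha p i j\<close> lift to ways around the same square, which
  commutes.  For \<open>Beta l\<close> and \<open>Gamma l\<close> a rotation has to be moved past the projection \<open>eps l\<close>; this
  costs the factor \<open>third_root l\<close>, which is the coefficient of the twisted arrow.
\<close>

lemma qp_rep_D: "qp_rep QD weight_D E evD arD"
proof -
  interpret rep: quiver_rep QD E evD arD by (rule quiver_rep_D)
  show ?thesis
  proof unfold_locales
    fix a assume a: "a \<in> arcs QD"
    show "(\<Oplus>p\<in>D.completions a. D.deriv_weight a (fst p) (snd p) \<odot> (arD (fst p) \<otimes> arD (snd p))) = \<zero>"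
    proof (cases a)
      case (Alpha p i j)
      then have "p \<in> Q0" using a by (simp add: arc_Alpha)
      then have p: "p \<in> inner" "p = rep p"
        using Q0_inner turn_fundamental by simp_all
      obtain m where m: "a = abar p m" and y: "p + shift m \<in> inner"
        using arc_is_abar[OF a[unfolded Alpha] p(2) p(1)] Alpha by blast
      have ret: "p + shift m + shift (m + 1) + shift (m + 2) = p" "p + shift m + shift (m + 2) + shift (m + 1) = p"
        using shift_sum_zero_iff[of m "m + 1" "m + 2"] by (simp_all add: add.assoc ac_simps)
      have ne: "p + shift m \<noteq> ctr" "p \<noteq> ctr" using y p by blast+
      show ?thesis
        unfolding m relation_D_step[OF quiver_rep_D p(1) y] path2_value_D[OF ne ret(1)] path2_value_D[OF ne ret(2)]
          commute[of "p + shift m" "m + 1" "m + 2"]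
        by (simp add: r_right_minus_eq)
    next
      case (Beta l)
      have s3: "s mod 3 = 1" and l: "l \<in> {0, 1, 2}"
        using a by (simp_all add: Beta quiver_D_simps)
      have "third_root l \<odot> (arD (Gamma l) \<otimes> arD twisted) = third_root (1 * l) \<odot> eps l \<otimes> (ar ctr 2 \<otimes> (ar after_ctr 3 \<otimes> U (- 1)))"
        by (simp add: scale_mult_left scale_mult_right m_assoc)
      also have "\<dots> = eps l \<otimes> U 1 \<otimes> (ar ctr 2 \<otimes> (ar after_ctr 3 \<otimes> U (- 1)))"
        by (simp only: eps_U)
      also have "\<dots> = eps l \<otimes> (U 1 \<otimes> ar ctr 2) \<otimes> (ar after_ctr 3 \<otimes> U (- 1))"
        by (simp only: m_assoc ar_closed U_closed eps_closed m_closed)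
      also have "U 1 \<otimes> ar ctr 2 = ar ctr 1 \<otimes> U 1"
        by (simp add: U_ar)
      also have "eps l \<otimes> (ar ctr 1 \<otimes> U 1) \<otimes> (ar after_ctr 3 \<otimes> U (- 1)) = eps l \<otimes> ar ctr 1 \<otimes> (U 1 \<otimes> ar after_ctr 3) \<otimes> U (- 1)"
        by (simp only: m_assoc ar_closed U_closed eps_closed m_closed)
      also have "U 1 \<otimes> ar after_ctr 3 = ar (ctr + shift 1) 2 \<otimes> U 1"
        by (simp add: U_ar rot_add_shift)
      also have "eps l \<otimes> ar ctr 1 \<otimes> (ar (ctr + shift 1) 2 \<otimes> U 1) \<otimes> U (- 1) =
          eps l \<otimes> (ar ctr 1 \<otimes> ar (ctr + shift 1) 2) \<otimes> (U 1 \<otimes> U (- 1))"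
        by (simp only: m_assoc ar_closed U_closed eps_closed m_closed)
      also have "\<dots> = arD (Gamma l) \<otimes> arD straight"
        by (simp add: commute[of ctr 1 2] U_add U_zero m_assoc)
      finally show ?thesis
        unfolding Beta relation_D_centre(1)[OF quiver_rep_D s3 l] by (simp add: r_right_minus_eq)
    next
      case (Gamma l)
      have s3: "s mod 3 = 1" and l: "l \<in> {0, 1, 2}"
        using a by (simp_all add: Gamma quiver_D_simps)
      have ends: "after_ctr + shift 3 = ctr - shift 1" "after_ctr + shift 1 = before_ctr"
        using shift_sum_zero_iff[of 1 2 3] shift_sum_zero_iff[of 0 1 2] by (simp_all add: eq_diff_eq ac_simps)
      have "third_root l \<odot> (arD twisted \<otimes> arD (Beta l)) = ar after_ctr 3 \<otimes> U (- 1) \<otimes> (ar before_ctr 0 \<otimes> (third_root (1 * l) \<odot> eps l))"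
        by (simp add: scale_mult_left scale_mult_right m_assoc)
      also have "\<dots> = ar after_ctr 3 \<otimes> U (- 1) \<otimes> (ar before_ctr 0 \<otimes> (U 1 \<otimes> eps l))"
        by (simp only: U_eps)
      also have "\<dots> = ar after_ctr 3 \<otimes> (U (- 1) \<otimes> ar before_ctr 0) \<otimes> (U 1 \<otimes> eps l)"
        by (simp only: m_assoc ar_closed U_closed eps_closed m_closed)
      also have "U (- 1) \<otimes> ar before_ctr 0 = ar (ctr - shift 1) 1 \<otimes> U (- 1)"
        by (simp add: U_ar rot_diff_triple rot_shift)
      also have "ar after_ctr 3 \<otimes> (ar (ctr - shift 1) 1 \<otimes> U (- 1)) \<otimes> (U 1 \<otimes> eps l) =
          ar after_ctr 3 \<otimes> ar (ctr - shift 1) 1 \<otimes> (U (- 1) \<otimes> U 1) \<otimes> eps l"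
        by (simp only: m_assoc ar_closed U_closed eps_closed m_closed)
      also have "ar after_ctr 3 \<otimes> ar (ctr - shift 1) 1 = ar after_ctr 1 \<otimes> ar before_ctr 3"
        using commute[of after_ctr 3 1] unfolding ends .
      also have "ar before_ctr 3 = ar before_ctr 0"
        by (rule ar_cong) simp
      also have "ar after_ctr 1 \<otimes> ar before_ctr 0 \<otimes> (U (- 1) \<otimes> U 1) \<otimes> eps l = arD straight \<otimes> arD (Beta l)"
        by (simp add: U_add U_zero m_assoc)
      finally show ?thesis
        unfolding Gamma relation_D_centre(2)[OF quiver_rep_D s3 l] by (simp add: r_right_minus_eq)
    qed
  qed
qed

end


section \<open>Equivariant representations from representations of the quotient\<close>

context triangle
begin

definition index where
  "index = Pt ` inner \<union> (if ctr \<in> N then Centre ` {0, 1, 2} else {})"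

lemma index_iff [simp]: "Pt x \<in> index \<longleftrightarrow> x \<in> inner" "Centre k \<in> index \<longleftrightarrow> ctr \<in> N \<and> k \<in> {0, 1, 2}"
  by (auto simp: index_def)

lemma finite_index: "finite index"
  by (simp add: index_def finite_simplex_points)

primrec point_of where
  "point_of (Pt x) = x"
| "point_of (Centre k) = ctr"

primrec rep_vertex where
  "rep_vertex (Pt x) = Pt (rep x)"
| "rep_vertex (Centre k) = Centre k"

lemma rep_vertex_mem: "u \<in> index \<Longrightarrow> rep_vertex u \<in> verts QD"
  using ctr_mem_iff rep_Q0 by (cases u) (simp_all add: quiver_D_simps)

lemma verts_index: "v \<in> verts QD \<Longrightarrow> v \<in> index"
  using ctr_mem_iff Q0_inner by (cases v) (auto simp: quiver_D_simps)

lemma end_cases: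
  obtains "z = ctr" "ctr \<in> N" | "z \<in> inner" | "z \<notin> N"
  by (cases "z \<in> N"; cases "z = ctr") auto

end

text \<open>
  Conversely, a representation of type D in an algebra \<open>B\<close> unfolds to an equivariant representation
  by linear maps on families of elements of \<open>B\<close>: such a family has one component for each point of
  the triangle other than the centre and three components for the centre.
\<close>

locale unfolded_rep = triangle s + R: qp_rep "quiver_D s" weight_D B be ba
  for s and B :: "(complex, 'b) module" (structure) and be ba
begin

sublocale P: power_of_space B index
  by unfold_locales

abbreviation "families \<equiv> index \<rightarrow>\<^sub>E carrier B"
abbreviation "EndV \<equiv> End_algebra (power_space index B)"

lemma ba_abar [simp]: "x \<in> inner \<Longrightarrow> x + shift i \<in> inner \<Longrightarrow> ba (abar x i) \<in> carrier B"
  by (rule R.ar_closed[OF abar_arc(1)])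

lemma ba_centre [simp]:
  "ctr \<in> N \<Longrightarrow> k \<in> {0, 1, 2} \<Longrightarrow> ba (Beta k) \<in> carrier B"
  "ctr \<in> N \<Longrightarrow> k \<in> {0, 1, 2} \<Longrightarrow> ba (Gamma k) \<in> carrier B"
  using ctr_mem_iff by (intro R.ar_closed; simp only: quiver_D_simps simp_thms)+

lemma centre_neighbours: "ctr \<in> N \<Longrightarrow> ctr + shift i \<in> inner" "ctr \<in> N \<Longrightarrow> ctr - shift i \<in> inner"
  using ctr_mem_iff before_mem[of i] after_mem[of i] by simp_all

definition op where
  "op T = (\<lambda>v\<in>families. \<lambda>u\<in>index. T v u)"

definition linear_op where
  "linear_op T \<longleftrightarrow>
    (\<forall>v\<in>families. \<forall>u\<in>index. T v u \<in> carrier B) \<and>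
    (\<forall>v\<in>families. \<forall>w\<in>families. \<forall>u\<in>index. T (\<lambda>i\<in>index. v i \<oplus> w i) u = T v u \<oplus> T w u) \<and>
    (\<forall>v\<in>families. \<forall>c. \<forall>u\<in>index. T (\<lambda>i\<in>index. c \<odot> v i) u = c \<odot> T v u)"

lemma linear_opI:
  assumes "\<And>v u. v \<in> families \<Longrightarrow> u \<in> index \<Longrightarrow> T v u \<in> carrier B"
    "\<And>v w u. v \<in> families \<Longrightarrow> w \<in> families \<Longrightarrow> u \<in> index \<Longrightarrow> T (\<lambda>i\<in>index. v i \<oplus> w i) u = T v u \<oplus> T w u"
    "\<And>v c u. v \<in> families \<Longrightarrow> u \<in> index \<Longrightarrow> T (\<lambda>i\<in>index. c \<odot> v i) u = c \<odot> T v u"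
  shows "linear_op T"
  using assms by (simp add: linear_op_def)

lemma linear_op_families: "linear_op T \<Longrightarrow> v \<in> families \<Longrightarrow> (\<lambda>u\<in>index. T v u) \<in> families"
  by (auto simp: linear_op_def)

lemma op_linear: "linear_op T \<Longrightarrow> op T \<in> linear_maps (power_space index B)"
proof (rule P.power.linear_mapsI)
  assume T: "linear_op T"
  show "op T \<in> extensional (carrier P.VI)"
    by (simp add: op_def)
  fix v assume v: "v \<in> carrier P.VI"
  then show "op T v \<in> carrier P.VI"
    using linear_op_families[OF T] by (simp add: op_def)
  show "op T (c \<odot>\<^bsub>P.VI\<^esub> v) = c \<odot>\<^bsub>P.VI\<^esub> op T v" for c
    using T v P.power.scale_closed[of v c] by (simp add: op_def linear_op_def cong: restrict_cong)
  fix w assume w: "w \<in> carrier P.VI"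
  show "op T (v \<oplus>\<^bsub>P.VI\<^esub> w) = op T v \<oplus>\<^bsub>P.VI\<^esub> op T w"
    using T v w P.power.a_closed[of v w] by (simp add: op_def linear_op_def cong: restrict_cong)
qed

lemma op_compose: "linear_op T \<Longrightarrow> op S \<otimes>\<^bsub>EndV\<^esub> op T = op (\<lambda>v. S (\<lambda>u\<in>index. T v u))"
  using linear_op_families[of T] by (simp add: op_def compose_def cong: restrict_cong)

lemma op_eqI: "(\<And>v u. v \<in> families \<Longrightarrow> u \<in> index \<Longrightarrow> S v u = T v u) \<Longrightarrow> op S = op T"
  unfolding op_def by (intro restrict_ext) simp

lemma op_zero: "\<zero>\<^bsub>EndV\<^esub> = op (\<lambda>v u. \<zero>)"
  by (simp add: op_def)

lemma op_one: "\<one>\<^bsub>EndV\<^esub> = op (\<lambda>v u. v u)"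
  by (simp add: op_def PiE_restrict cong: restrict_cong)

text \<open>One step in direction \<open>i\<close>, applied to the components over the end point.\<close>

definition step :: "int \<Rightarrow> (d_vertex \<Rightarrow> 'b) \<Rightarrow> d_vertex \<Rightarrow> 'b" where
  "step i v u = (case u of
     Pt x \<Rightarrow>
       if x + shift i = ctr \<and> ctr \<in> N
       then \<Oplus>k\<in>{0, 1, 2}. third_root (i * k) \<odot> (ba (Beta k) \<otimes> v (Centre k))
       else if x + shift i \<in> inner then ba (abar x i) \<otimes> v (Pt (x + shift i)) else \<zero>
   | Centre k \<Rightarrow> third_root ((2 - i) * k) \<odot> (ba (Gamma k) \<otimes> v (Pt (ctr + shift i))))"

text \<open>
  The rotation permutes the points and acts on the components of the centre by its eigenvalues.
\<close>

definition turned :: "int \<Rightarrow> (d_vertex \<Rightarrow> 'b) \<Rightarrow> d_vertex \<Rightarrow> 'b" where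
  "turned j v u = (case u of Pt x \<Rightarrow> v (Pt (rot (- j) x)) | Centre k \<Rightarrow> third_root (j * k) \<odot> v (Centre k))"

definition EV where "EV x = op (\<lambda>v u. if point_of u = x then v u else \<zero>)"
definition AR where "AR x i = op (\<lambda>v u. if point_of u = x then step i v u else \<zero>)"
definition UU where "UU j = op (turned j)"

lemma step_Pt_centre: "x + shift i = ctr \<Longrightarrow> ctr \<in> N \<Longrightarrow>
    step i v (Pt x) = (\<Oplus>k\<in>{0, 1, 2}. third_root (i * k) \<odot> (ba (Beta k) \<otimes> v (Centre k)))"
  by (simp add: step_def)

lemma step_Pt_inner: "x + shift i \<in> inner \<Longrightarrow> step i v (Pt x) = ba (abar x i) \<otimes> v (Pt (x + shift i))"
  by (simp add: step_def)

lemma step_Pt_outside: "x + shift i \<notin> N \<Longrightarrow> step i v (Pt x) = \<zero>"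
  by (auto simp: step_def)

lemma step_Centre: "step i v (Centre k) = third_root ((2 - i) * k) \<odot> (ba (Gamma k) \<otimes> v (Pt (ctr + shift i)))"
  by (simp add: step_def)

lemma step_closed:
  assumes v: "\<And>u. u \<in> index \<Longrightarrow> v u \<in> carrier B" and u: "u \<in> index"
  shows "step i v u \<in> carrier B"
proof (cases u)
  case (Pt x)
  then have x: "x \<in> inner" using u by simp
  consider "x + shift i = ctr" "ctr \<in> N" | "x + shift i \<in> inner" | "x + shift i \<notin> N" by (rule end_cases)
  then show ?thesis
  proof cases
    case 1
    then show ?thesis
      unfolding Pt step_Pt_centre[OF 1] by (intro R.E.finsum_closed Pi_I R.E.scale_closed R.E.m_closed ba_centre v)
        (simp_all only: index_iff simp_thms)
  next
    case 2
    then show ?thesis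
      unfolding Pt step_Pt_inner[OF 2] by (intro R.E.m_closed ba_abar v x) (simp_all only: index_iff)
  next
    case 3
    then show ?thesis
      unfolding Pt step_Pt_outside[OF 3] by simp
  qed
next
  case (Centre k)
  then have k: "ctr \<in> N" "k \<in> {0, 1, 2}" using u by (simp_all only: index_iff)
  show ?thesis
    unfolding Centre step_Centre using centre_neighbours(1)[OF k(1), of i]
    by (intro R.E.scale_closed R.E.m_closed ba_centre v k) (simp_all only: index_iff)
qed

lemma step_add:
  assumes v: "v \<in> families" and w: "w \<in> families" and u: "u \<in> index"
  shows "step i (\<lambda>u\<in>index. v u \<oplus> w u) u = step i v u \<oplus> step i w u"
proof (cases u)
  case (Pt x)
  then have x: "x \<in> inner" using u by simp
  consider "x + shift i = ctr" "ctr \<in> N" | "x + shift i \<in> inner" | "x + shift i \<notin> N" by (rule end_cases)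
  then show ?thesis
  proof cases
    case 1
    then show ?thesis
      unfolding Pt step_Pt_centre[OF 1] using v w
      by (simp add: R.E.finsum_012 R.E.r_distr R.E.scale_add_right R.E.a_ac)
  next
    case 2
    then have "ba (abar x i) \<in> carrier B" "Pt (x + shift i) \<in> index"
      using x by (simp_all only: ba_abar index_iff)
    then show ?thesis
      unfolding Pt step_Pt_inner[OF 2] using v w
      by (simp only: restrict_apply if_True R.E.r_distr P.power_mem)
  next
    case 3
    then show ?thesis
      unfolding Pt step_Pt_outside[OF 3] by simp
  qed
next
  case (Centre k)
  then have k: "ctr \<in> N" "k \<in> {0, 1, 2}" using u by (simp_all only: index_iff)
  then have "ba (Gamma k) \<in> carrier B" "Pt (ctr + shift i) \<in> index"
    using centre_neighbours(1)[OF k(1), of i] by (simp_all only: ba_centre index_iff)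
  then show ?thesis
    unfolding Centre step_Centre using v w
    by (simp only: restrict_apply if_True R.E.r_distr R.E.scale_add_right R.E.m_closed P.power_mem)
qed

lemma step_scale:
  assumes v: "v \<in> families" and u: "u \<in> index"
  shows "step i (\<lambda>u\<in>index. c \<odot> v u) u = c \<odot> step i v u"
proof (cases u)
  case (Pt x)
  then have x: "x \<in> inner" using u by simp
  consider "x + shift i = ctr" "ctr \<in> N" | "x + shift i \<in> inner" | "x + shift i \<notin> N" by (rule end_cases)
  then show ?thesis
  proof cases
    case 1
    then show ?thesis
      unfolding Pt step_Pt_centre[OF 1] using v
      by (simp add: R.E.finsum_012 R.E.scale_mult_right R.E.scale_add_right R.E.scale_scale mult.commute)
  next
    case 2
    then have "ba (abar x i) \<in> carrier B" "Pt (x + shift i) \<in> index"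
      using x by (simp_all only: ba_abar index_iff)
    then show ?thesis
      unfolding Pt step_Pt_inner[OF 2] using v
      by (simp only: restrict_apply if_True R.E.scale_mult_right P.power_mem)
  next
    case 3
    then show ?thesis
      unfolding Pt step_Pt_outside[OF 3] by simp
  qed
next
  case (Centre k)
  then have k: "ctr \<in> N" "k \<in> {0, 1, 2}" using u by (simp_all only: index_iff)
  then have "ba (Gamma k) \<in> carrier B" "Pt (ctr + shift i) \<in> index"
    using centre_neighbours(1)[OF k(1), of i] by (simp_all only: ba_centre index_iff)
  then show ?thesis
    unfolding Centre step_Centre using v
    by (simp only: restrict_apply if_True R.E.scale_mult_right R.E.scale_scale R.E.m_closed P.power_mem mult.commute)
qed

lemma step_agree:
  assumes agree: "\<And>u'. u' \<in> index \<Longrightarrow> point_of u' = point_of u + shift i \<Longrightarrow> v u' = w u'"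
    and w: "\<And>u. u \<in> index \<Longrightarrow> w u \<in> carrier B" and u: "u \<in> index"
  shows "step i v u = step i w u"
proof (cases u)
  case (Pt x)
  then have x: "x \<in> inner" using u by simp
  consider "x + shift i = ctr" "ctr \<in> N" | "x + shift i \<in> inner" | "x + shift i \<notin> N" by (rule end_cases)
  then show ?thesis
  proof cases
    case 1
    have "v (Centre k) = w (Centre k)" if "k \<in> {0, 1, 2}" for k
      by (rule agree) (simp_all only: Pt point_of.simps 1 index_iff that simp_thms)
    then have "v (Centre 0) = w (Centre 0)" "v (Centre 1) = w (Centre 1)" "v (Centre 2) = w (Centre 2)"
      by simp_all
    moreover have "w (Centre 0) \<in> carrier B" "w (Centre 1) \<in> carrier B" "w (Centre 2) \<in> carrier B"
      using w 1 by simp_all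
    ultimately show ?thesis
      unfolding Pt step_Pt_centre[OF 1] using 1(2) by (simp add: R.E.finsum_012)
  next
    case 2
    have "v (Pt (x + shift i)) = w (Pt (x + shift i))"
      by (rule agree) (simp_all only: Pt point_of.simps index_iff 2)
    then show ?thesis
      unfolding Pt step_Pt_inner[OF 2] by (simp only:)
  next
    case 3
    then show ?thesis
      unfolding Pt step_Pt_outside[OF 3] by simp
  qed
next
  case (Centre k)
  then have k: "ctr \<in> N" using u by (simp_all only: index_iff)
  have "v (Pt (ctr + shift i)) = w (Pt (ctr + shift i))"
    by (rule agree) (simp_all only: Centre point_of.simps index_iff centre_neighbours(1)[OF k])
  then show ?thesis
    unfolding Centre step_Centre by (simp only:)
qed

lemma step_mod: "step (i mod 3) v u = step i v u"
proof -
  have "third_root (i mod 3 * k) = third_root (i * k)" for k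
    by (rule third_root_cong) (rule mod_mult_left_eq)
  moreover have "third_root ((2 - i mod 3) * k) = third_root ((2 - i) * k)" for k
    by (rule third_root_cong) (metis mod_diff_right_eq mod_mult_left_eq)
  moreover have "abar x (i mod 3) = abar x i" for x
    by (rule abar_cong) simp
  ultimately show ?thesis
    unfolding step_def shift_mod by (simp only:)
qed

lemma linear_ops: "linear_op (\<lambda>v u. if point_of u = x then v u else \<zero>)"
  "linear_op (\<lambda>v u. if point_of u = x then step i v u else \<zero>)"
  "linear_op (turned j)"
proof -
  show "linear_op (\<lambda>v u. if point_of u = x then v u else \<zero>)"
    by (rule linear_opI) auto
  show "linear_op (\<lambda>v u. if point_of u = x then step i v u else \<zero>)"
    by (rule linear_opI) (simp_all add: step_closed step_add step_scale)
  show "linear_op (turned j)"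
  proof (rule linear_opI)
    fix v w u c assume v: "v \<in> families" and u: "u \<in> index"
    have mem: "Pt (rot (- j) x) \<in> index" if "u = Pt x" for x
      using u unfolding that by (simp only: index_iff inner_rot)
    show "turned j v u \<in> carrier B"
    proof (cases u)
      case (Pt x)
      then show ?thesis using P.power_mem[OF v mem[OF Pt]] by (simp add: turned_def)
    next
      case (Centre k)
      then show ?thesis using P.power_mem[OF v u] by (simp add: turned_def)
    qed
    show "turned j (\<lambda>i\<in>index. c \<odot> v i) u = c \<odot> turned j v u"
    proof (cases u)
      case (Pt x)
      then show ?thesis using mem[OF Pt] by (simp only: turned_def d_vertex.case restrict_apply if_True)
    next
      case (Centre k)
      then show ?thesis
        using P.power_mem[OF v u] u by (simp add: turned_def R.E.scale_scale mult.commute)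
    qed
    assume w: "w \<in> families"
    show "turned j (\<lambda>i\<in>index. v i \<oplus> w i) u = turned j v u \<oplus> turned j w u"
    proof (cases u)
      case (Pt x)
      then show ?thesis using mem[OF Pt] by (simp only: turned_def d_vertex.case restrict_apply if_True)
    next
      case (Centre k)
      then show ?thesis
        using P.power_mem[OF v u] P.power_mem[OF w u] u by (simp add: turned_def R.E.scale_add_right)
    qed
  qed
qed

lemma rot_flip: "rot (- j) y = x \<longleftrightarrow> y = rot j x"
  using rot_eq_iff[of j "rot (- j) y" x] by simp

lemma turned_turned:
  assumes "v \<in> families" "u \<in> index"
  shows "turned i (\<lambda>u\<in>index. turned j v u) u = turned (i + j) v u"
  using assms inner_rot[of "- i"] inner_rot[of "- j"]
  by (cases u) (auto simp: turned_def R.E.scale_scale third_root_add distrib_right ac_simps)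

lemma step_turned:
  assumes v: "v \<in> families" and u: "u \<in> index"
  shows "step (i - j) (\<lambda>u\<in>index. turned j v u) u = turned j (step i v) u"
proof (cases u)
  case (Pt y)
  define x where "x = rot (- j) y"
  have y: "y = rot j x" by (simp add: x_def)
  have x: "x \<in> inner" using u inner_rot[of j x] by (simp only: Pt y index_iff)
  have end_eq: "rot j x + shift (i - j) = rot j (x + shift i)"
    by (rule rot_add_shift[symmetric])
  have lhs: "turned j (step i v) u = step i v (Pt x)"
    by (simp add: Pt turned_def x_def)
  consider "x + shift i = ctr" "ctr \<in> N" | "x + shift i \<in> inner" | "x + shift i \<notin> N" by (rule end_cases)
  then show ?thesis
  proof cases
    case 1
    have "rot j x + shift (i - j) = ctr" unfolding end_eq 1 by simp
    note 2 = this 1(2)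
    have coeff: "third_root ((i - j) * k) * third_root (j * k) = third_root (i * k)" for k
      unfolding third_root_add[symmetric] by (rule arg_cong[of _ _ third_root]) (simp add: algebra_simps)
    show ?thesis
      unfolding lhs unfolding step_Pt_centre[OF 1] Pt y step_Pt_centre[OF 2] using v 1(2) coeff[of 0] coeff[of 1] coeff[of 2]
      by (simp add: R.E.finsum_012 turned_def R.E.scale_mult_right R.E.scale_scale)
  next
    case 2
    have 3: "rot j x + shift (i - j) \<in> inner" unfolding end_eq inner_rot by (rule 2)
    have "(\<lambda>u\<in>index. turned j v u) (Pt (rot j x + shift (i - j))) = v (Pt (x + shift i))"
      using 3 unfolding end_eq by (simp add: turned_def)
    then show ?thesis
      unfolding lhs unfolding step_Pt_inner[OF 2] Pt y step_Pt_inner[OF 3] abar_rot[OF x 2] by (simp only:)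
  next
    case 3
    have 4: "rot j x + shift (i - j) \<notin> N" unfolding end_eq simplex_rot by (rule 3)
    show ?thesis
      unfolding lhs unfolding step_Pt_outside[OF 3] Pt y step_Pt_outside[OF 4] by simp
  qed
next
  case (Centre k)
  then have k: "ctr \<in> N" "k \<in> {0, 1, 2}" using u by (simp_all only: index_iff)
  have "rot (- j) (ctr + shift (i - j)) = ctr + shift i"
    by (simp add: rot_add_shift)
  then have arg: "(\<lambda>u\<in>index. turned j v u) (Pt (ctr + shift (i - j))) = v (Pt (ctr + shift i))"
    using centre_neighbours(1)[OF k(1), of "i - j"] by (simp add: turned_def)
  have coeff: "third_root ((2 - (i - j)) * k) = third_root (j * k) * third_root ((2 - i) * k)"
    unfolding third_root_add[symmetric] by (rule arg_cong[of _ _ third_root]) (simp add: algebra_simps)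
  have closed: "v (Pt (ctr + shift i)) \<in> carrier B"
    using v centre_neighbours(1)[OF k(1), of i] by (intro P.power_mem) (simp_all only: index_iff)
  have "turned j (step i v) (Centre k) = third_root (j * k) \<odot> step i v (Centre k)"
    by (simp add: turned_def)
  then show ?thesis
    unfolding Centre step_Centre arg coeff using closed k
    by (simp only: R.E.scale_scale R.E.m_closed ba_centre)
qed

lemma path2_value_cong:
  assumes "j mod 3 = j' mod 3" "k mod 3 = k' mod 3"
  shows "path2_value B ba y j k = path2_value B ba y j' k'"
proof -
  have "(j + 2 - k) mod 3 = (j' + 2 - k') mod 3"
    using assms by (intro mod_diff_cong mod_add_cong refl)
  then have "third_root ((j + 2 - k) * l) = third_root ((j' + 2 - k') * l)" for l
    by (intro third_root_cong mod_mult_cong refl)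
  then show ?thesis
    unfolding path2_value_def step_value_def shift_cong[OF assms(1)] shift_cong[OF assms(2)]
      abar_cong[OF assms(1)] abar_cong[OF assms(2)] by (simp only:)
qed

lemma shift_third: "shift i + shift (i + 1) + shift (i + 2) = 0"
  using shift_sum_zero_iff[of i "i + 1" "i + 2"] by simp

text \<open>
  This is the relation of the arrow that lies under the step closing the square.
\<close>

lemma square_inner:
  assumes x: "x \<in> inner" and z: "x + shift i + shift (i + 1) \<in> inner"
  shows "path2_value B ba x i (i + 1) = path2_value B ba x (i + 1) i"
proof -
  let ?z = "x + shift i + shift (i + 1)"
  have zx: "?z + shift (i + 2) = x"
    using shift_third[of i] by (simp add: add.assoc)
  have mods: "(i + 2 + 1) mod 3 = i mod 3" "(i + 2 + 2) mod 3 = (i + 1) mod 3"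
    using mod_add_self2[of i 3] mod_add_self2[of "i + 1" 3] by (simp_all add: add.assoc)
  have "abar ?z (i + 2) \<in> arcs QD"
    using abar_arc(1)[of ?z "i + 2"] z x unfolding zx by blast
  from R.relation[OF this]
  have "path2_value B ba x (i + 2 + 1) (i + 2 + 2) \<ominus> path2_value B ba x (i + 2 + 2) (i + 2 + 1) = \<zero>"
    using relation_D_step[OF R.quiver_rep_axioms z, of "i + 2"] x unfolding zx by (simp only:)
  moreover have "path2_value B ba x (i + 2 + 1) (i + 2 + 2) = path2_value B ba x i (i + 1)"
    "path2_value B ba x (i + 2 + 2) (i + 2 + 1) = path2_value B ba x (i + 1) i"
    by (rule path2_value_cong[OF mods(1) mods(2)], rule path2_value_cong[OF mods(2) mods(1)])
  moreover have "path2_value B ba x j k \<in> carrier B" for j k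
  proof -
    have "step_value B ba p i \<in> carrier B" for p i
      unfolding step_value_def by simp
    then show ?thesis
      unfolding path2_value_def by (simp add: R.E.finsum_012)
  qed
  ultimately show ?thesis
    by (simp only: R.E.r_right_minus_eq)
qed

lemma centre_relations:
  assumes "ctr \<in> N" "k \<in> {0, 1, 2}"
  shows "third_root k \<odot> (ba (Gamma k) \<otimes> ba twisted) = ba (Gamma k) \<otimes> ba straight"
    and "third_root k \<odot> (ba twisted \<otimes> ba (Beta k)) = ba straight \<otimes> ba (Beta k)"
    and "ba twisted \<in> carrier B" "ba straight \<in> carrier B"
proof -
  have s3: "s mod 3 = 1" using assms(1) ctr_mem_iff by simp
  show closed: "ba twisted \<in> carrier B" "ba straight \<in> carrier B"
    using R.ar_closed centre_arrows[OF s3] by blast+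
  have arcs: "Beta k \<in> arcs QD" "Gamma k \<in> arcs QD"
    using s3 assms(2) by (simp_all only: quiver_D_simps simp_thms)
  show "third_root k \<odot> (ba (Gamma k) \<otimes> ba twisted) = ba (Gamma k) \<otimes> ba straight"
    using R.relation[OF arcs(1)] unfolding relation_D_centre(1)[OF R.quiver_rep_axioms s3 assms(2)]
    using closed assms by (simp only: R.E.r_right_minus_eq R.E.scale_closed R.E.m_closed ba_centre)
  show "third_root k \<odot> (ba twisted \<otimes> ba (Beta k)) = ba straight \<otimes> ba (Beta k)"
    using R.relation[OF arcs(2)] unfolding relation_D_centre(2)[OF R.quiver_rep_axioms s3 assms(2)]
    using closed assms by (simp only: R.E.r_right_minus_eq R.E.scale_closed R.E.m_closed ba_centre)
qed

lemma abar_at_centre: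
  assumes "ctr \<in> N"
  shows "abar (ctr + shift (j + 1)) j = straight" "abar (ctr + shift (j + 2)) j = twisted"
  using abar_centre ctr_mem_iff assms by blast+

lemma step_step_inner:
  assumes v: "v \<in> families" and x: "x \<in> inner" and z: "x + shift i + shift j \<in> inner"
  shows "step i (step j v) (Pt x) = path2_value B ba x i j \<otimes> v (Pt (x + shift i + shift j))"
proof -
  let ?y = "x + shift i"
  have vz: "v (Pt (?y + shift j)) \<in> carrier B"
    using v z by (intro P.power_mem) (simp_all only: index_iff)
  consider "?y = ctr" "ctr \<in> N" | "?y \<in> inner" | "?y \<notin> N" by (rule end_cases)
  then show ?thesis
  proof cases
    case 1
    have coeff: "third_root (i * k) * third_root ((2 - j) * k) = third_root ((i + 2 - j) * k)" for k
      unfolding third_root_add[symmetric] by (rule arg_cong[of _ _ third_root]) (simp add: algebra_simps)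
    have BG: "ba (Beta k) \<in> carrier B" "ba (Gamma k) \<in> carrier B" if "k \<in> {0, 1, 2}" for k
      using ba_centre[OF 1(2) that] by blast+
    have c: "v (Pt (ctr + shift j)) \<in> carrier B" using vz unfolding 1 .
    show ?thesis
      unfolding step_Pt_centre[OF 1] step_Centre path2_value_def if_P[OF conjI[OF 1]] unfolding 1(1)
      using BG[of 0] BG[of 1] BG[of 2] c coeff[of 0] coeff[of 1] coeff[of 2]
      by (simp add: R.E.finsum_012 R.E.l_distr R.E.scale_mult_left R.E.scale_mult_right R.E.scale_scale R.E.m_assoc)
  next
    case 2
    then have ne: "\<not> (?y = ctr \<and> ctr \<in> N)" by blast
    have steps: "step_value B ba x i = ba (abar x i)" "step_value B ba ?y j = ba (abar ?y j)"
      unfolding step_value_def using x 2 z by (simp_all only: if_True simp_thms)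
    show ?thesis
      unfolding step_Pt_inner[OF 2] step_Pt_inner[OF z] path2_value_def if_not_P[OF ne] steps
      using ba_abar[OF x 2] ba_abar[OF 2 z] vz by (simp only: R.E.m_assoc)
  next
    case 3
    then have out: "\<not> (?y = ctr \<and> ctr \<in> N)" "\<not> (x \<in> inner \<and> ?y \<in> inner)" by auto
    have step_closed: "step_value B ba p i \<in> carrier B" for p i
      unfolding step_value_def by simp
    show ?thesis
      unfolding step_Pt_outside[OF 3] path2_value_def if_not_P[OF out(1)] step_value_def[of B ba x] if_not_P[OF out(2)]
      using vz step_closed[of ?y j] by (simp only: R.E.l_null)
  qed
qed

text \<open>
  The centre may be the end of the square, its start, or one of the other two corners.  The first two
  cases are the relations of \<open>Gamma k\<close> and \<open>Beta k\<close>; the last one is part of \<open>step_step_inner\<close>.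
\<close>

lemma step_commute:
  assumes v: "v \<in> families" and u: "u \<in> index"
  shows "step i (step (i + 1) v) u = step (i + 1) (step i v) u"
proof (cases u)
  case (Pt x)
  then have x: "x \<in> inner" using u by (simp only: index_iff)
  let ?z = "x + shift i + shift (i + 1)"
  have z': "x + shift (i + 1) + shift i = ?z" by (simp add: ac_simps)
  consider "?z = ctr" "ctr \<in> N" | "?z \<in> inner" | "?z \<notin> N" by (rule end_cases)
  then show ?thesis
  proof cases
    case 2
    then have 3: "x + shift (i + 1) + shift i \<in> inner" unfolding z' .
    show ?thesis
      unfolding Pt step_step_inner[OF v x 2] step_step_inner[OF v x 3] square_inner[OF x 2] z' ..
  next
    case 1
    note cN = 1(2)
    have xc: "x = ctr + shift (i + 2)"
      using 1(1) shift_third[of i] by (simp add: add.assoc add_eq_0_iff2 flip: 1(1))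
    have y1: "x + shift i = ctr - shift (i + 1)" "x + shift (i + 1) = ctr - shift i"
      using 1(1) by (simp_all add: eq_diff_eq ac_simps)
    then have y: "x + shift i \<in> inner" "x + shift (i + 1) \<in> inner"
      using centre_neighbours(2)[OF cN] by (simp_all only:)
    have a: "abar x i = twisted" "abar x (i + 1) = straight"
      using abar_at_centre[OF cN, of i] abar_at_centre[OF cN, of "i + 1"] unfolding xc by (simp_all add: add.assoc)
    have c1: "x + shift i + shift (i + 1) = ctr" "x + shift (i + 1) + shift i = ctr"
      using 1(1) z' by (simp_all only:)
    have term_eq: "ba twisted \<otimes> (third_root ((i + 1) * k) \<odot> (ba (Beta k) \<otimes> v (Centre k))) =
        ba straight \<otimes> (third_root (i * k) \<odot> (ba (Beta k) \<otimes> v (Centre k)))" if k: "k \<in> {0, 1, 2}" for k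
    proof -
      have vk: "v (Centre k) \<in> carrier B"
        using v cN k by (intro P.power_mem) (simp_all only: index_iff simp_thms)
      note closed = vk ba_centre[OF cN k] centre_relations(3,4)[OF cN k]
      have "third_root ((i + 1) * k) = third_root (i * k) * third_root k"
        by (simp add: third_root_add distrib_right)
      then have "ba twisted \<otimes> (third_root ((i + 1) * k) \<odot> (ba (Beta k) \<otimes> v (Centre k))) =
          third_root (i * k) \<odot> ((third_root k \<odot> (ba twisted \<otimes> ba (Beta k))) \<otimes> v (Centre k))"
        using closed by (simp add: R.E.scale_mult_left R.E.scale_mult_right R.E.scale_scale R.E.m_assoc)
      also have "\<dots> = ba straight \<otimes> (third_root (i * k) \<odot> (ba (Beta k) \<otimes> v (Centre k)))"
        unfolding centre_relations(2)[OF cN k]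
        using closed by (simp add: R.E.scale_mult_left R.E.scale_mult_right R.E.m_assoc)
      finally show ?thesis .
    qed
    have closed: "ba twisted \<in> carrier B" "ba straight \<in> carrier B"
      "ba (Beta k) \<otimes> v (Centre k) \<in> carrier B" if "k \<in> {0, 1, 2}" for k
    proof -
      have "v (Centre k) \<in> carrier B"
        using v cN that by (intro P.power_mem) (simp_all only: index_iff simp_thms)
      then show "ba (Beta k) \<otimes> v (Centre k) \<in> carrier B"
        using ba_centre[OF cN that] by simp
      show "ba twisted \<in> carrier B" "ba straight \<in> carrier B"
        by (rule centre_relations(3,4)[OF cN that])+
    qed
    show ?thesis
      unfolding Pt step_Pt_inner[OF y(1)] step_Pt_inner[OF y(2)] step_Pt_centre[OF c1(1) cN] step_Pt_centre[OF c1(2) cN] a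
      using term_eq[of 0] term_eq[of 1] term_eq[of 2] closed[of 0] closed[of 1] closed[of 2]
      by (simp add: R.E.finsum_012 R.E.r_distr)
  next
    case 3
    have zero: "step a (step b v) (Pt x) = \<zero>" if ab: "x + shift a + shift b = ?z" "a + b = 2 * i + 1" "a = i \<or> a = i + 1" for a b
    proof -
      have out: "x + shift a + shift b \<notin> N" unfolding ab(1) by (rule 3)
      consider "x + shift a = ctr" "ctr \<in> N" | "x + shift a \<in> inner" | "x + shift a \<notin> N" by (rule end_cases)
      then show ?thesis
      proof cases
        case 1
        then show ?thesis using out centre_neighbours(1)[OF 1(2), of b] unfolding 1(1) by blast
      next
        case 2
        then show ?thesis
          unfolding step_Pt_inner[OF 2] step_Pt_outside[OF out] using ba_abar[OF x 2] by (simp only: R.E.r_null)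
      next
        case 3
        then show ?thesis by (rule step_Pt_outside)
      qed
    qed
    show ?thesis
      unfolding Pt using zero[of i "i + 1"] zero[of "i + 1" i] z' by simp
  qed
next
  case (Centre k)
  then have cN: "ctr \<in> N" and k: "k \<in> {0, 1, 2}" using u by (simp_all only: index_iff)
  let ?z = "ctr - shift (i + 2)"
  have ends: "ctr + shift i + shift (i + 1) = ?z" "ctr + shift (i + 1) + shift i = ?z"
    using shift_third[of i] by (simp_all add: eq_diff_eq ac_simps)
  have z: "ctr + shift i + shift (i + 1) \<in> inner" "ctr + shift (i + 1) + shift i \<in> inner"
    unfolding ends by (rule centre_neighbours(2)[OF cN])+
  have a: "abar (ctr + shift i) (i + 1) = twisted" "abar (ctr + shift (i + 1)) i = straight"
  proof -
    have "shift (i + 1 + 2) = shift i" by (rule shift_cong) (simp add: add.assoc)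
    then show "abar (ctr + shift i) (i + 1) = twisted" "abar (ctr + shift (i + 1)) i = straight"
      using abar_at_centre(2)[OF cN, of "i + 1"] abar_at_centre(1)[OF cN, of i] by (simp_all only:)
  qed
  have vz: "v (Pt ?z) \<in> carrier B"
    using v centre_neighbours(2)[OF cN] by (intro P.power_mem) (simp_all only: index_iff)
  note closed = vz ba_centre[OF cN k] centre_relations(3,4)[OF cN k]
  have root: "third_root ((2 - i) * k) = third_root ((2 - (i + 1)) * k) * third_root k"
    unfolding third_root_add[symmetric] by (rule arg_cong[of _ _ third_root]) (simp add: algebra_simps)
  have "third_root ((2 - i) * k) \<odot> (ba (Gamma k) \<otimes> (ba twisted \<otimes> v (Pt ?z))) =
      third_root ((2 - (i + 1)) * k) \<odot> ((third_root k \<odot> (ba (Gamma k) \<otimes> ba twisted)) \<otimes> v (Pt ?z))"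
    unfolding root using closed by (simp add: R.E.scale_mult_left R.E.scale_scale R.E.m_assoc)
  also have "\<dots> = third_root ((2 - (i + 1)) * k) \<odot> (ba (Gamma k) \<otimes> (ba straight \<otimes> v (Pt ?z)))"
    unfolding centre_relations(1)[OF cN k] using closed by (simp add: R.E.m_assoc)
  finally show ?thesis
    unfolding Centre step_Centre step_Pt_inner[OF z(1)] step_Pt_inner[OF z(2)] a ends .
qed

lemma AR_AR: "AR x i \<otimes>\<^bsub>EndV\<^esub> AR (x + shift i) j = op (\<lambda>v u. if point_of u = x then step i (step j v) u else \<zero>)"
proof -
  have "AR x i \<otimes>\<^bsub>EndV\<^esub> AR (x + shift i) j = op (\<lambda>v u. if point_of u = x
      then step i (\<lambda>u\<in>index. if point_of u = x + shift i then step j v u else \<zero>) u else \<zero>)"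
    unfolding AR_def by (rule op_compose[OF linear_ops(2)])
  also have "\<dots> = op (\<lambda>v u. if point_of u = x then step i (step j v) u else \<zero>)"
  proof (rule op_eqI, rule if_cong[OF refl _ refl])
    fix v u assume v: "v \<in> families" and u: "u \<in> index" and x: "point_of u = x"
    show "step i (\<lambda>u\<in>index. if point_of u = x + shift i then step j v u else \<zero>) u = step i (step j v) u"
      by (rule step_agree[OF _ _ u]) (simp_all add: x step_closed v)
  qed
  finally show ?thesis .
qed

lemma AR_mod: "AR x (i mod 3) = AR x i"
  unfolding AR_def step_mod ..

lemma AR_commute: "AR x i \<otimes>\<^bsub>EndV\<^esub> AR (x + shift i) j = AR x j \<otimes>\<^bsub>EndV\<^esub> AR (x + shift j) i"
proof -
  have cong: "AR x a = AR x b" if "a mod 3 = b mod 3" for x a b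
    using AR_mod[of x a] AR_mod[of x b] that by (simp only:)
  (* the three directions are cyclically ordered, so consecutive ones suffice *)
  have next_step: "AR x a \<otimes>\<^bsub>EndV\<^esub> AR (x + shift a) b = AR x b \<otimes>\<^bsub>EndV\<^esub> AR (x + shift b) a" if "(b - a) mod 3 = 1" for a b
  proof -
    have b: "b mod 3 = (a + 1) mod 3" by (rule mod3_shiftD[OF that])
    have "AR x a \<otimes>\<^bsub>EndV\<^esub> AR (x + shift a) (a + 1) = AR x (a + 1) \<otimes>\<^bsub>EndV\<^esub> AR (x + shift (a + 1)) a"
      unfolding AR_AR by (rule op_eqI) (simp only: step_commute)
    then show ?thesis
      by (simp only: cong[OF b] shift_cong[OF b])
  qed
  consider "(j - i) mod 3 = 0" | "(j - i) mod 3 = 1" | "(j - i) mod 3 = 2" by (rule mod3_cases)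
  then show ?thesis
  proof cases
    case 1
    then have "j mod 3 = i mod 3" using mod3_shiftD[of j i 0] by simp
    from cong[OF this] shift_cong[OF this] show ?thesis by (simp only:)
  next
    case 2
    then show ?thesis by (rule next_step)
  next
    case 3
    then have "(i - j) mod 3 = 1"
      using mod_minus_eq[of "j - i" 3] by simp
    from next_step[OF this] show ?thesis by (rule sym)
  qed
qed

lemma equivariant_rep_unfolding: "equivariant_rep s EndV EV AR UU"
proof (intro equivariant_rep.intro equivariant_rep_axioms.intro)
  show "triangle s" by (rule triangle_axioms)
  show "complex_ring EndV" by (rule P.power.End_complex_ring)
  fix x y :: triple and i j :: int
  show "EV x \<in> carrier EndV" "AR x i \<in> carrier EndV" "UU j \<in> carrier EndV"
    unfolding EV_def AR_def UU_def End_simps(1) by (rule op_linear, rule linear_ops)+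
  show "EV x = \<zero>\<^bsub>EndV\<^esub>" if "x \<notin> N"
    unfolding EV_def op_zero
  proof (rule op_eqI)
    fix v u assume "u \<in> index"
    then have "point_of u \<noteq> x" using that by (cases u) auto
    then show "(if point_of u = x then v u else \<zero>) = \<zero>" by simp
  qed
  show "EV x \<otimes>\<^bsub>EndV\<^esub> EV y = (if x = y then EV x else \<zero>\<^bsub>EndV\<^esub>)"
    unfolding EV_def op_zero op_compose[OF linear_ops(1)] if_distrib[of op, symmetric]
    by (cases "x = y") (auto intro!: op_eqI)
  show "EV x \<otimes>\<^bsub>EndV\<^esub> AR x i = AR x i"
    unfolding EV_def AR_def op_compose[OF linear_ops(2)] by (rule op_eqI) simp
  show "AR x i \<otimes>\<^bsub>EndV\<^esub> EV (x + shift i) = AR x i"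
    unfolding EV_def AR_def op_compose[OF linear_ops(1)]
  proof (rule op_eqI, rule if_cong[OF refl _ refl])
    fix v u assume v: "v \<in> families" and u: "u \<in> index" and x: "point_of u = x"
    show "step i (\<lambda>u\<in>index. if point_of u = x + shift i then v u else \<zero>) u = step i v u"
      by (rule step_agree[OF _ _ u]) (simp_all add: x v)
  qed
  show "AR x (i mod 3) = AR x i" by (rule AR_mod)
  show "UU 0 = \<one>\<^bsub>EndV\<^esub>"
    unfolding UU_def op_one
  proof (rule op_eqI)
    fix v u assume "v \<in> families" "u \<in> index"
    then show "turned 0 v u = v u" by (cases u) (auto simp: turned_def)
  qed
  show "UU i \<otimes>\<^bsub>EndV\<^esub> UU j = UU (i + j)"
    unfolding UU_def op_compose[OF linear_ops(3)] by (rule op_eqI) (rule turned_turned)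
  show "UU (j mod 3) = UU j"
  proof -
    have "rot (- (j mod 3)) x = rot (- j) x" for x
      by (rule rot_cong) (rule mod_minus_eq)
    moreover have "third_root (j mod 3 * k) = third_root (j * k)" for k
      by (rule third_root_cong) (rule mod_mult_left_eq)
    ultimately show ?thesis
      unfolding UU_def turned_def by (simp only:)
  qed
  show "UU j \<otimes>\<^bsub>EndV\<^esub> EV x = EV (rot j x) \<otimes>\<^bsub>EndV\<^esub> UU j"
    unfolding UU_def EV_def op_compose[OF linear_ops(1)] op_compose[OF linear_ops(3)]
  proof (rule op_eqI)
    fix v u assume v: "v \<in> families" and u: "u \<in> index"
    have "ctr = rot j x \<longleftrightarrow> ctr = x"
      using rot_eq_iff[of j ctr x] by simp
    then show "turned j (\<lambda>u\<in>index. if point_of u = x then v u else \<zero>) u =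
        (if point_of u = rot j x then (\<lambda>u\<in>index. turned j v u) u else \<zero>)"
      using u inner_rot[of "- j"] by (cases u) (auto simp: turned_def rot_flip)
  qed
  show "UU j \<otimes>\<^bsub>EndV\<^esub> AR x i = AR (rot j x) (i - j) \<otimes>\<^bsub>EndV\<^esub> UU j"
    unfolding UU_def AR_def op_compose[OF linear_ops(2)] op_compose[OF linear_ops(3)]
  proof (rule op_eqI)
    fix v u assume v: "v \<in> families" and u: "u \<in> index"
    have c: "ctr = rot j x \<longleftrightarrow> ctr = x"
      using rot_eq_iff[of j ctr x] by simp
    show "turned j (\<lambda>u\<in>index. if point_of u = x then step i v u else \<zero>) u =
        (if point_of u = rot j x then step (i - j) (\<lambda>u\<in>index. turned j v u) u else \<zero>)"
      unfolding step_turned[OF v u] using c u inner_rot[of "- j"] by (cases u) (auto simp: turned_def rot_flip)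
  qed
  show "AR x i \<otimes>\<^bsub>EndV\<^esub> AR (x + shift i) j = AR x j \<otimes>\<^bsub>EndV\<^esub> AR (x + shift j) i"
    by (rule AR_commute)
qed

lemma finsum_op:
  assumes "finite S" "\<And>x. x \<in> S \<Longrightarrow> linear_op (T x)"
  shows "finsum EndV (\<lambda>x. op (T x)) S = op (\<lambda>v u. \<Oplus>x\<in>S. T x v u)"
proof -
  interpret E: complex_ring EndV by (rule P.power.End_complex_ring)
  show ?thesis
    using assms
  proof (induction S rule: finite_induct)
    case empty
    then show ?case
      using op_zero by (simp only: E.finsum_empty R.E.finsum_empty)
  next
    case (insert a S)
    have closed: "T x v u \<in> carrier B" if "x \<in> insert a S" "v \<in> families" "u \<in> index" for x v u
      using insert.prems[OF that(1)] that(2,3) by (simp add: linear_op_def)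
    have "finsum EndV (\<lambda>x. op (T x)) (insert a S) = op (T a) \<oplus>\<^bsub>EndV\<^esub> finsum EndV (\<lambda>x. op (T x)) S"
      using insert op_linear by (intro E.finsum_insert) (auto simp only: End_simps(1) Pi_iff)
    also have "\<dots> = op (T a) \<oplus>\<^bsub>EndV\<^esub> op (\<lambda>v u. \<Oplus>x\<in>S. T x v u)"
      using insert by simp
    also have "\<dots> = op (\<lambda>v u. T a v u \<oplus> (\<Oplus>x\<in>S. T x v u))"
      by (simp add: op_def cong: restrict_cong)
    also have "\<dots> = op (\<lambda>v u. \<Oplus>x\<in>insert a S. T x v u)"
      by (rule op_eqI) (use closed insert in \<open>simp add: R.E.finsum_insert\<close>)
    finally show ?case .
  qed
qed

lemma EV_sum: "finsum EndV EV N = \<one>\<^bsub>EndV\<^esub>"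
proof -
  have "finsum EndV EV N = op (\<lambda>v u. \<Oplus>x\<in>N. if point_of u = x then v u else \<zero>)"
    unfolding EV_def by (rule finsum_op[OF finite_simplex_points linear_ops(1)])
  also have "\<dots> = op (\<lambda>v u. v u)"
  proof (rule op_eqI)
    fix v u assume v: "v \<in> families" and u: "u \<in> index"
    then have "point_of u \<in> N" by (cases u) auto
    then show "(\<Oplus>x\<in>N. if point_of u = x then v u else \<zero>) = v u"
      using R.E.finsum_delta[OF finite_simplex_points, of "point_of u" s "v u"] v u by (simp add: eq_commute)
  qed
  finally show ?thesis by (simp only: op_one)
qed

end


section \<open>The algebra of type D as a full corner\<close>

context equivariant_rep
begin

sublocale T: qp_rep "quiver_D s" weight_D E evD arD
  by (rule qp_rep_D)

abbreviation "theta \<equiv> T.hom_of_rep"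
abbreviation "theta_image \<equiv> T.hom_of_rep ` carrier D.Jac"

lemma image_vertex: "v \<in> verts QD \<Longrightarrow> evD v \<in> theta_image"
  and image_arrow: "a \<in> arcs QD \<Longrightarrow> arD a \<in> theta_image"
proof -
  interpret u: qp_rep QD weight_D D.Jac D.vertex D.arrow by (rule D.universal_rep)
  show "evD v \<in> theta_image" if "v \<in> verts QD"
    using imageI[where f = theta, OF u.ev_closed[OF that]] unfolding T.hom_vertex[OF that] .
  show "arD a \<in> theta_image" if "a \<in> arcs QD"
    using imageI[where f = theta, OF u.ar_closed[OF that]] unfolding T.hom_arrow[OF that] .
qed

lemma image_zero: "\<zero> \<in> theta_image"
  using imageI[where f = theta, OF D.Jac.zero_closed] unfolding T.hom.zero .

lemma image_add: "x \<in> theta_image \<Longrightarrow> y \<in> theta_image \<Longrightarrow> x \<oplus> y \<in> theta_image"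
proof (elim imageE)
  fix a b assume ab: "a \<in> carrier D.Jac" "b \<in> carrier D.Jac" and eq: "x = theta a" "y = theta b"
  show ?thesis
    using imageI[where f = theta, OF D.Jac.a_closed[OF ab]] unfolding eq T.hom.add[OF ab] .
qed

lemma image_mult: "x \<in> theta_image \<Longrightarrow> y \<in> theta_image \<Longrightarrow> x \<otimes> y \<in> theta_image"
proof (elim imageE)
  fix a b assume ab: "a \<in> carrier D.Jac" "b \<in> carrier D.Jac" and eq: "x = theta a" "y = theta b"
  show ?thesis
    using imageI[where f = theta, OF D.Jac.m_closed[OF ab]] unfolding eq T.hom.mult[OF ab] .
qed

lemma image_scale: "x \<in> theta_image \<Longrightarrow> c \<odot> x \<in> theta_image"
proof (elim imageE)
  fix a assume a: "a \<in> carrier D.Jac" and eq: "x = theta a"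
  show ?thesis
    using imageI[where f = theta, OF D.Jac.scale_closed[OF a]] unfolding eq T.hom.scale[OF a] .
qed

lemma image_carrier: "x \<in> theta_image \<Longrightarrow> x \<in> carrier E"
  using T.hom.closed by blast

lemma image_finsum:
  assumes "finite I" "\<And>i. i \<in> I \<Longrightarrow> f i \<in> theta_image"
  shows "finsum E f I \<in> theta_image"
  using assms
proof (induction I rule: finite_induct)
  case empty
  then show ?case using image_zero by simp
next
  case (insert i I)
  have "f \<in> I \<rightarrow> carrier E" "f i \<in> carrier E"
    using insert.prems image_carrier by blast+
  then have "finsum E f (insert i I) = f i \<oplus> finsum E f I"
    using insert.hyps by (intro finsum_insert)
  moreover have "f i \<in> theta_image" "finsum E f I \<in> theta_image"
    using insert by blast+
  ultimately show ?case
    using image_add by (simp only:)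
qed

text \<open>
  Every vertex of the unfolded triangle is isomorphic, by a power of the rotation, to a vertex of
  the fundamental domain.  These are the two mutually inverse maps.
\<close>

primrec to_rep where
  "to_rep (Pt x) = U (- turn x) \<otimes> ev x"
| "to_rep (Centre k) = eps k \<otimes> ev ctr"

primrec from_rep where
  "from_rep (Pt x) = ev x \<otimes> U (turn x)"
| "from_rep (Centre k) = ev ctr \<otimes> eps k"

lemma to_from_closed [simp]: "to_rep u \<in> carrier E" "from_rep u \<in> carrier E"
  by (cases u; simp)+

lemma to_rep_ev: "to_rep u \<otimes> ev x = (if point_of u = x then to_rep u else \<zero>)"
  by (cases u) (simp_all add: m_assoc ev_ev)

lemma ev_from_rep: "ev x \<otimes> from_rep w = (if point_of w = x then from_rep w else \<zero>)"
proof (cases w)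
  case (Pt y)
  have "ev x \<otimes> (ev y \<otimes> U (turn y)) = ev x \<otimes> ev y \<otimes> U (turn y)"
    by (simp only: m_assoc ev_closed U_closed)
  then show ?thesis by (simp add: Pt ev_ev)
next
  case (Centre k)
  have "ev x \<otimes> (ev ctr \<otimes> eps k) = ev x \<otimes> ev ctr \<otimes> eps k"
    by (simp only: m_assoc ev_closed eps_closed)
  then show ?thesis by (simp add: Centre ev_ev)
qed

lemma evD_to_rep:
  assumes "u \<in> index"
  shows "evD (rep_vertex u) \<otimes> to_rep u = to_rep u"
proof (cases u)
  case (Pt x)
  have "ev (rep x) \<otimes> (U (- turn x) \<otimes> ev x) = ev (rep x) \<otimes> (ev (rep x) \<otimes> U (- turn x))"
    by (simp only: U_ev rep_def)
  also have "\<dots> = ev (rep x) \<otimes> ev (rep x) \<otimes> U (- turn x)"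
    by (simp only: m_assoc ev_closed U_closed)
  also have "\<dots> = U (- turn x) \<otimes> ev x"
    by (simp add: ev_ev U_ev rep_def)
  finally show ?thesis by (simp add: Pt)
next
  case (Centre k)
  then have k: "k \<in> {0, 1, 2}" using assms by (simp only: index_iff)
  have "ev ctr \<otimes> eps k \<otimes> (eps k \<otimes> ev ctr) = ev ctr \<otimes> (eps k \<otimes> eps k) \<otimes> ev ctr"
    by (simp only: m_assoc ev_closed eps_closed m_closed)
  also have "\<dots> = eps k \<otimes> (ev ctr \<otimes> ev ctr)"
    by (simp only: eps_eps[OF k k] if_True ev_ctr_eps m_assoc ev_closed eps_closed simp_thms)
  finally show ?thesis by (simp add: Centre ev_ev)
qed

lemma from_rep_evD:
  assumes "u \<in> index"
  shows "from_rep u \<otimes> evD (rep_vertex u) = from_rep u"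
proof (cases u)
  case (Pt x)
  have "ev x \<otimes> U (turn x) \<otimes> ev (rep x) = ev x \<otimes> (U (turn x) \<otimes> ev (rep x))"
    by (simp only: m_assoc ev_closed U_closed)
  also have "\<dots> = ev x \<otimes> ev x \<otimes> U (turn x)"
    by (simp add: U_ev m_assoc)
  finally show ?thesis by (simp add: Pt ev_ev)
next
  case (Centre k)
  then have k: "k \<in> {0, 1, 2}" using assms by (simp only: index_iff)
  have "ev ctr \<otimes> eps k \<otimes> (ev ctr \<otimes> eps k) = ev ctr \<otimes> (eps k \<otimes> ev ctr) \<otimes> eps k"
    by (simp only: m_assoc ev_closed eps_closed m_closed)
  also have "\<dots> = ev ctr \<otimes> ev ctr \<otimes> (eps k \<otimes> eps k)"
    by (simp only: ev_ctr_eps[symmetric] m_assoc ev_closed eps_closed m_closed)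
  finally show ?thesis by (simp add: Centre ev_ev eps_eps[OF k k])
qed

lemma from_to:
  "from_rep (Pt x) \<otimes> to_rep (Pt x) = ev x"
  "k \<in> {0, 1, 2} \<Longrightarrow> from_rep (Centre k) \<otimes> to_rep (Centre k) = ev ctr \<otimes> eps k"
proof -
  have "ev x \<otimes> U (turn x) \<otimes> (U (- turn x) \<otimes> ev x) = ev x \<otimes> (U (turn x) \<otimes> U (- turn x)) \<otimes> ev x"
    by (simp only: m_assoc ev_closed U_closed m_closed)
  then show "from_rep (Pt x) \<otimes> to_rep (Pt x) = ev x"
    by (simp add: U_add U_zero ev_ev)
  assume k: "k \<in> {0, 1, 2}"
  have "ev ctr \<otimes> eps k \<otimes> (eps k \<otimes> ev ctr) = ev ctr \<otimes> (eps k \<otimes> eps k) \<otimes> ev ctr"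
    by (simp only: m_assoc ev_closed eps_closed m_closed)
  also have "\<dots> = ev ctr \<otimes> (eps k \<otimes> ev ctr)"
    by (simp only: eps_eps[OF k k] if_True m_assoc ev_closed eps_closed simp_thms)
  also have "\<dots> = ev ctr \<otimes> ev ctr \<otimes> eps k"
    by (simp only: ev_ctr_eps[symmetric] m_assoc ev_closed eps_closed)
  finally show "from_rep (Centre k) \<otimes> to_rep (Centre k) = ev ctr \<otimes> eps k"
    by (simp add: ev_ev)
qed

lemma to_from:
  assumes "u \<in> index" "w \<in> index" "point_of u = point_of w"
  shows "to_rep u \<otimes> from_rep w = (if u = w then evD (rep_vertex u) else \<zero>)"
proof (cases u)
  case u: (Pt x)
  then have w: "w = Pt x"
    using assms by (cases w) auto
  have "U (- turn x) \<otimes> ev x \<otimes> (ev x \<otimes> U (turn x)) = U (- turn x) \<otimes> (ev x \<otimes> ev x) \<otimes> U (turn x)"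
    by (simp only: m_assoc ev_closed U_closed m_closed)
  also have "\<dots> = ev (rep x) \<otimes> (U (- turn x) \<otimes> U (turn x))"
    by (simp add: ev_ev U_ev rep_def m_assoc)
  finally show ?thesis by (simp add: u w U_add U_zero)
next
  case u: (Centre k)
  then obtain l where w: "w = Centre l"
    using assms by (cases w) auto
  have kl: "k \<in> {0, 1, 2}" "l \<in> {0, 1, 2}"
    using assms(1,2) unfolding u w by (simp_all only: index_iff)
  have "eps k \<otimes> ev ctr \<otimes> (ev ctr \<otimes> eps l) = eps k \<otimes> (ev ctr \<otimes> ev ctr) \<otimes> eps l"
    by (simp only: m_assoc ev_closed eps_closed m_closed)
  also have "\<dots> = ev ctr \<otimes> (eps k \<otimes> eps l)"
    by (simp only: ev_ev if_True ev_ctr_eps[symmetric] m_assoc ev_closed eps_closed simp_thms)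
  finally show ?thesis by (simp add: u w eps_eps[OF kl])
qed

lemma from_to_sum: "(\<Oplus>u\<in>index. from_rep u \<otimes> to_rep u) = (\<Oplus>x\<in>N. ev x)"
proof -
  let ?f = "\<lambda>u. from_rep u \<otimes> to_rep u"
  have fin: "finite inner" using finite_simplex_points by blast
  have "finsum E ?f (Pt ` inner) = (\<Oplus>x\<in>inner. ?f (Pt x))"
    by (rule finsum_reindex) (auto simp: inj_on_def)
  then have points: "finsum E ?f (Pt ` inner) = (\<Oplus>x\<in>inner. ev x)"
    by (simp only: from_to)
  show ?thesis
  proof (cases "ctr \<in> N")
    case False
    then have "inner = N" "index = Pt ` inner" by (auto simp: index_def)
    then show ?thesis using points by (simp only:)
  next
    case True
    have "finsum E ?f (Centre ` {0, 1, 2}) = (\<Oplus>k\<in>{0, 1, 2}. ?f (Centre k))"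
      by (rule finsum_reindex) (auto simp: inj_on_def)
    also have "\<dots> = (\<Oplus>k\<in>{0, 1, 2}. ev ctr \<otimes> eps k)"
      by (rule finsum_eqI) (simp_all only: from_to m_closed ev_closed eps_closed)
    also have "\<dots> = ev ctr \<otimes> (eps 0 \<oplus> (eps 1 \<oplus> eps 2))"
      by (simp add: finsum_012 r_distr)
    finally have centre: "finsum E ?f (Centre ` {0, 1, 2}) = ev ctr"
      unfolding eps_sum by simp
    have "index = Centre ` {0, 1, 2} \<union> Pt ` inner" using True by (auto simp: index_def)
    then have "finsum E ?f index = finsum E ?f (Centre ` {0, 1, 2}) \<oplus> finsum E ?f (Pt ` inner)"
      using fin by (simp only:) (rule finsum_Un_disjoint; auto)
    also have "\<dots> = finsum E ev (insert ctr inner)"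
      unfolding centre points using fin by (intro finsum_insert[symmetric]) auto
    also have "insert ctr inner = N" using True by blast
    finally show ?thesis .
  qed
qed

text \<open>
  The elements all of whose components between representatives come from the algebra of type D.
  They form a subalgebra, because the identity is the sum of the products of the two maps above.
\<close>

definition in_corner where
  "in_corner x \<longleftrightarrow> (\<forall>u\<in>index. \<forall>w\<in>index. to_rep u \<otimes> x \<otimes> from_rep w \<in> theta_image)"

lemma corner_ev: "in_corner (ev x)"
  unfolding in_corner_def
proof (intro ballI)
  fix u w assume uw: "u \<in> index" "w \<in> index"
  have "to_rep u \<otimes> ev x \<otimes> from_rep w = to_rep u \<otimes> (ev x \<otimes> ev x) \<otimes> from_rep w"
    by (simp add: ev_ev)
  also have "\<dots> = (to_rep u \<otimes> ev x) \<otimes> (ev x \<otimes> from_rep w)"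
    by (simp only: m_assoc to_from_closed ev_closed m_closed)
  finally have eq: "to_rep u \<otimes> ev x \<otimes> from_rep w = (to_rep u \<otimes> ev x) \<otimes> (ev x \<otimes> from_rep w)" .
  show "to_rep u \<otimes> ev x \<otimes> from_rep w \<in> theta_image"
  proof (cases "point_of u = x \<and> point_of w = x")
    case True
    then have "to_rep u \<otimes> ev x \<otimes> from_rep w = (if u = w then evD (rep_vertex u) else \<zero>)"
      unfolding eq unfolding to_rep_ev ev_from_rep using to_from[OF uw] by simp
    then show ?thesis
      using image_vertex[OF rep_vertex_mem[OF uw(1)]] image_zero by (cases "u = w") simp_all
  next
    case False
    then have "to_rep u \<otimes> ev x \<otimes> from_rep w = \<zero>"
      unfolding eq unfolding to_rep_ev ev_from_rep by auto
    then show ?thesis using image_zero by simp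
  qed
qed

lemma corner_ar: "in_corner (ar x i)"
  unfolding in_corner_def
proof (intro ballI)
  fix u w assume uw: "u \<in> index" "w \<in> index"
  let ?y = "x + shift i"
  have "to_rep u \<otimes> ar x i \<otimes> from_rep w = to_rep u \<otimes> (ev x \<otimes> ar x i \<otimes> ev ?y) \<otimes> from_rep w"
    by (simp add: ev_ar ar_ev)
  also have "\<dots> = (to_rep u \<otimes> ev x) \<otimes> ar x i \<otimes> (ev ?y \<otimes> from_rep w)"
    by (simp only: m_assoc to_from_closed ev_closed ar_closed m_closed)
  finally have eq: "to_rep u \<otimes> ar x i \<otimes> from_rep w = (to_rep u \<otimes> ev x) \<otimes> ar x i \<otimes> (ev ?y \<otimes> from_rep w)" .
  show "to_rep u \<otimes> ar x i \<otimes> from_rep w \<in> theta_image"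
  proof (cases "point_of u = x \<and> point_of w = ?y")
    case False
    then have "to_rep u \<otimes> ar x i \<otimes> from_rep w = \<zero>"
      unfolding eq to_rep_ev ev_from_rep by auto
    then show ?thesis using image_zero by simp
  next
    case True
    show ?thesis
    proof (cases u)
      case u: (Pt p)
      then have p: "u = Pt x" using True by simp
      then have x: "x \<in> inner" using uw by (simp only: index_iff)
      have left: "to_rep u \<otimes> ar x i = U (- turn x) \<otimes> ar x i"
        by (simp add: p m_assoc ev_ar)
      show ?thesis
      proof (cases w)
        case (Pt q)
        then have q: "w = Pt ?y" using True by simp
        then have y: "?y \<in> inner" using uw by (simp only: index_iff)
        have "to_rep u \<otimes> ar x i \<otimes> from_rep w = U (- turn x) \<otimes> (ar x i \<otimes> ev ?y) \<otimes> U (turn ?y)"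
          unfolding left by (simp add: q m_assoc)
        then have "to_rep u \<otimes> ar x i \<otimes> from_rep w = arD (abar x i)"
          by (simp only: ar_ev arD_abar)
        then show ?thesis
          using image_arrow[OF abar_arc(1)[OF x y]] by (simp only:)
      next
        case (Centre k)
        then have y: "?y = ctr" and cN: "ctr \<in> N" and k: "k \<in> {0, 1, 2}"
          using True uw by (simp_all only: point_of.simps index_iff)
        have s3: "s mod 3 = 1" using cN ctr_mem_iff by simp
        have xc: "x = ctr - shift i" using y by (simp add: eq_diff_eq)
        have "U (- turn x) = U i"
          unfolding xc turn_before[OF s3] by (rule U_cong) (simp add: mod_minus_eq)
        then have "to_rep u \<otimes> ar x i \<otimes> from_rep w = U i \<otimes> (ar x i \<otimes> ev ?y) \<otimes> eps k"
          unfolding left y by (simp add: Centre m_assoc)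
        also have "\<dots> = U i \<otimes> ar x i \<otimes> eps k"
          by (simp only: ar_ev)
        also have "U i \<otimes> ar x i = ar before_ctr 0 \<otimes> U i"
          by (simp add: U_ar xc rot_diff_triple rot_shift)
        also have "ar before_ctr 0 \<otimes> U i \<otimes> eps k = ar before_ctr 0 \<otimes> (U i \<otimes> eps k)"
          by (simp only: m_assoc ar_closed U_closed eps_closed)
        also have "\<dots> = third_root (i * k) \<odot> arD (Beta k)"
          by (simp add: U_eps scale_mult_right)
        finally show ?thesis
          using image_scale[OF image_arrow[of "Beta k"]] s3 k by (simp only: quiver_D_simps simp_thms)
      qed
    next
      case u: (Centre k)
      then have x: "x = ctr" and cN: "ctr \<in> N" and k: "k \<in> {0, 1, 2}"
        using True uw by (simp_all add: u)
      have s3: "s mod 3 = 1" using cN ctr_mem_iff by simp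
      show ?thesis
      proof (cases w)
        case (Pt q)
        then have q: "w = Pt (ctr + shift i)" using True x by simp
        have "U (turn (ctr + shift i)) = U (2 - i)"
          unfolding turn_after[OF s3] by (rule U_mod)
        then have "to_rep u \<otimes> ar x i \<otimes> from_rep w =
            eps k \<otimes> (ev ctr \<otimes> ar ctr i \<otimes> ev (ctr + shift i)) \<otimes> U (2 - i)"
          by (simp add: u q x m_assoc)
        also have "\<dots> = eps k \<otimes> (ar ctr i \<otimes> U (2 - i))"
          by (simp add: ev_ar ar_ev m_assoc)
        also have "ar ctr i \<otimes> U (2 - i) = U (2 - i) \<otimes> ar ctr 2"
          by (simp add: ar_U)
        also have "eps k \<otimes> (U (2 - i) \<otimes> ar ctr 2) = (eps k \<otimes> U (2 - i)) \<otimes> ar ctr 2"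
          by (simp only: m_assoc eps_closed U_closed ar_closed)
        also have "\<dots> = third_root ((2 - i) * k) \<odot> arD (Gamma k)"
          by (simp add: eps_U scale_mult_left)
        finally show ?thesis
          using image_scale[OF image_arrow[of "Gamma k"]] s3 k by (simp only: quiver_D_simps simp_thms)
      next
        case (Centre l)
        then have "shift i = 0" using True x by simp
        then show ?thesis using shift_nonzero[of i] by simp
      qed
    qed
  qed
qed

lemma corner_U: "in_corner (U j)"
  unfolding in_corner_def
proof (intro ballI)
  fix u w assume uw: "u \<in> index" "w \<in> index"
  let ?p = "point_of w"
  have "to_rep u \<otimes> U j \<otimes> from_rep w = to_rep u \<otimes> U j \<otimes> (ev ?p \<otimes> from_rep w)"
    by (simp add: ev_from_rep)
  also have "\<dots> = to_rep u \<otimes> (U j \<otimes> ev ?p) \<otimes> from_rep w"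
    by (simp only: m_assoc to_from_closed U_closed ev_closed m_closed)
  also have "\<dots> = (to_rep u \<otimes> ev (rot j ?p)) \<otimes> U j \<otimes> from_rep w"
    by (simp only: U_ev m_assoc to_from_closed U_closed ev_closed m_closed)
  finally have eq: "to_rep u \<otimes> U j \<otimes> from_rep w = (to_rep u \<otimes> ev (rot j ?p)) \<otimes> U j \<otimes> from_rep w" .
  show "to_rep u \<otimes> U j \<otimes> from_rep w \<in> theta_image"
  proof (cases "point_of u = rot j ?p")
    case False
    then have "to_rep u \<otimes> U j \<otimes> from_rep w = \<zero>"
      unfolding eq to_rep_ev by simp
    then show ?thesis using image_zero by simp
  next
    case True
    show ?thesis
    proof (cases w)
      case w: (Pt y)
      then have y: "y \<in> inner" using uw by (simp only: index_iff)
      then have ne: "rot j y \<in> inner" by (simp only: inner_rot)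
      then have u: "u = Pt (rot j y)"
        using True w by (cases u) auto
      have t: "U (- turn (rot j y)) \<otimes> U (j + turn y) = \<one>"
      proof -
        have "turn (rot j y) = (turn y + j) mod 3"
          using turn_rot[of y j] y by blast
        then have "U (- turn (rot j y)) = U (- (turn y + j))"
          by (intro U_cong) (simp add: mod_minus_eq)
        then show ?thesis by (simp add: U_add U_zero add.commute)
      qed
      have "to_rep u \<otimes> U j \<otimes> from_rep w = U (- turn (rot j y)) \<otimes> ev (rot j y) \<otimes> (U j \<otimes> ev y) \<otimes> U (turn y)"
        by (simp add: u w m_assoc)
      also have "U j \<otimes> ev y = ev (rot j y) \<otimes> U j"
        by (rule U_ev)
      also have "U (- turn (rot j y)) \<otimes> ev (rot j y) \<otimes> (ev (rot j y) \<otimes> U j) \<otimes> U (turn y) =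
          U (- turn (rot j y)) \<otimes> (ev (rot j y) \<otimes> ev (rot j y)) \<otimes> (U j \<otimes> U (turn y))"
        by (simp only: m_assoc U_closed ev_closed m_closed)
      also have "\<dots> = U (- turn (rot j y)) \<otimes> ev (rot j y) \<otimes> U (j + turn y)"
        by (simp only: ev_ev if_True simp_thms U_add)
      also have "U (- turn (rot j y)) \<otimes> ev (rot j y) = ev (rep (rot j y)) \<otimes> U (- turn (rot j y))"
        by (simp only: U_ev rep_def)
      also have "ev (rep (rot j y)) \<otimes> U (- turn (rot j y)) \<otimes> U (j + turn y) =
          ev (rep (rot j y)) \<otimes> (U (- turn (rot j y)) \<otimes> U (j + turn y))"
        by (simp only: m_assoc U_closed ev_closed)
      finally have "to_rep u \<otimes> U j \<otimes> from_rep w = evD (rep_vertex u)"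
        unfolding t by (simp add: u)
      then show ?thesis
        using image_vertex[OF rep_vertex_mem[OF uw(1)]] by (simp only:)
    next
      case w: (Centre l)
      then obtain k where u: "u = Centre k"
        using True uw by (cases u) auto
      have kl: "k \<in> {0, 1, 2}" "l \<in> {0, 1, 2}"
        using uw unfolding u w by (simp_all only: index_iff)
      have "to_rep u \<otimes> U j \<otimes> from_rep w = eps k \<otimes> ev ctr \<otimes> (U j \<otimes> ev ctr) \<otimes> eps l"
        by (simp add: u w m_assoc)
      also have "\<dots> = eps k \<otimes> (ev ctr \<otimes> ev ctr) \<otimes> (U j \<otimes> eps l)"
        by (simp only: U_ev rot_ctr m_assoc U_closed ev_closed eps_closed m_closed)
      also have "\<dots> = third_root (j * l) \<odot> (ev ctr \<otimes> (eps k \<otimes> eps l))"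
        by (simp add: ev_ev U_eps scale_mult_right ev_ctr_eps[symmetric] m_assoc)
      finally have "to_rep u \<otimes> U j \<otimes> from_rep w = third_root (j * l) \<odot> (if k = l then evD (rep_vertex u) else \<zero>)"
        by (simp add: eps_eps[OF kl] u)
      then show ?thesis
        using image_scale[OF image_vertex[OF rep_vertex_mem[OF uw(1)]]] image_zero by simp
    qed
  qed
qed

lemma corner_add:
  assumes "x \<in> carrier E" "y \<in> carrier E" "in_corner x" "in_corner y"
  shows "in_corner (x \<oplus> y)"
  unfolding in_corner_def
proof (intro ballI)
  fix u w assume uw: "u \<in> index" "w \<in> index"
  have "to_rep u \<otimes> (x \<oplus> y) \<otimes> from_rep w = to_rep u \<otimes> x \<otimes> from_rep w \<oplus> to_rep u \<otimes> y \<otimes> from_rep w"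
    using assms(1,2) by (simp only: r_distr l_distr to_from_closed m_closed)
  moreover have "to_rep u \<otimes> x \<otimes> from_rep w \<in> theta_image" "to_rep u \<otimes> y \<otimes> from_rep w \<in> theta_image"
    using assms(3,4) uw unfolding in_corner_def by blast+
  ultimately show "to_rep u \<otimes> (x \<oplus> y) \<otimes> from_rep w \<in> theta_image"
    using image_add by (simp only:)
qed

lemma corner_scale:
  assumes "x \<in> carrier E" "in_corner x"
  shows "in_corner (c \<odot> x)"
  unfolding in_corner_def
proof (intro ballI)
  fix u w assume uw: "u \<in> index" "w \<in> index"
  have "to_rep u \<otimes> (c \<odot> x) \<otimes> from_rep w = c \<odot> (to_rep u \<otimes> x \<otimes> from_rep w)"
    using assms(1) by (simp only: scale_mult_left scale_mult_right to_from_closed m_closed)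
  moreover have "to_rep u \<otimes> x \<otimes> from_rep w \<in> theta_image"
    using assms(2) uw unfolding in_corner_def by blast
  ultimately show "to_rep u \<otimes> (c \<odot> x) \<otimes> from_rep w \<in> theta_image"
    using image_scale by (simp only:)
qed

text \<open>
  Between the two factors one is written as the sum of the \<open>from_rep v \<otimes> to_rep v\<close>.
\<close>

lemma corner_mult:
  assumes one: "\<one> = (\<Oplus>x\<in>N. ev x)"
    and x: "x \<in> carrier E" "in_corner x" and y: "y \<in> carrier E" "in_corner y"
  shows "in_corner (x \<otimes> y)"
  unfolding in_corner_def
proof (intro ballI)
  fix u w assume uw: "u \<in> index" "w \<in> index"
  let ?f = "\<lambda>v. from_rep v \<otimes> to_rep v"
  have closed: "?f \<in> index \<rightarrow> carrier E" "(\<lambda>v. to_rep u \<otimes> x \<otimes> ?f v) \<in> index \<rightarrow> carrier E"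
    using x by (auto simp: Pi_iff)
  have "to_rep u \<otimes> (x \<otimes> y) \<otimes> from_rep w = (to_rep u \<otimes> x) \<otimes> (\<Oplus>v\<in>index. ?f v) \<otimes> (y \<otimes> from_rep w)"
    unfolding from_to_sum one[symmetric] using x y by (simp add: m_assoc)
  also have "\<dots> = (\<Oplus>v\<in>index. (to_rep u \<otimes> x) \<otimes> ?f v \<otimes> (y \<otimes> from_rep w))"
    using x y closed by (simp only: finsum_rdistr[OF finite_index] finsum_ldistr[OF finite_index] m_closed to_from_closed)
  also have "\<dots> \<in> theta_image"
  proof (rule image_finsum[OF finite_index])
    fix v assume v: "v \<in> index"
    have "(to_rep u \<otimes> x) \<otimes> ?f v \<otimes> (y \<otimes> from_rep w) = (to_rep u \<otimes> x \<otimes> from_rep v) \<otimes> (to_rep v \<otimes> y \<otimes> from_rep w)"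
      using x y by (simp only: m_assoc m_closed to_from_closed)
    moreover have "to_rep u \<otimes> x \<otimes> from_rep v \<in> theta_image" "to_rep v \<otimes> y \<otimes> from_rep w \<in> theta_image"
      using x(2) y(2) uw v unfolding in_corner_def by blast+
    ultimately show "(to_rep u \<otimes> x) \<otimes> ?f v \<otimes> (y \<otimes> from_rep w) \<in> theta_image"
      using image_mult by (simp only:)
  qed
  finally show "to_rep u \<otimes> (x \<otimes> y) \<otimes> from_rep w \<in> theta_image" .
qed

lemma theta_one: "theta \<one>\<^bsub>D.Jac\<^esub> = (\<Oplus>v\<in>verts QD. evD v)"
proof -
  interpret u: qp_rep QD weight_D D.Jac D.vertex D.arrow by (rule D.universal_rep)
  have "theta \<one>\<^bsub>D.Jac\<^esub> = (\<Oplus>v\<in>verts QD. theta (D.vertex v))"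
    unfolding D.one_eq_sum_vertices by (rule T.hom.finsum) (auto simp: Pi_iff)
  also have "\<dots> = (\<Oplus>v\<in>verts QD. evD v)"
    by (rule finsum_eqI) (simp_all only: T.hom_vertex T.ev_closed)
  finally show ?thesis .
qed

lemma onto_corner:
  assumes "x \<in> carrier E" "in_corner x"
  shows "theta \<one>\<^bsub>D.Jac\<^esub> \<otimes> x \<otimes> theta \<one>\<^bsub>D.Jac\<^esub> \<in> theta_image"
proof -
  have fin: "finite (verts QD)"
    by (rule finite_subset[OF _ finite_index]) (rule subsetI, rule verts_index)
  have ends: "to_rep v = evD v" "from_rep v = evD v" if "v \<in> verts QD" for v
    using that by (cases v; simp add: quiver_D_simps U_zero ev_ctr_eps)+
  have closed: "evD v \<in> carrier E" for v by (cases v) simp_all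
  then have closed': "evD \<in> verts QD \<rightarrow> carrier E" "(\<lambda>v. evD v \<otimes> x) \<in> verts QD \<rightarrow> carrier E"
    "\<And>y. y \<in> carrier E \<Longrightarrow> (\<lambda>w. y \<otimes> evD w) \<in> verts QD \<rightarrow> carrier E"
    using assms by (auto simp: Pi_iff)
  have "theta \<one>\<^bsub>D.Jac\<^esub> \<otimes> x \<otimes> theta \<one>\<^bsub>D.Jac\<^esub> = (\<Oplus>w\<in>verts QD. (\<Oplus>v\<in>verts QD. evD v \<otimes> x) \<otimes> evD w)"
    unfolding theta_one finsum_ldistr[OF fin assms(1) closed'(1)]
    by (rule finsum_rdistr[OF fin finsum_closed[OF closed'(2)] closed'(1)])
  also have "\<dots> \<in> theta_image"
  proof (rule image_finsum[OF fin])
    fix w assume w: "w \<in> verts QD"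
    have "(\<Oplus>v\<in>verts QD. evD v \<otimes> x) \<otimes> evD w = (\<Oplus>v\<in>verts QD. evD v \<otimes> x \<otimes> evD w)"
      by (rule finsum_ldistr[OF fin closed closed'(2)])
    also have "\<dots> \<in> theta_image"
    proof (rule image_finsum[OF fin])
      fix v assume v: "v \<in> verts QD"
      have "to_rep v \<otimes> x \<otimes> from_rep w \<in> theta_image"
        using assms(2) verts_index[OF v] verts_index[OF w] unfolding in_corner_def by blast
      then show "evD v \<otimes> x \<otimes> evD w \<in> theta_image"
        by (simp only: ends(1)[OF v] ends(2)[OF w])
    qed
    finally show "(\<Oplus>v\<in>verts QD. evD v \<otimes> x) \<otimes> evD w \<in> theta_image" .
  qed
  finally show ?thesis .
qed

lemma theta_one_to_rep:
  assumes "u \<in> index"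
  shows "theta \<one>\<^bsub>D.Jac\<^esub> \<otimes> to_rep u = to_rep u" "from_rep u \<otimes> theta \<one>\<^bsub>D.Jac\<^esub> = from_rep u"
proof -
  interpret u: qp_rep QD weight_D D.Jac D.vertex D.arrow by (rule D.universal_rep)
  note v = rep_vertex_mem[OF assms]
  have th: "theta \<one>\<^bsub>D.Jac\<^esub> \<in> carrier E" and e: "evD (rep_vertex u) \<in> carrier E"
    using T.ev_closed[OF v] by simp_all
  have unit: "theta \<one>\<^bsub>D.Jac\<^esub> \<otimes> evD (rep_vertex u) = evD (rep_vertex u)"
    "evD (rep_vertex u) \<otimes> theta \<one>\<^bsub>D.Jac\<^esub> = evD (rep_vertex u)"
    unfolding T.hom_vertex[OF v, symmetric] T.hom.mult[OF D.Jac.one_closed u.ev_closed[OF v], symmetric]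
      T.hom.mult[OF u.ev_closed[OF v] D.Jac.one_closed, symmetric]
    by (simp_all only: D.Jac.l_one D.Jac.r_one u.ev_closed[OF v])
  have "theta \<one>\<^bsub>D.Jac\<^esub> \<otimes> to_rep u = (theta \<one>\<^bsub>D.Jac\<^esub> \<otimes> evD (rep_vertex u)) \<otimes> to_rep u"
    using m_assoc[OF th e to_from_closed(1)[of u]] unfolding evD_to_rep[OF assms] by (rule sym)
  then show "theta \<one>\<^bsub>D.Jac\<^esub> \<otimes> to_rep u = to_rep u"
    by (simp only: unit evD_to_rep[OF assms])
  have "from_rep u \<otimes> theta \<one>\<^bsub>D.Jac\<^esub> = from_rep u \<otimes> (evD (rep_vertex u) \<otimes> theta \<one>\<^bsub>D.Jac\<^esub>)"
    using m_assoc[OF to_from_closed(2)[of u] e th] unfolding from_rep_evD[OF assms] .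
  then show "from_rep u \<otimes> theta \<one>\<^bsub>D.Jac\<^esub> = from_rep u"
    by (simp only: unit from_rep_evD[OF assms])
qed

end


section \<open>The comparison\<close>

context triangle
begin

lemma ends_in_verts:
  assumes "a \<in> arcs QD"
  shows "tail QD a \<in> verts QD" "head QD a \<in> verts QD"
  using assms before_ctr_mem after_ctr_mem by (cases a; simp add: quiver_D_simps arc_Alpha head_Alpha)+

end

context unfolded_rep
begin

sublocale L: equivariant_rep s EndV EV AR UU
  by (rule equivariant_rep_unfolding)

lemma End_maps: "f \<in> carrier EndV \<Longrightarrow> z \<in> families \<Longrightarrow> f z \<in> families"
  using P.power.linear_mapsD(1)[of f z] by simp

lemma End_apply: "z \<in> families \<Longrightarrow> (f \<otimes>\<^bsub>EndV\<^esub> g) z = f (g z)"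
  by (simp add: compose_eq)

lemma generators_apply:
  assumes "z \<in> families" "u \<in> index"
  shows "EV x z u = (if point_of u = x then z u else \<zero>)"
    and "AR x i z u = (if point_of u = x then step i z u else \<zero>)"
    and "UU j z u = turned j z u"
  using assms by (simp_all add: EV_def AR_def UU_def op_def)

lemma eps_apply:
  assumes z: "z \<in> families" and cN: "ctr \<in> N" and k: "k \<in> {0, 1, 2}" and l: "l \<in> {0, 1, 2}"
  shows "L.eps k z (Centre l) = (if k = l then z (Centre l) else \<zero>)"
proof -
  have C: "Centre l \<in> index" using cN l by (simp only: index_iff simp_thms)
  have zl: "z (Centre l) \<in> carrier B" by (rule P.power_mem[OF z C])
  have UUz: "UU j z (Centre l) = third_root (j * l) \<odot> z (Centre l)" for j
    unfolding generators_apply(3)[OF z C] by (simp add: turned_def)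
  have coeffs: "third_root (- k) * third_root (1 * l) = third_root (l - k)"
    "third_root (- (2 * k)) * third_root (2 * l) = third_root (2 * (l - k))"
    unfolding third_root_add[symmetric] by (rule arg_cong[of _ _ third_root], simp)+
  have "L.eps k z (Centre l) = (1 / 3) \<odot> (z (Centre l) \<oplus> third_root (- k) \<odot> UU 1 z (Centre l) \<oplus>
      third_root (- (2 * k)) \<odot> UU 2 z (Centre l))"
    using z C by (simp add: L.eps_def del: index_iff)
  also have "\<dots> = (1 / 3) \<odot> (1 \<odot> z (Centre l) \<oplus> third_root (l - k) \<odot> z (Centre l) \<oplus>
      third_root (2 * (l - k)) \<odot> z (Centre l))"
    unfolding UUz using zl by (simp only: R.E.scale_scale coeffs R.E.scale_one)
  also have "\<dots> = (1 / 3 * (1 + third_root (l - k) + third_root (2 * (l - k)))) \<odot> z (Centre l)"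
    using zl by (simp only: R.E.scale_add_left[symmetric] R.E.scale_scale)
  also have "\<dots> = (if k = l then z (Centre l) else \<zero>)"
  proof -
    have "(l - k) mod 3 = 0 \<longleftrightarrow> k = l"
      using k l by (elim insertE emptyE) simp_all
    then show ?thesis
      unfolding third_root_orthogonality using zl by simp
  qed
  finally show ?thesis .
qed

text \<open>
  The algebra \<open>B\<close> itself sits in the space of families: the component of \<open>w\<close> at a vertex of the
  fundamental domain is \<open>w\<close> cut off at that vertex, and the other components vanish.
\<close>

definition vec where
  "vec w = (\<lambda>u\<in>index. if u \<in> verts QD then be u \<otimes> w else \<zero>)"

lemma vec_families [simp]: "w \<in> carrier B \<Longrightarrow> vec w \<in> families"
  by (auto simp: vec_def)

lemma vec_vertex: "v \<in> verts QD \<Longrightarrow> vec w v = be v \<otimes> w"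
  using verts_index[of v] by (simp add: vec_def)

lemma vec_be:
  assumes v: "v \<in> verts QD" and w: "w \<in> carrier B" and u: "u \<in> index"
  shows "vec (be v \<otimes> w) u = (if u = v then be v \<otimes> w else \<zero>)"
proof (cases "u \<in> verts QD")
  case True
  have "be u \<otimes> (be v \<otimes> w) = be u \<otimes> be v \<otimes> w"
    using R.ev_closed[OF True] R.ev_closed[OF v] w by (simp only: R.E.m_assoc)
  then show ?thesis
    unfolding vec_vertex[OF True] using R.ev_ev[OF True v] R.ev_closed[OF v] w by simp
next
  case False
  then show ?thesis using u v by (auto simp: vec_def)
qed

lemma vec_ba:
  assumes a: "a \<in> arcs QD" and w: "w \<in> carrier B" and u: "u \<in> index"
  shows "vec (ba a \<otimes> w) u = (if u = tail QD a then ba a \<otimes> w else \<zero>)"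
proof -
  note t = ends_in_verts(1)[OF a]
  have "ba a \<otimes> w = be (tail QD a) \<otimes> (ba a \<otimes> w)"
    using R.ev_ar[OF a] R.E.m_assoc[OF R.ev_closed[OF t] R.ar_closed[OF a] w] by (simp only:)
  then show ?thesis
    using vec_be[OF t R.E.m_closed[OF R.ar_closed[OF a] w] u] by (simp only:)
qed

lemma ba_vec:
  assumes a: "a \<in> arcs QD" and w: "w \<in> carrier B"
  shows "ba a \<otimes> vec w (head QD a) = ba a \<otimes> w"
proof -
  note h = ends_in_verts(2)[OF a]
  show ?thesis
    unfolding vec_vertex[OF h]
    using R.ar_ev[OF a] R.E.m_assoc[OF R.ar_closed[OF a] R.ev_closed[OF h] w] by (simp only:)
qed

lemma vertex_vec:
  assumes v: "v \<in> verts QD" and w: "w \<in> carrier B"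
  shows "L.evD v (vec w) = vec (be v \<otimes> w)"
proof (rule P.power_ext)
  show "L.evD v (vec w) \<in> families"
    by (rule End_maps[OF L.T.ev_closed[OF v] vec_families[OF w]])
  show "vec (be v \<otimes> w) \<in> families"
    using R.ev_closed[OF v] w by simp
  fix u assume u: "u \<in> index"
  note z = vec_families[OF w]
  show "L.evD v (vec w) u = vec (be v \<otimes> w) u"
    unfolding vec_be[OF v w u]
  proof (cases v)
    case (Pt x)
    then have "x \<in> Q0" using v by (simp only: quiver_D_simps)
    then have "x \<noteq> ctr" using Q0_inner by blast
    then have "point_of u = x \<longleftrightarrow> u = v"
      by (cases u) (auto simp: Pt)
    then show "L.evD v (vec w) u = (if u = v then be v \<otimes> w else \<zero>)"
      using generators_apply(1)[OF z u, of x] vec_vertex[OF v] by (simp add: Pt)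
  next
    case (Centre k)
    then have cN: "ctr \<in> N" and k: "k \<in> {0, 1, 2}"
      using v ctr_mem_iff by (simp_all only: quiver_D_simps simp_thms)
    have closed: "L.eps k (vec w) \<in> families"
      by (rule End_maps[OF L.eps_closed z])
    have "L.evD v (vec w) u = (if point_of u = ctr then L.eps k (vec w) u else \<zero>)"
      unfolding Centre L.evD.simps End_apply[OF z] by (rule generators_apply(1)[OF closed u])
    also have "\<dots> = (if u = v then be v \<otimes> w else \<zero>)"
    proof (cases u)
      case (Pt y)
      then have "y \<noteq> ctr" using u by simp
      then show ?thesis by (simp add: Pt Centre)
    next
      case u': (Centre l)
      then have l: "l \<in> {0, 1, 2}" using u by (simp only: index_iff)
      have "k = l \<longleftrightarrow> u = v" unfolding u' Centre by auto
      then show ?thesis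
        using eps_apply[OF z cN k l] vec_vertex[OF v, of w] by (auto simp: u' Centre)
    qed
    finally show "L.evD v (vec w) u = (if u = v then be v \<otimes> w else \<zero>)" .
  qed
qed

lemma arrow_vec:
  assumes a: "a \<in> arcs QD" and w: "w \<in> carrier B"
  shows "L.arD a (vec w) = vec (ba a \<otimes> w)"
proof (rule P.power_ext)
  show "L.arD a (vec w) \<in> families"
    by (rule End_maps[OF L.T.ar_closed[OF a] vec_families[OF w]])
  show "vec (ba a \<otimes> w) \<in> families"
    using R.ar_closed[OF a] w by simp
  fix u assume u: "u \<in> index"
  note z = vec_families[OF w]
  show "L.arD a (vec w) u = vec (ba a \<otimes> w) u"
    unfolding vec_ba[OF a w u]
  proof (cases a)
    case (Alpha x i j)
    then have xQ: "x \<in> Q0" using a by (simp add: arc_Alpha)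
    then have x: "x \<in> inner" "x = rep x" "x \<noteq> ctr"
      using Q0_inner[OF xQ] turn_fundamental[OF xQ] by auto
    obtain m where m: "a = abar x m" and y: "x + shift m \<in> inner"
      using arc_is_abar[OF a[unfolded Alpha] x(2) x(1)] Alpha by blast
    let ?y = "x + shift m"
    have arD: "L.arD a = AR x m \<otimes>\<^bsub>EndV\<^esub> UU (turn ?y)"
      unfolding m L.arD_abar turn_fundamental(1)[OF xQ]
      by (simp only: minus_zero L.U_zero L.l_one L.ar_closed)
    have closed: "UU (turn ?y) (vec w) \<in> families"
      by (rule End_maps[OF L.U_closed z])
    have yi: "Pt ?y \<in> index" using y by (simp only: index_iff)
    have tail: "point_of u = x \<longleftrightarrow> u = tail QD a"
      using x(3) unfolding Alpha quiver_D_simps by (cases u) auto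
    have "L.arD a (vec w) u = (if point_of u = x then step m (UU (turn ?y) (vec w)) u else \<zero>)"
      unfolding arD End_apply[OF z] by (rule generators_apply(2)[OF closed u])
    also have "\<dots> = (if u = tail QD a then ba a \<otimes> w else \<zero>)"
    proof (cases "u = tail QD a")
      case True
      then have u: "u = Pt x" by (simp add: Alpha quiver_D_simps)
      have "UU (turn ?y) (vec w) (Pt ?y) = vec w (Pt (rep ?y))"
        unfolding generators_apply(3)[OF z yi] by (simp add: turned_def rep_def)
      then have "step m (UU (turn ?y) (vec w)) u = ba a \<otimes> vec w (head QD a)"
        unfolding u step_Pt_inner[OF y] m abar_arc(3)[OF x(1) y] by (simp only:)
      then show ?thesis
        using True tail ba_vec[OF a w] by simp
    next
      case False
      then show ?thesis using tail by simp
    qed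
    finally show "L.arD a (vec w) u = (if u = tail QD a then ba a \<otimes> w else \<zero>)" .
  next
    case (Beta k)
    then have s3: "s mod 3 = 1" and k: "k \<in> {0, 1, 2}" and cN: "ctr \<in> N"
      using a ctr_mem_iff by (simp_all only: quiver_D_simps simp_thms)
    have before: "before_ctr + shift 0 = ctr" by simp
    have ne: "before_ctr \<noteq> ctr" by (rule before_mem(2)[OF s3])
    have tail: "point_of u = before_ctr \<longleftrightarrow> u = tail QD a"
      using ne unfolding Beta quiver_D_simps by (cases u) auto
    have Ck: "Centre k \<in> index" using cN k by (simp only: index_iff simp_thms)
    have closed: "L.eps k (vec w) \<in> families"
      by (rule End_maps[OF L.eps_closed z])
    have val: "step 0 (L.eps k (vec w)) (Pt before_ctr) = ba (Beta k) \<otimes> vec w (Centre k)"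
    proof -
      have prod: "ba (Beta k) \<otimes> vec w (Centre k) \<in> carrier B"
        using ba_centre(1)[OF cN k] P.power_mem[OF z Ck] by (rule R.E.m_closed)
      have "step 0 (L.eps k (vec w)) (Pt before_ctr) =
          (\<Oplus>l\<in>{0, 1, 2}. if l = k then ba (Beta k) \<otimes> vec w (Centre k) else \<zero>)"
        unfolding step_Pt_centre[OF before cN]
      proof (rule R.E.finsum_eqI)
        fix l :: int assume l: "l \<in> {0, 1, 2}"
        show "third_root (0 * l) \<odot> (ba (Beta l) \<otimes> L.eps k (vec w) (Centre l)) =
            (if l = k then ba (Beta k) \<otimes> vec w (Centre k) else \<zero>)"
          unfolding eps_apply[OF z cN k l] using prod ba_centre(1)[OF cN l] by auto
        show "(if l = k then ba (Beta k) \<otimes> vec w (Centre k) else \<zero>) \<in> carrier B"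
          using prod by simp
      qed
      also have "\<dots> = ba (Beta k) \<otimes> vec w (Centre k)"
        using k prod by (intro R.E.finsum_delta) simp_all
      finally show ?thesis .
    qed
    have "L.arD a (vec w) u = (if point_of u = before_ctr then step 0 (L.eps k (vec w)) u else \<zero>)"
      unfolding Beta L.arD.simps End_apply[OF z] by (rule generators_apply(2)[OF closed u])
    also have "\<dots> = (if u = tail QD a then ba a \<otimes> w else \<zero>)"
      using tail val ba_vec[OF a w] by (simp add: Beta quiver_D_simps)
    finally show "L.arD a (vec w) u = (if u = tail QD a then ba a \<otimes> w else \<zero>)" .
  next
    case (Gamma k)
    then have s3: "s mod 3 = 1" and k: "k \<in> {0, 1, 2}" and cN: "ctr \<in> N"
      using a ctr_mem_iff by (simp_all only: quiver_D_simps simp_thms)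
    have "L.arD a = L.eps k \<otimes>\<^bsub>EndV\<^esub> (EV ctr \<otimes>\<^bsub>EndV\<^esub> AR ctr 2)"
      by (simp only: Gamma L.arD.simps L.ev_ar)
    also have "\<dots> = (L.eps k \<otimes>\<^bsub>EndV\<^esub> EV ctr) \<otimes>\<^bsub>EndV\<^esub> AR ctr 2"
      by (rule L.m_assoc[OF L.eps_closed L.ev_closed L.ar_closed, symmetric])
    also have "\<dots> = EV ctr \<otimes>\<^bsub>EndV\<^esub> (L.eps k \<otimes>\<^bsub>EndV\<^esub> AR ctr 2)"
      unfolding L.ev_ctr_eps[symmetric] by (rule L.m_assoc[OF L.ev_closed L.eps_closed L.ar_closed])
    finally have arD: "L.arD a = EV ctr \<otimes>\<^bsub>EndV\<^esub> (L.eps k \<otimes>\<^bsub>EndV\<^esub> AR ctr 2)" .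
    have AR: "AR ctr 2 (vec w) \<in> families"
      by (rule End_maps[OF L.ar_closed z])
    have closed: "L.eps k (AR ctr 2 (vec w)) \<in> families"
      by (rule End_maps[OF L.eps_closed AR])
    have "L.arD a (vec w) u = (if point_of u = ctr then L.eps k (AR ctr 2 (vec w)) u else \<zero>)"
      unfolding arD End_apply[OF z] by (rule generators_apply(1)[OF closed u])
    also have "\<dots> = (if u = tail QD a then ba a \<otimes> w else \<zero>)"
    proof (cases u)
      case (Pt y)
      then have "y \<noteq> ctr" using u by simp
      then show ?thesis by (simp add: Pt Gamma quiver_D_simps)
    next
      case u': (Centre l)
      then have l: "l \<in> {0, 1, 2}" using u by (simp only: index_iff)
      have h: "Pt (ctr + shift 2) = head QD a" by (simp only: Gamma quiver_D_simps)
      have tail: "u = tail QD a \<longleftrightarrow> k = l" unfolding u' Gamma quiver_D_simps by auto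
      have "L.eps k (AR ctr 2 (vec w)) u = (if k = l then AR ctr 2 (vec w) (Centre l) else \<zero>)"
        unfolding u' by (rule eps_apply[OF AR cN k l])
      also have "AR ctr 2 (vec w) (Centre l) = third_root ((2 - 2) * l) \<odot> (ba (Gamma l) \<otimes> vec w (head QD a))"
        unfolding generators_apply(2)[OF z u[unfolded u']] step_Centre h by simp
      finally have "L.eps k (AR ctr 2 (vec w)) u =
          (if k = l then third_root ((2 - 2) * l) \<odot> (ba (Gamma l) \<otimes> vec w (head QD a)) else \<zero>)" .
      moreover have "ba a \<otimes> w \<in> carrier B"
        using R.ar_closed[OF a] w by simp
      ultimately show ?thesis
        using ba_vec[OF a w] unfolding tail by (auto simp: u' Gamma)
    qed
    finally show "L.arD a (vec w) u = (if u = tail QD a then ba a \<otimes> w else \<zero>)" .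
  qed
qed

text \<open>
  The family \<open>vec w\<close> is what the skew group algebra sees of \<open>w\<close>: on such families \<open>theta b\<close> is left
  multiplication by the image of \<open>b\<close>.
\<close>

lemma theta_vec:
  assumes "b \<in> carrier D.Jac"
  shows "\<forall>w\<in>carrier B. L.theta b (vec w) = vec (R.hom_of_rep b \<otimes> w)"
  using assms
proof (induction rule: D.Jac_generated)
  case (vert v)
  show ?case
    unfolding L.T.hom_vertex[OF vert] R.hom_vertex[OF vert] using vertex_vec[OF vert] by blast
next
  case (arc a)
  show ?case
    unfolding L.T.hom_arrow[OF arc] R.hom_arrow[OF arc] using arrow_vec[OF arc] by blast
next
  case zero
  show ?case
  proof
    fix w assume w: "w \<in> carrier B"
    have "be u \<otimes> \<zero> = \<zero>" if "u \<in> verts QD" for u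
      using R.ev_closed[OF that] by simp
    then have "vec (\<zero> \<otimes> w) = (\<lambda>u\<in>index. \<zero>)"
      unfolding vec_def using w by (intro restrict_ext) simp
    moreover have "L.theta \<zero>\<^bsub>D.Jac\<^esub> (vec w) = (\<lambda>u\<in>index. \<zero>)"
      unfolding L.T.hom.zero using vec_families[OF w] by simp
    ultimately show "L.theta \<zero>\<^bsub>D.Jac\<^esub> (vec w) = vec (R.hom_of_rep \<zero>\<^bsub>D.Jac\<^esub> \<otimes> w)"
      unfolding R.hom.zero by (simp only:)
  qed
next
  case (add x y)
  show ?case
  proof
    fix w assume w: "w \<in> carrier B"
    have xy: "R.hom_of_rep x \<in> carrier B" "R.hom_of_rep y \<in> carrier B"
      using add.hyps by (simp_all only: R.hom.closed)
    have "L.theta (x \<oplus>\<^bsub>D.Jac\<^esub> y) (vec w) = (\<lambda>u\<in>index. L.theta x (vec w) u \<oplus> L.theta y (vec w) u)"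
      unfolding L.T.hom.add[OF add.hyps] using vec_families[OF w] by simp
    also have "\<dots> = (\<lambda>u\<in>index. vec (R.hom_of_rep x \<otimes> w) u \<oplus> vec (R.hom_of_rep y \<otimes> w) u)"
      using add.IH w by simp
    also have "\<dots> = vec (R.hom_of_rep (x \<oplus>\<^bsub>D.Jac\<^esub> y) \<otimes> w)"
      unfolding R.hom.add[OF add.hyps] vec_def
      by (rule restrict_ext) (simp add: xy w R.E.l_distr R.E.r_distr R.ev_closed)
    finally show "L.theta (x \<oplus>\<^bsub>D.Jac\<^esub> y) (vec w) = vec (R.hom_of_rep (x \<oplus>\<^bsub>D.Jac\<^esub> y) \<otimes> w)" .
  qed
next
  case (mult x y)
  show ?case
  proof
    fix w assume w: "w \<in> carrier B"
    have xy: "R.hom_of_rep x \<in> carrier B" "R.hom_of_rep y \<in> carrier B"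
      using mult.hyps by (simp_all only: R.hom.closed)
    have "L.theta (x \<otimes>\<^bsub>D.Jac\<^esub> y) (vec w) = L.theta x (L.theta y (vec w))"
      unfolding L.T.hom.mult[OF mult.hyps] by (rule End_apply[OF vec_families[OF w]])
    also have "\<dots> = L.theta x (vec (R.hom_of_rep y \<otimes> w))"
      using mult.IH(2) w by simp
    also have "\<dots> = vec (R.hom_of_rep x \<otimes> (R.hom_of_rep y \<otimes> w))"
      using mult.IH(1) R.E.m_closed[OF xy(2) w] by blast
    finally show "L.theta (x \<otimes>\<^bsub>D.Jac\<^esub> y) (vec w) = vec (R.hom_of_rep (x \<otimes>\<^bsub>D.Jac\<^esub> y) \<otimes> w)"
      unfolding R.hom.mult[OF mult.hyps] R.E.m_assoc[OF xy w] .
  qed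
next
  case (scale x c)
  show ?case
  proof
    fix w assume w: "w \<in> carrier B"
    have x: "R.hom_of_rep x \<in> carrier B"
      using scale.hyps by (simp only: R.hom.closed)
    have "L.theta (c \<odot>\<^bsub>D.Jac\<^esub> x) (vec w) = (\<lambda>u\<in>index. c \<odot> L.theta x (vec w) u)"
      unfolding L.T.hom.scale[OF scale.hyps] using vec_families[OF w] by simp
    also have "\<dots> = (\<lambda>u\<in>index. c \<odot> vec (R.hom_of_rep x \<otimes> w) u)"
      using scale.IH w by simp
    also have "\<dots> = vec (R.hom_of_rep (c \<odot>\<^bsub>D.Jac\<^esub> x) \<otimes> w)"
      unfolding R.hom.scale[OF scale.hyps] vec_def
      by (rule restrict_ext) (simp add: x w R.E.scale_mult_left R.E.scale_mult_right R.ev_closed)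
    finally show "L.theta (c \<odot>\<^bsub>D.Jac\<^esub> x) (vec w) = vec (R.hom_of_rep (c \<odot>\<^bsub>D.Jac\<^esub> x) \<otimes> w)" .
  qed
qed

end

context triangle
begin

text \<open>
  The unfolding of the algebra of type D acts faithfully on the family of one, whose components are
  the vertices: \<open>b\<close> is the sum of the \<open>D.vertex v \<otimes> b\<close>.
\<close>

lemma morita_equivalent_D_Skew: "morita_equivalent TYPE('m) D.Jac Skew"
proof -
  interpret S: equivariant_rep s Skew evS arS US by (rule skew_equivariant_rep)
  interpret R: unfolded_rep s D.Jac D.vertex D.arrow
    by (intro unfolded_rep.intro triangle_axioms D.universal_rep)
  obtain F where F: "complex_ring_hom Skew R.EndV F"
    and F_ev: "\<And>x. F (evS x) = R.EV x" and F_ar: "\<And>x i. F (arS x i) = R.AR x i"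
    and F_US: "\<And>j. F (US j) = (\<Oplus>\<^bsub>R.EndV\<^esub>x\<in>N. R.EV x) \<otimes>\<^bsub>R.EndV\<^esub> R.UU j"
    using R.L.Skew_universal by blast
  interpret F: complex_ring_hom Skew R.EndV F by (rule F)
  have F_U: "F (US j) = R.UU j" for j
    unfolding F_US R.EV_sum by (rule R.L.l_one[OF R.L.U_closed])
  (* although homomorphisms need not be unital, this one is: the points of the unfolding sum to one *)
  have F_one: "F \<one>\<^bsub>Skew\<^esub> = \<one>\<^bsub>R.EndV\<^esub>"
    using F_U[of 0] unfolding S.U_zero R.L.U_zero .
  have F_eps: "F (S.eps k) = R.L.eps k" for k
    unfolding S.eps_def R.L.eps_def
    by (simp only: F.scale F.add F_one F_U skew.S.one_closed skew.S.scale_closed skew.S.a_closed S.U_closed)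
  have F_evD: "F (S.evD v) = R.L.evD v" for v
    by (cases v) (simp_all only: S.evD.simps R.L.evD.simps F.mult F_ev F_eps S.ev_closed S.eps_closed)
  have F_arD: "F (S.arD a) = R.L.arD a" for a
    by (cases a) (simp_all only: S.arD.simps R.L.arD.simps F.mult F_ar F_eps F_U S.ar_closed S.eps_closed S.U_closed)
  have F_theta: "F (S.theta b) = R.L.theta b" if "b \<in> carrier D.Jac" for b
    using that
    by (induction rule: D.Jac_generated)
      (simp_all only: S.T.hom_vertex R.L.T.hom_vertex S.T.hom_arrow R.L.T.hom_arrow F_evD F_arD
        S.T.hom.zero R.L.T.hom.zero F.zero S.T.hom.add R.L.T.hom.add F.add S.T.hom.mult R.L.T.hom.mult F.mult
        S.T.hom.scale R.L.T.hom.scale F.scale S.T.hom.closed)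
  have identity: "R.R.hom_of_rep b = b" if "b \<in> carrier D.Jac" for b
    using that
    by (induction rule: D.Jac_generated)
      (simp_all only: R.R.hom_vertex R.R.hom_arrow R.R.hom.zero R.R.hom.add R.R.hom.mult R.R.hom.scale)
  have injective: "inj_on S.theta (carrier D.Jac)"
  proof (rule inj_onI)
    fix a b assume ab: "a \<in> carrier D.Jac" "b \<in> carrier D.Jac" and eq: "S.theta a = S.theta b"
    have theta_vec_one: "R.L.theta x (R.vec \<one>\<^bsub>D.Jac\<^esub>) = R.vec x" if x: "x \<in> carrier D.Jac" for x
    proof -
      have "R.L.theta x (R.vec \<one>\<^bsub>D.Jac\<^esub>) = R.vec (R.R.hom_of_rep x \<otimes>\<^bsub>D.Jac\<^esub> \<one>\<^bsub>D.Jac\<^esub>)"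
        by (rule bspec[OF R.theta_vec[OF x] D.Jac.one_closed])
      then show ?thesis
        unfolding identity[OF x] D.Jac.r_one[OF x] .
    qed
    have "R.vec a = R.vec b"
      unfolding theta_vec_one[OF ab(1), symmetric] theta_vec_one[OF ab(2), symmetric]
        F_theta[OF ab(1), symmetric] F_theta[OF ab(2), symmetric] eq ..
    then have vertex_eq: "D.vertex v \<otimes>\<^bsub>D.Jac\<^esub> a = D.vertex v \<otimes>\<^bsub>D.Jac\<^esub> b" if "v \<in> verts QD" for v
      unfolding R.vec_vertex[OF that, symmetric] by (simp only:)
    have fin: "finite (verts QD)"
      by (rule finite_subset[OF _ finite_index]) (rule subsetI, rule verts_index)
    have vertices: "D.vertex \<in> verts QD \<rightarrow> carrier D.Jac"
      by (rule Pi_I) (rule R.R.ev_closed)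
    have expand: "x = (\<Oplus>\<^bsub>D.Jac\<^esub>v\<in>verts QD. D.vertex v \<otimes>\<^bsub>D.Jac\<^esub> x)" if x: "x \<in> carrier D.Jac" for x
    proof -
      have "x = (\<Oplus>\<^bsub>D.Jac\<^esub>v\<in>verts QD. D.vertex v) \<otimes>\<^bsub>D.Jac\<^esub> x"
        unfolding D.one_eq_sum_vertices[symmetric] by (rule D.Jac.l_one[OF x, symmetric])
      also have "\<dots> = (\<Oplus>\<^bsub>D.Jac\<^esub>v\<in>verts QD. D.vertex v \<otimes>\<^bsub>D.Jac\<^esub> x)"
        by (rule D.Jac.finsum_ldistr[OF fin x vertices])
      finally show ?thesis .
    qed
    have "(\<Oplus>\<^bsub>D.Jac\<^esub>v\<in>verts QD. D.vertex v \<otimes>\<^bsub>D.Jac\<^esub> a) = (\<Oplus>\<^bsub>D.Jac\<^esub>v\<in>verts QD. D.vertex v \<otimes>\<^bsub>D.Jac\<^esub> b)"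
      by (rule D.Jac.finsum_eqI) (erule vertex_eq, rule D.Jac.m_closed[OF R.R.ev_closed ab(2)], assumption)
    then show "a = b"
      unfolding expand[OF ab(1), symmetric] expand[OF ab(2), symmetric] .
  qed
  have corner: "S.in_corner x" if "x \<in> carrier Skew" for x
    using that
  proof (induction rule: Skew_generated)
    case (ev x)
    show ?case by (rule S.corner_ev)
  next
    case (ar x i)
    show ?case by (rule S.corner_ar)
  next
    case (U j)
    show ?case by (rule S.corner_U)
  next
    case (add u v)
    then show ?case by (rule S.corner_add)
  next
    case (mult u v)
    show ?case by (rule S.corner_mult[OF Skew_one mult(1) mult(3) mult(2) mult(4)])
  next
    case (scale u c)
    then show ?case by (rule S.corner_scale)
  qed
  interpret corner: full_corner D.Jac Skew S.theta "S.theta \<one>\<^bsub>D.Jac\<^esub>" index S.to_rep S.from_rep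
  proof (intro full_corner.intro full_corner_axioms.intro)
    show "complex_ring_hom D.Jac Skew S.theta" by (rule S.T.hom.complex_ring_hom_axioms)
    show "S.theta \<one>\<^bsub>D.Jac\<^esub> \<otimes>\<^bsub>Skew\<^esub> x \<otimes>\<^bsub>Skew\<^esub> S.theta \<one>\<^bsub>D.Jac\<^esub> \<in> S.theta ` carrier D.Jac" if "x \<in> carrier Skew" for x
      by (rule S.onto_corner[OF that corner[OF that]])
    show "(\<Oplus>\<^bsub>Skew\<^esub>u\<in>index. S.from_rep u \<otimes>\<^bsub>Skew\<^esub> S.to_rep u) = \<one>\<^bsub>Skew\<^esub>"
      unfolding S.from_to_sum by (rule Skew_one[symmetric])
  qed (rule refl injective finite_index S.to_from_closed S.theta_one_to_rep | assumption)+
  show ?thesis by (rule corner.morita_equivalent_corner)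
qed

end

theorem theorem1:
  fixes s :: nat
  assumes "s \<ge> 2"
  shows "morita_equivalent TYPE('m) (Pi_D s)
    (skew_group_algebra (Pi_A s) (integer_mod_group 3) omega_action)"
proof -
  interpret triangle s by unfold_locales (rule assms)
  show ?thesis
    using morita_equivalent_D_Skew unfolding Pi_D_def Pi_A_def potential_D_def potential_A_def .
qed

end
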